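(* Let $H=\{P=0\}\subset\mathbf{P}^N$ be a smooth hypersurface of degree $d\ge1$. The complex $$0\longrightarrow\operatorname{Ker}\delta[-1,-2d+1]\overset{\alpha(P)}{\longrightarrow}\operatorname{Ker}\delta^2[0,-d]\overset{\beta(P)}{\longrightarrow}\operatorname{Ker}\delta$$ provides a locally free bi-graded resolution of $\bigoplus_{m\ge1,\,n\in\mathbb{Z}}S^m\Omega_H(m+n)$. That is, for all $m\ge1$ and $n\in\mathbb{Z}$, the complex of vector bundles on $\mathbf{P}^N$ $$0\to\operatorname{Ker}\delta_{m-1,n-2d+1}\overset{\alpha(P)}{\longrightarrow}\operatorname{Ker}\delta^2_{m,n-d}\overset{\beta(P)}{\longrightarrow}\operatorname{Ker}\delta_{m,n}$$ is a locally free resolution of (the push-forward to $\mathbf{P}^N$ of) $S^m\Omega_H(m+n)$.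
   Context: Throughout $N\ge2$, and everything is over $\mathbb{C}$. $X_0,\dots,X_N$ are the homogeneous coordinates of $\mathbf{P}^N$, $Y=(Y_0,\dots,Y_N)$ are auxiliary variables, $\mathbb{C}[Y]_m$ is the space of homogeneous polynomials of degree $m$ in $Y$ (zero if $m<0$). Set $\delta=\sum_{i=0}^N X_i\frac{\partial}{\partial Y_i}$; for $k\ge1$, $\operatorname{Ker}\delta^k_{m,n}$ denotes the kernel of $\delta^k:\mathbb{C}[Y]_m\otimes\mathcal{O}_{\mathbf{P}^N}(n)\to\mathbb{C}[Y]_{m-k}\otimes\mathcal{O}_{\mathbf{P}^N}(n+k)$, and $\operatorname{Ker}\delta^k=\bigoplus_{m\in\mathbb{N},n\in\mathbb{Z}}\operatorname{Ker}\delta^k_{m,n}$. For a bi-graded object $M$, $M[a,b]_{m,n}=M_{m+a,n+b}$. For $P\in\mathbb{C}[X_0,\dots,X_N]$ homogeneous of degree $d$, $\alpha(P)$ is multiplication by $\frac1d(\mathrm{d}P)_X(Y)=\frac1d\sum_{j=0}^N\frac{\partial P}{\partial X_j}(X)Y_j$, and $\beta(P)(A)=P\,A-\alpha(P)(\delta(A))$. *)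

theory Defs
  imports "HOL-Analysis.Analysis" "HOL-Algebra.QuotRing" "HOL-Algebra.Module"
begin

section \<open>Modules given by generators and relations\<close>

definition free_module :: "('a, 'r) ring_scheme \<Rightarrow> 'g set \<Rightarrow> ('a, 'g \<Rightarrow> 'a) module" where
  "free_module A G =
    \<lparr>carrier = {u. (\<forall>g\<in>G. u g \<in> carrier A) \<and> (\<forall>g. g \<notin> G \<longrightarrow> u g = \<zero>\<^bsub>A\<^esub>) \<and> finite {g. u g \<noteq> \<zero>\<^bsub>A\<^esub>}},
     mult = undefined, one = undefined,
     zero = (\<lambda>_. \<zero>\<^bsub>A\<^esub>), add = (\<lambda>u v g. u g \<oplus>\<^bsub>A\<^esub> v g), smult = (\<lambda>a u g. a \<otimes>\<^bsub>A\<^esub> u g)\<rparr>"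

definition free_gen :: "('a, 'r) ring_scheme \<Rightarrow> 'g \<Rightarrow> 'g \<Rightarrow> 'a" where
  "free_gen A g = (\<lambda>h. if h = g then \<one>\<^bsub>A\<^esub> else \<zero>\<^bsub>A\<^esub>)"

definition module_span :: "('a, 'r) ring_scheme \<Rightarrow> ('a, 'm, 's) module_scheme \<Rightarrow> 'm set \<Rightarrow> 'm set" where
  "module_span A M S = \<Inter>{N. submodule N A M \<and> S \<subseteq> N}"

definition quot_module :: "('a, 'm, 's) module_scheme \<Rightarrow> 'm set \<Rightarrow> ('a, 'm set) module" where
  "quot_module M N =
    \<lparr>carrier = a_rcosets\<^bsub>M\<^esub> N, mult = undefined, one = undefined,
     zero = N, add = set_add M, smult = (\<lambda>a C. \<Union>x\<in>C. N +>\<^bsub>M\<^esub> (a \<odot>\<^bsub>M\<^esub> x))\<rparr>"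

definition presented_module ::
  "('a, 'r) ring_scheme \<Rightarrow> 'g set \<Rightarrow> ('g \<Rightarrow> 'a) set \<Rightarrow> ('a, ('g \<Rightarrow> 'a) set) module" where
  "presented_module A G R = quot_module (free_module A G) (module_span A (free_module A G) R)"

definition presented_gen ::
  "('a, 'r) ring_scheme \<Rightarrow> 'g set \<Rightarrow> ('g \<Rightarrow> 'a) set \<Rightarrow> 'g \<Rightarrow> ('g \<Rightarrow> 'a) set" where
  "presented_gen A G R g = module_span A (free_module A G) R +>\<^bsub>free_module A G\<^esub> free_gen A g"


subsection \<open>Kaehler differentials of a ring \<open>A\<close> relative to a subring \<open>K\<close>\<close>

definition kaehler_rels :: "('a, 'r) ring_scheme \<Rightarrow> 'a set \<Rightarrow> ('a \<Rightarrow> 'a) set" where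
  "kaehler_rels A K = (let F = free_module A (carrier A); e = free_gen A in
      {e (a \<oplus>\<^bsub>A\<^esub> b) \<ominus>\<^bsub>F\<^esub> (e a \<oplus>\<^bsub>F\<^esub> e b) |a b. a \<in> carrier A \<and> b \<in> carrier A}
    \<union> {e (a \<otimes>\<^bsub>A\<^esub> b) \<ominus>\<^bsub>F\<^esub> (a \<odot>\<^bsub>F\<^esub> e b \<oplus>\<^bsub>F\<^esub> b \<odot>\<^bsub>F\<^esub> e a) |a b. a \<in> carrier A \<and> b \<in> carrier A}
    \<union> {e c |c. c \<in> K})"

definition kaehler :: "('a, 'r) ring_scheme \<Rightarrow> 'a set \<Rightarrow> ('a, ('a \<Rightarrow> 'a) set) module" where
  "kaehler A K = presented_module A (carrier A) (kaehler_rels A K)"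

definition kaehler_d :: "('a, 'r) ring_scheme \<Rightarrow> 'a set \<Rightarrow> 'a \<Rightarrow> ('a \<Rightarrow> 'a) set" where
  "kaehler_d A K = presented_gen A (carrier A) (kaehler_rels A K)"


subsection \<open>Symmetric powers\<close>

definition sym_gens :: "nat \<Rightarrow> ('a, 'm, 's) module_scheme \<Rightarrow> 'm list set" where
  "sym_gens m M = {xs. length xs = m \<and> set xs \<subseteq> carrier M}"

definition sym_rels ::
  "('a, 'r) ring_scheme \<Rightarrow> nat \<Rightarrow> ('a, 'm, 's) module_scheme \<Rightarrow> ('m list \<Rightarrow> 'a) set" where
  "sym_rels A m M = (let F = free_module A (sym_gens m M); e = free_gen A in
      {e (xs @ [x \<oplus>\<^bsub>M\<^esub> y] @ ys) \<ominus>\<^bsub>F\<^esub> (e (xs @ [x] @ ys) \<oplus>\<^bsub>F\<^esub> e (xs @ [y] @ ys)) |xs x y ys.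
         x \<in> carrier M \<and> y \<in> carrier M \<and> xs @ [x] @ ys \<in> sym_gens m M}
    \<union> {e (xs @ [a \<odot>\<^bsub>M\<^esub> x] @ ys) \<ominus>\<^bsub>F\<^esub> a \<odot>\<^bsub>F\<^esub> e (xs @ [x] @ ys) |a xs x ys.
         a \<in> carrier A \<and> xs @ [x] @ ys \<in> sym_gens m M}
    \<union> {e (xs @ [x, y] @ ys) \<ominus>\<^bsub>F\<^esub> e (xs @ [y, x] @ ys) |xs x y ys.
         xs @ [x, y] @ ys \<in> sym_gens m M})"

definition sym_power ::
  "('a, 'r) ring_scheme \<Rightarrow> nat \<Rightarrow> ('a, 'm, 's) module_scheme \<Rightarrow> ('a, ('m list \<Rightarrow> 'a) set) module" where
  "sym_power A m M = presented_module A (sym_gens m M) (sym_rels A m M)"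

definition sym_prod ::
  "('a, 'r) ring_scheme \<Rightarrow> nat \<Rightarrow> ('a, 'm, 's) module_scheme \<Rightarrow> 'm list \<Rightarrow> ('m list \<Rightarrow> 'a) set" where
  "sym_prod A m M = presented_gen A (sym_gens m M) (sym_rels A m M)"


subsection \<open>Tensor products\<close>

definition tensor_rels ::
  "('a, 'r) ring_scheme \<Rightarrow> ('a, 'm, 's) module_scheme \<Rightarrow> ('a, 'l, 't) module_scheme
    \<Rightarrow> ('m \<times> 'l \<Rightarrow> 'a) set" where
  "tensor_rels A M L = (let F = free_module A (carrier M \<times> carrier L); e = free_gen A in
      {e (x \<oplus>\<^bsub>M\<^esub> y, z) \<ominus>\<^bsub>F\<^esub> (e (x, z) \<oplus>\<^bsub>F\<^esub> e (y, z)) |x y z.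
         x \<in> carrier M \<and> y \<in> carrier M \<and> z \<in> carrier L}
    \<union> {e (x, z \<oplus>\<^bsub>L\<^esub> w) \<ominus>\<^bsub>F\<^esub> (e (x, z) \<oplus>\<^bsub>F\<^esub> e (x, w)) |x z w.
         x \<in> carrier M \<and> z \<in> carrier L \<and> w \<in> carrier L}
    \<union> {e (a \<odot>\<^bsub>M\<^esub> x, z) \<ominus>\<^bsub>F\<^esub> a \<odot>\<^bsub>F\<^esub> e (x, z) |a x z.
         a \<in> carrier A \<and> x \<in> carrier M \<and> z \<in> carrier L}
    \<union> {e (x, a \<odot>\<^bsub>L\<^esub> z) \<ominus>\<^bsub>F\<^esub> a \<odot>\<^bsub>F\<^esub> e (x, z) |a x z.
         a \<in> carrier A \<and> x \<in> carrier M \<and> z \<in> carrier L})"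

definition tensor ::
  "('a, 'r) ring_scheme \<Rightarrow> ('a, 'm, 's) module_scheme \<Rightarrow> ('a, 'l, 't) module_scheme
    \<Rightarrow> ('a, ('m \<times> 'l \<Rightarrow> 'a) set) module" where
  "tensor A M L = presented_module A (carrier M \<times> carrier L) (tensor_rels A M L)"

definition tensor_elem ::
  "('a, 'r) ring_scheme \<Rightarrow> ('a, 'm, 's) module_scheme \<Rightarrow> ('a, 'l, 't) module_scheme
    \<Rightarrow> 'm \<Rightarrow> 'l \<Rightarrow> ('m \<times> 'l \<Rightarrow> 'a) set" where
  "tensor_elem A M L x z = presented_gen A (carrier M \<times> carrier L) (tensor_rels A M L) (x, z)"


section \<open>Sheaves of modules on a ringed space\<close>

text \<open>All sheaves below are sheaves of functions, so a restriction map needs only its target open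
  set as an argument.\<close>

record ('p, 'a) ringed_space =
  top_of :: "'p topology"
  fsec :: "'p set \<Rightarrow> 'a ring"
  fres :: "'p set \<Rightarrow> 'a \<Rightarrow> 'a"

record ('p, 'a, 's) module_sheaf =
  sec :: "'p set \<Rightarrow> ('a, 's) module"
  res :: "'p set \<Rightarrow> 's \<Rightarrow> 's"

definition sheaf_of_modules :: "('p, 'a) ringed_space \<Rightarrow> ('p, 'a, 's) module_sheaf \<Rightarrow> bool" where
  "sheaf_of_modules X F \<longleftrightarrow>
     (\<forall>U. openin (top_of X) U \<longrightarrow> module (fsec X U) (sec F U)) \<and>
     (\<forall>U V. openin (top_of X) U \<longrightarrow> openin (top_of X) V \<longrightarrow> V \<subseteq> U \<longrightarrow>
        (\<forall>s\<in>carrier (sec F U). res F V s \<in> carrier (sec F V)) \<and>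
        (\<forall>s\<in>carrier (sec F U). \<forall>t\<in>carrier (sec F U).
           res F V (s \<oplus>\<^bsub>sec F U\<^esub> t) = res F V s \<oplus>\<^bsub>sec F V\<^esub> res F V t) \<and>
        (\<forall>a\<in>carrier (fsec X U). \<forall>s\<in>carrier (sec F U).
           res F V (a \<odot>\<^bsub>sec F U\<^esub> s) = fres X V a \<odot>\<^bsub>sec F V\<^esub> res F V s)) \<and>
     (\<forall>U. openin (top_of X) U \<longrightarrow> (\<forall>s\<in>carrier (sec F U). res F U s = s)) \<and>
     (\<forall>U V W. openin (top_of X) U \<longrightarrow> openin (top_of X) V \<longrightarrow> openin (top_of X) W \<longrightarrow>
        W \<subseteq> V \<longrightarrow> V \<subseteq> U \<longrightarrow> (\<forall>s\<in>carrier (sec F U). res F W (res F V s) = res F W s)) \<and>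
     (\<forall>\<V> s. (\<forall>V\<in>\<V>. openin (top_of X) V \<and> s V \<in> carrier (sec F V)) \<longrightarrow>
        (\<forall>V\<in>\<V>. \<forall>W\<in>\<V>. res F (V \<inter> W) (s V) = res F (V \<inter> W) (s W)) \<longrightarrow>
        (\<exists>!t. t \<in> carrier (sec F (\<Union>\<V>)) \<and> (\<forall>V\<in>\<V>. res F V t = s V)))"

text \<open>Locally free of finite rank: near every point there is a finite family of sections that
  restricts to a basis over every smaller open set.\<close>

definition locally_free :: "('p, 'a) ringed_space \<Rightarrow> ('p, 'a, 's) module_sheaf \<Rightarrow> bool" where
  "locally_free X F \<longleftrightarrow> sheaf_of_modules X F \<and>
     (\<forall>p\<in>topspace (top_of X). \<exists>V r b. openin (top_of X) V \<and> p \<in> V \<and>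
        (\<forall>i<r::nat. b i \<in> carrier (sec F V)) \<and>
        (\<forall>W. openin (top_of X) W \<longrightarrow> W \<subseteq> V \<longrightarrow>
          (\<forall>s\<in>carrier (sec F W). \<exists>!c. c \<in> {..<r} \<rightarrow>\<^sub>E carrier (fsec X W) \<and>
             s = (\<Oplus>\<^bsub>sec F W\<^esub>i\<in>{..<r}. c i \<odot>\<^bsub>sec F W\<^esub> res F W (b i)))))"

definition sheaf_hom :: "('p, 'a) ringed_space \<Rightarrow> ('p, 'a, 's) module_sheaf \<Rightarrow>
    ('p, 'a, 't) module_sheaf \<Rightarrow> ('p set \<Rightarrow> 's \<Rightarrow> 't) \<Rightarrow> bool" where
  "sheaf_hom X F G \<phi> \<longleftrightarrow>
     (\<forall>U. openin (top_of X) U \<longrightarrow>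
        (\<forall>s\<in>carrier (sec F U). \<phi> U s \<in> carrier (sec G U)) \<and>
        (\<forall>s\<in>carrier (sec F U). \<forall>t\<in>carrier (sec F U).
           \<phi> U (s \<oplus>\<^bsub>sec F U\<^esub> t) = \<phi> U s \<oplus>\<^bsub>sec G U\<^esub> \<phi> U t) \<and>
        (\<forall>a\<in>carrier (fsec X U). \<forall>s\<in>carrier (sec F U).
           \<phi> U (a \<odot>\<^bsub>sec F U\<^esub> s) = a \<odot>\<^bsub>sec G U\<^esub> \<phi> U s)) \<and>
     (\<forall>U V. openin (top_of X) U \<longrightarrow> openin (top_of X) V \<longrightarrow> V \<subseteq> U \<longrightarrow>
        (\<forall>s\<in>carrier (sec F U). \<phi> V (res F V s) = res G V (\<phi> U s)))"

definition sheaf_injective :: "('p, 'a) ringed_space \<Rightarrow> ('p, 'a, 's) module_sheaf \<Rightarrow>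
    ('p, 'a, 't) module_sheaf \<Rightarrow> ('p set \<Rightarrow> 's \<Rightarrow> 't) \<Rightarrow> bool" where
  "sheaf_injective X F G \<phi> \<longleftrightarrow>
     (\<forall>U. openin (top_of X) U \<longrightarrow>
        (\<forall>s\<in>carrier (sec F U). \<phi> U s = \<zero>\<^bsub>sec G U\<^esub> \<longrightarrow> s = \<zero>\<^bsub>sec F U\<^esub>))"

definition in_image_sheaf :: "('p, 'a) ringed_space \<Rightarrow> ('p, 'a, 's) module_sheaf \<Rightarrow>
    ('p, 'a, 't) module_sheaf \<Rightarrow> ('p set \<Rightarrow> 's \<Rightarrow> 't) \<Rightarrow> 'p set \<Rightarrow> 't \<Rightarrow> bool" where
  "in_image_sheaf X F G \<phi> U t \<longleftrightarrow>
     (\<forall>p\<in>U. \<exists>V. openin (top_of X) V \<and> p \<in> V \<and> V \<subseteq> U \<and>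
        (\<exists>s\<in>carrier (sec F V). \<phi> V s = res G V t))"

definition sheaf_surjective :: "('p, 'a) ringed_space \<Rightarrow> ('p, 'a, 's) module_sheaf \<Rightarrow>
    ('p, 'a, 't) module_sheaf \<Rightarrow> ('p set \<Rightarrow> 's \<Rightarrow> 't) \<Rightarrow> bool" where
  "sheaf_surjective X F G \<phi> \<longleftrightarrow>
     (\<forall>U. openin (top_of X) U \<longrightarrow> (\<forall>t\<in>carrier (sec G U). in_image_sheaf X F G \<phi> U t))"

definition sheaf_exact :: "('p, 'a) ringed_space \<Rightarrow> ('p, 'a, 's) module_sheaf \<Rightarrow>
    ('p, 'a, 't) module_sheaf \<Rightarrow> ('p, 'a, 'u) module_sheaf \<Rightarrow>
    ('p set \<Rightarrow> 's \<Rightarrow> 't) \<Rightarrow> ('p set \<Rightarrow> 't \<Rightarrow> 'u) \<Rightarrow> bool" where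
  "sheaf_exact X F G H \<phi> \<psi> \<longleftrightarrow>
     (\<forall>U. openin (top_of X) U \<longrightarrow>
        (\<forall>t\<in>carrier (sec G U). \<psi> U t = \<zero>\<^bsub>sec H U\<^esub> \<longleftrightarrow> in_image_sheaf X F G \<phi> U t))"

text \<open>\<open>0 \<rightarrow> E\<^sub>2 \<rightarrow> E\<^sub>1 \<rightarrow> E\<^sub>0\<close> is a locally free resolution of \<open>G\<close>: it extends, by some
  augmentation \<open>\<epsilon>\<close>, to an exact sequence \<open>0 \<rightarrow> E\<^sub>2 \<rightarrow> E\<^sub>1 \<rightarrow> E\<^sub>0 \<rightarrow> G \<rightarrow> 0\<close>.\<close>

definition locally_free_resolution :: "('p, 'a) ringed_space \<Rightarrow>
    ('p, 'a, 's) module_sheaf \<Rightarrow> ('p set \<Rightarrow> 's \<Rightarrow> 't) \<Rightarrow>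
    ('p, 'a, 't) module_sheaf \<Rightarrow> ('p set \<Rightarrow> 't \<Rightarrow> 'u) \<Rightarrow>
    ('p, 'a, 'u) module_sheaf \<Rightarrow> ('p, 'a, 'v) module_sheaf \<Rightarrow> bool" where
  "locally_free_resolution X E\<^sub>2 \<phi> E\<^sub>1 \<psi> E\<^sub>0 G \<longleftrightarrow>
     locally_free X E\<^sub>2 \<and> locally_free X E\<^sub>1 \<and> locally_free X E\<^sub>0 \<and> sheaf_of_modules X G \<and>
     sheaf_hom X E\<^sub>2 E\<^sub>1 \<phi> \<and> sheaf_hom X E\<^sub>1 E\<^sub>0 \<psi> \<and>
     sheaf_injective X E\<^sub>2 E\<^sub>1 \<phi> \<and> sheaf_exact X E\<^sub>2 E\<^sub>1 E\<^sub>0 \<phi> \<psi> \<and>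
     (\<exists>\<epsilon>. sheaf_hom X E\<^sub>0 G \<epsilon> \<and> sheaf_exact X E\<^sub>1 E\<^sub>0 G \<psi> \<epsilon> \<and> sheaf_surjective X E\<^sub>0 G \<epsilon>)"


section \<open>Projective space\<close>

text \<open>The homogeneous coordinates are indexed by a finite type \<open>'n\<close> with \<open>N + 1\<close> elements, and
  polynomials are identified with polynomial functions on \<open>\<complex>\<^sup>N\<^sup>+\<^sup>1\<close>.\<close>

definition exponents :: "nat \<Rightarrow> ('n::finite \<Rightarrow> nat) set" where
  "exponents m = {e. (\<Sum>i\<in>UNIV. e i) = m}"

definition monomial :: "('n::finite \<Rightarrow> nat) \<Rightarrow> complex ^ 'n \<Rightarrow> complex" where
  "monomial e X = (\<Prod>i\<in>UNIV. X $ i ^ e i)"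

definition homog_poly :: "nat \<Rightarrow> (complex ^ 'n::finite \<Rightarrow> complex) \<Rightarrow> bool" where
  "homog_poly d f \<longleftrightarrow> (\<exists>c. f = (\<lambda>X. \<Sum>e\<in>exponents d. c e * monomial e X))"

definition partial :: "'n::finite \<Rightarrow> (complex ^ 'n \<Rightarrow> complex) \<Rightarrow> complex ^ 'n \<Rightarrow> complex" where
  "partial i f X = deriv (\<lambda>t. f (\<chi> j. if j = i then t else X $ j)) (X $ i)"

text \<open>A point of \<open>P\<^sup>N\<close> is a punctured line through the origin. For a set \<open>U\<close> of points, \<open>\<Union>U\<close> is
  then the punctured cone over \<open>U\<close>.\<close>

type_synonym 'n point = "(complex ^ 'n) set"

definition proj_points :: "'n::finite point set" where
  "proj_points = {{c *s X |c. c \<noteq> 0} |X. X \<noteq> 0}"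

definition basic_open :: "(complex ^ 'n::finite \<Rightarrow> complex) \<Rightarrow> 'n point set" where
  "basic_open f = {p \<in> proj_points. \<forall>X\<in>p. f X \<noteq> 0}"

definition zariski :: "'n::finite point topology" where
  "zariski = topology_generated_by {basic_open f |f d. homog_poly d f}"

text \<open>Sections of \<open>O(n)\<close> over \<open>U\<close> are functions on the cone over \<open>U\<close> that are locally quotients
  \<open>a/b\<close> of homogeneous polynomials with \<open>deg a - deg b = n\<close>. Regularity concerns only the
  values on the cone; sections are extended by \<open>0\<close> outside it.\<close>

definition regular_on :: "int \<Rightarrow> 'n::finite point set \<Rightarrow> (complex ^ 'n \<Rightarrow> complex) \<Rightarrow> bool" where
  "regular_on n U f \<longleftrightarrow>
     (\<forall>p\<in>U. \<exists>V a b k l. openin zariski V \<and> p \<in> V \<and> V \<subseteq> U \<and>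
        homog_poly k a \<and> homog_poly l b \<and> int k - int l = n \<and>
        (\<forall>X\<in>\<Union>V. b X \<noteq> 0 \<and> f X = a X / b X))"

definition O_sections :: "int \<Rightarrow> 'n::finite point set \<Rightarrow> (complex ^ 'n \<Rightarrow> complex) set" where
  "O_sections n U = {f. regular_on n U f \<and> (\<forall>X. X \<notin> \<Union>U \<longrightarrow> f X = 0)}"

definition proj_space :: "('n::finite point, complex ^ 'n \<Rightarrow> complex) ringed_space" where
  "proj_space =
    \<lparr>top_of = zariski,
     fsec = (\<lambda>U. \<lparr>carrier = O_sections 0 U, mult = (\<lambda>f g X. f X * g X),
                  one = (\<lambda>X. if X \<in> \<Union>U then 1 else 0),
                  zero = (\<lambda>X. 0), add = (\<lambda>f g X. f X + g X)\<rparr>),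
     fres = (\<lambda>V f X. if X \<in> \<Union>V then f X else 0)\<rparr>"


section \<open>The bundles \<open>Ker \<delta>\<^sup>k\<close> and the maps \<open>\<alpha>(P)\<close>, \<open>\<beta>(P)\<close>\<close>

text \<open>Sections of \<open>\<complex>[Y]\<^sub>m \<otimes> O(n)\<close>, as functions of \<open>X\<close> and \<open>Y\<close>.\<close>

definition Y_sections ::
  "nat \<Rightarrow> int \<Rightarrow> 'n::finite point set \<Rightarrow> (complex ^ 'n \<Rightarrow> complex ^ 'n \<Rightarrow> complex) set" where
  "Y_sections m n U =
     {\<lambda>X Y. \<Sum>e\<in>exponents m. a e X * monomial e Y |a. \<forall>e\<in>exponents m. a e \<in> O_sections n U}"

definition delta :: "(complex ^ 'n::finite \<Rightarrow> complex ^ 'n \<Rightarrow> complex)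
    \<Rightarrow> complex ^ 'n \<Rightarrow> complex ^ 'n \<Rightarrow> complex" where
  "delta F = (\<lambda>X Y. \<Sum>i\<in>UNIV. X $ i * partial i (F X) Y)"

text \<open>If \<open>m < k\<close> then \<open>\<delta>\<^sup>k\<close> vanishes on polynomials of degree \<open>m\<close> in \<open>Y\<close>, in accordance with
  the convention that \<open>\<complex>[Y]\<^sub>m\<^sub>-\<^sub>k = 0\<close>.\<close>

definition Ker_delta :: "nat \<Rightarrow> nat \<Rightarrow> int \<Rightarrow>
    ('n::finite point, complex ^ 'n \<Rightarrow> complex,
     complex ^ 'n \<Rightarrow> complex ^ 'n \<Rightarrow> complex) module_sheaf" where
  "Ker_delta k m n =
    \<lparr>sec = (\<lambda>U. \<lparr>carrier = {F \<in> Y_sections m n U. \<forall>X Y. (delta ^^ k) F X Y = 0},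
                 mult = undefined, one = undefined,
                 zero = (\<lambda>X Y. 0), add = (\<lambda>F G X Y. F X Y + G X Y),
                 smult = (\<lambda>f F X Y. f X * F X Y)\<rparr>),
     res = (\<lambda>V F X Y. if X \<in> \<Union>V then F X Y else 0)\<rparr>"

definition alpha :: "nat \<Rightarrow> (complex ^ 'n::finite \<Rightarrow> complex)
    \<Rightarrow> (complex ^ 'n \<Rightarrow> complex ^ 'n \<Rightarrow> complex) \<Rightarrow> complex ^ 'n \<Rightarrow> complex ^ 'n \<Rightarrow> complex" where
  "alpha d P F = (\<lambda>X Y. 1 / of_nat d * (\<Sum>j\<in>UNIV. partial j P X * Y $ j) * F X Y)"

definition beta :: "nat \<Rightarrow> (complex ^ 'n::finite \<Rightarrow> complex)
    \<Rightarrow> (complex ^ 'n \<Rightarrow> complex ^ 'n \<Rightarrow> complex) \<Rightarrow> complex ^ 'n \<Rightarrow> complex ^ 'n \<Rightarrow> complex" where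
  "beta d P A = (\<lambda>X Y. P X * A X Y - alpha d P (delta A) X Y)"


section \<open>Symmetric differentials on a hypersurface\<close>

text \<open>Smoothness is the Jacobian criterion; in particular it excludes \<open>P = 0\<close>.\<close>

definition smooth_hypersurface :: "nat \<Rightarrow> (complex ^ 'n::finite \<Rightarrow> complex) \<Rightarrow> bool" where
  "smooth_hypersurface d P \<longleftrightarrow> homog_poly d P \<and>
     (\<forall>X. X \<noteq> 0 \<longrightarrow> P X = 0 \<longrightarrow> (\<exists>i. partial i P X \<noteq> 0))"

definition hypersurface :: "(complex ^ 'n::finite \<Rightarrow> complex) \<Rightarrow> 'n point set" where
  "hypersurface P = {p \<in> proj_points. \<forall>X\<in>p. P X = 0}"

text \<open>\<open>H\<close> carries \<open>O\<^sub>H(k) = O(k) / P O(k - d)\<close>. The stalk at \<open>p\<close> consists of the classes of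
  functions \<open>f\<close> that are regular of degree \<open>k\<close> near \<open>p\<close>, where \<open>f\<close> and \<open>g\<close> are identified if
  \<open>g = f + P h\<close> near \<open>p\<close> for some \<open>h\<close> that is regular of degree \<open>k - d\<close>.\<close>

definition near_regular :: "int \<Rightarrow> 'n::finite point \<Rightarrow> (complex ^ 'n \<Rightarrow> complex) set" where
  "near_regular k p = {f. \<exists>V. openin zariski V \<and> p \<in> V \<and> regular_on k V f}"

definition OH_germ :: "nat \<Rightarrow> (complex ^ 'n::finite \<Rightarrow> complex) \<Rightarrow> 'n point \<Rightarrow> int
    \<Rightarrow> (complex ^ 'n \<Rightarrow> complex) \<Rightarrow> (complex ^ 'n \<Rightarrow> complex) set" where
  "OH_germ d P p k f = {g \<in> near_regular k p. \<exists>V h. openin zariski V \<and> p \<in> V \<and>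
     regular_on (k - int d) V h \<and> (\<forall>X\<in>\<Union>V. g X = f X + P X * h X)}"

definition OH_stalk :: "nat \<Rightarrow> (complex ^ 'n::finite \<Rightarrow> complex) \<Rightarrow> 'n point
    \<Rightarrow> ((complex ^ 'n \<Rightarrow> complex) set) ring" where
  "OH_stalk d P p =
    \<lparr>carrier = OH_germ d P p 0 ` near_regular 0 p,
     mult = (\<lambda>C D. \<Union>f\<in>C. \<Union>g\<in>D. OH_germ d P p 0 (\<lambda>X. f X * g X)),
     one = OH_germ d P p 0 (\<lambda>X. 1), zero = OH_germ d P p 0 (\<lambda>X. 0),
     add = (\<lambda>C D. \<Union>f\<in>C. \<Union>g\<in>D. OH_germ d P p 0 (\<lambda>X. f X + g X))\<rparr>"

definition OH_constants :: "nat \<Rightarrow> (complex ^ 'n::finite \<Rightarrow> complex) \<Rightarrow> 'n point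
    \<Rightarrow> (complex ^ 'n \<Rightarrow> complex) set set" where
  "OH_constants d P p = range (\<lambda>c. OH_germ d P p 0 (\<lambda>X. c))"

definition OH_twist_stalk :: "nat \<Rightarrow> (complex ^ 'n::finite \<Rightarrow> complex) \<Rightarrow> 'n point \<Rightarrow> int
    \<Rightarrow> ((complex ^ 'n \<Rightarrow> complex) set, (complex ^ 'n \<Rightarrow> complex) set) module" where
  "OH_twist_stalk d P p k =
    \<lparr>carrier = OH_germ d P p k ` near_regular k p,
     mult = undefined, one = undefined, zero = OH_germ d P p k (\<lambda>X. 0),
     add = (\<lambda>C D. \<Union>f\<in>C. \<Union>g\<in>D. OH_germ d P p k (\<lambda>X. f X + g X)),
     smult = (\<lambda>C D. \<Union>f\<in>C. \<Union>g\<in>D. OH_germ d P p k (\<lambda>X. f X * g X))\<rparr>"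

definition Omega_stalk where
  "Omega_stalk d P p = kaehler (OH_stalk d P p) (OH_constants d P p)"

text \<open>The stalk of \<open>S\<^sup>m \<Omega>\<^sub>H \<otimes> O\<^sub>H(k)\<close>, and its elements \<open>(df\<^sub>1 \<cdots> df\<^sub>m) \<otimes> h\<close>.\<close>

definition Sym_Omega_stalk where
  "Sym_Omega_stalk d P m k p =
     tensor (OH_stalk d P p) (sym_power (OH_stalk d P p) m (Omega_stalk d P p))
       (OH_twist_stalk d P p k)"

definition Sym_Omega_elem where
  "Sym_Omega_elem d P m k p fs h =
     tensor_elem (OH_stalk d P p) (sym_power (OH_stalk d P p) m (Omega_stalk d P p))
       (OH_twist_stalk d P p k)
       (sym_prod (OH_stalk d P p) m (Omega_stalk d P p)
          (map (\<lambda>f. kaehler_d (OH_stalk d P p) (OH_constants d P p) (OH_germ d P p 0 f)) fs))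
       (OH_germ d P p k h)"

text \<open>The push-forward to \<open>P\<^sup>N\<close> of the sheaf \<open>S\<^sup>m \<Omega>\<^sub>H(k)\<close>: its sections over \<open>U\<close> are the families
  of stalk elements on \<open>U \<inter> H\<close> that are locally induced by a finite sum of symbols
  \<open>(df\<^sub>1 \<cdots> df\<^sub>m) \<otimes> h\<close>. Here \<open>O\<^sub>H\<close> and \<open>O\<^sub>H(k)\<close> are quotients of \<open>O\<close> and \<open>O(k)\<close>, so that locally
  the \<open>f\<^sub>i\<close> and \<open>h\<close> may be taken regular on an open subset of \<open>P\<^sup>N\<close>.\<close>

definition Sym_Omega where
  "Sym_Omega d P m k =
    \<lparr>sec = (\<lambda>U. \<lparr>carrier = {s.
          (\<forall>p. p \<notin> U \<inter> hypersurface P \<longrightarrow> s p = undefined) \<and>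
          (\<forall>p\<in>U \<inter> hypersurface P. \<exists>V r h f. openin zariski V \<and> p \<in> V \<and> V \<subseteq> U \<and>
             (\<forall>j<r::nat. regular_on k V (h j) \<and> length (f j) = m \<and>
                (\<forall>g\<in>set (f j). regular_on 0 V g)) \<and>
             (\<forall>q\<in>V \<inter> hypersurface P.
                s q = (\<Oplus>\<^bsub>Sym_Omega_stalk d P m k q\<^esub>j\<in>{..<r}. Sym_Omega_elem d P m k q (f j) (h j))))},
        mult = undefined, one = undefined,
        zero = (\<lambda>p\<in>U \<inter> hypersurface P. \<zero>\<^bsub>Sym_Omega_stalk d P m k p\<^esub>),
        add = (\<lambda>s t. \<lambda>p\<in>U \<inter> hypersurface P. s p \<oplus>\<^bsub>Sym_Omega_stalk d P m k p\<^esub> t p),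
        smult = (\<lambda>a s. \<lambda>p\<in>U \<inter> hypersurface P.
                   OH_germ d P p 0 a \<odot>\<^bsub>Sym_Omega_stalk d P m k p\<^esub> s p)\<rparr>),
     res = (\<lambda>V s. restrict s (V \<inter> hypersurface P))\<rparr>"

end

theory Submission
  imports Defs
begin

text \<open>The augmentation \<open>Ker \<delta>\<^sub>m\<^sub>,\<^sub>n \<rightarrow> S\<^sup>m \<Omega>\<^sub>H(m + n)\<close> is the substitution \<open>Y = dX\<close>: over the chart
  \<open>X\<^sub>i \<noteq> 0\<close>, elements of \<open>Ker \<delta>\<close> are polynomials in \<open>\<zeta>\<^sub>j = Y\<^sub>j - (X\<^sub>j / X\<^sub>i) Y\<^sub>i\<close>, and \<open>\<zeta>\<^sub>j\<close> is sent to
  \<open>X\<^sub>i d(X\<^sub>j / X\<^sub>i)\<close>. In the other direction, \<open>(df\<^sub>1 \<cdots> df\<^sub>m) \<otimes> h\<close> is lifted to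
  \<open>h \<Prod>\<^sub>l (\<Sum>\<^sub>j \<partial>\<^sub>jf\<^sub>l Y\<^sub>j)\<close>. As \<open>\<Omega>\<^sub>H\<close> is generated by the \<open>d(X\<^sub>j / X\<^sub>i)\<close> subject to the conormal relation
  only, the two maps are inverse to each other modulo \<open>P\<close> and \<open>dP\<close>, and these multiples within
  \<open>Ker \<delta>\<close> are exactly the image of \<open>\<beta>(P)\<close>. Off \<open>H\<close> the map \<open>\<beta>(P)\<close> is onto because \<open>P\<close> is invertible.
  If \<open>P A = \<alpha>(P)(\<delta> A)\<close>, then \<open>A\<close> vanishes on \<open>dP = 0\<close> by density, hence \<open>A\<close> is a multiple of
  \<open>dP\<close>; here smoothness provides an invertible partial derivative \<open>\<partial>\<^sub>iP\<close>, also at points off \<open>H\<close> by Euler's formula.\<close>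

section \<open>Homogeneous polynomial functions\<close>

text \<open>The stalks of S^m \<Omega>_H are quotients of free modules by lists of relations, so
  beforehand it is not even visible that a given symbol is nonzero. They are compared with
  functions: a map \<open>lift\<close> out of the presented module, well defined only modulo the
  space \<open>Z\<close> of germs in the image of \<beta>(P), and a map \<sigma> back, given by
  coefficients in a chart. Three facts are proved: \<open>lift\<close> after \<sigma> is the
  identity modulo \<open>Z\<close>, \<sigma> kills \<open>Z\<close>, and \<sigma> is onto. The
  kernel of \<sigma> then needs no separate division by P and dP: if \<sigma> F = 0, then F is
  congruent to \<open>lift\<close> of 0 and so lies in \<open>Z\<close>. What makes
  \<open>lift\<close> well defined is that the differential of P h, for h of degree opposite to that
  of P, is \<beta>(P) of the differential of h, by Euler's formula; this explains the shape of
  \<beta>(P). The map \<sigma> depends on a chart, \<open>lift\<close> does not, and injectivity of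
  \<open>lift\<close> makes the maps \<sigma> glue. Derivatives are the classical complex ones,
  usable on Zariski germs because cones over Zariski open sets are open.\<close>

lemma finite_exponents [simp]: "finite (exponents m :: ('n::finite \<Rightarrow> nat) set)"
proof (rule finite_subset)
  show "(exponents m :: ('n \<Rightarrow> nat) set) \<subseteq> PiE UNIV (\<lambda>_. {..m})"
  proof
    fix e :: "'n \<Rightarrow> nat" assume "e \<in> exponents m"
    then have "(\<Sum>i\<in>UNIV. e i) = m" by (simp add: exponents_def)
    then have "e i \<le> m" for i using member_le_sum[of i UNIV e] by auto
    then show "e \<in> PiE UNIV (\<lambda>_. {..m})" by auto
  qed
qed (auto intro: finite_PiE)

lemma exponents_add: "e \<in> exponents m \<Longrightarrow> e' \<in> exponents n \<Longrightarrow> (\<lambda>i. e i + e' i) \<in> exponents (m + n)"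
  by (simp add: exponents_def sum.distrib)

lemma exponents_0: "exponents 0 = {\<lambda>_. 0}"
  by (auto simp: exponents_def)

lemma monomial_add: "monomial (\<lambda>i. e i + e' i) X = monomial e X * monomial e' X"
  by (simp add: monomial_def power_add prod.distrib)

lemma monomial_0 [simp]: "monomial (\<lambda>_. 0) X = 1"
  by (simp add: monomial_def)

lemma monomial_one [simp]: "monomial e (\<chi> i. 1) = 1"
  by (simp add: monomial_def)

lemma monomial_mult: "monomial e (\<chi> i. X $ i * Y $ i) = monomial e X * monomial e Y"
  by (simp add: monomial_def power_mult_distrib prod.distrib)

lemma monomial_scale: "e \<in> exponents m \<Longrightarrow> monomial e (c *s X) = c ^ m * monomial e X"
  by (auto simp add: monomial_def power_mult_distrib prod.distrib exponents_def power_sum)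

definition unit_exp :: "'n::finite \<Rightarrow> 'n \<Rightarrow> nat" where
  "unit_exp i = (\<lambda>j. if j = i then 1 else 0)"

lemma unit_exp_exponents: "unit_exp i \<in> exponents 1"
  by (simp add: unit_exp_def exponents_def)

lemma unit_exp_apply [simp]: "unit_exp i i = 1" "j \<noteq> i \<Longrightarrow> unit_exp i j = 0"
  by (simp_all add: unit_exp_def)

lemma monomial_unit_exp [simp]: "monomial (unit_exp i) X = X $ i"
proof -
  have "monomial (unit_exp i) X = (\<Prod>j\<in>UNIV. if j = i then X $ j else 1)"
    unfolding monomial_def by (rule prod.cong) (auto simp: unit_exp_def)
  then show ?thesis by simp
qed

text \<open>Dedekind's argument for the independence of distinct multiplicative characters.\<close>

lemma monomials_independent:
  fixes c :: "('n::finite \<Rightarrow> nat) \<Rightarrow> complex"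
  assumes "finite E" "\<And>X. (\<Sum>e\<in>E. c e * monomial e X) = 0" "e \<in> E"
  shows "c e = 0"
  using assms
proof (induction "card E" arbitrary: E c e rule: less_induct)
  case less
  have other: "c e1 = 0" if e01: "e1 \<in> E" "e0 \<in> E" "e1 \<noteq> e0" for e0 e1
  proof -
    obtain i where i: "e1 i \<noteq> e0 i" using e01(3) by (meson ext)
    \<comment> \<open>Doubling the single coordinate in which e1 and e0 differ separates them: the
      monomial of e takes the value 2 ^ e i at this vector.\<close>
    define a :: "complex ^ 'n" where "a = (\<chi> j. if j = i then 2 else 1)"
    have ma: "monomial e a = 2 ^ e i" for e
    proof -
      have "monomial e a = (\<Prod>j\<in>UNIV. if j = i then 2 ^ e i else 1)"
        unfolding monomial_def a_def by (rule prod.cong) auto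
      then show ?thesis by simp
    qed
    have "monomial e1 a \<noteq> monomial e0 a"
    proof
      assume "monomial e1 a = monomial e0 a"
      then have "norm ((2::complex) ^ e1 i) = norm ((2::complex) ^ e0 i)" by (simp add: ma)
      then have "(2::real) ^ e1 i = 2 ^ e0 i" by (simp add: norm_power)
      with i show False by simp
    qed
    \<comment> \<open>Evaluate the relation at the coordinatewise product of a and X and subtract
      \<open>monomial e0 a\<close> times the relation at X: the e0 term cancels, and the shorter
      relation falls under the induction hypothesis.\<close>
    moreover have "(\<Sum>e\<in>E - {e0}. (c e * (monomial e a - monomial e0 a)) * monomial e X) = 0" for X
    proof -
      have "0 = (\<Sum>e\<in>E. c e * monomial e (\<chi> i. a $ i * X $ i))
          - monomial e0 a * (\<Sum>e\<in>E. c e * monomial e X)"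
        by (simp add: less.prems)
      also have "\<dots> = (\<Sum>e\<in>E. (c e * (monomial e a - monomial e0 a)) * monomial e X)"
        unfolding sum_distrib_left sum_subtractf[symmetric]
        by (rule sum.cong) (auto simp: monomial_mult algebra_simps)
      also have "\<dots> = (\<Sum>e\<in>E - {e0}. (c e * (monomial e a - monomial e0 a)) * monomial e X)"
        using that less.prems(1) by (simp add: sum.remove[of E e0])
      finally show ?thesis by simp
    qed
    moreover have "card (E - {e0}) < card E"
      using that less.prems(1) by (meson card_Diff1_less)
    ultimately have "c e1 * (monomial e1 a - monomial e0 a) = 0"
      using less.hyps[of "E - {e0}" "\<lambda>e. c e * (monomial e a - monomial e0 a)" e1] that less.prems(1)
      by auto
    with \<open>monomial e1 a \<noteq> monomial e0 a\<close> show ?thesis by simp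
  qed
  \<comment> \<open>If E has a second element, it plays the part of e0 in \<open>other\<close>; if
    not, the vector of ones reads off the only coefficient.\<close>
  show ?case
  proof (cases "E = {e}")
    case True
    then show ?thesis using less.prems(2)[of "\<chi> i. 1"] by simp
  next
    case False
    then show ?thesis using other less.prems(3) by blast
  qed
qed

section \<open>Operations on homogeneous polynomials, and their coefficients\<close>

lemma homog_poly_zero [simp]: "homog_poly d (\<lambda>X. 0)"
  unfolding homog_poly_def by (rule exI[of _ "\<lambda>_. 0"]) simp

lemma homog_poly_add: "homog_poly d f \<Longrightarrow> homog_poly d g \<Longrightarrow> homog_poly d (\<lambda>X. f X + g X)"
  unfolding homog_poly_def
proof (elim exE)
  fix c c' assume "f = (\<lambda>X. \<Sum>e\<in>exponents d. c e * monomial e X)"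
    "g = (\<lambda>X. \<Sum>e\<in>exponents d. c' e * monomial e X)"
  then show "\<exists>c. (\<lambda>X. f X + g X) = (\<lambda>X. \<Sum>e\<in>exponents d. c e * monomial e X)"
    by (intro exI[of _ "\<lambda>e. c e + c' e"]) (auto simp: sum.distrib algebra_simps)
qed

lemma homog_poly_cmult: "homog_poly d f \<Longrightarrow> homog_poly d (\<lambda>X. a * f X)"
  unfolding homog_poly_def
proof (elim exE)
  fix c assume "f = (\<lambda>X. \<Sum>e\<in>exponents d. c e * monomial e X)"
  then show "\<exists>c. (\<lambda>X. a * f X) = (\<lambda>X. \<Sum>e\<in>exponents d. c e * monomial e X)"
    by (intro exI[of _ "\<lambda>e. a * c e"]) (auto simp: sum_distrib_left algebra_simps)
qed

lemma homog_poly_diff: "homog_poly d f \<Longrightarrow> homog_poly d g \<Longrightarrow> homog_poly d (\<lambda>X. f X - g X)"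
  using homog_poly_add[of d f "\<lambda>X. -1 * g X"] homog_poly_cmult[of d g "-1"] by simp

lemma homog_poly_sum: "(\<And>i. i \<in> I \<Longrightarrow> homog_poly d (f i)) \<Longrightarrow> homog_poly d (\<lambda>X. \<Sum>i\<in>I. f i X)"
  by (induction I rule: infinite_finite_induct) (auto intro: homog_poly_add)

lemma homog_poly_monomial: "e \<in> exponents d \<Longrightarrow> homog_poly d (monomial e)"
  unfolding homog_poly_def
  by (rule exI[of _ "\<lambda>e'. if e' = e then 1 else 0"]) (simp add: if_distrib[of "\<lambda>x. x * _"] cong: if_cong)

lemma homog_poly_mult:
  assumes "homog_poly d f" "homog_poly d' g"
  shows "homog_poly (d + d') (\<lambda>X. f X * g X)"
proof -
  obtain c c' where c: "f = (\<lambda>X. \<Sum>e\<in>exponents d. c e * monomial e X)"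
    "g = (\<lambda>X. \<Sum>e\<in>exponents d'. c' e * monomial e X)"
    using assms unfolding homog_poly_def by auto
  have "(\<lambda>X. f X * g X) = (\<lambda>X. \<Sum>e\<in>exponents d. \<Sum>e'\<in>exponents d'.
      (c e * c' e') * monomial (\<lambda>i. e i + e' i) X)"
    unfolding c sum_product by (simp add: monomial_add algebra_simps)
  then show ?thesis
    by (simp only:) (intro homog_poly_sum homog_poly_cmult homog_poly_monomial exponents_add)
qed

lemma homog_poly_const [simp]: "homog_poly 0 (\<lambda>X. c)"
  unfolding homog_poly_def by (rule exI[of _ "\<lambda>_. c"]) (simp add: exponents_0)

lemma homog_poly_0_iff: "homog_poly 0 f \<longleftrightarrow> (\<exists>c. f = (\<lambda>X. c))"
  unfolding homog_poly_def by (auto simp: exponents_0)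

lemma homog_poly_coord [simp]: "homog_poly 1 (\<lambda>X. X $ i)"
proof -
  have "monomial (unit_exp i) = (\<lambda>X. X $ i)" by (rule ext) simp
  then show ?thesis using homog_poly_monomial[OF unit_exp_exponents[of i]] by simp
qed

lemma homog_poly_power: "homog_poly d f \<Longrightarrow> homog_poly (k * d) (\<lambda>X. f X ^ k)"
  by (induction k) (simp_all add: homog_poly_mult)

lemma homog_poly_scale: "homog_poly d f \<Longrightarrow> f (c *s X) = c ^ d * f X"
  by (auto simp: homog_poly_def monomial_scale sum_distrib_left algebra_simps intro!: sum.cong)

text \<open>A choice of coefficients. For homogeneous q of degree m, \<open>coeffs_of_unique\<close>
  shows that there is no freedom in it on \<open>exponents m\<close>, so that it commutes with sums
  and scalar multiples.\<close>

definition coeffs_of :: "nat \<Rightarrow> (complex ^ 'n::finite \<Rightarrow> complex) \<Rightarrow> ('n \<Rightarrow> nat) \<Rightarrow> complex" where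
  "coeffs_of m q = (SOME c. q = (\<lambda>Y. \<Sum>e\<in>exponents m. c e * monomial e Y))"

lemma coeffs_of: "homog_poly m q \<Longrightarrow> q Y = (\<Sum>e\<in>exponents m. coeffs_of m q e * monomial e Y)"
  unfolding homog_poly_def coeffs_of_def by (drule someI_ex) meson

lemma coeffs_of_unique:
  assumes "\<And>Y. q Y = (\<Sum>e\<in>exponents m. c e * monomial e Y)" "e \<in> exponents m"
  shows "coeffs_of m q e = c e"
proof -
  have h: "homog_poly m q" using assms(1) unfolding homog_poly_def by blast
  have "(\<Sum>e\<in>exponents m. (coeffs_of m q e - c e) * monomial e Y) = 0" for Y
    using coeffs_of[OF h, of Y] assms(1)[of Y] by (simp add: sum_subtractf left_diff_distrib)
  then have "coeffs_of m q e - c e = 0"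
    using monomials_independent[OF finite_exponents, of "\<lambda>e. coeffs_of m q e - c e" m e] assms(2) by blast
  then show ?thesis by simp
qed

lemma coeffs_of_add:
  assumes "homog_poly m q" "homog_poly m r" "e \<in> exponents m"
  shows "coeffs_of m (\<lambda>Y. q Y + r Y) e = coeffs_of m q e + coeffs_of m r e"
  by (rule coeffs_of_unique)
    (simp_all add: assms(3) coeffs_of[OF assms(1), symmetric] coeffs_of[OF assms(2), symmetric]
      distrib_right sum.distrib)

lemma coeffs_of_cmult:
  assumes "homog_poly m q" "e \<in> exponents m"
  shows "coeffs_of m (\<lambda>Y. a * q Y) e = a * coeffs_of m q e"
  by (rule coeffs_of_unique)
    (simp_all add: assms(2) coeffs_of[OF assms(1), symmetric] sum_distrib_left[symmetric] mult.assoc)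

lemma coeffs_of_zero: "e \<in> exponents m \<Longrightarrow> coeffs_of m (\<lambda>Y. 0) e = 0"
  by (rule coeffs_of_unique) auto

lemma homog_poly_continuous: "homog_poly d f \<Longrightarrow> continuous_on UNIV f"
  unfolding homog_poly_def monomial_def by (auto intro!: continuous_intros)

lemma homog_poly_isCont: "homog_poly d f \<Longrightarrow> isCont f X"
  using homog_poly_continuous continuous_on_eq_continuous_at by blast

text \<open>A polynomial function restricted to a line is a polynomial in one variable, so its zero set
  has empty interior unless it vanishes identically.\<close>

lemma monomial_line_poly: "\<exists>p. \<forall>t. poly p t = monomial e (X + t *s V)"
proof -
  have "poly (\<Prod>i\<in>UNIV. [:X $ i, V $ i:] ^ e i) t = monomial e (X + t *s V)" for t
    by (simp add: monomial_def poly_prod)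
  then show ?thesis by blast
qed

lemma homog_poly_line_poly:
  assumes "homog_poly d f"
  shows "\<exists>p. \<forall>t. poly p t = f (X + t *s V)"
proof -
  obtain c where c: "f = (\<lambda>X. \<Sum>e\<in>exponents d. c e * monomial e X)"
    using assms unfolding homog_poly_def by auto
  obtain p where p: "\<And>e t. poly (p e) t = monomial e (X + t *s V)"
    using monomial_line_poly[of _ X V] by metis
  show ?thesis
    by (rule exI[of _ "\<Sum>e\<in>exponents d. Polynomial.smult (c e) (p e)"]) (simp add: poly_sum p c)
qed

text \<open>A nonzero polynomial is cancelled against a function that is merely continuous, so that
  regular functions of X and polynomials in Y are treated alike. On the line from X to V the
  polynomial f has finitely many zeros, whereas nonvanishing of g at X would make f vanish for all
  small parameters.\<close>

lemma zero_by_density: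
  fixes f g :: "complex ^ 'n::finite \<Rightarrow> complex"
  assumes f: "homog_poly d f" "f V \<noteq> 0"
    and S: "open S" "X \<in> S" and g: "continuous_on S g" and fg: "\<And>X. X \<in> S \<Longrightarrow> f X * g X = 0"
  shows "g X = 0"
proof (rule ccontr)
  assume gX: "g X \<noteq> 0"
  define T where "T = {Z \<in> S. g Z \<noteq> 0}"
  have "T = S \<inter> g -` (- {0})" by (auto simp: T_def)
  then have "open T" using continuous_open_preimage[OF g S(1)] by auto
  have fT: "f Z = 0" if "Z \<in> T" for Z using fg[of Z] that by (auto simp: T_def)
  obtain p where p: "\<And>t. poly p t = f (X + t *s (V - X))"
    using homog_poly_line_poly[OF f(1)] by metis
  have "poly p 1 \<noteq> 0" using f(2) by (simp add: p)
  then have "p \<noteq> 0" by auto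
  then have fin: "finite {t. poly p t = 0}" by (rule poly_roots_finite)
  have "continuous_on UNIV (\<lambda>t::complex. X + t *s (V - X))"
    unfolding vector_scalar_mult_def by (intro continuous_intros)
  then have "open ((\<lambda>t. X + t *s (V - X)) -` T)"
    using \<open>open T\<close> by (simp add: continuous_on_open_vimage)
  moreover have "0 \<in> (\<lambda>t. X + t *s (V - X)) -` T" using S gX by (simp add: T_def)
  ultimately have "infinite ((\<lambda>t. X + t *s (V - X)) -` T)"
    using finite_imp_not_open by (metis empty_iff)
  moreover have "(\<lambda>t. X + t *s (V - X)) -` T \<subseteq> {t. poly p t = 0}"
    using fT p by auto
  ultimately show False using fin finite_subset by blast
qed

section \<open>Directional derivatives\<close>

text \<open>Derivatives along all complex directions, required to depend linearly on the direction.
  An axis as direction gives \<open>partial\<close>; differentiating in Y along the direction X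
  gives \<delta>. Unlike \<open>partial\<close>, which is a value of \<open>deriv\<close> and always
  has some value, this predicate guarantees differentiability.\<close>

definition has_pd :: "(complex ^ 'n::finite \<Rightarrow> complex) \<Rightarrow> ('n \<Rightarrow> complex) \<Rightarrow> complex ^ 'n \<Rightarrow> bool" where
  "has_pd f D X \<longleftrightarrow>
    (\<forall>V. ((\<lambda>t. f (X + t *s V)) has_field_derivative (\<Sum>i\<in>UNIV. V $ i * D i)) (at 0))"

lemma has_pd_partial:
  assumes "has_pd f D X"
  shows "partial i f X = D i"
proof -
  have "((\<lambda>t. f (X + t *s axis i 1)) has_field_derivative (\<Sum>j\<in>UNIV. axis i 1 $ j * D j)) (at 0)"
    using assms unfolding has_pd_def by blast
  moreover have "(\<Sum>j\<in>UNIV. axis i 1 $ j * D j) = (\<Sum>j\<in>UNIV. if j = i then D i else 0)"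
    by (rule sum.cong) (auto simp: axis_def)
  ultimately have "((\<lambda>t. f (X + t *s axis i 1)) has_field_derivative D i) (at (X $ i + - X $ i))"
    by simp
  \<comment> \<open>Zero is written as X_i - X_i so that the base point of the line can be shifted
    to the value X_i, where \<open>partial\<close> differentiates.\<close>
  then have "((\<lambda>t. f (X + (t + - X $ i) *s axis i 1)) has_field_derivative D i) (at (X $ i))"
    by (subst (asm) DERIV_shift)
  moreover have "(\<lambda>t. f (X + (t + - X $ i) *s axis i 1)) = (\<lambda>t. f (\<chi> j. if j = i then t else X $ j))"
    by (intro ext arg_cong[of _ _ f]) (auto simp: vec_eq_iff axis_def)
  ultimately show ?thesis unfolding partial_def by (metis DERIV_imp_deriv)
qed

lemma has_pdD: "has_pd f D X \<Longrightarrow> has_pd f (\<lambda>i. partial i f X) X"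
  using has_pd_partial[of f D X] by simp

lemma has_pd_const: "has_pd (\<lambda>X. c) (\<lambda>i. 0) X"
  by (simp add: has_pd_def)

lemma has_pd_coord: "has_pd (\<lambda>X. X $ j) (\<lambda>i. if i = j then 1 else 0) X"
  unfolding has_pd_def by (auto intro!: derivative_eq_intros simp: if_distrib[of "\<lambda>x. _ * x"] cong: if_cong)

lemma has_pd_add:
  "has_pd f D X \<Longrightarrow> has_pd g E X \<Longrightarrow> has_pd (\<lambda>X. f X + g X) (\<lambda>i. D i + E i) X"
  unfolding has_pd_def by (auto intro!: derivative_eq_intros simp: distrib_left sum.distrib)

lemma has_pd_mult:
  assumes "has_pd f D X" "has_pd g E X"
  shows "has_pd (\<lambda>X. f X * g X) (\<lambda>i. D i * g X + f X * E i) X"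
  unfolding has_pd_def
proof
  fix V
  have "((\<lambda>t. f (X + t *s V) * g (X + t *s V)) has_field_derivative
      (\<Sum>i\<in>UNIV. V $ i * D i) * g (X + 0 *s V) + (\<Sum>i\<in>UNIV. V $ i * E i) * f (X + 0 *s V)) (at 0)"
    using assms unfolding has_pd_def by (intro DERIV_mult) auto
  then show "((\<lambda>t. f (X + t *s V) * g (X + t *s V)) has_field_derivative
      (\<Sum>i\<in>UNIV. V $ i * (D i * g X + f X * E i))) (at 0)"
    by (simp add: distrib_left sum.distrib sum_distrib_left sum_distrib_right algebra_simps)
qed

lemma has_pd_divide:
  assumes "has_pd f D X" "has_pd g E X" "g X \<noteq> 0"
  shows "has_pd (\<lambda>X. f X / g X) (\<lambda>i. (D i * g X - f X * E i) / (g X * g X)) X"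
  unfolding has_pd_def
proof
  fix V
  have "((\<lambda>t. f (X + t *s V) / g (X + t *s V)) has_field_derivative
      ((\<Sum>i\<in>UNIV. V $ i * D i) * g (X + 0 *s V) - f (X + 0 *s V) * (\<Sum>i\<in>UNIV. V $ i * E i))
        / (g (X + 0 *s V) * g (X + 0 *s V))) (at 0)"
    using assms unfolding has_pd_def by (intro DERIV_divide) auto
  moreover have "(\<Sum>i\<in>UNIV. V $ i * ((D i * g X - f X * E i) / (g X * g X)))
      = ((\<Sum>i\<in>UNIV. V $ i * D i) * g X - f X * (\<Sum>i\<in>UNIV. V $ i * E i)) / (g X * g X)"
    unfolding sum_distrib_left sum_distrib_right sum_subtractf[symmetric] sum_divide_distrib
    by (intro sum.cong refl) (simp only: times_divide_eq_right, simp add: algebra_simps)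
  ultimately show "((\<lambda>t. f (X + t *s V) / g (X + t *s V)) has_field_derivative
      (\<Sum>i\<in>UNIV. V $ i * ((D i * g X - f X * E i) / (g X * g X)))) (at 0)"
    by simp
qed

lemma has_pd_sum:
  "(\<And>j. j \<in> J \<Longrightarrow> has_pd (f j) (D j) X) \<Longrightarrow> has_pd (\<lambda>X. \<Sum>j\<in>J. f j X) (\<lambda>i. \<Sum>j\<in>J. D j i) X"
  by (induction J rule: infinite_finite_induct) (auto intro: has_pd_add has_pd_const)

lemma has_pd_cmult: "has_pd f D X \<Longrightarrow> has_pd (\<lambda>X. c * f X) (\<lambda>i. c * D i) X"
  using has_pd_mult[OF has_pd_const[of c X], of f D] by simp

lemma has_pd_power:
  "has_pd f D X \<Longrightarrow> has_pd (\<lambda>X. f X ^ k) (\<lambda>i. of_nat k * f X ^ (k - 1) * D i) X"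
proof (induction k)
  case (Suc k)
  have "(\<lambda>i. D i * f X ^ k + f X * (of_nat k * f X ^ (k - 1) * D i))
      = (\<lambda>i. of_nat (Suc k) * f X ^ (Suc k - 1) * D i)"
    by (cases k) (auto simp: algebra_simps)
  then show ?case using has_pd_mult[OF Suc.prems Suc.IH[OF Suc.prems]] by simp
qed (simp add: has_pd_const)

lemma has_pd_prod:
  assumes "finite J" "\<And>j. j \<in> J \<Longrightarrow> has_pd (f j) (D j) X"
  shows "has_pd (\<lambda>X. \<Prod>j\<in>J. f j X) (\<lambda>i. \<Sum>j\<in>J. D j i * (\<Prod>k\<in>J - {j}. f k X)) X"
  using assms
proof (induction J)
  case (insert a J)
  have "(\<lambda>i. \<Sum>j\<in>insert a J. D j i * (\<Prod>k\<in>insert a J - {j}. f k X))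
      = (\<lambda>i. D a i * (\<Prod>k\<in>J. f k X) + f a X * (\<Sum>j\<in>J. D j i * (\<Prod>k\<in>J - {j}. f k X)))"
  proof
    fix i
    have "(\<Prod>k\<in>insert a J - {j}. f k X) = f a X * (\<Prod>k\<in>J - {j}. f k X)" if "j \<in> J" for j
      using insert.hyps that by (subst insert_Diff_if) auto
    then have "(\<Sum>j\<in>J. D j i * (\<Prod>k\<in>insert a J - {j}. f k X))
        = f a X * (\<Sum>j\<in>J. D j i * (\<Prod>k\<in>J - {j}. f k X))"
      unfolding sum_distrib_left by (intro sum.cong) (auto simp: algebra_simps)
    then show "(\<Sum>j\<in>insert a J. D j i * (\<Prod>k\<in>insert a J - {j}. f k X))
        = D a i * (\<Prod>k\<in>J. f k X) + f a X * (\<Sum>j\<in>J. D j i * (\<Prod>k\<in>J - {j}. f k X))"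
      using insert.hyps by (simp add: insert_Diff_if)
  qed
  then show ?case
    using has_pd_mult[OF insert.prems insert.IH, of a] insert by simp
qed (simp add: has_pd_const)

text \<open>Truncated subtraction is harmless: if \<open>e i = 0\<close>, the factor
  \<open>of_nat (e i)\<close> vanishes.\<close>

lemma has_pd_monomial:
  "has_pd (monomial e) (\<lambda>i. of_nat (e i) * monomial (e(i := e i - 1)) X) X"
proof -
  have "has_pd (\<lambda>X. \<Prod>j\<in>UNIV. X $ j ^ e j)
    (\<lambda>i. \<Sum>j\<in>UNIV. (of_nat (e j) * X $ j ^ (e j - 1) * (if i = j then 1 else 0)) *
      (\<Prod>k\<in>UNIV - {j}. X $ k ^ e k)) X"
    by (intro has_pd_prod has_pd_power has_pd_coord) auto
  moreover have "(\<Sum>j\<in>UNIV. (of_nat (e j) * X $ j ^ (e j - 1) * (if i = j then 1 else 0)) *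
      (\<Prod>k\<in>UNIV - {j}. X $ k ^ e k)) = of_nat (e i) * monomial (e(i := e i - 1)) X" for i
  proof -
    have "(\<Sum>j\<in>UNIV. (of_nat (e j) * X $ j ^ (e j - 1) * (if i = j then 1 else 0)) *
      (\<Prod>k\<in>UNIV - {j}. X $ k ^ e k))
      = (\<Sum>j\<in>UNIV. if j = i then of_nat (e i) * X $ i ^ (e i - 1) * (\<Prod>k\<in>UNIV - {i}. X $ k ^ e k) else 0)"
      by (rule sum.cong) auto
    also have "\<dots> = of_nat (e i) * X $ i ^ (e i - 1) * (\<Prod>k\<in>UNIV - {i}. X $ k ^ e k)" by simp
    also have "(\<Prod>k\<in>UNIV - {i}. X $ k ^ e k) = (\<Prod>k\<in>UNIV - {i}. X $ k ^ (e(i := e i - 1)) k)"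
      by (rule prod.cong) auto
    finally show ?thesis unfolding monomial_def by (simp add: prod.remove[of UNIV i])
  qed
  ultimately show ?thesis unfolding monomial_def[abs_def] by simp
qed

lemma has_pd_monomial_sum:
  "has_pd (\<lambda>X. \<Sum>e\<in>E. c e * monomial e X)
    (\<lambda>i. \<Sum>e\<in>E. c e * (of_nat (e i) * monomial (e(i := e i - 1)) X)) X"
  by (rule has_pd_sum, rule has_pd_cmult, rule has_pd_monomial)

lemma has_pd_homog:
  assumes "homog_poly d f" shows "has_pd f (\<lambda>i. partial i f X) X"
proof -
  obtain c where c: "f = (\<lambda>X. \<Sum>e\<in>exponents d. c e * monomial e X)"
    using assms unfolding homog_poly_def by auto
  show ?thesis unfolding c
    by (rule has_pdD[OF has_pd_monomial_sum])
qed

lemma lower_exponents: "e \<in> exponents d \<Longrightarrow> e i \<noteq> 0 \<Longrightarrow> e(i := e i - 1) \<in> exponents (d - 1)"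
proof -
  assume e: "e \<in> exponents d" "e i \<noteq> 0"
  have "(\<Sum>j\<in>UNIV. (e(i := e i - 1)) j) = e i - 1 + (\<Sum>j\<in>UNIV - {i}. e j)"
    by (subst sum.remove[of _ i]) auto
  moreover have "(\<Sum>j\<in>UNIV. e j) = e i + (\<Sum>j\<in>UNIV - {i}. e j)"
    by (subst sum.remove[of _ i]) auto
  ultimately show ?thesis using e by (simp add: exponents_def)
qed

text \<open>In degree 0 the truncated \<open>d - 1\<close> is again 0, which is correct because the
  derivative is then the zero polynomial, homogeneous of every degree.\<close>

lemma homog_poly_partial:
  assumes "homog_poly d f" shows "homog_poly (d - 1) (partial i f)"
proof -
  obtain c where c: "f = (\<lambda>X. \<Sum>e\<in>exponents d. c e * monomial e X)"
    using assms unfolding homog_poly_def by auto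
  have p: "partial i f = (\<lambda>X. \<Sum>e\<in>exponents d. c e * (of_nat (e i) * monomial (e(i := e i - 1)) X))"
    unfolding c by (rule ext, rule has_pd_partial[OF has_pd_monomial_sum])
  have q: "homog_poly (d - 1) (\<lambda>X. of_nat (e i) * monomial (e(i := e i - 1)) X)"
    if "e \<in> exponents d" for e
    using lower_exponents[OF that, of i]
    by (cases "e i = 0") (auto intro!: homog_poly_cmult homog_poly_monomial)
  show ?thesis unfolding p by (rule homog_poly_sum, rule homog_poly_cmult, rule q)
qed

lemma partial_const [simp]: "partial i (\<lambda>X. c) X = 0"
  using has_pd_partial[OF has_pd_const] by metis

lemma partial_homog_0: "homog_poly 0 f \<Longrightarrow> partial i f X = 0"
  by (auto simp: homog_poly_0_iff)

lemma euler_homog: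
  assumes "homog_poly d f"
  shows "(\<Sum>i\<in>UNIV. X $ i * partial i f X) = of_nat d * f X"
proof -
  obtain c where c: "f = (\<lambda>X. \<Sum>e\<in>exponents d. c e * monomial e X)"
    using assms unfolding homog_poly_def by auto
  have p: "partial i f X = (\<Sum>e\<in>exponents d. c e * (of_nat (e i) * monomial (e(i := e i - 1)) X))" for i
    unfolding c by (rule has_pd_partial[OF has_pd_monomial_sum])
  have m: "X $ i * (of_nat (e i) * monomial (e(i := e i - 1)) X) = of_nat (e i) * monomial e X" for e i
  proof (cases "e i = 0")
    case False
    have "monomial e X = X $ i ^ e i * (\<Prod>k\<in>UNIV - {i}. X $ k ^ e k)"
      unfolding monomial_def by (simp add: prod.remove[of UNIV i])
    moreover have "monomial (e(i := e i - 1)) X = X $ i ^ (e i - 1) * (\<Prod>k\<in>UNIV - {i}. X $ k ^ (e(i := e i - 1)) k)"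
      unfolding monomial_def by (simp add: prod.remove[of UNIV i])
    moreover have "(\<Prod>k\<in>UNIV - {i}. X $ k ^ (e(i := e i - 1)) k) = (\<Prod>k\<in>UNIV - {i}. X $ k ^ e k)"
      by (rule prod.cong) auto
    ultimately show ?thesis using False by (simp add: power_eq_if)
  qed simp
  have "(\<Sum>i\<in>UNIV. X $ i * partial i f X)
      = (\<Sum>i\<in>UNIV. \<Sum>e\<in>exponents d. c e * (of_nat (e i) * monomial e X))"
    unfolding p sum_distrib_left by (intro sum.cong refl) (subst mult.left_commute, subst m, rule refl)
  also have "\<dots> = (\<Sum>e\<in>exponents d. \<Sum>i\<in>UNIV. c e * (of_nat (e i) * monomial e X))"
    by (rule sum.swap)
  also have "\<dots> = (\<Sum>e\<in>exponents d. of_nat d * (c e * monomial e X))"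
  proof (rule sum.cong)
    fix e :: "'a \<Rightarrow> nat" assume "e \<in> exponents d"
    then have "(\<Sum>i\<in>UNIV. of_nat (e i) :: complex) = of_nat d"
      by (simp add: exponents_def flip: of_nat_sum)
    then show "(\<Sum>i\<in>UNIV. c e * (of_nat (e i) * monomial e X)) = of_nat d * (c e * monomial e X)"
      unfolding sum_distrib_left[symmetric] sum_distrib_right[symmetric] by simp
  qed simp
  finally show ?thesis by (simp add: c sum_distrib_left)
qed

lemma has_pd_transform:
  assumes "has_pd f D X" "\<forall>\<^sub>F Z in nhds X. f Z = g Z"
  shows "has_pd g D X"
  unfolding has_pd_def
proof
  fix V
  obtain S where S: "open S" "X \<in> S" "\<And>Z. Z \<in> S \<Longrightarrow> f Z = g Z"
    using assms(2) unfolding eventually_nhds by auto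
  have "continuous_on UNIV (\<lambda>t::complex. X + t *s V)"
    unfolding vector_scalar_mult_def by (intro continuous_intros)
  then have "open ((\<lambda>t. X + t *s V) -` S)" using S(1) by (simp add: continuous_on_open_vimage)
  moreover have "((\<lambda>t. f (X + t *s V)) has_field_derivative (\<Sum>i\<in>UNIV. V $ i * D i)) (at 0)"
    using assms(1) unfolding has_pd_def by blast
  ultimately show "((\<lambda>t. g (X + t *s V)) has_field_derivative (\<Sum>i\<in>UNIV. V $ i * D i)) (at 0)"
    using S(2,3) has_field_derivative_transform_within_open[of "\<lambda>t. f (X + t *s V)" _ 0
        "(\<lambda>t. X + t *s V) -` S" "\<lambda>t. g (X + t *s V)"] by auto
qed

section \<open>Germs on projective space\<close>

lemma proj_point_nonzero: "p \<in> proj_points \<Longrightarrow> X \<in> p \<Longrightarrow> X \<noteq> 0"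
  by (auto simp: proj_points_def)

lemma proj_point_nonempty: "p \<in> proj_points \<Longrightarrow> \<exists>X. X \<in> p"
proof -
  assume "p \<in> proj_points"
  then obtain Z where "p = {c *s Z |c. c \<noteq> 0}" by (auto simp: proj_points_def)
  then have "1 *s Z \<in> p" by (simp only:) (rule CollectI, rule exI[of _ 1], simp)
  then show ?thesis by blast
qed

lemma proj_point_eq:
  assumes "p \<in> proj_points" "X \<in> p"
  shows "p = {c *s X |c. c \<noteq> 0}"
proof -
  obtain Z where Z: "p = {c *s Z |c. c \<noteq> 0}" using assms(1) by (auto simp: proj_points_def)
  then obtain a where a: "X = a *s Z" "a \<noteq> 0" using assms(2) by auto
  have "\<exists>b. c *s Z = b *s X \<and> b \<noteq> 0" if "c \<noteq> 0" for c
    using a that by (intro exI[of _ "c / a"]) (simp add: vector_smult_assoc)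
  moreover have "\<exists>b. c *s X = b *s Z \<and> b \<noteq> 0" if "c \<noteq> 0" for c
    using a that by (intro exI[of _ "c * a"]) (simp add: vector_smult_assoc)
  ultimately show ?thesis unfolding Z by blast
qed

lemma proj_point_through: "X \<noteq> 0 \<Longrightarrow> {c *s X |c. c \<noteq> 0} \<in> proj_points \<and> X \<in> {c *s X |c. c \<noteq> 0}"
proof
  show "X \<in> {c *s X |c. c \<noteq> 0}" by (rule CollectI, rule exI[of _ 1], simp)
qed (auto simp: proj_points_def)

lemma basic_open_iff:
  assumes "homog_poly d f" "p \<in> proj_points" "X \<in> p"
  shows "p \<in> basic_open f \<longleftrightarrow> f X \<noteq> 0"
  using assms by (auto simp: basic_open_def proj_point_eq[OF assms(2,3)] homog_poly_scale[OF assms(1)])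

lemma openin_basic_open: "homog_poly d f \<Longrightarrow> openin zariski (basic_open f)"
  unfolding zariski_def openin_topology_generated_by_iff by (rule generate_topology_on.Basis) auto

text \<open>By definition the basic open sets only generate the topology. They form a base because
  the nonvanishing loci of f and g meet in that of f g, which is again homogeneous.\<close>

lemma zariski_base:
  assumes "openin zariski U" "p \<in> U"
  shows "\<exists>f d. homog_poly d f \<and> p \<in> basic_open f \<and> basic_open f \<subseteq> U"
  using assms unfolding zariski_def openin_topology_generated_by_iff
proof (induction arbitrary: p rule: generate_topology_on.induct)
  case (Int a b)
  obtain f d where f: "homog_poly d f" "p \<in> basic_open f" "basic_open f \<subseteq> a"
    using Int.IH(1)[of p] Int.prems by auto
  obtain g e where g: "homog_poly e g" "p \<in> basic_open g" "basic_open g \<subseteq> b"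
    using Int.IH(2)[of p] Int.prems by auto
  have "basic_open (\<lambda>X. f X * g X) = basic_open f \<inter> basic_open g" by (auto simp: basic_open_def)
  then have "p \<in> basic_open (\<lambda>X. f X * g X)" "basic_open (\<lambda>X. f X * g X) \<subseteq> a \<inter> b"
    using f g by auto
  with homog_poly_mult[OF f(1) g(1)] show ?case by blast
next
  case (UN K)
  then obtain k where k: "k \<in> K" "p \<in> k" by auto
  obtain f d where "homog_poly d f" "p \<in> basic_open f" "basic_open f \<subseteq> k"
    using UN.IH[OF k] by auto
  with k show ?case by blast
qed auto

lemma openin_zariski_subset: "openin zariski U \<Longrightarrow> U \<subseteq> proj_points"
  using zariski_base by (fastforce simp: basic_open_def)

lemma openin_proj_points: "openin zariski (proj_points :: 'n::finite point set)"
proof -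
  have "basic_open (\<lambda>X. 1) = (proj_points :: 'n point set)" by (auto simp: basic_open_def)
  moreover have "openin zariski (basic_open (\<lambda>X::complex ^ 'n. 1))"
    by (rule openin_basic_open[OF homog_poly_const])
  ultimately show ?thesis by simp
qed

lemma topspace_zariski: "topspace zariski = proj_points"
  using openin_proj_points openin_zariski_subset
  by (metis openin_subset openin_topspace subset_antisym)

lemma cone_basic_open:
  assumes f: "homog_poly d f"
  shows "\<Union>(basic_open f) = {X. X \<noteq> 0 \<and> f X \<noteq> 0}"
proof (intro equalityI subsetI)
  fix X assume X: "X \<in> {X. X \<noteq> 0 \<and> f X \<noteq> 0}"
  define p where "p = {c *s X |c. c \<noteq> 0}"
  have p: "p \<in> proj_points" "X \<in> p" using proj_point_through X unfolding p_def by auto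
  then have "p \<in> basic_open f" using basic_open_iff[OF f p] X by simp
  with p show "X \<in> \<Union>(basic_open f)" by blast
qed (auto simp: basic_open_def dest: proj_point_nonzero)

lemma open_cone_basic: "homog_poly d f \<Longrightarrow> open (\<Union>(basic_open f))"
proof -
  assume f: "homog_poly d f"
  have "\<Union>(basic_open f) = (- {0}) \<inter> (f -` (- {0}))" unfolding cone_basic_open[OF f] by auto
  moreover have "open (f -` (- {0}))"
    using homog_poly_continuous[OF f] by (simp add: continuous_on_open_vimage open_Compl)
  ultimately show ?thesis by (simp add: open_Int open_Compl)
qed

text \<open>Bridge to the classical topology: what holds on a Zariski neighbourhood holds
  classically near each vector of its cone, and equalities there may be differentiated.\<close>

lemma open_cone: "openin zariski U \<Longrightarrow> open (\<Union>U)"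
proof -
  assume U: "openin zariski U"
  have "\<exists>T. open T \<and> X \<in> T \<and> T \<subseteq> \<Union>U" if X: "X \<in> \<Union>U" for X
  proof -
    obtain p where p: "p \<in> U" "X \<in> p" using X by auto
    then obtain f d where "homog_poly d f" "p \<in> basic_open f" "basic_open f \<subseteq> U"
      using zariski_base[OF U] by blast
    then show ?thesis using p open_cone_basic by (intro exI[of _ "\<Union>(basic_open f)"]) auto
  qed
  then show ?thesis by (subst open_subopen) auto
qed

text \<open>Distinct points are disjoint punctured lines, so a vector in both cones lies on one
  point common to U and V.\<close>

lemma in_cone_Int:
  assumes "openin zariski U" "openin zariski V"
  shows "X \<in> \<Union>(U \<inter> V) \<longleftrightarrow> X \<in> \<Union>U \<and> X \<in> \<Union>V"
proof
  assume "X \<in> \<Union>U \<and> X \<in> \<Union>V"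
  then obtain p q where p: "p \<in> U" "q \<in> V" "X \<in> p" "X \<in> q" by auto
  then have "p \<in> proj_points" "q \<in> proj_points" using assms openin_zariski_subset by auto
  then have "p = q" using proj_point_eq[of p X] proj_point_eq[of q X] p by simp
  with p show "X \<in> \<Union>(U \<inter> V)" by auto
qed auto

section \<open>The filter of cones over Zariski neighbourhoods of a point\<close>

definition zf :: "'n::finite point \<Rightarrow> (complex ^ 'n) filter" where
  "zf p = (INF V\<in>{V. openin zariski V \<and> p \<in> V}. principal (\<Union>V))"

text \<open>Finite intersections make the family of neighbourhoods directed, so eventually means on
  the cone over one Zariski neighbourhood. Equality of germs at p becomes eventual equality along
  \<open>zf p\<close>, and the shrinking of neighbourhoods is left to the filter.\<close>

lemma eventually_zf:
  assumes "p \<in> proj_points"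
  shows "eventually Q (zf p) \<longleftrightarrow> (\<exists>V. openin zariski V \<and> p \<in> V \<and> (\<forall>X\<in>\<Union>V. Q X))"
proof -
  have "eventually Q (zf p) \<longleftrightarrow>
      (\<exists>V\<in>{V. openin zariski V \<and> p \<in> V}. eventually Q (principal (\<Union>V)))"
    unfolding zf_def
  proof (rule eventually_INF_base)
    have "proj_points \<in> {V. openin zariski V \<and> p \<in> V}" using assms by (simp add: openin_proj_points)
    then show "{V. openin zariski V \<and> p \<in> V} \<noteq> {}" by blast
  next
    fix a b assume "a \<in> {V. openin zariski V \<and> p \<in> V}" "b \<in> {V. openin zariski V \<and> p \<in> V}"
    then show "\<exists>x\<in>{V. openin zariski V \<and> p \<in> V}.
        principal (\<Union>x) \<le> inf (principal (\<Union>a)) (principal (\<Union>b))"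
      by (intro bexI[of _ "a \<inter> b"]) auto
  qed
  then show ?thesis by (simp add: eventually_principal)
qed

lemma eventually_zfI:
  "openin zariski V \<Longrightarrow> p \<in> V \<Longrightarrow> (\<And>X. X \<in> \<Union>V \<Longrightarrow> Q X) \<Longrightarrow> eventually Q (zf p)"
  using eventually_zf[of p Q] openin_zariski_subset[of V] by blast

lemma eventually_zfE:
  assumes "eventually Q (zf p)" "openin zariski U" "p \<in> U"
  obtains V where "openin zariski V" "p \<in> V" "V \<subseteq> U" "\<forall>X\<in>\<Union>V. Q X"
proof -
  have "p \<in> proj_points" using assms openin_zariski_subset by auto
  from assms(1)[unfolded eventually_zf[OF this]]
  obtain V where V: "openin zariski V" "p \<in> V" "\<forall>X\<in>\<Union>V. Q X" by blast
  show ?thesis using that[of "V \<inter> U"] V assms by auto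
qed

lemma eventually_zf_in: "openin zariski U \<Longrightarrow> p \<in> U \<Longrightarrow> eventually (\<lambda>X. X \<in> \<Union>U) (zf p)"
  by (rule eventually_zfI) auto

lemma eventually_zf_point:
  assumes "eventually Q (zf p)" "p \<in> proj_points" "X \<in> p" shows "Q X"
  using assms(1,3) unfolding eventually_zf[OF assms(2)] by blast

lemma eventually_zf_nhds:
  assumes "eventually Q (zf p)" "p \<in> proj_points"
  shows "eventually (\<lambda>X. eventually Q (nhds X)) (zf p)"
proof -
  obtain V where V: "openin zariski V" "p \<in> V" "\<forall>X\<in>\<Union>V. Q X"
    using assms(1) unfolding eventually_zf[OF assms(2)] by blast
  then show ?thesis using open_cone[OF V(1)]
    by (intro eventually_zfI[OF V(1,2)]) (auto simp: eventually_nhds)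
qed

lemma eventually_zf_open:
  assumes "openin zariski U" "\<And>p. p \<in> U \<Longrightarrow> eventually Q (zf p)" "X \<in> \<Union>U"
  shows "Q X"
  using assms eventually_zf_point openin_zariski_subset by (metis UnionE subsetD)

lemma eventually_zf_nonzero:
  assumes "homog_poly d f" "p \<in> proj_points" "X \<in> p" "f X \<noteq> 0"
  shows "eventually (\<lambda>X. f X \<noteq> 0) (zf p)"
  using assms basic_open_iff[OF assms(1-3)]
  by (intro eventually_zfI[OF openin_basic_open[OF assms(1)]]) (auto simp: cone_basic_open)

section \<open>Regular germs of degree n: arithmetic, derivatives, continuity\<close>

lemma near_regular_iff:
  assumes p: "p \<in> proj_points"
  shows "f \<in> near_regular n p \<longleftrightarrow> (\<exists>a b k l. homog_poly k a \<and> homog_poly l b \<and> int k - int l = n \<and>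
     eventually (\<lambda>X. b X \<noteq> 0 \<and> f X = a X / b X) (zf p))"
proof
  assume "f \<in> near_regular n p"
  then obtain V where V: "openin zariski V" "p \<in> V" "regular_on n V f" by (auto simp: near_regular_def)
  then obtain W a b k l where W: "openin zariski W" "p \<in> W" "homog_poly k a" "homog_poly l b"
    "int k - int l = n" "\<forall>X\<in>\<Union>W. b X \<noteq> 0 \<and> f X = a X / b X"
    unfolding regular_on_def by metis
  then show "\<exists>a b k l. homog_poly k a \<and> homog_poly l b \<and> int k - int l = n \<and>
     eventually (\<lambda>X. b X \<noteq> 0 \<and> f X = a X / b X) (zf p)"
    using eventually_zf[OF p] by blast
next
  assume "\<exists>a b k l. homog_poly k a \<and> homog_poly l b \<and> int k - int l = n \<and>
     eventually (\<lambda>X. b X \<noteq> 0 \<and> f X = a X / b X) (zf p)"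
  then obtain a b k l V where V: "homog_poly k a" "homog_poly l b" "int k - int l = n"
    "openin zariski V" "p \<in> V" "\<forall>X\<in>\<Union>V. b X \<noteq> 0 \<and> f X = a X / b X"
    unfolding eventually_zf[OF p] by blast
  then have "regular_on n V f" unfolding regular_on_def by blast
  with V show "f \<in> near_regular n p" by (auto simp: near_regular_def)
qed

lemma near_regularE:
  assumes "f \<in> near_regular n p" "p \<in> proj_points"
  obtains a b k l where "homog_poly k a" "homog_poly l b" "int k - int l = n"
    "eventually (\<lambda>X. b X \<noteq> 0 \<and> f X = a X / b X) (zf p)"
  using assms(1) unfolding near_regular_iff[OF assms(2)] by blast

lemma near_regularI:
  assumes "p \<in> proj_points" "homog_poly k a" "homog_poly l b" "int k - int l = n"
    "eventually (\<lambda>X. b X \<noteq> 0 \<and> f X = a X / b X) (zf p)"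
  shows "f \<in> near_regular n p"
  using assms(2-) unfolding near_regular_iff[OF assms(1)] by blast

text \<open>Regularity is a local condition, so sections can be built and tested one point at a
  time. The values of f far from p do not affect \<open>near_regular\<close>, which leaves room for
  extension by zero.\<close>

lemma regular_on_iff:
  assumes U: "openin zariski U"
  shows "regular_on n U f \<longleftrightarrow> (\<forall>p\<in>U. f \<in> near_regular n p)"
proof
  assume "regular_on n U f" then show "\<forall>p\<in>U. f \<in> near_regular n p"
    using U by (auto simp: near_regular_def)
next
  assume r: "\<forall>p\<in>U. f \<in> near_regular n p"
  show "regular_on n U f" unfolding regular_on_def
  proof
    fix p assume p: "p \<in> U"
    then have pp: "p \<in> proj_points" using U openin_zariski_subset by auto
    obtain a b k l where ab: "homog_poly k a" "homog_poly l b" "int k - int l = n"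
      "eventually (\<lambda>X. b X \<noteq> 0 \<and> f X = a X / b X) (zf p)"
      by (rule near_regularE[OF bspec[OF r p] pp])
    obtain V where V: "openin zariski V" "p \<in> V" "V \<subseteq> U"
      "\<forall>X\<in>\<Union>V. b X \<noteq> 0 \<and> f X = a X / b X"
      by (rule eventually_zfE[OF ab(4) U p])
    show "\<exists>V a b k l. openin zariski V \<and> p \<in> V \<and> V \<subseteq> U \<and>
        homog_poly k a \<and> homog_poly l b \<and> int k - int l = n \<and>
        (\<forall>X\<in>\<Union>V. b X \<noteq> 0 \<and> f X = a X / b X)"
      using ab(1-3)
      by (intro exI[of _ V] exI[of _ a] exI[of _ b] exI[of _ k] exI[of _ l] conjI ballI) (use V in auto)
  qed
qed

lemma regular_on_imp_near_regular: "regular_on n V f \<Longrightarrow> openin zariski V \<Longrightarrow> p \<in> V \<Longrightarrow> f \<in> near_regular n p"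
  by (auto simp: near_regular_def)

lemma near_regular_cong:
  assumes "f \<in> near_regular n p" "eventually (\<lambda>X. f X = g X) (zf p)" "p \<in> proj_points"
  shows "g \<in> near_regular n p"
proof -
  obtain a b k l where ab: "homog_poly k a" "homog_poly l b" "int k - int l = n"
    "eventually (\<lambda>X. b X \<noteq> 0 \<and> f X = a X / b X) (zf p)"
    by (rule near_regularE[OF assms(1) assms(3)])
  show ?thesis
    by (rule near_regularI[OF assms(3) ab(1-3)]) (use ab(4) assms(2) in eventually_elim, simp)
qed

lemma near_regular_homog: "homog_poly d f \<Longrightarrow> p \<in> proj_points \<Longrightarrow> f \<in> near_regular (int d) p"
  by (rule near_regularI[of p d f 0 "\<lambda>X. 1"]) auto

lemma near_regular_const: "p \<in> proj_points \<Longrightarrow> (\<lambda>X. c) \<in> near_regular 0 p"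
  using near_regular_homog[OF homog_poly_const] by simp

lemma near_regular_coord: "p \<in> proj_points \<Longrightarrow> (\<lambda>X. X $ i) \<in> near_regular 1 p"
  using near_regular_homog[OF homog_poly_coord] by simp

lemma near_regular_add:
  assumes "f \<in> near_regular n p" "g \<in> near_regular n p" "p \<in> proj_points"
  shows "(\<lambda>X. f X + g X) \<in> near_regular n p"
proof -
  obtain a b k l where ab: "homog_poly k a" "homog_poly l b" "int k - int l = n"
    "eventually (\<lambda>X. b X \<noteq> 0 \<and> f X = a X / b X) (zf p)"
    by (rule near_regularE[OF assms(1) assms(3)])
  obtain a' b' k' l' where ab': "homog_poly k' a'" "homog_poly l' b'" "int k' - int l' = n"
    "eventually (\<lambda>X. b' X \<noteq> 0 \<and> g X = a' X / b' X) (zf p)"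
    by (rule near_regularE[OF assms(2) assms(3)])
  \<comment> \<open>Both summands of the numerator a b' + b a' have the same degree because the two
    quotients do.\<close>
  have eq: "l + k' = k + l'" using ab(3) ab'(3) by linarith
  have "homog_poly (k + l') (\<lambda>X. a X * b' X + b X * a' X)"
    using homog_poly_mult[OF ab(1) ab'(2)] homog_poly_mult[OF ab(2) ab'(1)] unfolding eq
    by (rule homog_poly_add)
  moreover have "homog_poly (l + l') (\<lambda>X. b X * b' X)" by (intro homog_poly_mult ab ab')
  ultimately show ?thesis
  proof (rule near_regularI[OF assms(3)])
    show "int (k + l') - int (l + l') = n" using ab(3) by simp
    show "eventually (\<lambda>X. b X * b' X \<noteq> 0 \<and> f X + g X = (a X * b' X + b X * a' X) / (b X * b' X)) (zf p)"
      using ab(4) ab'(4) by eventually_elim (simp add: field_simps)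
  qed
qed

lemma near_regular_mult:
  assumes "f \<in> near_regular n p" "g \<in> near_regular n' p" "p \<in> proj_points"
  shows "(\<lambda>X. f X * g X) \<in> near_regular (n + n') p"
proof -
  obtain a b k l where ab: "homog_poly k a" "homog_poly l b" "int k - int l = n"
    "eventually (\<lambda>X. b X \<noteq> 0 \<and> f X = a X / b X) (zf p)"
    by (rule near_regularE[OF assms(1) assms(3)])
  obtain a' b' k' l' where ab': "homog_poly k' a'" "homog_poly l' b'" "int k' - int l' = n'"
    "eventually (\<lambda>X. b' X \<noteq> 0 \<and> g X = a' X / b' X) (zf p)"
    by (rule near_regularE[OF assms(2) assms(3)])
  show ?thesis
  proof (rule near_regularI[OF assms(3) homog_poly_mult[OF ab(1) ab'(1)] homog_poly_mult[OF ab(2) ab'(2)]])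
    show "int (k + k') - int (l + l') = n + n'" using ab(3) ab'(3) by simp
    show "eventually (\<lambda>X. b X * b' X \<noteq> 0 \<and> f X * g X = a X * a' X / (b X * b' X)) (zf p)"
      using ab(4) ab'(4) by eventually_elim (simp add: field_simps)
  qed
qed

lemma near_regular_cmult: "f \<in> near_regular n p \<Longrightarrow> p \<in> proj_points \<Longrightarrow> (\<lambda>X. c * f X) \<in> near_regular n p"
  using near_regular_mult[OF near_regular_const, of p f n c] by simp

text \<open>The zero germ still needs a presentation of the right degree; for n < 0 it is 0 /
  X_i^(-n) with a coordinate X_i that does not vanish at p.\<close>

lemma near_regular_zero: "p \<in> proj_points \<Longrightarrow> (\<lambda>X. 0) \<in> near_regular n p"
proof -
  assume p: "p \<in> proj_points"
  show ?thesis
  proof (cases "n \<ge> 0")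
    case True
    then show ?thesis using near_regular_homog[OF homog_poly_zero[of "nat n"] p] by simp
  next
    case False
    obtain X where X: "X \<in> p" using proj_point_nonempty p by auto
    then have "X \<noteq> 0" using p proj_point_nonzero by auto
    then obtain i where i: "X $ i \<noteq> 0" by (auto simp: vec_eq_iff)
    show ?thesis
    proof (rule near_regularI[OF p homog_poly_zero[of 0] homog_poly_power[OF homog_poly_coord[of i], of "nat (- n)"]])
      show "int 0 - int (nat (- n) * 1) = n" using False by simp
      show "eventually (\<lambda>X. X $ i ^ nat (- n) \<noteq> 0 \<and> 0 = 0 / X $ i ^ nat (- n)) (zf p)"
        using eventually_zf_nonzero[OF homog_poly_coord[of i] p X i] by eventually_elim simp
    qed
  qed
qed

lemma near_regular_uminus: "f \<in> near_regular n p \<Longrightarrow> p \<in> proj_points \<Longrightarrow> (\<lambda>X. - f X) \<in> near_regular n p"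
  using near_regular_cmult[of f n p "-1"] by simp

lemma near_regular_sum:
  "(\<And>i. i \<in> I \<Longrightarrow> f i \<in> near_regular n p) \<Longrightarrow> p \<in> proj_points \<Longrightarrow>
    (\<lambda>X. \<Sum>i\<in>I. f i X) \<in> near_regular n p"
  by (induction I rule: infinite_finite_induct) (auto intro: near_regular_zero near_regular_add)

lemma near_regular_nonzero:
  assumes "f \<in> near_regular n p" "p \<in> proj_points" "X \<in> p" "f X \<noteq> 0"
  shows "eventually (\<lambda>X. f X \<noteq> 0) (zf p)"
proof -
  obtain a b k l where ab: "homog_poly k a" "homog_poly l b" "int k - int l = n"
    "eventually (\<lambda>X. b X \<noteq> 0 \<and> f X = a X / b X) (zf p)"
    by (rule near_regularE[OF assms(1) assms(2)])
  have "a X \<noteq> 0" using eventually_zf_point[OF ab(4) assms(2,3)] assms(4) by auto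
  from eventually_zf_nonzero[OF ab(1) assms(2,3) this] ab(4)
  show ?thesis by eventually_elim simp
qed

lemma near_regular_inverse:
  assumes "f \<in> near_regular n p" "p \<in> proj_points" "X \<in> p" "f X \<noteq> 0"
  shows "(\<lambda>X. inverse (f X)) \<in> near_regular (- n) p"
proof -
  obtain a b k l where ab: "homog_poly k a" "homog_poly l b" "int k - int l = n"
    "eventually (\<lambda>X. b X \<noteq> 0 \<and> f X = a X / b X) (zf p)"
    by (rule near_regularE[OF assms(1) assms(2)])
  show ?thesis
  proof (rule near_regularI[OF assms(2) ab(2,1)])
    show "int l - int k = - n" using ab(3) by simp
    show "eventually (\<lambda>X. a X \<noteq> 0 \<and> inverse (f X) = b X / a X) (zf p)"
      using ab(4) near_regular_nonzero[OF assms] by eventually_elim auto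
  qed
qed

lemma near_regular_power: "f \<in> near_regular n p \<Longrightarrow> p \<in> proj_points \<Longrightarrow> (\<lambda>X. f X ^ k) \<in> near_regular (int k * n) p"
proof (induction k)
  case (Suc k)
  then show ?case using near_regular_mult[of f n p "\<lambda>X. f X ^ k" "int k * n"] by (simp add: algebra_simps)
qed (simp add: near_regular_const)

lemma near_regular_powi:
  assumes "f \<in> near_regular 1 p" "p \<in> proj_points" "X \<in> p" "f X \<noteq> 0"
  shows "(\<lambda>X. f X powi k) \<in> near_regular k p"
proof (cases "k \<ge> 0")
  case True
  then show ?thesis using near_regular_power[OF assms(1,2), of "nat k"] by (simp add: power_int_def)
next
  case False
  then show ?thesis
    using near_regular_power[OF near_regular_inverse[OF assms] assms(2), of "nat (- k)"]
    by (simp add: power_int_def)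
qed

text \<open>The quotient rule lowers the degree by one, and Euler's formulas for numerator and
  denominator combine to Euler's formula in degree k - l = n, negative degrees included.\<close>

lemma near_regular_pd:
  assumes "f \<in> near_regular n p" "p \<in> proj_points"
  shows "eventually (\<lambda>X. has_pd f (\<lambda>i. partial i f X) X) (zf p)"
    and "partial i f \<in> near_regular (n - 1) p"
    and "eventually (\<lambda>X. (\<Sum>i\<in>UNIV. X $ i * partial i f X) = of_int n * f X) (zf p)"
proof -
  obtain a b k l where ab: "homog_poly k a" "homog_poly l b" "int k - int l = n"
    "eventually (\<lambda>X. b X \<noteq> 0 \<and> f X = a X / b X) (zf p)"
    by (rule near_regularE[OF assms(1) assms(2)])
  have pd: "eventually (\<lambda>X. has_pd f (\<lambda>i. (partial i a X * b X - a X * partial i b X) / (b X * b X)) X) (zf p)"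
    using eventually_zf_nhds[OF ab(4) assms(2)] ab(4)
  proof eventually_elim
    case (elim X)
    have "has_pd (\<lambda>X. a X / b X) (\<lambda>i. (partial i a X * b X - a X * partial i b X) / (b X * b X)) X"
      using elim by (intro has_pd_divide has_pd_homog[OF ab(1)] has_pd_homog[OF ab(2)]) auto
    then show ?case
      by (rule has_pd_transform) (use elim(1) in eventually_elim, simp)
  qed
  then show "eventually (\<lambda>X. has_pd f (\<lambda>i. partial i f X) X) (zf p)"
    by eventually_elim (rule has_pdD)
  have p: "eventually (\<lambda>X. \<forall>i. partial i f X = (partial i a X * b X - a X * partial i b X) / (b X * b X)) (zf p)"
    using pd by eventually_elim (auto simp: has_pd_partial)
  show "partial i f \<in> near_regular (n - 1) p"
  proof (cases "k + l = 0")
    \<comment> \<open>Here a and b are constants. The degree \<open>k + l - 1\<close> expected of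
      the numerator would be truncated, but the derivative is zero.\<close>
    case True
    then have "eventually (\<lambda>X. 0 = partial i f X) (zf p)"
      using p ab(1,2) by (auto elim!: eventually_mono simp: partial_homog_0)
    then show ?thesis using near_regular_cong[OF near_regular_zero _ assms(2)] assms(2) by blast
  next
    case False
    have 1: "homog_poly (k + l - 1) (\<lambda>X. partial i a X * b X)"
    proof (cases "k = 0")
      case True then show ?thesis using partial_homog_0[of a i] ab(1) by simp
    next
      case False then show ?thesis using homog_poly_mult[OF homog_poly_partial[OF ab(1), of i] ab(2)] by simp
    qed
    have 2: "homog_poly (k + l - 1) (\<lambda>X. a X * partial i b X)"
    proof (cases "l = 0")
      case True then show ?thesis using partial_homog_0[of b i] ab(2) by simp
    next
      case False then show ?thesis using homog_poly_mult[OF ab(1) homog_poly_partial[OF ab(2), of i]] by simp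
    qed
    show ?thesis
    proof (rule near_regularI[OF assms(2) homog_poly_diff[OF 1 2] homog_poly_mult[OF ab(2) ab(2)]])
      show "int (k + l - 1) - int (l + l) = n - 1" using ab(3) False by linarith
      show "eventually (\<lambda>X. b X * b X \<noteq> 0 \<and> partial i f X =
          (partial i a X * b X - a X * partial i b X) / (b X * b X)) (zf p)"
        using ab(4) p by eventually_elim auto
    qed
  qed
  show "eventually (\<lambda>X. (\<Sum>i\<in>UNIV. X $ i * partial i f X) = of_int n * f X) (zf p)"
    using ab(4) p
  proof eventually_elim
    case (elim X)
    have "(\<Sum>i\<in>UNIV. X $ i * partial i f X) =
        (\<Sum>i\<in>UNIV. X $ i * partial i a X * (b X / (b X * b X)) - X $ i * partial i b X * (a X / (b X * b X)))"
      by (intro sum.cong refl, subst spec[OF elim(2)])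
        (simp only: times_divide_eq_right right_diff_distrib diff_divide_distrib mult_ac)
    also have "\<dots> = (\<Sum>i\<in>UNIV. X $ i * partial i a X) * (b X / (b X * b X))
        - (\<Sum>i\<in>UNIV. X $ i * partial i b X) * (a X / (b X * b X))"
      by (simp only: sum_subtractf sum_distrib_right)
    also have "\<dots> = of_nat k * a X * (b X / (b X * b X)) - of_nat l * b X * (a X / (b X * b X))"
      by (simp add: euler_homog[OF ab(1)] euler_homog[OF ab(2)])
    also have "\<dots> = of_int (int k - int l) * (a X / b X)"
      using elim(1) by (simp add: field_simps)
    finally show ?case using elim(1) ab(3) by simp
  qed
qed

lemma near_regular_isCont:
  assumes "f \<in> near_regular n p" "p \<in> proj_points"
  shows "eventually (\<lambda>X. isCont f X) (zf p)"
proof -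
  obtain a b k l where ab: "homog_poly k a" "homog_poly l b" "int k - int l = n"
    "eventually (\<lambda>X. b X \<noteq> 0 \<and> f X = a X / b X) (zf p)"
    by (rule near_regularE[OF assms(1) assms(2)])
  show ?thesis using eventually_zf_nhds[OF ab(4) assms(2)] ab(4)
  proof eventually_elim
    case (elim X)
    have "isCont (\<lambda>X. a X / b X) X"
      using elim(2) by (intro continuous_divide homog_poly_isCont[OF ab(1)] homog_poly_isCont[OF ab(2)]) auto
    moreover have "eventually (\<lambda>Z. f Z = a Z / b Z) (nhds X)" using elim(1) by eventually_elim simp
    ultimately show ?case using isCont_cong[of f "\<lambda>Z. a Z / b Z" X] by simp
  qed
qed

lemma partial_cong:
  assumes "f \<in> near_regular n p" "eventually (\<lambda>X. f X = g X) (zf p)" "p \<in> proj_points"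
  shows "eventually (\<lambda>X. \<forall>i. partial i f X = partial i g X) (zf p)"
  using near_regular_pd(1)[OF assms(1,3)] eventually_zf_nhds[OF assms(2,3)]
proof eventually_elim
  case (elim X)
  then have "has_pd g (\<lambda>i. partial i f X) X" by (rule has_pd_transform)
  then show ?case by (simp add: has_pd_partial)
qed

lemma partial_add:
  assumes "f \<in> near_regular n p" "g \<in> near_regular n p" "p \<in> proj_points"
  shows "eventually (\<lambda>X. \<forall>i. partial i (\<lambda>X. f X + g X) X = partial i f X + partial i g X) (zf p)"
  using near_regular_pd(1)[OF assms(1,3)] near_regular_pd(1)[OF assms(2,3)]
proof eventually_elim
  case (elim X)
  show ?case using has_pd_partial[OF has_pd_add[OF elim]] by simp
qed

lemma partial_mult:
  assumes "f \<in> near_regular n p" "g \<in> near_regular n' p" "p \<in> proj_points"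
  shows "eventually (\<lambda>X. \<forall>i. partial i (\<lambda>X. f X * g X) X = partial i f X * g X + f X * partial i g X) (zf p)"
  using near_regular_pd(1)[OF assms(1,3)] near_regular_pd(1)[OF assms(2,3)]
proof eventually_elim
  case (elim X)
  show ?case using has_pd_partial[OF has_pd_mult[OF elim]] by simp
qed

text \<open>Used with f = P: it cancels P on the whole cone, even over points of H, where P itself
  is zero.\<close>

lemma near_regular_zero_by_density:
  assumes U: "openin zariski U" and f: "homog_poly d f" "f V \<noteq> 0"
    and g: "\<And>p. p \<in> U \<Longrightarrow> g \<in> near_regular n p" and fg: "\<And>X. X \<in> \<Union>U \<Longrightarrow> f X * g X = 0" and X: "X \<in> \<Union>U"
  shows "g X = 0"
proof (rule zero_by_density[OF f open_cone[OF U] X _ fg])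
  have "isCont g Z" if "Z \<in> \<Union>U" for Z
    by (rule eventually_zf_open[OF U near_regular_isCont[OF g] that]) (use openin_zariski_subset[OF U] in auto)
  then show "continuous_on (\<Union>U) g" by (simp add: continuous_at_imp_continuous_on)
qed

section \<open>Germs of polynomials in \<open>Y\<close>\<close>

lemma homog_poly_prod:
  "finite I \<Longrightarrow> (\<And>i. i \<in> I \<Longrightarrow> homog_poly (d i) (f i)) \<Longrightarrow> homog_poly (\<Sum>i\<in>I. d i) (\<lambda>X. \<Prod>i\<in>I. f i X)"
  by (induction I rule: finite_induct) (auto intro: homog_poly_mult)

lemma homog_poly_subst:
  assumes "homog_poly m q" "\<And>i. homog_poly 1 (\<lambda>T. l T $ i)"
  shows "homog_poly m (\<lambda>T. q (l T))"
proof -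
  obtain c where c: "q = (\<lambda>X. \<Sum>e\<in>exponents m. c e * monomial e X)"
    using assms(1) unfolding homog_poly_def by auto
  have "homog_poly m (\<lambda>T. monomial e (l T))" if "e \<in> exponents m" for e
  proof -
    have "homog_poly (\<Sum>i\<in>UNIV. e i * 1) (\<lambda>T. \<Prod>i\<in>UNIV. (l T $ i) ^ e i)"
      by (rule homog_poly_prod) (auto intro: homog_poly_power[OF assms(2), simplified])
    then show ?thesis using that by (simp add: exponents_def monomial_def)
  qed
  then show ?thesis unfolding c by (auto intro!: homog_poly_sum homog_poly_cmult)
qed

text \<open>The stalk at p of \<complex>[Y]_m \<otimes> O(n), before functions that agree near p are
  identified.\<close>

definition near_Y :: "nat \<Rightarrow> int \<Rightarrow> 'n::finite point \<Rightarrow> (complex ^ 'n \<Rightarrow> complex ^ 'n \<Rightarrow> complex) set" where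
  "near_Y m n p = {F. \<exists>a. (\<forall>e\<in>exponents m. a e \<in> near_regular n p) \<and>
     eventually (\<lambda>X. \<forall>Y. F X Y = (\<Sum>e\<in>exponents m. a e X * monomial e Y)) (zf p)}"

lemma near_YI:
  assumes "\<And>e. e \<in> exponents m \<Longrightarrow> a e \<in> near_regular n p"
    "eventually (\<lambda>X. \<forall>Y. F X Y = (\<Sum>e\<in>exponents m. a e X * monomial e Y)) (zf p)"
  shows "F \<in> near_Y m n p"
  using assms unfolding near_Y_def by blast

lemma near_YE:
  assumes "F \<in> near_Y m n p"
  obtains a where "\<forall>e\<in>exponents m. a e \<in> near_regular n p"
    "eventually (\<lambda>X. \<forall>Y. F X Y = (\<Sum>e\<in>exponents m. a e X * monomial e Y)) (zf p)"
  using assms unfolding near_Y_def by blast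

lemma near_Y_cong:
  assumes "F \<in> near_Y m n p" "eventually (\<lambda>X. \<forall>Y. F X Y = G X Y) (zf p)"
  shows "G \<in> near_Y m n p"
proof -
  obtain a where a: "\<forall>e\<in>exponents m. a e \<in> near_regular n p"
    "eventually (\<lambda>X. \<forall>Y. F X Y = (\<Sum>e\<in>exponents m. a e X * monomial e Y)) (zf p)"
    by (rule near_YE[OF assms(1)])
  show ?thesis
    by (rule near_YI[of _ a]) (use a(1) in blast, use a(2) assms(2) in eventually_elim, simp)
qed

lemma near_Y_homog: "F \<in> near_Y m n p \<Longrightarrow> eventually (\<lambda>X. homog_poly m (F X)) (zf p)"
proof -
  assume F: "F \<in> near_Y m n p"
  obtain a where a: "\<forall>e\<in>exponents m. a e \<in> near_regular n p"
    "eventually (\<lambda>X. \<forall>Y. F X Y = (\<Sum>e\<in>exponents m. a e X * monomial e Y)) (zf p)"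
    by (rule near_YE[OF F])
  from a(2) show ?thesis
  proof eventually_elim
    case (elim X)
    then show ?case unfolding homog_poly_def by (intro exI[of _ "\<lambda>e. a e X"] ext) simp
  qed
qed

text \<open>Regularity is assumed for some system of coefficients; since monomials are independent,
  near p it is the one picked by \<open>coeffs_of\<close>.\<close>

lemma near_Y_coeff:
  assumes "F \<in> near_Y m n p" "e \<in> exponents m" "p \<in> proj_points"
  shows "(\<lambda>X. coeffs_of m (F X) e) \<in> near_regular n p"
proof -
  obtain a where a: "\<forall>e\<in>exponents m. a e \<in> near_regular n p"
    "eventually (\<lambda>X. \<forall>Y. F X Y = (\<Sum>e\<in>exponents m. a e X * monomial e Y)) (zf p)"
    by (rule near_YE[OF assms(1)])
  have "eventually (\<lambda>X. a e X = coeffs_of m (F X) e) (zf p)"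
    using a(2)
  proof eventually_elim
    case (elim X)
    show ?case by (rule coeffs_of_unique[symmetric, OF _ assms(2)]) (use elim in simp)
  qed
  from near_regular_cong[OF bspec[OF a(1) assms(2)] this assms(3)] show ?thesis .
qed

lemma near_Y_term:
  assumes "f \<in> near_regular n p" "e \<in> exponents m" "p \<in> proj_points"
  shows "(\<lambda>X Y. f X * monomial e Y) \<in> near_Y m n p"
proof (rule near_YI[of m "\<lambda>e'. if e' = e then f else (\<lambda>X. 0)"])
  show "(if e' = e then f else (\<lambda>X. 0)) \<in> near_regular n p" for e'
    using assms near_regular_zero by auto
  have "(\<Sum>e'\<in>exponents m. (if e' = e then f else (\<lambda>X. 0)) X * monomial e' Y)
      = (\<Sum>e'\<in>exponents m. if e' = e then f X * monomial e Y else 0)" for X Y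
    by (rule sum.cong) auto
  then show "eventually (\<lambda>X. \<forall>Y. f X * monomial e Y =
      (\<Sum>e'\<in>exponents m. (if e' = e then f else (\<lambda>X. 0)) X * monomial e' Y)) (zf p)"
    using assms(2) by simp
qed

lemma near_Y_add:
  assumes "F \<in> near_Y m n p" "G \<in> near_Y m n p" "p \<in> proj_points"
  shows "(\<lambda>X Y. F X Y + G X Y) \<in> near_Y m n p"
proof -
  obtain a where a: "\<forall>e\<in>exponents m. a e \<in> near_regular n p"
    "eventually (\<lambda>X. \<forall>Y. F X Y = (\<Sum>e\<in>exponents m. a e X * monomial e Y)) (zf p)"
    by (rule near_YE[OF assms(1)])
  obtain b where b: "\<forall>e\<in>exponents m. b e \<in> near_regular n p"
    "eventually (\<lambda>X. \<forall>Y. G X Y = (\<Sum>e\<in>exponents m. b e X * monomial e Y)) (zf p)"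
    by (rule near_YE[OF assms(2)])
  show ?thesis
  proof (rule near_YI)
    show "(\<lambda>X. a e X + b e X) \<in> near_regular n p" if "e \<in> exponents m" for e
      by (rule near_regular_add[OF bspec[OF a(1) that] bspec[OF b(1) that] assms(3)])
    show "eventually (\<lambda>X. \<forall>Y. F X Y + G X Y = (\<Sum>e\<in>exponents m. (a e X + b e X) * monomial e Y)) (zf p)"
      using a(2) b(2) by eventually_elim (simp add: distrib_right sum.distrib)
  qed
qed

lemma near_Y_smult:
  assumes "f \<in> near_regular n p" "F \<in> near_Y m n' p" "p \<in> proj_points"
  shows "(\<lambda>X Y. f X * F X Y) \<in> near_Y m (n + n') p"
proof -
  obtain a where a: "\<forall>e\<in>exponents m. a e \<in> near_regular n' p"
    "eventually (\<lambda>X. \<forall>Y. F X Y = (\<Sum>e\<in>exponents m. a e X * monomial e Y)) (zf p)"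
    by (rule near_YE[OF assms(2)])
  show ?thesis
  proof (rule near_YI)
    show "(\<lambda>X. f X * a e X) \<in> near_regular (n + n') p" if "e \<in> exponents m" for e
      by (rule near_regular_mult[OF assms(1) bspec[OF a(1) that] assms(3)])
    show "eventually (\<lambda>X. \<forall>Y. f X * F X Y = (\<Sum>e\<in>exponents m. (f X * a e X) * monomial e Y)) (zf p)"
      using a(2) by eventually_elim (simp add: sum_distrib_left mult.assoc)
  qed
qed

lemma near_Y_zero: "p \<in> proj_points \<Longrightarrow> (\<lambda>X Y. 0) \<in> near_Y m n p"
  by (rule near_YI[of _ "\<lambda>e X. 0"]) (auto intro: near_regular_zero)

lemma near_Y_cmult: "F \<in> near_Y m n p \<Longrightarrow> p \<in> proj_points \<Longrightarrow> (\<lambda>X Y. c * F X Y) \<in> near_Y m n p"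
  using near_Y_smult[OF near_regular_const[of p c], of F m n] by simp

lemma near_Y_diff:
  "F \<in> near_Y m n p \<Longrightarrow> G \<in> near_Y m n p \<Longrightarrow> p \<in> proj_points \<Longrightarrow> (\<lambda>X Y. F X Y - G X Y) \<in> near_Y m n p"
  using near_Y_add[OF _ near_Y_cmult[of G m n p "-1"], of F] by simp

lemma near_Y_sum:
  "(\<And>i. i \<in> I \<Longrightarrow> F i \<in> near_Y m n p) \<Longrightarrow> p \<in> proj_points \<Longrightarrow> (\<lambda>X Y. \<Sum>i\<in>I. F i X Y) \<in> near_Y m n p"
  by (induction I rule: infinite_finite_induct) (auto intro: near_Y_zero near_Y_add)

lemma near_Y_mult:
  assumes "F \<in> near_Y m n p" "G \<in> near_Y m' n' p" "p \<in> proj_points"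
  shows "(\<lambda>X Y. F X Y * G X Y) \<in> near_Y (m + m') (n + n') p"
proof -
  obtain a where a: "\<forall>e\<in>exponents m. a e \<in> near_regular n p"
    "eventually (\<lambda>X. \<forall>Y. F X Y = (\<Sum>e\<in>exponents m. a e X * monomial e Y)) (zf p)"
    by (rule near_YE[OF assms(1)])
  obtain b where b: "\<forall>e\<in>exponents m'. b e \<in> near_regular n' p"
    "eventually (\<lambda>X. \<forall>Y. G X Y = (\<Sum>e\<in>exponents m'. b e X * monomial e Y)) (zf p)"
    by (rule near_YE[OF assms(2)])
  have "(\<lambda>X Y. \<Sum>e\<in>exponents m. \<Sum>e'\<in>exponents m'. (a e X * b e' X) * monomial (\<lambda>i. e i + e' i) Y)
      \<in> near_Y (m + m') (n + n') p"
    by (intro near_Y_sum near_Y_term near_regular_mult exponents_add) (use a(1) b(1) assms(3) in auto)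
  then show ?thesis
  proof (rule near_Y_cong)
    show "eventually (\<lambda>X. \<forall>Y. (\<Sum>e\<in>exponents m. \<Sum>e'\<in>exponents m'.
        (a e X * b e' X) * monomial (\<lambda>i. e i + e' i) Y) = F X Y * G X Y) (zf p)"
      using a(2) b(2)
    proof eventually_elim
      case (elim X)
      then show ?case
        by (simp add: sum_product monomial_add mult_ac)
    qed
  qed
qed

lemma near_Y_const: "f \<in> near_regular n p \<Longrightarrow> p \<in> proj_points \<Longrightarrow> (\<lambda>X Y. f X) \<in> near_Y 0 n p"
  using near_Y_term[of f n p "\<lambda>_. 0" 0] by (simp add: exponents_0)

lemma near_Y_var: "p \<in> proj_points \<Longrightarrow> (\<lambda>X Y. Y $ i) \<in> near_Y 1 0 p"
  using near_Y_term[OF near_regular_const[of p 1] unit_exp_exponents[of i]] by simp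

lemma near_Y_power:
  "F \<in> near_Y m n p \<Longrightarrow> p \<in> proj_points \<Longrightarrow> (\<lambda>X Y. F X Y ^ k) \<in> near_Y (k * m) (int k * n) p"
proof (induction k)
  case 0
  then show ?case using near_Y_const[OF near_regular_const[of p 1]] by simp
next
  case (Suc k)
  have "(\<lambda>X Y. F X Y * F X Y ^ k) \<in> near_Y (m + k * m) (n + int k * n) p"
    by (rule near_Y_mult) (use Suc in auto)
  then show ?case by (simp add: algebra_simps)
qed

lemma near_Y_prod:
  assumes "finite I" "\<And>i. i \<in> I \<Longrightarrow> F i \<in> near_Y (d i) 0 p" "p \<in> proj_points"
  shows "(\<lambda>X Y. \<Prod>i\<in>I. F i X Y) \<in> near_Y (\<Sum>i\<in>I. d i) 0 p"
  using assms
proof (induction I rule: finite_induct)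
  case empty
  then show ?case using near_Y_const[OF near_regular_const[of p 1]] by simp
next
  case (insert x I)
  then have "(\<lambda>X Y. F x X Y * (\<Prod>i\<in>I. F i X Y)) \<in> near_Y (d x + (\<Sum>i\<in>I. d i)) (0 + 0) p"
    by (intro near_Y_mult) auto
  then show ?case using insert by simp
qed

lemma near_Y_subst:
  assumes "F \<in> near_Y m n p" "\<And>i. (\<lambda>X Y. l X Y $ i) \<in> near_Y 1 0 p" "p \<in> proj_points"
  shows "(\<lambda>X Y. F X (l X Y)) \<in> near_Y m n p"
proof -
  obtain a where a: "\<forall>e\<in>exponents m. a e \<in> near_regular n p"
    "eventually (\<lambda>X. \<forall>Y. F X Y = (\<Sum>e\<in>exponents m. a e X * monomial e Y)) (zf p)"
    by (rule near_YE[OF assms(1)])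
  have "(\<lambda>X Y. monomial e (l X Y)) \<in> near_Y m 0 p" if "e \<in> exponents m" for e
  proof -
    have "(\<lambda>X Y. \<Prod>i\<in>UNIV. (l X Y $ i) ^ e i) \<in> near_Y (\<Sum>i\<in>UNIV. e i) 0 p"
    proof (rule near_Y_prod[OF _ _ assms(3)])
      fix i show "(\<lambda>X Y. (l X Y $ i) ^ e i) \<in> near_Y (e i) 0 p"
        using near_Y_power[OF assms(2,3), of i "e i"] by simp
    qed simp
    then show ?thesis using that by (simp add: monomial_def exponents_def)
  qed
  note mono = this
  have "(\<lambda>X Y. \<Sum>e\<in>exponents m. a e X * monomial e (l X Y)) \<in> near_Y m (n + 0) p"
    by (rule near_Y_sum[OF near_Y_smult[OF bspec[OF a(1)] mono assms(3)] assms(3)])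
  then have "(\<lambda>X Y. \<Sum>e\<in>exponents m. a e X * monomial e (l X Y)) \<in> near_Y m n p" by simp
  then show ?thesis by (rule near_Y_cong) (use a(2) in eventually_elim, simp)
qed

section \<open>The operator \<delta> on polynomials in Y\<close>

lemma delta_cong: "F X = G X \<Longrightarrow> delta F X = delta G X"
  by (simp add: delta_def)

text \<open>X is only a parameter: \<delta> differentiates in Y alone, so its powers may be computed
  from F at the one X considered.\<close>

lemma delta_pow_cong: "F X = G X \<Longrightarrow> (delta ^^ k) F X = (delta ^^ k) G X"
  by (induction k) (auto intro: delta_cong)

lemma delta_zero: "delta (\<lambda>X Y. 0) = (\<lambda>X Y. 0)"
  by (simp add: delta_def)

lemma delta_pow_zero: "(delta ^^ k) (\<lambda>X Y. 0) = (\<lambda>X Y. 0)"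
  by (induction k) (auto simp: delta_zero)

lemma delta_eqI:
  assumes "has_pd (F X) D Y" shows "delta F X Y = (\<Sum>i\<in>UNIV. X $ i * D i)"
  unfolding delta_def using has_pd_partial[OF assms] by simp

lemma delta_pow_Suc: "(delta ^^ Suc k) F = (delta ^^ k) (delta F)"
  by (simp add: funpow_swap1)

lemma delta_homog: "homog_poly m (F X) \<Longrightarrow> homog_poly (m - 1) (delta F X)"
  unfolding delta_def by (intro homog_poly_sum homog_poly_cmult homog_poly_partial)

lemma delta_add:
  assumes "homog_poly m (F X)" "homog_poly m' (G X)"
  shows "delta (\<lambda>X Y. F X Y + G X Y) X Y = delta F X Y + delta G X Y"
  using delta_eqI[where F = "\<lambda>X Y. F X Y + G X Y",
      OF has_pd_add[OF has_pd_homog[OF assms(1), of Y] has_pd_homog[OF assms(2), of Y]]]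
  by (simp add: delta_def distrib_left sum.distrib)

lemma delta_smult:
  assumes "homog_poly m (F X)"
  shows "delta (\<lambda>X Y. f X * F X Y) X Y = f X * delta F X Y"
  using delta_eqI[where F = "\<lambda>X Y. f X * F X Y", OF has_pd_cmult[OF has_pd_homog[OF assms, of Y], of "f X"]]
  by (simp add: delta_def sum_distrib_left mult_ac)

lemma delta_diff:
  assumes "homog_poly m (F X)" "homog_poly m' (G X)"
  shows "delta (\<lambda>X Y. F X Y - G X Y) X Y = delta F X Y - delta G X Y"
  using delta_add[where F = F and G = "\<lambda>X Y. -1 * G X Y", OF assms(1), of m']
    delta_smult[where F = G and f = "\<lambda>X. -1", OF assms(2)] homog_poly_cmult[OF assms(2), of "-1"] by simp

lemma delta_mult:
  assumes "homog_poly m (F X)" "homog_poly m' (G X)"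
  shows "delta (\<lambda>X Y. F X Y * G X Y) X Y = delta F X Y * G X Y + F X Y * delta G X Y"
  using delta_eqI[where F = "\<lambda>X Y. F X Y * G X Y",
      OF has_pd_mult[OF has_pd_homog[OF assms(1), of Y] has_pd_homog[OF assms(2), of Y]]]
  by (simp add: delta_def distrib_left sum.distrib sum_distrib_left sum_distrib_right mult_ac)

lemma delta_pow_add:
  "homog_poly m (F X) \<Longrightarrow> homog_poly m (G X) \<Longrightarrow>
    (delta ^^ k) (\<lambda>X Y. F X Y + G X Y) X Y = (delta ^^ k) F X Y + (delta ^^ k) G X Y"
proof (induction k arbitrary: m F G)
  case (Suc k)
  have "delta (\<lambda>X Y. F X Y + G X Y) X = (\<lambda>Y. delta F X Y + delta G X Y)"
    by (rule ext) (rule delta_add[of m F X m G, OF Suc.prems])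
  then have "(delta ^^ k) (delta (\<lambda>X Y. F X Y + G X Y)) X = (delta ^^ k) (\<lambda>X Y. delta F X Y + delta G X Y) X"
    by (rule delta_pow_cong)
  then show ?case
    unfolding delta_pow_Suc using Suc.IH[of "m - 1" "delta F" "delta G"]
      delta_homog[of m F X] delta_homog[of m G X] Suc.prems by simp
qed simp

lemma delta_pow_smult:
  "homog_poly m (F X) \<Longrightarrow> (delta ^^ k) (\<lambda>X Y. f X * F X Y) X Y = f X * (delta ^^ k) F X Y"
proof (induction k arbitrary: m F)
  case (Suc k)
  have "delta (\<lambda>X Y. f X * F X Y) X = (\<lambda>Y. f X * delta F X Y)"
    by (rule ext) (rule delta_smult[of m F X, OF Suc.prems])
  then have "(delta ^^ k) (delta (\<lambda>X Y. f X * F X Y)) X = (delta ^^ k) (\<lambda>X Y. f X * delta F X Y) X"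
    by (rule delta_pow_cong)
  then show ?case
    unfolding delta_pow_Suc using Suc.IH[of "m - 1" "delta F"] delta_homog[of m F X] Suc.prems by simp
qed simp

text \<open>For m = 0 the truncated \<open>m - 1\<close> is correct, since \<delta> F is then zero
  near p.\<close>

lemma near_Y_delta:
  assumes "F \<in> near_Y m n p" "p \<in> proj_points"
  shows "delta F \<in> near_Y (m - 1) (n + 1) p"
proof -
  obtain a where a: "\<forall>e\<in>exponents m. a e \<in> near_regular n p"
    "eventually (\<lambda>X. \<forall>Y. F X Y = (\<Sum>e\<in>exponents m. a e X * monomial e Y)) (zf p)"
    by (rule near_YE[OF assms(1)])
  have "(\<lambda>X Y. (a e X * X $ i * of_nat (e i)) * monomial (e(i := e i - 1)) Y) \<in> near_Y (m - 1) (n + 1) p"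
    if "e \<in> exponents m" for e i
  proof (cases "e i = 0")
    case True
    then show ?thesis using near_Y_zero assms(2) by simp
  next
    case False
    have "(\<lambda>X. a e X * X $ i * of_nat (e i)) \<in> near_regular (n + 1 + 0) p"
      by (intro near_regular_mult near_regular_coord near_regular_const) (use a(1) that assms(2) in auto)
    then show ?thesis using near_Y_term lower_exponents[OF that False] assms(2) by simp
  qed
  then have "(\<lambda>X Y. \<Sum>i\<in>UNIV. \<Sum>e\<in>exponents m. (a e X * X $ i * of_nat (e i)) * monomial (e(i := e i - 1)) Y)
      \<in> near_Y (m - 1) (n + 1) p"
    by (intro near_Y_sum) (use assms(2) in auto)
  then show ?thesis
  proof (rule near_Y_cong)
    show "eventually (\<lambda>X. \<forall>Y. (\<Sum>i\<in>UNIV. \<Sum>e\<in>exponents m.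
       (a e X * X $ i * of_nat (e i)) * monomial (e(i := e i - 1)) Y) = delta F X Y) (zf p)"
      using a(2)
    proof eventually_elim
      case (elim X)
      have F: "F X = (\<lambda>Y. \<Sum>e\<in>exponents m. a e X * monomial e Y)" using elim by auto
      show ?case
      proof
        fix Y
        have "has_pd (F X) (\<lambda>i. \<Sum>e\<in>exponents m. a e X * (of_nat (e i) * monomial (e(i := e i - 1)) Y)) Y"
          unfolding F by (rule has_pd_monomial_sum)
        then show "(\<Sum>i\<in>UNIV. \<Sum>e\<in>exponents m. (a e X * X $ i * of_nat (e i)) * monomial (e(i := e i - 1)) Y)
            = delta F X Y"
          by (subst delta_eqI) (auto simp: sum_distrib_left mult_ac)
      qed
    qed
  qed
qed

lemma delta_eventually_cong:
  "eventually (\<lambda>X. \<forall>Y. F X Y = G X Y) (zf p) \<Longrightarrow>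
    eventually (\<lambda>X. \<forall>Y. (delta ^^ k) F X Y = (delta ^^ k) G X Y) (zf p)"
proof (erule eventually_mono)
  fix X assume "\<forall>Y. F X Y = G X Y"
  then have "F X = G X" by auto
  from delta_pow_cong[where F = F and G = G, OF this]
  show "\<forall>Y. (delta ^^ k) F X Y = (delta ^^ k) G X Y" by simp
qed

section \<open>Germs of sections of Ker \<delta>^k\<close>

definition near_K :: "nat \<Rightarrow> nat \<Rightarrow> int \<Rightarrow> 'n::finite point \<Rightarrow> (complex ^ 'n \<Rightarrow> complex ^ 'n \<Rightarrow> complex) set" where
  "near_K k m n p = {F \<in> near_Y m n p. eventually (\<lambda>X. \<forall>Y. (delta ^^ k) F X Y = 0) (zf p)}"

lemma near_K_cong:
  assumes "F \<in> near_K k m n p" "eventually (\<lambda>X. \<forall>Y. F X Y = G X Y) (zf p)"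
  shows "G \<in> near_K k m n p"
  unfolding near_K_def
proof (intro CollectI conjI)
  show "G \<in> near_Y m n p" using assms(1) near_Y_cong[OF _ assms(2)] by (simp add: near_K_def)
  have "eventually (\<lambda>X. \<forall>Y. (delta ^^ k) F X Y = 0) (zf p)" using assms(1) by (simp add: near_K_def)
  then show "eventually (\<lambda>X. \<forall>Y. (delta ^^ k) G X Y = 0) (zf p)"
    using delta_eventually_cong[OF assms(2), of k] by eventually_elim simp
qed

lemma near_K_add:
  assumes "F \<in> near_K k m n p" "G \<in> near_K k m n p" "p \<in> proj_points"
  shows "(\<lambda>X Y. F X Y + G X Y) \<in> near_K k m n p"
  unfolding near_K_def
proof (intro CollectI conjI)
  have F: "F \<in> near_Y m n p" "G \<in> near_Y m n p"
    "eventually (\<lambda>X. \<forall>Y. (delta ^^ k) F X Y = 0) (zf p)" "eventually (\<lambda>X. \<forall>Y. (delta ^^ k) G X Y = 0) (zf p)"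
    using assms by (auto simp: near_K_def)
  show "(\<lambda>X Y. F X Y + G X Y) \<in> near_Y m n p" by (rule near_Y_add) fact+
  show "eventually (\<lambda>X. \<forall>Y. (delta ^^ k) (\<lambda>X Y. F X Y + G X Y) X Y = 0) (zf p)"
    using near_Y_homog[OF F(1)] near_Y_homog[OF F(2)] F(3,4)
    by eventually_elim (simp add: delta_pow_add)
qed

lemma near_K_smult:
  assumes "f \<in> near_regular n p" "F \<in> near_K k m n' p" "p \<in> proj_points"
  shows "(\<lambda>X Y. f X * F X Y) \<in> near_K k m (n + n') p"
  unfolding near_K_def
proof (intro CollectI conjI)
  have F: "F \<in> near_Y m n' p" "eventually (\<lambda>X. \<forall>Y. (delta ^^ k) F X Y = 0) (zf p)"
    using assms by (auto simp: near_K_def)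
  show "(\<lambda>X Y. f X * F X Y) \<in> near_Y m (n + n') p" by (rule near_Y_smult) fact+
  show "eventually (\<lambda>X. \<forall>Y. (delta ^^ k) (\<lambda>X Y. f X * F X Y) X Y = 0) (zf p)"
    using near_Y_homog[OF F(1)] F(2)
    by eventually_elim (simp add: delta_pow_smult)
qed

lemma near_K_zero: "p \<in> proj_points \<Longrightarrow> (\<lambda>X Y. 0) \<in> near_K k m n p"
  by (auto simp: near_K_def near_Y_zero delta_pow_zero)

lemma near_K_cmult: "F \<in> near_K k m n p \<Longrightarrow> p \<in> proj_points \<Longrightarrow> (\<lambda>X Y. c * F X Y) \<in> near_K k m n p"
  using near_K_smult[OF near_regular_const[of p c], of F k m n] by simp

text \<open>\<open>zf p\<close> is a filter on vectors, whereas membership in \<open>near_K\<close>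
  refers to a point. Through \<open>point_of\<close> the fact that a germ at p is also a germ at all
  points near p becomes an eventual statement, which combines with others of that kind.\<close>

definition point_of :: "complex ^ 'n::finite \<Rightarrow> 'n point" where
  "point_of X = {c *s X |c. c \<noteq> 0}"

lemma point_of_eq: "p \<in> proj_points \<Longrightarrow> X \<in> p \<Longrightarrow> point_of X = p"
  using proj_point_eq[of p X] by (simp add: point_of_def)

lemma eventually_zf_spread:
  assumes "openin zariski V" "p \<in> V" "\<And>q. q \<in> V \<Longrightarrow> Q q"
  shows "eventually (\<lambda>X. Q (point_of X)) (zf p)"
proof (rule eventually_zfI[OF assms(1,2)])
  fix X assume "X \<in> \<Union>V"
  then obtain q where q: "q \<in> V" "X \<in> q" by auto
  then have "point_of X = q" using openin_zariski_subset[OF assms(1)] by (intro point_of_eq) auto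
  then show "Q (point_of X)" using assms(3) q by simp
qed

lemma eventually_zf_eventually:
  assumes "eventually Q (zf p)" "p \<in> proj_points"
  shows "eventually (\<lambda>X. eventually Q (zf (point_of X))) (zf p)"
proof -
  obtain V where V: "openin zariski V" "p \<in> V" "\<forall>X\<in>\<Union>V. Q X"
    using assms(1) unfolding eventually_zf[OF assms(2)] by blast
  show ?thesis
    by (rule eventually_zf_spread[OF V(1,2)]) (rule eventually_zfI[OF V(1)], use V(3) in auto)
qed

lemma near_regular_spread:
  assumes "f \<in> near_regular n p"
  shows "eventually (\<lambda>X. f \<in> near_regular n (point_of X)) (zf p)"
proof -
  obtain V where V: "openin zariski V" "p \<in> V" "regular_on n V f"
    using assms by (auto simp: near_regular_def)
  show ?thesis
    by (rule eventually_zf_spread[OF V(1,2)]) (use V in \<open>auto simp: near_regular_def\<close>)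
qed

lemma near_Y_spread:
  assumes "F \<in> near_Y m n p" "p \<in> proj_points"
  shows "eventually (\<lambda>X. F \<in> near_Y m n (point_of X)) (zf p)"
proof -
  obtain a where a: "\<forall>e\<in>exponents m. a e \<in> near_regular n p"
    "eventually (\<lambda>X. \<forall>Y. F X Y = (\<Sum>e\<in>exponents m. a e X * monomial e Y)) (zf p)"
    by (rule near_YE[OF assms(1)])
  have "eventually (\<lambda>X. \<forall>e\<in>exponents m. a e \<in> near_regular n (point_of X)) (zf p)"
    by (rule eventually_ball_finite) (use a(1) near_regular_spread in auto)
  then show ?thesis using eventually_zf_eventually[OF a(2) assms(2)]
    by eventually_elim (rule near_YI, auto)
qed

lemma near_K_spread:
  assumes "F \<in> near_K k m n p" "p \<in> proj_points"
  shows "eventually (\<lambda>X. F \<in> near_K k m n (point_of X)) (zf p)"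
proof -
  have F: "F \<in> near_Y m n p" "eventually (\<lambda>X. \<forall>Y. (delta ^^ k) F X Y = 0) (zf p)"
    using assms by (auto simp: near_K_def)
  show ?thesis
    using near_Y_spread[OF F(1) assms(2)] eventually_zf_eventually[OF F(2) assms(2)]
    by eventually_elim (simp add: near_K_def)
qed

section \<open>Sections of the bundles\<close>

lemma O_sections_iff:
  assumes "openin zariski U"
  shows "f \<in> O_sections n U \<longleftrightarrow> (\<forall>X. X \<notin> \<Union>U \<longrightarrow> f X = 0) \<and> (\<forall>p\<in>U. f \<in> near_regular n p)"
  unfolding O_sections_def using regular_on_iff[OF assms] by auto

text \<open>Coefficients of local expansions glue because they are unique: the functions
  \<open>coeffs_of\<close>, cut off outside the cone, are global coefficients.\<close>

lemma Y_sections_iff: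
  assumes U: "openin zariski U"
  shows "F \<in> Y_sections m n U \<longleftrightarrow>
    (\<forall>X Y. X \<notin> \<Union>U \<longrightarrow> F X Y = 0) \<and> (\<forall>p\<in>U. F \<in> near_Y m n p)"
proof
  assume "F \<in> Y_sections m n U"
  then obtain a where F: "F = (\<lambda>X Y. \<Sum>e\<in>exponents m. a e X * monomial e Y)"
    and a: "\<forall>e\<in>exponents m. a e \<in> O_sections n U"
    unfolding Y_sections_def by blast
  show "(\<forall>X Y. X \<notin> \<Union>U \<longrightarrow> F X Y = 0) \<and> (\<forall>p\<in>U. F \<in> near_Y m n p)"
  proof (intro conjI allI impI ballI)
    fix X Y assume "X \<notin> \<Union>U"
    then show "F X Y = 0" using a unfolding F O_sections_iff[OF U] by (intro sum.neutral) auto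
  next
    fix p assume "p \<in> U"
    then show "F \<in> near_Y m n p"
      using a unfolding F O_sections_iff[OF U] by (intro near_YI[of m a]) auto
  qed
next
  assume F: "(\<forall>X Y. X \<notin> \<Union>U \<longrightarrow> F X Y = 0) \<and> (\<forall>p\<in>U. F \<in> near_Y m n p)"
  define a where "a e X = (if X \<in> \<Union>U then coeffs_of m (F X) e else 0)" for e X
  have h: "homog_poly m (F X)" if "X \<in> \<Union>U" for X
    by (rule eventually_zf_open[OF U near_Y_homog that]) (use F in auto)
  have "F X Y = (\<Sum>e\<in>exponents m. a e X * monomial e Y)" for X Y
  proof (cases "X \<in> \<Union>U")
    case True
    then show ?thesis using coeffs_of[OF h[OF True], of Y] unfolding a_def by simp
  next
    case False
    then show ?thesis using F unfolding a_def by simp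
  qed
  moreover have "a e \<in> O_sections n U" if e: "e \<in> exponents m" for e
    unfolding O_sections_iff[OF U]
  proof (intro conjI allI impI ballI)
    fix p assume p: "p \<in> U"
    then have pp: "p \<in> proj_points" using U openin_zariski_subset by auto
    have "(\<lambda>X. coeffs_of m (F X) e) \<in> near_regular n p"
      using near_Y_coeff[OF _ e pp] F p by blast
    then show "a e \<in> near_regular n p"
      by (rule near_regular_cong[OF _ _ pp])
        (use eventually_zf_in[OF U p] in eventually_elim, simp add: a_def)
  qed (simp add: a_def)
  ultimately show "F \<in> Y_sections m n U" unfolding Y_sections_def by blast
qed

text \<open>All conditions on a section are pointwise in X, hence can be tested on germs. This
  reduces statements on sections to the calculus of \<open>near_K\<close>.\<close>

lemma Ker_delta_iff:
  assumes U: "openin zariski U"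
  shows "F \<in> carrier (sec (Ker_delta k m n) U) \<longleftrightarrow>
    (\<forall>X Y. X \<notin> \<Union>U \<longrightarrow> F X Y = 0) \<and> (\<forall>p\<in>U. F \<in> near_K k m n p)"
proof -
  have 1: "(delta ^^ k) F X Y = 0" if "\<forall>X Y. X \<notin> \<Union>U \<longrightarrow> F X Y = 0" "X \<notin> \<Union>U" for X Y
  proof -
    have "F X = (\<lambda>Y. 0)" using that by auto
    then have "(delta ^^ k) F X = (delta ^^ k) (\<lambda>X Y. 0) X" by (rule delta_pow_cong)
    then show ?thesis by (simp add: delta_pow_zero)
  qed
  have 2: "(delta ^^ k) F X Y = 0"
    if "\<forall>p\<in>U. eventually (\<lambda>X. \<forall>Y. (delta ^^ k) F X Y = 0) (zf p)" "X \<in> \<Union>U" for X Y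
  proof -
    have "\<forall>Y. (delta ^^ k) F X Y = 0"
      by (rule eventually_zf_open[OF U _ that(2)]) (use that(1) in blast)
    then show ?thesis by blast
  qed
  have c: "F \<in> carrier (sec (Ker_delta k m n) U) \<longleftrightarrow>
      F \<in> Y_sections m n U \<and> (\<forall>X Y. (delta ^^ k) F X Y = 0)" by (simp add: Ker_delta_def)
  show ?thesis unfolding c Y_sections_iff[OF U]
  proof (rule iffI)
    assume B: "(\<forall>X Y. X \<notin> \<Union>U \<longrightarrow> F X Y = 0) \<and> (\<forall>p\<in>U. F \<in> near_K k m n p)"
    have "(delta ^^ k) F X Y = 0" for X Y
      by (cases "X \<in> \<Union>U") (rule 2, use B in \<open>simp add: near_K_def\<close>, simp, rule 1, use B in auto)
    with B show "((\<forall>X Y. X \<notin> \<Union>U \<longrightarrow> F X Y = 0) \<and> (\<forall>p\<in>U. F \<in> near_Y m n p)) \<and>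
        (\<forall>X Y. (delta ^^ k) F X Y = 0)"
      by (simp add: near_K_def)
  qed (simp add: near_K_def)
qed

lemma Ker_delta_simps [simp]:
  "zero (sec (Ker_delta k m n) U) = (\<lambda>X Y. 0)"
  "add (sec (Ker_delta k m n) U) = (\<lambda>F G X Y. F X Y + G X Y)"
  "smult (sec (Ker_delta k m n) U) = (\<lambda>f F X Y. f X * F X Y)"
  "res (Ker_delta k m n) = (\<lambda>V F X Y. if X \<in> \<Union>V then F X Y else 0)"
  by (simp_all add: Ker_delta_def)

lemma proj_space_simps [simp]:
  "top_of proj_space = zariski"
  "carrier (fsec proj_space U) = O_sections 0 U"
  "mult (fsec proj_space U) = (\<lambda>f g X. f X * g X)"
  "one (fsec proj_space U) = (\<lambda>X. if X \<in> \<Union>U then 1 else 0)"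
  "zero (fsec proj_space U) = (\<lambda>X. 0)"
  "add (fsec proj_space U) = (\<lambda>f g X. f X + g X)"
  "fres proj_space = (\<lambda>V f X. if X \<in> \<Union>V then f X else 0)"
  by (simp_all add: proj_space_def)

lemma cring_fsec:
  assumes U: "openin zariski U"
  shows "cring (fsec proj_space U)"
proof (rule cringI)
  have pp: "p \<in> proj_points" if "p \<in> U" for p using U openin_zariski_subset that by auto
  have cl: "(\<lambda>X. f X + g X) \<in> O_sections 0 U" "(\<lambda>X. f X * g X) \<in> O_sections 0 U" "(\<lambda>X. - f X) \<in> O_sections 0 U"
    if "f \<in> O_sections 0 U" "g \<in> O_sections 0 U" for f g
    using that pp near_regular_mult[of f 0 _ g 0] unfolding O_sections_iff[OF U]
    by (auto intro: near_regular_add near_regular_uminus)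
  have z: "(\<lambda>X. 0) \<in> O_sections 0 U"
    using pp near_regular_zero unfolding O_sections_iff[OF U] by auto
  have o: "(\<lambda>X. if X \<in> \<Union>U then 1 else 0) \<in> O_sections 0 U"
    unfolding O_sections_iff[OF U]
  proof (intro conjI ballI)
    fix p assume p: "p \<in> U"
    show "(\<lambda>X. if X \<in> \<Union>U then 1 else 0) \<in> near_regular 0 p"
      by (rule near_regular_cong[OF near_regular_const[OF pp[OF p], of 1] _ pp[OF p]])
        (use eventually_zf_in[OF U p] in eventually_elim, simp)
  qed auto
  show "abelian_group (fsec proj_space U)"
  proof (rule abelian_groupI)
    fix f assume f: "f \<in> carrier (fsec proj_space U)"
    show "\<exists>g\<in>carrier (fsec proj_space U). g \<oplus>\<^bsub>fsec proj_space U\<^esub> f = \<zero>\<^bsub>fsec proj_space U\<^esub>"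
      using cl(3)[of f f] f by (intro bexI[of _ "\<lambda>X. - f X"]) auto
  qed (auto simp: cl z algebra_simps)
  have one: "(\<lambda>X. (if X \<in> \<Union>U then 1 else 0) * f X) = f" if "f \<in> O_sections 0 U" for f
    using that unfolding O_sections_iff[OF U] by (intro ext) auto
  show "comm_monoid (fsec proj_space U)"
  proof (rule comm_monoidI)
    fix f assume "f \<in> carrier (fsec proj_space U)"
    then show "\<one>\<^bsub>fsec proj_space U\<^esub> \<otimes>\<^bsub>fsec proj_space U\<^esub> f = f" using one[of f] by simp
  qed (use cl o in \<open>auto simp: algebra_simps\<close>)
qed (auto simp: algebra_simps)

lemma module_Ker_delta:
  assumes U: "openin zariski U"
  shows "module (fsec proj_space U) (sec (Ker_delta k m n) U)"
proof -
  have pp: "p \<in> proj_points" if "p \<in> U" for p using U openin_zariski_subset that by auto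
  let ?K = "carrier (sec (Ker_delta k m n) U)"
  have add: "(\<lambda>X Y. F X Y + G X Y) \<in> ?K" if "F \<in> ?K" "G \<in> ?K" for F G
    using that near_K_add[of F k m n _ G] pp unfolding Ker_delta_iff[OF U] by auto
  have sm: "(\<lambda>X Y. f X * F X Y) \<in> ?K" if "f \<in> O_sections 0 U" "F \<in> ?K" for f F
    using that near_K_smult[of f 0 _ F k m n] pp unfolding Ker_delta_iff[OF U] O_sections_iff[OF U] by auto
  have neg: "(\<lambda>X Y. - F X Y) \<in> ?K" if "F \<in> ?K" for F
    using that near_K_cmult[of F k m n _ "-1"] pp unfolding Ker_delta_iff[OF U] by auto
  have z: "(\<lambda>X Y. 0) \<in> ?K" using pp unfolding Ker_delta_iff[OF U] by (auto intro: near_K_zero)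
  show ?thesis
  proof (rule moduleI)
  show "cring (fsec proj_space U)" by (rule cring_fsec[OF U])
  show "abelian_group (sec (Ker_delta k m n) U)"
  proof (rule abelian_groupI)
    fix F assume F: "F \<in> ?K"
    show "\<exists>G\<in>?K. G \<oplus>\<^bsub>sec (Ker_delta k m n) U\<^esub> F = \<zero>\<^bsub>sec (Ker_delta k m n) U\<^esub>"
      by (rule bexI[OF _ neg[OF F]]) simp
  qed (use add z in \<open>auto simp: algebra_simps\<close>)
  show "\<one>\<^bsub>fsec proj_space U\<^esub> \<odot>\<^bsub>sec (Ker_delta k m n) U\<^esub> F = F" if "F \<in> ?K" for F
    using that unfolding Ker_delta_iff[OF U] by (auto intro!: ext)
  qed (use sm in \<open>auto simp: algebra_simps\<close>)
qed

lemma near_K_restrict: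
  assumes "F \<in> near_K k m n p" "openin zariski V" "p \<in> V"
  shows "(\<lambda>X Y. if X \<in> \<Union>V then F X Y else 0) \<in> near_K k m n p"
  by (rule near_K_cong[OF assms(1)]) (use eventually_zf_in[OF assms(2,3)] in eventually_elim, simp)

lemma Ker_delta_restrict:
  assumes "openin zariski V" "\<And>p. p \<in> V \<Longrightarrow> F \<in> near_K k m n p"
  shows "(\<lambda>X Y. if X \<in> \<Union>V then F X Y else 0) \<in> carrier (sec (Ker_delta k m n) V)"
  unfolding Ker_delta_iff[OF assms(1)] using near_K_restrict[OF assms(2) assms(1)] by simp

lemma Ker_delta_homog:
  assumes U: "openin zariski U" and F: "F \<in> carrier (sec (Ker_delta k m n) U)"
  shows "homog_poly m (F X)"
proof (cases "X \<in> \<Union>U")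
  case True
  show ?thesis
    by (rule eventually_zf_open[OF U near_Y_homog[where F = F and m = m and n = n] True])
      (use F in \<open>auto simp: Ker_delta_iff[OF U] near_K_def\<close>)
next
  case False
  then have "F X = (\<lambda>Y. 0)" using F by (auto simp: Ker_delta_iff[OF U])
  then show ?thesis by simp
qed

lemma Ker_delta_delta:
  assumes F: "F \<in> carrier (sec (Ker_delta k m n) U)"
  shows "(delta ^^ k) F X Y = 0"
  using F by (simp add: Ker_delta_def)

lemma sheaf_of_modules_Ker_delta: "sheaf_of_modules proj_space (Ker_delta k m n)"
  unfolding sheaf_of_modules_def
proof (intro conjI allI impI)
  fix U assume "openin (top_of proj_space) (U :: 'a point set)"
  then show "module (fsec proj_space U) (sec (Ker_delta k m n) U)" by (simp add: module_Ker_delta)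
next
  fix U V assume UV: "openin (top_of proj_space) (U :: 'a point set)" "openin (top_of proj_space) V" "V \<subseteq> U"
  then have "openin zariski U" "openin zariski V" by simp_all
  then show "\<forall>s\<in>carrier (sec (Ker_delta k m n) U). res (Ker_delta k m n) V s \<in> carrier (sec (Ker_delta k m n) V)"
    by (intro ballI) (simp only: Ker_delta_simps, rule Ker_delta_restrict, use UV(3) in \<open>auto simp: Ker_delta_iff\<close>)
next
  fix U assume "openin (top_of proj_space) (U :: 'a point set)"
  then show "\<forall>s\<in>carrier (sec (Ker_delta k m n) U). res (Ker_delta k m n) U s = s"
    by (auto simp: Ker_delta_iff intro!: ext)
next
  fix U V W assume "openin (top_of proj_space) (U :: 'a point set)" "openin (top_of proj_space) V"
    "openin (top_of proj_space) W" and WV: "W \<subseteq> V" "V \<subseteq> U"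
  have "X \<in> \<Union>V" if "X \<in> \<Union>W" for X using that WV by blast
  then show "\<forall>s\<in>carrier (sec (Ker_delta k m n) U).
      res (Ker_delta k m n) W (res (Ker_delta k m n) V s) = res (Ker_delta k m n) W s"
    by (intro ballI ext) simp
next
  fix \<V> and s :: "'a point set \<Rightarrow> _"
  assume s: "\<forall>V\<in>\<V>. openin (top_of proj_space) V \<and> s V \<in> carrier (sec (Ker_delta k m n) V)"
    and ov: "\<forall>V\<in>\<V>. \<forall>W\<in>\<V>. res (Ker_delta k m n) (V \<inter> W) (s V) = res (Ker_delta k m n) (V \<inter> W) (s W)"
  have op: "openin zariski V" if "V \<in> \<V>" for V using s that by simp
  have opU: "openin zariski (\<Union>\<V>)" using op by (intro openin_Union) auto
  have agree: "s V X = s W X" if V: "V \<in> \<V>" "W \<in> \<V>" "X \<in> \<Union>V" "X \<in> \<Union>W" for V W X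
  proof -
    have "X \<in> \<Union>(V \<inter> W)" using V in_cone_Int[OF op op] by blast
    moreover have "res (Ker_delta k m n) (V \<inter> W) (s V) X = res (Ker_delta k m n) (V \<inter> W) (s W) X"
      by (rule fun_cong[OF bspec[OF bspec[OF ov V(1)] V(2)]])
    ultimately show ?thesis by simp
  qed
  \<comment> \<open>Sections are functions, so gluing amounts to picking any member of the cover
    whose cone contains X; over an empty cover this is the zero section.\<close>
  define t where "t X = (if X \<in> \<Union>(\<Union>\<V>) then s (SOME V. V \<in> \<V> \<and> X \<in> \<Union>V) X else (\<lambda>Y. 0))" for X
  have t: "t X = s V X" if V: "V \<in> \<V>" "X \<in> \<Union>V" for V X
  proof -
    have "(SOME V. V \<in> \<V> \<and> X \<in> \<Union>V) \<in> \<V> \<and> X \<in> \<Union>(SOME V. V \<in> \<V> \<and> X \<in> \<Union>V)"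
      by (rule someI[of _ V]) (use V in blast)
    then have "s (SOME V. V \<in> \<V> \<and> X \<in> \<Union>V) X = s V X" using agree V by blast
    moreover have "X \<in> \<Union>(\<Union>\<V>)" using V by blast
    ultimately show ?thesis unfolding t_def by simp
  qed
  show "\<exists>!t. t \<in> carrier (sec (Ker_delta k m n) (\<Union>\<V>)) \<and> (\<forall>V\<in>\<V>. res (Ker_delta k m n) V t = s V)"
  proof (rule ex1I[of _ t])
    have "t \<in> near_K k m n p" if p: "p \<in> \<Union>\<V>" for p
    proof -
      obtain V where V: "V \<in> \<V>" "p \<in> V" using p by blast
      then have "s V \<in> near_K k m n p" using s by (auto simp: Ker_delta_iff)
      then show ?thesis
        by (rule near_K_cong) (use eventually_zf_in[OF op[OF V(1)] V(2)] in eventually_elim, simp add: t[OF V(1)])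
    qed
    moreover have "res (Ker_delta k m n) V t = s V" if V: "V \<in> \<V>" for V
    proof (intro ext)
      fix X Y
      show "res (Ker_delta k m n) V t X Y = s V X Y"
      proof (cases "X \<in> \<Union>V")
        case True then show ?thesis using t[OF V] by simp
      next
        case False then show ?thesis using s V by (auto simp: Ker_delta_iff)
      qed
    qed
    ultimately show "t \<in> carrier (sec (Ker_delta k m n) (\<Union>\<V>)) \<and> (\<forall>V\<in>\<V>. res (Ker_delta k m n) V t = s V)"
      unfolding Ker_delta_iff[OF opU] by (simp add: t_def)
  next
    fix t' assume t': "t' \<in> carrier (sec (Ker_delta k m n) (\<Union>\<V>)) \<and> (\<forall>V\<in>\<V>. res (Ker_delta k m n) V t' = s V)"
    show "t' = t"
    proof (intro ext)
      fix X Y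
      show "t' X Y = t X Y"
      proof (cases "X \<in> \<Union>(\<Union>\<V>)")
        case True
        then obtain V where V: "V \<in> \<V>" "X \<in> \<Union>V" by blast
        then have "res (Ker_delta k m n) V t' X Y = s V X Y" using t' by simp
        then show ?thesis using t[OF V] V(2) by simp
      next
        case False then show ?thesis using t' unfolding Ker_delta_iff[OF opU] by (simp add: t_def)
      qed
    qed
  qed
qed (auto intro!: ext)

lemma finsum_Ker_delta:
  assumes U: "openin zariski U" and "finite I" "f \<in> I \<rightarrow> carrier (sec (Ker_delta k m n) U)"
  shows "finsum (sec (Ker_delta k m n) U) f I = (\<lambda>X Y. \<Sum>i\<in>I. f i X Y)"
  using assms(2,3)
proof (induction I rule: finite_induct)
  case empty
  interpret module "fsec proj_space U" "sec (Ker_delta k m n) U" by (rule module_Ker_delta[OF U])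
  show ?case using M.finsum_empty by simp
next
  case (insert x I)
  interpret module "fsec proj_space U" "sec (Ker_delta k m n) U" by (rule module_Ker_delta[OF U])
  show ?case using insert by (subst M.finsum_insert) auto
qed

section \<open>Affine charts\<close>

text \<open>Linear coordinates in Y adapted to \<delta>, for X_i \<noteq> 0; \<open>zeta\<close> is
  the inverse change. Moving Y in the direction X changes only the i-th new coordinate, at the rate
  X_i. So \<delta> becomes X_i d/dT_i, and Ker \<delta>^k becomes the polynomials of degree less
  than k in T_i.\<close>

definition eta :: "'n::finite \<Rightarrow> complex ^ 'n \<Rightarrow> complex ^ 'n \<Rightarrow> complex ^ 'n" where
  "eta i X T = (\<chi> j. if j = i then T $ i else T $ j + X $ j / X $ i * T $ i)"

definition zeta :: "'n::finite \<Rightarrow> complex ^ 'n \<Rightarrow> complex ^ 'n \<Rightarrow> complex ^ 'n" where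
  "zeta i X Y = (\<chi> j. if j = i then Y $ i else Y $ j - X $ j / X $ i * Y $ i)"

lemma zeta_eta [simp]: "zeta i X (eta i X T) = T"
  by (simp add: zeta_def eta_def vec_eq_iff)

lemma eta_zeta [simp]: "eta i X (zeta i X Y) = Y"
  by (simp add: zeta_def eta_def vec_eq_iff)

lemma zeta_line: "X $ i \<noteq> 0 \<Longrightarrow> zeta i X (Y + t *s X) = zeta i X Y + t *s (X $ i *s axis i 1)"
  by (auto simp: zeta_def vec_eq_iff axis_def algebra_simps)

lemma homog_poly_linear: "homog_poly 1 (\<lambda>Y. Y $ j + c * Y $ i)"
  by (intro homog_poly_add homog_poly_cmult homog_poly_coord)

lemma homog_poly_eta: "homog_poly m q \<Longrightarrow> homog_poly m (\<lambda>T. q (eta i X T))"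
proof (erule homog_poly_subst)
  fix j show "homog_poly 1 (\<lambda>T. eta i X T $ j)"
    by (cases "j = i") (use homog_poly_linear[of j "X $ j / X $ i" i] homog_poly_coord[of i] in \<open>simp_all add: eta_def\<close>)
qed

lemma homog_poly_zeta: "homog_poly m q \<Longrightarrow> homog_poly m (\<lambda>T. q (zeta i X T))"
proof (erule homog_poly_subst)
  fix j show "homog_poly 1 (\<lambda>T. zeta i X T $ j)"
    by (cases "j = i") (use homog_poly_linear[of j "- (X $ j / X $ i)" i] homog_poly_coord[of i] in \<open>simp_all add: zeta_def\<close>)
qed

definition chart_coeff ::
  "nat \<Rightarrow> 'n::finite \<Rightarrow> (complex ^ 'n \<Rightarrow> complex ^ 'n \<Rightarrow> complex) \<Rightarrow> ('n \<Rightarrow> nat) \<Rightarrow> complex ^ 'n \<Rightarrow> complex" where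
  "chart_coeff m i F e X = coeffs_of m (\<lambda>T. F X (eta i X T)) e"

lemma chart_expansion:
  assumes "homog_poly m (F X)"
  shows "F X Y = (\<Sum>e\<in>exponents m. chart_coeff m i F e X * monomial e (zeta i X Y))"
  using coeffs_of[OF homog_poly_eta[OF assms], of i X "zeta i X Y"] by (simp add: chart_coeff_def)

lemma delta_line:
  assumes "homog_poly m (F X)"
  shows "((\<lambda>t. F X (Y + t *s X)) has_field_derivative delta F X Y) (at 0)"
  using has_pd_homog[OF assms, of Y] unfolding has_pd_def delta_def by blast

text \<open>Both sides are the derivative of one function along the line Y + t X, on the right
  computed with \<open>zeta_line\<close>; derivatives are unique.\<close>

lemma delta_zeta_monomial:
  assumes e: "e \<in> exponents m" and X: "X $ i \<noteq> 0"
  shows "delta (\<lambda>X Y. monomial e (zeta i X Y)) X Y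
    = (X $ i * of_nat (e i)) * monomial (e(i := e i - 1)) (zeta i X Y)"
proof -
  have "((\<lambda>t. monomial e (zeta i X (Y + t *s X))) has_field_derivative
      delta (\<lambda>X Y. monomial e (zeta i X Y)) X Y) (at 0)"
    by (rule delta_line[where F = "\<lambda>X Y. monomial e (zeta i X Y)"])
      (rule homog_poly_zeta[OF homog_poly_monomial[OF e]])
  moreover have "((\<lambda>t. monomial e (zeta i X (Y + t *s X))) has_field_derivative
      (\<Sum>j\<in>UNIV. (X $ i *s axis i 1) $ j * (of_nat (e j) * monomial (e(j := e j - 1)) (zeta i X Y)))) (at 0)"
    using has_pd_monomial[of e "zeta i X Y"] unfolding has_pd_def zeta_line[OF X] by blast
  ultimately have "delta (\<lambda>X Y. monomial e (zeta i X Y)) X Y =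
      (\<Sum>j\<in>UNIV. (X $ i *s axis i 1) $ j * (of_nat (e j) * monomial (e(j := e j - 1)) (zeta i X Y)))"
    by (rule DERIV_unique)
  also have "\<dots> = (\<Sum>j\<in>UNIV. if j = i then X $ i * (of_nat (e i) * monomial (e(i := e i - 1)) (zeta i X Y)) else 0)"
    by (rule sum.cong) (auto simp: axis_def)
  finally show ?thesis by simp
qed

lemma delta_sum:
  assumes "finite I" "\<And>j. j \<in> I \<Longrightarrow> homog_poly m (F j X)"
  shows "delta (\<lambda>X Y. \<Sum>j\<in>I. F j X Y) X Y = (\<Sum>j\<in>I. delta (F j) X Y)"
  using assms
proof (induction I rule: finite_induct)
  case empty
  then show ?case by (simp add: delta_zero)
next
  case (insert x I)
  have "delta (\<lambda>X Y. F x X Y + (\<Sum>j\<in>I. F j X Y)) X Y = delta (F x) X Y + delta (\<lambda>X Y. \<Sum>j\<in>I. F j X Y) X Y"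
    by (rule delta_add[where m = m and m' = m]) (use insert in \<open>auto intro: homog_poly_sum\<close>)
  then show ?case using insert by simp
qed

lemma sum_lower_exponents:
  fixes i :: "'n::finite" and h :: "('n \<Rightarrow> nat) \<Rightarrow> complex"
  assumes "m \<ge> 1"
  shows "(\<Sum>e\<in>exponents m. if e i = 0 then 0 else h e) = (\<Sum>e\<in>exponents (m - 1). h (e(i := e i + 1)))"
proof -
  have "(\<Sum>e\<in>exponents m. if e i = 0 then 0 else h e) = (\<Sum>e\<in>{e\<in>exponents m. e i \<noteq> 0}. h e)"
    by (rule sum.mono_neutral_cong_right) auto
  also have "\<dots> = (\<Sum>e\<in>exponents (m - 1). h (e(i := e i + 1)))"
  proof (rule sum.reindex_bij_witness[of _ "\<lambda>e. e(i := e i + 1)" "\<lambda>e. e(i := e i - 1)"])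
    fix e assume "e \<in> {e\<in>exponents m. e i \<noteq> 0}"
    then show "(e(i := e i - 1))(i := (e(i := e i - 1)) i + 1) = e" "e(i := e i - 1) \<in> exponents (m - 1)"
      using lower_exponents[of e m i] by (auto simp: fun_eq_iff)
  next
    fix e :: "'n \<Rightarrow> nat" assume e: "e \<in> exponents (m - 1)"
    have "e(i := e i + 1) = (\<lambda>j. e j + unit_exp i j)" by (auto simp: unit_exp_def)
    then show "e(i := e i + 1) \<in> {e\<in>exponents m. e i \<noteq> 0}"
      using exponents_add[OF e unit_exp_exponents[of i]] assms by auto
  qed auto
  finally show ?thesis .
qed

text \<open>Comparison of coefficients in \<delta> = X_i d/dT_i.\<close>

lemma chart_coeff_delta:
  assumes F: "homog_poly m (F X)" and X: "X $ i \<noteq> 0" and e: "e \<in> exponents m" "e i \<noteq> 0"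
  shows "chart_coeff (m - 1) i (delta F) (e(i := e i - 1)) X = X $ i * of_nat (e i) * chart_coeff m i F e X"
proof -
  have m: "m \<ge> 1" using e member_le_sum[of i UNIV e] by (auto simp: exponents_def)
  define c where "c e = chart_coeff m i F e X" for e
  have h: "homog_poly m (\<lambda>Y. monomial e (zeta i X Y))" if "e \<in> exponents m" for e
    by (rule homog_poly_zeta[OF homog_poly_monomial[OF that]])
  have "F X = (\<lambda>Y. \<Sum>e\<in>exponents m. c e * monomial e (zeta i X Y))"
    using chart_expansion[where F = F, OF F] by (auto simp: c_def)
  then have "delta F X = delta (\<lambda>X Y. \<Sum>e\<in>exponents m. c e * monomial e (zeta i X Y)) X" by (rule delta_cong)
  also have "\<dots> = (\<lambda>Y. \<Sum>e\<in>exponents m. if e i = 0 then 0 else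
       c e * ((X $ i * of_nat (e i)) * monomial (e(i := e i - 1)) (zeta i X Y)))"
  proof
    fix Y
    have "delta (\<lambda>X Y. \<Sum>e\<in>exponents m. c e * monomial e (zeta i X Y)) X Y
      = (\<Sum>e\<in>exponents m. delta (\<lambda>X Y. c e * monomial e (zeta i X Y)) X Y)"
      by (rule delta_sum[where m = m]) (auto intro: homog_poly_cmult h)
    also have "\<dots> = (\<Sum>e\<in>exponents m. if e i = 0 then 0 else
       c e * ((X $ i * of_nat (e i)) * monomial (e(i := e i - 1)) (zeta i X Y)))"
    proof (rule sum.cong)
      fix e :: "'a \<Rightarrow> nat" assume e: "e \<in> exponents m"
      show "delta (\<lambda>X Y. c e * monomial e (zeta i X Y)) X Y = (if e i = 0 then 0 else
         c e * ((X $ i * of_nat (e i)) * monomial (e(i := e i - 1)) (zeta i X Y)))"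
        using delta_smult[where F = "\<lambda>X Y. monomial e (zeta i X Y)" and f = "\<lambda>X. c e", OF h[OF e], of Y]
          delta_zeta_monomial[where e = e and Y = Y, OF e X] by simp
    qed simp
    finally show "delta (\<lambda>X Y. \<Sum>e\<in>exponents m. c e * monomial e (zeta i X Y)) X Y
      = (\<Sum>e\<in>exponents m. if e i = 0 then 0 else
       c e * ((X $ i * of_nat (e i)) * monomial (e(i := e i - 1)) (zeta i X Y)))" .
  qed
  \<comment> \<open>The terms with \<open>e i = 0\<close> contribute nothing; the others are indexed
    by the lowered exponent, which runs through \<open>exponents (m - 1)\<close> once.\<close>
  also have "\<dots> = (\<lambda>Y. \<Sum>e\<in>exponents (m - 1).
      (c (e(i := e i + 1)) * (X $ i * of_nat (e i + 1))) * monomial e (zeta i X Y))"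
    by (subst sum_lower_exponents[OF m]) (simp add: mult.assoc)
  finally have "delta F X (eta i X T) = (\<Sum>e\<in>exponents (m - 1).
      (c (e(i := e i + 1)) * (X $ i * of_nat (e i + 1))) * monomial e T)" for T by simp
  then have "chart_coeff (m - 1) i (delta F) (e(i := e i - 1)) X =
      c ((e(i := e i - 1))(i := (e(i := e i - 1)) i + 1)) * (X $ i * of_nat ((e(i := e i - 1)) i + 1))"
    unfolding chart_coeff_def by (rule coeffs_of_unique[OF _ lower_exponents[OF e]])
  moreover have "(e(i := e i - 1))(i := (e(i := e i - 1)) i + 1) = e" "(e(i := e i - 1)) i + 1 = e i"
    using e(2) by (auto simp: fun_eq_iff)
  ultimately show ?thesis by (simp only: c_def mult_ac)
qed

text \<open>Applying \<delta> k times multiplies this coefficient by X_i^k e_i (e_i - 1) ... (e_i -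
  k + 1), a nonzero number for k \<le> e_i: characteristic zero enters here.\<close>

lemma chart_coeff_vanish:
  "homog_poly m (F X) \<Longrightarrow> X $ i \<noteq> 0 \<Longrightarrow> \<forall>Y. (delta ^^ k) F X Y = 0 \<Longrightarrow> e \<in> exponents m \<Longrightarrow> k \<le> e i \<Longrightarrow>
    chart_coeff m i F e X = 0"
proof (induction k arbitrary: m F e)
  case 0
  then show ?case by (simp add: chart_coeff_def coeffs_of_zero)
next
  case (Suc k)
  have "chart_coeff (m - 1) i (delta F) (e(i := e i - 1)) X = 0"
  proof (rule Suc.IH)
    show "homog_poly (m - 1) (delta F X)" by (rule delta_homog) fact
    show "\<forall>Y. (delta ^^ k) (delta F) X Y = 0" using Suc.prems(3) unfolding delta_pow_Suc .
    show "e(i := e i - 1) \<in> exponents (m - 1)" by (rule lower_exponents) (use Suc.prems in auto)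
  qed (use Suc.prems in auto)
  moreover have "chart_coeff (m - 1) i (delta F) (e(i := e i - 1)) X = X $ i * of_nat (e i) * chart_coeff m i F e X"
    by (rule chart_coeff_delta) (use Suc.prems in auto)
  ultimately show ?case using Suc.prems by auto
qed

text \<open>Converse of \<open>chart_coeff_vanish\<close> on monomials: each \<delta> lowers the
  i-th exponent by one until it is 0, and the next application gives zero.\<close>

lemma delta_pow_zeta_monomial:
  "e \<in> exponents m \<Longrightarrow> X $ i \<noteq> 0 \<Longrightarrow> e i < k \<Longrightarrow> (delta ^^ k) (\<lambda>X Y. monomial e (zeta i X Y)) X Y = 0"
proof (induction k arbitrary: m e)
  case (Suc k)
  let ?e = "e(i := e i - 1)"
  have "delta (\<lambda>X Y. monomial e (zeta i X Y)) X =
      (\<lambda>X Y. (X $ i * of_nat (e i)) * monomial ?e (zeta i X Y)) X"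
    using delta_zeta_monomial[OF Suc.prems(1,2)] by auto
  then have 1: "(delta ^^ k) (delta (\<lambda>X Y. monomial e (zeta i X Y))) X =
     (delta ^^ k) (\<lambda>X Y. (X $ i * of_nat (e i)) * monomial ?e (zeta i X Y)) X" by (rule delta_pow_cong)
  show ?case
  proof (cases "e i = 0")
    case True
    then show ?thesis unfolding delta_pow_Suc 1 by (simp add: delta_pow_zero)
  next
    case False
    have e: "?e \<in> exponents (m - 1)" by (rule lower_exponents[OF Suc.prems(1) False])
    have "(delta ^^ k) (\<lambda>X Y. monomial ?e (zeta i X Y)) X Y = 0"
      by (rule Suc.IH[OF e Suc.prems(2)]) (use Suc.prems(3) False in auto)
    then show ?thesis unfolding delta_pow_Suc 1
      using delta_pow_smult[where F = "\<lambda>X Y. monomial ?e (zeta i X Y)" and f = "\<lambda>X. X $ i * of_nat (e i)"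
          and X = X and m = "m - 1" and k = k and Y = Y]
        homog_poly_zeta[OF homog_poly_monomial[OF e]] by simp
  qed
qed simp

section \<open>Standard charts and local freeness of Ker \<delta>^k\<close>

definition chart :: "'n::finite \<Rightarrow> 'n point set" where
  "chart i = basic_open (\<lambda>X. X $ i)"

lemma openin_chart: "openin zariski (chart i)"
  unfolding chart_def by (rule openin_basic_open[OF homog_poly_coord])

lemma in_chart: "p \<in> chart i \<Longrightarrow> p \<in> proj_points" "p \<in> chart i \<Longrightarrow> X \<in> p \<Longrightarrow> X $ i \<noteq> 0"
  by (auto simp: chart_def basic_open_def)

lemma exists_chart: "p \<in> proj_points \<Longrightarrow> \<exists>i. p \<in> chart i"
proof -
  assume p: "p \<in> proj_points"
  obtain X where X: "X \<in> p" using proj_point_nonempty[OF p] by blast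
  then have "X \<noteq> 0" using p by (auto dest: proj_point_nonzero)
  then obtain i where "X $ i \<noteq> 0" by (auto simp: vec_eq_iff)
  then show ?thesis using basic_open_iff[OF homog_poly_coord p X] by (auto simp: chart_def)
qed

lemma in_chart_eventually: "p \<in> chart i \<Longrightarrow> eventually (\<lambda>X. X $ i \<noteq> 0) (zf p)"
  by (rule eventually_zfI[OF openin_chart]) (auto dest: in_chart(2))

lemma near_regular_powi_coord:
  assumes "p \<in> chart i" shows "(\<lambda>X. X $ i powi k) \<in> near_regular k p"
proof -
  note p = in_chart(1)[OF assms]
  obtain X where X: "X \<in> p" using proj_point_nonempty[OF p] by blast
  show ?thesis by (rule near_regular_powi[OF near_regular_coord[OF p] p X in_chart(2)[OF assms X]])
qed

lemma near_regular_ratio: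
  assumes "p \<in> chart i" shows "(\<lambda>X. X $ j / X $ i) \<in> near_regular 0 p"
proof -
  note p = in_chart(1)[OF assms]
  have "(\<lambda>X. X $ j * X $ i powi (-1)) \<in> near_regular (1 + -1) p"
    by (rule near_regular_mult[OF near_regular_coord[OF p] near_regular_powi_coord[OF assms] p])
  then show ?thesis by (simp add: field_simps power_int_def)
qed

lemma near_Y_zeta:
  assumes "p \<in> chart i" shows "(\<lambda>X Y. zeta i X Y $ j) \<in> near_Y 1 0 p"
proof (cases "j = i")
  case True
  then show ?thesis using near_Y_var[OF in_chart(1)[OF assms]] by (simp add: zeta_def)
next
  case False
  note p = in_chart(1)[OF assms]
  have "(\<lambda>X Y. X $ j / X $ i * Y $ i) \<in> near_Y 1 (0 + 0) p"
    by (rule near_Y_smult[OF near_regular_ratio[OF assms] near_Y_var[OF p] p])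
  then have "(\<lambda>X Y. Y $ j - X $ j / X $ i * Y $ i) \<in> near_Y 1 0 p"
    by (intro near_Y_diff near_Y_var p) simp
  then show ?thesis using False by (simp add: zeta_def)
qed

lemma near_Y_eta:
  assumes "p \<in> chart i" shows "(\<lambda>X Y. eta i X Y $ j) \<in> near_Y 1 0 p"
proof (cases "j = i")
  case True
  then show ?thesis using near_Y_var[OF in_chart(1)[OF assms]] by (simp add: eta_def)
next
  case False
  note p = in_chart(1)[OF assms]
  have "(\<lambda>X Y. X $ j / X $ i * Y $ i) \<in> near_Y 1 (0 + 0) p"
    by (rule near_Y_smult[OF near_regular_ratio[OF assms] near_Y_var[OF p] p])
  then have "(\<lambda>X Y. Y $ j + X $ j / X $ i * Y $ i) \<in> near_Y 1 0 p"
    by (intro near_Y_add near_Y_var p) simp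
  then show ?thesis using False by (simp add: eta_def)
qed

lemma near_regular_chart_coeff:
  assumes "F \<in> near_Y m n p" "p \<in> chart i" "e \<in> exponents m"
  shows "chart_coeff m i F e \<in> near_regular n p"
  unfolding chart_coeff_def
  using near_Y_coeff[OF near_Y_subst[OF assms(1) near_Y_eta[OF assms(2)] in_chart(1)[OF assms(2)]]
      assms(3) in_chart(1)[OF assms(2)]] .

text \<open>X_i^n trivialises O(n) over the chart, and degree less than k in T_i is the kernel
  condition for \<delta>^k = (X_i d/dT_i)^k.\<close>

lemma chart_basis_near_K:
  assumes p: "p \<in> chart i" and e: "e \<in> exponents m" "e i < k"
  shows "(\<lambda>X Y. X $ i powi n * monomial e (zeta i X Y)) \<in> near_K k m n p"
proof -
  note pp = in_chart(1)[OF p]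
  have Y: "(\<lambda>X Y. monomial e (zeta i X Y)) \<in> near_Y m 0 p"
    using near_Y_subst[OF near_Y_term[OF near_regular_const[OF pp, of 1] e(1) pp] near_Y_zeta[OF p] pp] by simp
  have "(\<lambda>X Y. monomial e (zeta i X Y)) \<in> near_K k m 0 p"
    unfolding near_K_def
  proof (intro CollectI conjI Y)
    show "eventually (\<lambda>X. \<forall>Y. (delta ^^ k) (\<lambda>X Y. monomial e (zeta i X Y)) X Y = 0) (zf p)"
      using in_chart_eventually[OF p] by eventually_elim (simp add: delta_pow_zeta_monomial[OF e(1) _ e(2)])
  qed
  from near_K_smult[OF near_regular_powi_coord[OF p, of n] this pp] show ?thesis by simp
qed

lemma locally_free_Ker_delta:
  "locally_free proj_space (Ker_delta k m n :: ('n::finite point, complex ^ 'n \<Rightarrow> complex,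
     complex ^ 'n \<Rightarrow> complex ^ 'n \<Rightarrow> complex) module_sheaf)"
  unfolding locally_free_def
proof (intro conjI sheaf_of_modules_Ker_delta ballI)
  fix p :: "'n point" assume "p \<in> topspace (top_of proj_space)"
  then have "p \<in> proj_points" by (simp add: topspace_zariski)
  then obtain i where pi: "p \<in> chart i" using exists_chart by blast
  \<comment> \<open>These exponents index a basis over the chart: \<open>chart_coeff_vanish\<close>
    excludes all others and \<open>chart_basis_near_K\<close> admits these. The enumeration
    \<open>h\<close> is there because local freeness asks for indices below some r.\<close>
  define B :: "('n \<Rightarrow> nat) set" where "B = {e\<in>exponents m. e i < k}"
  have finB: "finite B" by (simp add: B_def)
  define r where "r = card B"
  obtain h where h: "bij_betw h {..<r} B"
    using ex_bij_betw_nat_finite[OF finB] by (auto simp: r_def lessThan_atLeast0)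
  define g where "g = inv_into {..<r} h"
  have gh: "g (h j) = j" if "j < r" for j
    using h that unfolding g_def bij_betw_def by (simp add: inv_into_f_f)
  have hB: "h j \<in> exponents m" "h j i < k" if "j < r" for j
    using h that unfolding bij_betw_def B_def by auto
  let ?V = "chart i"
  define b where "b j X Y = (if X \<in> \<Union>?V then X $ i powi n * monomial (h j) (zeta i X Y) else 0)" for j X Y
  have bV: "b j \<in> carrier (sec (Ker_delta k m n) ?V)" if "j < r" for j
  proof -
    have "(\<lambda>X Y. if X \<in> \<Union>?V then X $ i powi n * monomial (h j) (zeta i X Y) else 0)
        \<in> carrier (sec (Ker_delta k m n) ?V)"
      by (rule Ker_delta_restrict[OF openin_chart]) (rule chart_basis_near_K[OF _ hB[OF that]])
    then show ?thesis by (simp add: b_def[abs_def])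
  qed
  show "\<exists>V r b. openin (top_of proj_space) V \<and> p \<in> V \<and>
     (\<forall>j<r::nat. b j \<in> carrier (sec (Ker_delta k m n) V)) \<and>
     (\<forall>W. openin (top_of proj_space) W \<longrightarrow> W \<subseteq> V \<longrightarrow>
       (\<forall>s\<in>carrier (sec (Ker_delta k m n) W). \<exists>!c. c \<in> {..<r} \<rightarrow>\<^sub>E carrier (fsec proj_space W) \<and>
          s = (\<Oplus>\<^bsub>sec (Ker_delta k m n) W\<^esub>j\<in>{..<r}. c j \<odot>\<^bsub>sec (Ker_delta k m n) W\<^esub> res (Ker_delta k m n) W (b j))))"
  proof (intro exI[of _ ?V] exI[of _ r] exI[of _ b] conjI allI impI ballI bV pi)
    show "openin (top_of proj_space) ?V" by (simp add: openin_chart)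
    fix W and s :: "complex ^ 'n \<Rightarrow> complex ^ 'n \<Rightarrow> complex"
    assume "openin (top_of proj_space) W" and WV: "W \<subseteq> ?V" and s: "s \<in> carrier (sec (Ker_delta k m n) W)"
    then have W: "openin zariski W" by simp
    have Wc: "X \<in> \<Union>?V" "X $ i \<noteq> 0" if "X \<in> \<Union>W" for X using that WV by (auto dest: in_chart(2))
    interpret module "fsec proj_space W" "sec (Ker_delta k m n) W" by (rule module_Ker_delta[OF W])
    have bW: "res (Ker_delta k m n) W (b j) \<in> carrier (sec (Ker_delta k m n) W)" if "j < r" for j
      using sheaf_of_modules_Ker_delta[of k m n] bV[OF that] W WV openin_chart[of i]
      unfolding sheaf_of_modules_def by (metis proj_space_simps(1))
    have comb: "(\<Oplus>\<^bsub>sec (Ker_delta k m n) W\<^esub>j\<in>{..<r}. c j \<odot>\<^bsub>sec (Ker_delta k m n) W\<^esub> res (Ker_delta k m n) W (b j))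
        = (\<lambda>X Y. \<Sum>j<r. c j X * (if X \<in> \<Union>W then X $ i powi n * monomial (h j) (zeta i X Y) else 0))"
      if c: "c \<in> {..<r} \<rightarrow>\<^sub>E O_sections 0 W" for c
    proof (subst finsum_Ker_delta[OF W])
      have "c j \<odot>\<^bsub>sec (Ker_delta k m n) W\<^esub> res (Ker_delta k m n) W (b j) \<in> carrier (sec (Ker_delta k m n) W)" if "j < r" for j
        by (rule smult_closed) (use c that bW in \<open>auto simp: PiE_def Pi_def\<close>)
      then show "(\<lambda>j. c j \<odot>\<^bsub>sec (Ker_delta k m n) W\<^esub> res (Ker_delta k m n) W (b j))
        \<in> {..<r} \<rightarrow> carrier (sec (Ker_delta k m n) W)" by auto
      show "(\<lambda>X Y. \<Sum>j<r. (c j \<odot>\<^bsub>sec (Ker_delta k m n) W\<^esub> res (Ker_delta k m n) W (b j)) X Y)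
        = (\<lambda>X Y. \<Sum>j<r. c j X * (if X \<in> \<Union>W then X $ i powi n * monomial (h j) (zeta i X Y) else 0))"
        by (intro ext sum.cong) (use Wc in \<open>auto simp: b_def\<close>)
    qed simp
    \<comment> \<open>The coefficients of s in the chart have degree n; division by X_i^n brings
      them to degree 0, and the cut-off outside the cone makes them sections.\<close>
    define c where "c = (\<lambda>j\<in>{..<r}. \<lambda>X. if X \<in> \<Union>W then X $ i powi (- n) * chart_coeff m i s (h j) X else 0)"
    have cO: "c \<in> {..<r} \<rightarrow>\<^sub>E O_sections 0 W"
    proof (rule PiE_I)
      fix j assume "j \<in> {..<r}"
      then have j: "j < r" by simp
      show "c j \<in> O_sections 0 W"
        unfolding O_sections_iff[OF W]
      proof (intro conjI ballI allI impI)
        fix q assume q: "q \<in> W"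
        then have qi: "q \<in> chart i" using WV by blast
        have "s \<in> near_Y m n q" using s q by (simp add: Ker_delta_iff[OF W] near_K_def)
        then have "(\<lambda>X. X $ i powi (- n) * chart_coeff m i s (h j) X) \<in> near_regular (- n + n) q"
          by (intro near_regular_mult near_regular_powi_coord qi near_regular_chart_coeff hB j in_chart(1)[OF qi])
        then have "(\<lambda>X. X $ i powi (- n) * chart_coeff m i s (h j) X) \<in> near_regular 0 q" by simp
        then show "c j \<in> near_regular 0 q"
          by (rule near_regular_cong[OF _ _ in_chart(1)[OF qi]])
            (use eventually_zf_in[OF W q] in eventually_elim, simp add: c_def j)
      qed (use j in \<open>auto simp: c_def\<close>)
    qed (simp add: c_def)
    have sc: "s X Y = (\<Sum>j<r. c j X * (if X \<in> \<Union>W then X $ i powi n * monomial (h j) (zeta i X Y) else 0))" for X Y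
    proof (cases "X \<in> \<Union>W")
      case True
      have "s X Y = (\<Sum>e\<in>exponents m. chart_coeff m i s e X * monomial e (zeta i X Y))"
        by (rule chart_expansion[where F = s, OF Ker_delta_homog[OF W s]])
      also have "\<dots> = (\<Sum>e\<in>B. chart_coeff m i s e X * monomial e (zeta i X Y))"
      proof (rule sum.mono_neutral_right)
        show "\<forall>e\<in>exponents m - B. chart_coeff m i s e X * monomial e (zeta i X Y) = 0"
        proof
          fix e assume "e \<in> exponents m - B"
          then have e: "e \<in> exponents m" "k \<le> e i" by (auto simp: B_def)
          show "chart_coeff m i s e X * monomial e (zeta i X Y) = 0"
            using chart_coeff_vanish[where F = s, OF Ker_delta_homog[OF W s] Wc(2)[OF True] _ e]
              Ker_delta_delta[OF s] by simp
        qed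
      qed (auto simp: B_def)
      also have "\<dots> = (\<Sum>j<r. chart_coeff m i s (h j) X * monomial (h j) (zeta i X Y))"
        by (rule sum.reindex_bij_betw[OF h, symmetric])
      also have "\<dots> = (\<Sum>j<r. c j X * (X $ i powi n * monomial (h j) (zeta i X Y)))"
        by (rule sum.cong) (use True Wc(2)[OF True] in \<open>auto simp: c_def power_int_minus\<close>)
      finally show ?thesis using True by simp
    next
      case False
      then show ?thesis using s by (simp add: Ker_delta_iff[OF W])
    qed
    show "\<exists>!c. c \<in> {..<r} \<rightarrow>\<^sub>E carrier (fsec proj_space W) \<and>
          s = (\<Oplus>\<^bsub>sec (Ker_delta k m n) W\<^esub>j\<in>{..<r}. c j \<odot>\<^bsub>sec (Ker_delta k m n) W\<^esub> res (Ker_delta k m n) W (b j))"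
    proof (rule ex1I[of _ c])
      show "c \<in> {..<r} \<rightarrow>\<^sub>E carrier (fsec proj_space W) \<and>
          s = (\<Oplus>\<^bsub>sec (Ker_delta k m n) W\<^esub>j\<in>{..<r}. c j \<odot>\<^bsub>sec (Ker_delta k m n) W\<^esub> res (Ker_delta k m n) W (b j))"
        unfolding comb[OF cO] by (intro conjI ext sc) (use cO in simp)
    next
      fix c' assume c': "c' \<in> {..<r} \<rightarrow>\<^sub>E carrier (fsec proj_space W) \<and>
          s = (\<Oplus>\<^bsub>sec (Ker_delta k m n) W\<^esub>j\<in>{..<r}. c' j \<odot>\<^bsub>sec (Ker_delta k m n) W\<^esub> res (Ker_delta k m n) W (b j))"
      then have c'O: "c' \<in> {..<r} \<rightarrow>\<^sub>E O_sections 0 W" by simp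
      have s': "s X Y = (\<Sum>j<r. c' j X * (if X \<in> \<Union>W then X $ i powi n * monomial (h j) (zeta i X Y) else 0))" for X Y
        by (rule fun_cong[OF fun_cong[OF trans[OF conjunct2[OF c'] comb[OF c'O]]]])
      show "c' = c"
      proof (rule PiE_ext[OF c'O cO])
        fix j assume "j \<in> {..<r}"
        then have j: "j < r" by simp
        have O: "c j \<in> O_sections 0 W" "c' j \<in> O_sections 0 W" using cO c'O j by auto
        show "c' j = c j"
        proof
          fix X
          show "c' j X = c j X"
          proof (cases "X \<in> \<Union>W")
            case True
            \<comment> \<open>For fixed X the substitution Y = \<open>eta i X T\<close> turns the
              difference of two expansions into a relation between distinct monomials in T.\<close>
            have "(\<Sum>e\<in>B. (c' (g e) X - c (g e) X) * X $ i powi n * monomial e T) = 0" for T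
            proof -
              have "(\<Sum>e\<in>B. (c' (g e) X - c (g e) X) * X $ i powi n * monomial e T)
                = (\<Sum>j<r. (c' (g (h j)) X - c (g (h j)) X) * X $ i powi n * monomial (h j) T)"
                by (rule sum.reindex_bij_betw[OF h, symmetric])
              also have "\<dots> = (\<Sum>j<r. (c' j X - c j X) * X $ i powi n * monomial (h j) T)"
                by (rule sum.cong) (auto simp: gh)
              also have "\<dots> = s X (eta i X T) - s X (eta i X T)"
                using s'[of X "eta i X T"] sc[of X "eta i X T"] True
                by (simp add: sum_subtractf left_diff_distrib mult.assoc)
              finally show ?thesis by simp
            qed
            from monomials_independent[OF finB this, of "h j"]
            have "(c' (g (h j)) X - c (g (h j)) X) * X $ i powi n = 0"
              using hB[OF j] by (simp add: B_def)
            then show ?thesis using Wc(2)[OF True] by (simp add: gh[OF j])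
          next
            case False
            then show ?thesis using O unfolding O_sections_iff[OF W] by simp
          qed
        qed
      qed
    qed
  qed
qed

section \<open>The maps \<open>\<alpha>(P)\<close> and \<open>\<beta>(P)\<close>\<close>

lemma near_regular_mult_deg:
  "f \<in> near_regular n p \<Longrightarrow> g \<in> near_regular n' p \<Longrightarrow> p \<in> proj_points \<Longrightarrow> n + n' = N \<Longrightarrow>
    (\<lambda>X. f X * g X) \<in> near_regular N p"
  using near_regular_mult[of f n p g n'] by simp

lemma near_Y_smult_deg:
  "f \<in> near_regular n p \<Longrightarrow> F \<in> near_Y m n' p \<Longrightarrow> p \<in> proj_points \<Longrightarrow> n + n' = N \<Longrightarrow>
    (\<lambda>X Y. f X * F X Y) \<in> near_Y m N p"
  using near_Y_smult[of f n p F m n'] by simp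

lemma near_Y_mult_deg:
  "F \<in> near_Y m n p \<Longrightarrow> G \<in> near_Y m' n' p \<Longrightarrow> p \<in> proj_points \<Longrightarrow> m + m' = M \<Longrightarrow> n + n' = N \<Longrightarrow>
    (\<lambda>X Y. F X Y * G X Y) \<in> near_Y M N p"
  using near_Y_mult[of F m n p G m' n'] by simp

lemma near_Y_eval:
  assumes "F \<in> near_Y m n p" "p \<in> proj_points"
  shows "(\<lambda>X. F X Y) \<in> near_regular n p"
proof -
  obtain a where a: "\<forall>e\<in>exponents m. a e \<in> near_regular n p"
    "eventually (\<lambda>X. \<forall>Y. F X Y = (\<Sum>e\<in>exponents m. a e X * monomial e Y)) (zf p)"
    by (rule near_YE[OF assms(1)])
  have "(\<lambda>X. \<Sum>e\<in>exponents m. monomial e Y * a e X) \<in> near_regular n p"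
    by (intro near_regular_sum near_regular_cmult) (use a(1) assms(2) in auto)
  then show ?thesis
    by (rule near_regular_cong[OF _ _ assms(2)]) (use a(2) in eventually_elim, simp add: mult.commute)
qed

locale smooth_hypersurface_context =
  fixes d :: nat and P :: "complex ^ 'n::finite \<Rightarrow> complex"
  assumes d: "d \<ge> 1" and smooth: "smooth_hypersurface d P"
begin

lemma P_homog: "homog_poly d P"
  using smooth by (simp add: smooth_hypersurface_def)

lemma P_near: "p \<in> proj_points \<Longrightarrow> P \<in> near_regular (int d) p"
  by (rule near_regular_homog[OF P_homog])

lemma partial_P_near: "p \<in> proj_points \<Longrightarrow> partial i P \<in> near_regular (int d - 1) p"
  using near_regular_pd(2)[OF P_near] by blast

lemma exists_partial_nonzero: "X \<noteq> 0 \<Longrightarrow> \<exists>i. partial i P X \<noteq> 0"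
proof (cases "P X = 0")
  case True
  assume "X \<noteq> 0" then show ?thesis using smooth True unfolding smooth_hypersurface_def by blast
next
  case False
  then have "(\<Sum>i\<in>UNIV. X $ i * partial i P X) \<noteq> 0" using euler_homog[OF P_homog, of X] d by simp
  then show ?thesis by (metis (mono_tags, lifting) mult_zero_right sum.neutral)
qed

lemma P_nonzero: "\<exists>V. P V \<noteq> 0"
proof (rule ccontr)
  assume "\<not> (\<exists>V. P V \<noteq> 0)"
  then have "P = (\<lambda>X. 0)" by auto
  \<comment> \<open>Any nonzero vector would contradict smoothness; \<open>undefined\<close> is just
    some coordinate index.\<close>
  then have "partial i P (axis undefined 1) = 0" for i by simp
  moreover have "(axis undefined 1 :: complex ^ 'n) \<noteq> 0" by (simp add: axis_eq_0_iff)
  ultimately show False using exists_partial_nonzero by blast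
qed

definition dP :: "complex ^ 'n \<Rightarrow> complex ^ 'n \<Rightarrow> complex" where
  "dP X Y = 1 / of_nat d * (\<Sum>j\<in>UNIV. partial j P X * Y $ j)"

lemma alpha_dP: "alpha d P F X Y = dP X Y * F X Y"
  by (simp add: alpha_def dP_def)

lemma beta_dP: "beta d P A X Y = P X * A X Y - dP X Y * delta A X Y"
  by (simp add: beta_def alpha_dP)

lemma dP_homog: "homog_poly 1 (dP X)"
  unfolding dP_def by (intro homog_poly_cmult homog_poly_sum homog_poly_coord)

lemma dP_near: "p \<in> proj_points \<Longrightarrow> dP \<in> near_Y 1 (int d - 1) p"
  unfolding dP_def
  by (intro near_Y_cmult near_Y_sum near_Y_smult_deg[OF partial_P_near near_Y_var]) auto

lemma dP_axis: "dP X (axis i 1) = partial i P X / of_nat d"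
proof -
  have "(\<Sum>j\<in>UNIV. partial j P X * axis i 1 $ j) = (\<Sum>j\<in>UNIV. if j = i then partial i P X else 0)"
    by (rule sum.cong) (auto simp: axis_def)
  then show ?thesis by (simp add: dP_def)
qed

text \<open>Euler's formula; the factor 1/d in \<alpha>(P) is there to produce P without a
  multiple.\<close>

lemma delta_dP: "delta dP X Y = P X"
proof -
  have "has_pd (dP X) (\<lambda>i. 1 / of_nat d * (\<Sum>j\<in>UNIV. partial j P X * (if i = j then 1 else 0))) Y"
    unfolding dP_def by (intro has_pd_cmult has_pd_sum has_pd_coord)
  then have "delta dP X Y = (\<Sum>i\<in>UNIV. X $ i * (1 / of_nat d * partial i P X))"
    by (subst delta_eqI) (auto simp: if_distrib[of "\<lambda>x. _ * x"] cong: if_cong)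
  also have "\<dots> = 1 / of_nat d * (\<Sum>i\<in>UNIV. X $ i * partial i P X)"
    unfolding sum_distrib_left by (simp add: mult_ac)
  also have "\<dots> = P X" using euler_homog[OF P_homog, of X] d by simp
  finally show ?thesis .
qed

lemma alpha_fun: "alpha d P F = (\<lambda>X Y. dP X Y * F X Y)"
  by (intro ext) (rule alpha_dP)

lemma beta_fun: "beta d P A = (\<lambda>X Y. P X * A X Y - dP X Y * delta A X Y)"
  by (intro ext) (rule beta_dP)

text \<open>Leibniz rule with \<delta> dP = P. For F in Ker \<delta> only P F is left, which
  \<delta> kills. Hence \<alpha>(P) maps Ker \<delta> into Ker \<delta>^2, and applying \<beta>(P)
  afterwards gives P dP F - dP P F = 0.\<close>

lemma delta_alpha:
  assumes "homog_poly m (F X)"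
  shows "delta (alpha d P F) X Y = P X * F X Y + dP X Y * delta F X Y"
  unfolding alpha_fun using delta_mult[where F = dP and G = F, OF dP_homog assms] by (simp add: delta_dP)

text \<open>The two terms P \<delta> A cancel and the rest is a multiple of \<delta>^2 A, so
  \<beta>(P) carries Ker \<delta>^2 into Ker \<delta>.\<close>

lemma delta_beta:
  assumes "homog_poly m (A X)"
  shows "delta (beta d P A) X Y = - dP X Y * delta (delta A) X Y"
proof -
  have h: "homog_poly (m - 1) (delta A X)" by (rule delta_homog) fact
  have "delta (beta d P A) X Y = delta (\<lambda>X Y. P X * A X Y) X Y - delta (\<lambda>X Y. dP X Y * delta A X Y) X Y"
    unfolding beta_fun
    by (rule delta_diff[where m = m and m' = "1 + (m - 1)"])
      (use assms homog_poly_cmult homog_poly_mult[OF dP_homog h] in auto)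
  also have "\<dots> = P X * delta A X Y - (P X * delta A X Y + dP X Y * delta (delta A) X Y)"
    using delta_smult[where F = A and f = P, OF assms] delta_mult[where F = dP and G = "delta A", OF dP_homog h]
    by (simp add: delta_dP)
  finally show ?thesis by simp
qed

lemma alpha_near_K:
  assumes F: "F \<in> near_K 1 m n p" and p: "p \<in> proj_points" and M: "m + 1 = M" "n + int d - 1 = N"
  shows "alpha d P F \<in> near_K 2 M N p"
  unfolding near_K_def
proof (intro CollectI conjI)
  have Y: "F \<in> near_Y m n p" and K: "eventually (\<lambda>X. \<forall>Y. delta F X Y = 0) (zf p)"
    using F by (auto simp: near_K_def)
  show "alpha d P F \<in> near_Y M N p"
    unfolding alpha_fun by (rule near_Y_mult_deg[OF dP_near[OF p] Y p]) (use M in auto)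
  show "eventually (\<lambda>X. \<forall>Y. (delta ^^ 2) (alpha d P F) X Y = 0) (zf p)"
    using near_Y_homog[OF Y] K
  proof eventually_elim
    case (elim X)
    have "delta (alpha d P F) X = (\<lambda>X Y. P X * F X Y) X"
      using delta_alpha[where F = F, OF elim(1)] elim(2) by auto
    then have "delta (delta (alpha d P F)) X = delta (\<lambda>X Y. P X * F X Y) X" by (rule delta_cong)
    then show ?case
      using delta_smult[where F = F and f = P, OF elim(1)] elim(2) by (simp add: numeral_2_eq_2)
  qed
qed

lemma beta_near_K:
  assumes A: "A \<in> near_K 2 m n p" and p: "p \<in> proj_points" and m: "m \<ge> 1" and N: "n + int d = N"
  shows "beta d P A \<in> near_K 1 m N p"
  unfolding near_K_def
proof (intro CollectI conjI)
  have Y: "A \<in> near_Y m n p" and K: "eventually (\<lambda>X. \<forall>Y. delta (delta A) X Y = 0) (zf p)"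
    using A by (auto simp: near_K_def numeral_2_eq_2)
  show "beta d P A \<in> near_Y m N p"
    unfolding beta_fun
    by (intro near_Y_diff near_Y_smult_deg[OF P_near[OF p] Y] near_Y_mult_deg[OF dP_near[OF p] near_Y_delta[OF Y p]] p)
      (use m N in auto)
  show "eventually (\<lambda>X. \<forall>Y. (delta ^^ 1) (beta d P A) X Y = 0) (zf p)"
    using near_Y_homog[OF Y] K
    by eventually_elim (simp add: delta_beta)
qed

lemma sheaf_hom_alpha:
  assumes m: "m \<ge> 1"
  shows "sheaf_hom proj_space (Ker_delta 1 (m - 1) (n - 2 * int d + 1)) (Ker_delta 2 m (n - int d)) (\<lambda>U. alpha d P)"
  unfolding sheaf_hom_def
proof (intro conjI allI impI ballI)
  fix U F assume "openin (top_of proj_space) (U :: 'n point set)"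
    and F: "F \<in> carrier (sec (Ker_delta 1 (m - 1) (n - 2 * int d + 1)) U)"
  then have U: "openin zariski U" by simp
  have pp: "p \<in> proj_points" if "p \<in> U" for p using openin_zariski_subset[OF U] that by blast
  show "alpha d P F \<in> carrier (sec (Ker_delta 2 m (n - int d)) U)"
    using F m pp unfolding Ker_delta_iff[OF U]
    by (auto simp: alpha_fun intro!: alpha_near_K[unfolded alpha_fun])
qed (auto simp: alpha_fun algebra_simps intro!: ext)

lemma sheaf_hom_beta:
  assumes m: "m \<ge> 1"
  shows "sheaf_hom proj_space (Ker_delta 2 m (n - int d)) (Ker_delta 1 m n) (\<lambda>U. beta d P)"
  unfolding sheaf_hom_def
proof (intro conjI allI impI ballI)
  fix U F assume "openin (top_of proj_space) (U :: 'n point set)"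
    and F: "F \<in> carrier (sec (Ker_delta 2 m (n - int d)) U)"
  then have U: "openin zariski U" by simp
  have pp: "p \<in> proj_points" if "p \<in> U" for p using openin_zariski_subset[OF U] that by blast
  have z: "beta d P F X Y = 0" if "X \<notin> \<Union>U" for X Y
  proof -
    have "F X = (\<lambda>Y. 0)" using F that by (auto simp: Ker_delta_iff[OF U])
    then show ?thesis using delta_cong[where F = F and X = X and G = "\<lambda>X Y. 0"] by (simp add: beta_dP delta_zero)
  qed
  have "beta d P F \<in> near_K 1 m n p" if "p \<in> U" for p
    by (rule beta_near_K[OF _ pp[OF that] m, of _ "n - int d"]) (use F that in \<open>auto simp: Ker_delta_iff[OF U]\<close>)
  with z show "beta d P F \<in> carrier (sec (Ker_delta 1 m n) U)"
    unfolding Ker_delta_iff[OF U] by blast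
next
  fix U F G assume "openin (top_of proj_space) (U :: 'n point set)"
    and F: "F \<in> carrier (sec (Ker_delta 2 m (n - int d)) U)" and G: "G \<in> carrier (sec (Ker_delta 2 m (n - int d)) U)"
  then have U: "openin zariski U" by simp
  show "beta d P (F \<oplus>\<^bsub>sec (Ker_delta 2 m (n - int d)) U\<^esub> G) = beta d P F \<oplus>\<^bsub>sec (Ker_delta 1 m n) U\<^esub> beta d P G"
  proof (intro ext)
    fix X Y
    show "beta d P (F \<oplus>\<^bsub>sec (Ker_delta 2 m (n - int d)) U\<^esub> G) X Y
        = (beta d P F \<oplus>\<^bsub>sec (Ker_delta 1 m n) U\<^esub> beta d P G) X Y"
      using delta_add[where F = F and G = G, OF Ker_delta_homog[OF U F] Ker_delta_homog[OF U G], of X Y]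
      by (simp add: beta_dP algebra_simps)
  qed
next
  fix U f F assume "openin (top_of proj_space) (U :: 'n point set)"
    and F: "F \<in> carrier (sec (Ker_delta 2 m (n - int d)) U)"
  then have U: "openin zariski U" by simp
  show "beta d P (f \<odot>\<^bsub>sec (Ker_delta 2 m (n - int d)) U\<^esub> F) = f \<odot>\<^bsub>sec (Ker_delta 1 m n) U\<^esub> beta d P F"
  proof (intro ext)
    fix X Y
    show "beta d P (f \<odot>\<^bsub>sec (Ker_delta 2 m (n - int d)) U\<^esub> F) X Y = (f \<odot>\<^bsub>sec (Ker_delta 1 m n) U\<^esub> beta d P F) X Y"
      using delta_smult[where F = F and f = f, OF Ker_delta_homog[OF U F], of X Y]
      by (simp add: beta_dP algebra_simps)
  qed
next
  fix U V F
  show "beta d P (res (Ker_delta 2 m (n - int d)) V F) = res (Ker_delta 1 m n) V (beta d P F)"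
  proof (intro ext)
    fix X Y
    show "beta d P (res (Ker_delta 2 m (n - int d)) V F) X Y = res (Ker_delta 1 m n) V (beta d P F) X Y"
    proof (cases "X \<in> \<Union>V")
      case True
      then have "delta (res (Ker_delta 2 m (n - int d)) V F) X = delta F X" by (intro delta_cong) simp
      then show ?thesis using True by (simp add: beta_dP)
    next
      case False
      then have "delta (res (Ker_delta 2 m (n - int d)) V F) X = delta (\<lambda>X Y. 0) X" by (intro delta_cong) auto
      then show ?thesis using False by (simp add: beta_dP delta_zero)
    qed
  qed
qed

text \<open>At a fixed X the form dP is a nonzero linear form in Y, by smoothness and Euler's
  formula, and so can be cancelled in the polynomial functions of Y.\<close>

lemma dP_density:
  assumes X: "X \<noteq> 0" and q: "homog_poly m q" and z: "\<And>Y. dP X Y * q Y = 0"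
  shows "q Y = 0"
proof -
  obtain i where "partial i P X \<noteq> 0" using exists_partial_nonzero[OF X] by blast
  then have "dP X (axis i 1) \<noteq> 0" using d by (simp add: dP_axis)
  then show ?thesis
    by (rule zero_by_density[OF dP_homog _ open_UNIV UNIV_I homog_poly_continuous[OF q]]) (use z in auto)
qed

lemma cone_nonzero: "openin zariski U \<Longrightarrow> X \<in> \<Union>U \<Longrightarrow> X \<noteq> 0"
  using openin_zariski_subset proj_point_nonzero by blast

text \<open>Injectivity holds for each X separately, by cancelling dP among polynomials in
  Y.\<close>

lemma sheaf_injective_alpha:
  "sheaf_injective proj_space (Ker_delta 1 m n) (Ker_delta 2 m' n') (\<lambda>U. alpha d P)"
  unfolding sheaf_injective_def
proof (intro allI impI ballI)
  fix U F assume "openin (top_of proj_space) (U :: 'n point set)"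
    and F: "F \<in> carrier (sec (Ker_delta 1 m n) U)" and z: "alpha d P F = \<zero>\<^bsub>sec (Ker_delta 2 m' n') U\<^esub>"
  then have U: "openin zariski U" by simp
  have z': "dP X Y * F X Y = 0" for X Y
    using fun_cong[OF fun_cong[OF z, of X], of Y] by (simp add: alpha_dP)
  have "F X Y = 0" for X Y
  proof (cases "X \<in> \<Union>U")
    case True
    show ?thesis by (rule dP_density[OF cone_nonzero[OF U True] Ker_delta_homog[OF U F] z'])
  next
    case False then show ?thesis using F by (simp add: Ker_delta_iff[OF U])
  qed
  then show "F = \<zero>\<^bsub>sec (Ker_delta 1 m n) U\<^esub>" by (auto intro!: ext)
qed

text \<open>On the locus where \<open>\<partial>\<^sub>iP\<close> is invertible, \<open>slide i X\<close> moves \<open>Y\<close> along the \<open>i\<close>-th axis into the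
  kernel of \<open>dP\<close>; \<open>slope i t\<close> is the quotient of \<open>t(X, Y) - t(X, slide i X Y)\<close> by \<open>dP\<close>.\<close>

definition slide :: "'n \<Rightarrow> complex ^ 'n \<Rightarrow> complex ^ 'n \<Rightarrow> complex ^ 'n" where
  "slide i X Y = (\<chi> j. if j = i then Y $ i - of_nat d / partial i P X * dP X Y else Y $ j)"

definition slope :: "nat \<Rightarrow> 'n \<Rightarrow> (complex ^ 'n \<Rightarrow> complex ^ 'n \<Rightarrow> complex) \<Rightarrow> complex ^ 'n \<Rightarrow> complex ^ 'n \<Rightarrow> complex" where
  "slope m i t X Y = (\<Sum>e\<in>exponents m. coeffs_of m (t X) e * (of_nat d / partial i P X *
     ((\<Prod>j\<in>UNIV - {i}. Y $ j ^ e j) * (\<Sum>l<e i. slide i X Y $ i ^ (e i - Suc l) * Y $ i ^ l))))"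

text \<open>dP takes the value \<open>partial i P X / d\<close> on the i-th axis vector, so the
  factor \<open>d / partial i P X\<close> in \<open>slide\<close> makes the correction cancel dP X Y
  exactly.\<close>

lemma dP_slide:
  assumes "partial i P X \<noteq> 0" shows "dP X (slide i X Y) = 0"
proof -
  define c where "c = of_nat d / partial i P X * dP X Y"
  have "(\<Sum>j\<in>UNIV. partial j P X * slide i X Y $ j)
      = (\<Sum>j\<in>UNIV. partial j P X * Y $ j - (if j = i then partial i P X * c else 0))"
    by (rule sum.cong) (auto simp: slide_def c_def right_diff_distrib)
  also have "\<dots> = (\<Sum>j\<in>UNIV. partial j P X * Y $ j) - partial i P X * c"
    by (simp add: sum_subtractf)
  also have "(\<Sum>j\<in>UNIV. partial j P X * Y $ j) = of_nat d * dP X Y" using d by (simp add: dP_def)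
  also have "partial i P X * c = of_nat d * dP X Y" using assms by (simp add: c_def)
  finally show ?thesis by (simp add: dP_def[of X "slide i X Y"])
qed

text \<open>Only the i-th coordinate moves, so each monomial changes by a multiple of a^k - b^k,
  where a - b is a multiple of dP. The factorisation of a^k - b^k exhibits the quotient as a
  polynomial, without dividing by dP.\<close>

lemma slope:
  assumes "homog_poly m (t X)"
  shows "t X Y - t X (slide i X Y) = dP X Y * slope m i t X Y"
proof -
  have "monomial e Y - monomial e (slide i X Y) = dP X Y * (of_nat d / partial i P X *
     ((\<Prod>j\<in>UNIV - {i}. Y $ j ^ e j) * (\<Sum>l<e i. slide i X Y $ i ^ (e i - Suc l) * Y $ i ^ l)))" for e
  proof -
    have 1: "monomial e Z = Z $ i ^ e i * (\<Prod>j\<in>UNIV - {i}. Z $ j ^ e j)" for Z :: "complex ^ 'n"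
      unfolding monomial_def by (simp add: prod.remove[of UNIV i])
    have 2: "(\<Prod>j\<in>UNIV - {i}. slide i X Y $ j ^ e j) = (\<Prod>j\<in>UNIV - {i}. Y $ j ^ e j)"
      by (rule prod.cong) (auto simp: slide_def)
    have 3: "Y $ i - slide i X Y $ i = of_nat d / partial i P X * dP X Y" by (simp add: slide_def)
    have "monomial e Y - monomial e (slide i X Y)
        = (Y $ i ^ e i - slide i X Y $ i ^ e i) * (\<Prod>j\<in>UNIV - {i}. Y $ j ^ e j)"
      unfolding 1 2 by (simp add: left_diff_distrib)
    also have "Y $ i ^ e i - slide i X Y $ i ^ e i = (of_nat d / partial i P X * dP X Y) *
        (\<Sum>l<e i. slide i X Y $ i ^ (e i - Suc l) * Y $ i ^ l)"
      unfolding power_diff_sumr2 3 ..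
    finally show ?thesis by (simp only: mult_ac)
  qed
  note m = this
  have "t X Y - t X (slide i X Y)
      = (\<Sum>e\<in>exponents m. coeffs_of m (t X) e * (monomial e Y - monomial e (slide i X Y)))"
    by (simp add: coeffs_of[OF assms, symmetric] right_diff_distrib sum_subtractf)
  also have "\<dots> = dP X Y * slope m i t X Y"
    unfolding m slope_def sum_distrib_left by (intro sum.cong refl) (simp only: mult_ac)
  finally show ?thesis .
qed

lemma slide_near:
  assumes p: "p \<in> proj_points" and a: "Z \<in> p" "partial i P Z \<noteq> 0"
  shows "(\<lambda>X Y. slide i X Y $ j) \<in> near_Y 1 0 p"
    and "(\<lambda>X. of_nat d / partial i P X) \<in> near_regular (- (int d - 1)) p"
proof -
  have "(\<lambda>X. of_nat d * inverse (partial i P X)) \<in> near_regular (- (int d - 1)) p"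
    by (rule near_regular_cmult[OF near_regular_inverse[OF partial_P_near[OF p] p a] p])
  then show q: "(\<lambda>X. of_nat d / partial i P X) \<in> near_regular (- (int d - 1)) p"
    by (simp add: divide_inverse)
  show "(\<lambda>X Y. slide i X Y $ j) \<in> near_Y 1 0 p"
  proof (cases "j = i")
    case True
    have "(\<lambda>X Y. Y $ i - of_nat d / partial i P X * dP X Y) \<in> near_Y 1 0 p"
      by (intro near_Y_diff near_Y_var p near_Y_smult_deg[OF q dP_near[OF p]]) simp
    then show ?thesis using True by (simp add: slide_def)
  next
    case False
    then show ?thesis using near_Y_var[OF p, of j] by (simp add: slide_def)
  qed
qed

text \<open>Division by dP lowers the degree in Y by 1 and the degree in X by d - 1; the latter
  comes from the factor \<open>d / partial i P\<close>.\<close>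

lemma slope_near:
  assumes t: "t \<in> near_Y m n p" and p: "p \<in> proj_points" and a: "Z \<in> p" "partial i P Z \<noteq> 0"
    and N: "n - int d + 1 = N"
  shows "slope m i t \<in> near_Y (m - 1) N p"
  unfolding slope_def
proof (rule near_Y_sum[OF _ p])
  fix e :: "'n \<Rightarrow> nat" assume e: "e \<in> exponents m"
  have y: "(\<lambda>X Y. Y $ j ^ k) \<in> near_Y k 0 p" for j k
    using near_Y_power[OF near_Y_var[OF p, of j] p, of k] by simp
  have s: "(\<lambda>X Y. slide i X Y $ i ^ k) \<in> near_Y k 0 p" for k
    using near_Y_power[OF slide_near(1)[OF p a, of i] p, of k] by simp
  have 1: "(\<lambda>X Y. \<Prod>j\<in>UNIV - {i}. Y $ j ^ e j) \<in> near_Y (\<Sum>j\<in>UNIV - {i}. e j) 0 p"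
    by (rule near_Y_prod) (use y p in auto)
  have 2: "(\<lambda>X Y. \<Sum>l<e i. slide i X Y $ i ^ (e i - Suc l) * Y $ i ^ l) \<in> near_Y (e i - 1) 0 p"
    by (rule near_Y_sum[OF near_Y_mult_deg[OF s y p] p]) auto
  have "(\<lambda>X Y. (\<Prod>j\<in>UNIV - {i}. Y $ j ^ e j) * (\<Sum>l<e i. slide i X Y $ i ^ (e i - Suc l) * Y $ i ^ l))
      \<in> near_Y (m - 1) 0 p"
  proof (cases "e i = 0")
    case True then show ?thesis using near_Y_zero[OF p] by simp
  next
    case False
    have "(\<Sum>j\<in>UNIV. e j) = e i + (\<Sum>j\<in>UNIV - {i}. e j)" by (rule sum.remove) auto
    then show ?thesis using e False by (intro near_Y_mult_deg[OF 1 2 p]) (auto simp: exponents_def)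
  qed
  then have "(\<lambda>X Y. of_nat d / partial i P X * ((\<Prod>j\<in>UNIV - {i}. Y $ j ^ e j) *
     (\<Sum>l<e i. slide i X Y $ i ^ (e i - Suc l) * Y $ i ^ l))) \<in> near_Y (m - 1) (- (int d - 1)) p"
    by (rule near_Y_smult_deg[OF slide_near(2)[OF p a] _ p]) simp
  then show "(\<lambda>X Y. coeffs_of m (t X) e * (of_nat d / partial i P X * ((\<Prod>j\<in>UNIV - {i}. Y $ j ^ e j) *
     (\<Sum>l<e i. slide i X Y $ i ^ (e i - Suc l) * Y $ i ^ l)))) \<in> near_Y (m - 1) N p"
    by (rule near_Y_smult_deg[OF near_Y_coeff[OF t e p] _ p]) (use N in simp)
qed

lemma sheaf_exact_alpha_beta:
  assumes m: "m \<ge> 1"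
  shows "sheaf_exact proj_space (Ker_delta 1 (m - 1) (n - 2 * int d + 1)) (Ker_delta 2 m (n - int d))
    (Ker_delta 1 m n) (\<lambda>U. alpha d P) (\<lambda>U. beta d P)"
  unfolding sheaf_exact_def
proof (intro allI impI ballI iffI)
  fix U t assume "openin (top_of proj_space) (U :: 'n point set)"
    and t: "t \<in> carrier (sec (Ker_delta 2 m (n - int d)) U)"
    and im: "in_image_sheaf proj_space (Ker_delta 1 (m - 1) (n - 2 * int d + 1)) (Ker_delta 2 m (n - int d))
      (\<lambda>U. alpha d P) U t"
  then have U: "openin zariski U" by simp
  have "beta d P t X Y = 0" for X Y
  proof (cases "X \<in> \<Union>U")
    case False
    then have "t X = (\<lambda>Y. 0)" using t by (auto simp: Ker_delta_iff[OF U])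
    then show ?thesis using delta_cong[where F = t and X = X and G = "\<lambda>X Y. 0"] by (simp add: beta_dP delta_zero)
  next
    case True
    then obtain p where p: "p \<in> U" "X \<in> p" by blast
    obtain V s where V: "openin zariski V" "p \<in> V" "V \<subseteq> U"
      and s: "s \<in> carrier (sec (Ker_delta 1 (m - 1) (n - 2 * int d + 1)) V)"
      and ts: "alpha d P s = res (Ker_delta 2 m (n - int d)) V t"
      using im p(1) unfolding in_image_sheaf_def by auto
    have XV: "X \<in> \<Union>V" using V p by blast
    have "t X = alpha d P s X" using fun_cong[OF ts, of X] XV by simp
    moreover from this have "delta t X = delta (alpha d P s) X" by (rule delta_cong)
    moreover have "delta s X Y = 0" using Ker_delta_delta[OF s, of X Y] by simp
    ultimately show ?thesis
      using delta_alpha[where F = s and Y = Y, OF Ker_delta_homog[OF V(1) s]] by (simp add: beta_dP alpha_dP)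
  qed
  then show "beta d P t = \<zero>\<^bsub>sec (Ker_delta 1 m n) U\<^esub>" by (auto intro!: ext)
next
  fix U t assume "openin (top_of proj_space) (U :: 'n point set)"
    and t: "t \<in> carrier (sec (Ker_delta 2 m (n - int d)) U)"
    and z: "beta d P t = \<zero>\<^bsub>sec (Ker_delta 1 m n) U\<^esub>"
  then have U: "openin zariski U" by simp
  have z': "P X * t X Y = dP X Y * delta t X Y" for X Y
    using fun_cong[OF fun_cong[OF z, of X], of Y] by (simp add: beta_dP)
  show "in_image_sheaf proj_space (Ker_delta 1 (m - 1) (n - 2 * int d + 1)) (Ker_delta 2 m (n - int d))
      (\<lambda>U. alpha d P) U t"
    unfolding in_image_sheaf_def
  proof
    fix p assume p: "p \<in> U"
    then have pp: "p \<in> proj_points" using openin_zariski_subset[OF U] by blast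
    obtain Z where Z: "Z \<in> p" using proj_point_nonempty[OF pp] by blast
    obtain i where i: "partial i P Z \<noteq> 0"
      using exists_partial_nonzero[OF proj_point_nonzero[OF pp Z]] by blast
    \<comment> \<open>Division by dP requires an invertible \<open>partial i P\<close>; near p some
      index i provides one.\<close>
    define V where "V = U \<inter> basic_open (partial i P)"
    have V: "openin zariski V" unfolding V_def
      by (intro openin_Int U openin_basic_open[OF homog_poly_partial[OF P_homog]])
    have pV: "p \<in> V" unfolding V_def using p basic_open_iff[OF homog_poly_partial[OF P_homog] pp Z] i by simp
    have a: "partial i P X \<noteq> 0" if "q \<in> V" "X \<in> q" for q X using that by (auto simp: V_def basic_open_def)
    have qp: "q \<in> proj_points" if "q \<in> V" for q using openin_zariski_subset[OF V] that by blast
    have tY: "t \<in> near_Y m (n - int d) q" if "q \<in> V" for q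
      using t that by (auto simp: Ker_delta_iff[OF U] near_K_def V_def)
    note th = Ker_delta_homog[OF U t]
    \<comment> \<open>At \<open>slide i X Y\<close> the form dP vanishes, so the hypothesis reads P
      t = 0 there. P is then cancelled by density, with Y fixed and X variable.\<close>
    have slide0: "t X (slide i X Y) = 0" if X: "X \<in> \<Union>V" for X Y
    proof -
      obtain W where W: "P W \<noteq> 0" using P_nonzero by blast
      have nr: "(\<lambda>X. t X (slide i X Y)) \<in> near_regular (n - int d) q" if q: "q \<in> V" for q
      proof -
        obtain Q where Q: "Q \<in> q" using proj_point_nonempty[OF qp[OF q]] by blast
        show ?thesis
          by (rule near_Y_eval[OF near_Y_subst[OF tY[OF q] slide_near(1)[OF qp[OF q] Q a[OF q Q]] qp[OF q]] qp[OF q]])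
      qed
      show ?thesis
      proof (rule near_regular_zero_by_density[where g = "\<lambda>X. t X (slide i X Y)", OF V P_homog W nr _ X])
        fix X assume "X \<in> \<Union>V"
        then have "partial i P X \<noteq> 0" using a by blast
        then show "P X * t X (slide i X Y) = 0" unfolding z' by (simp add: dP_slide)
      qed
    qed
    have ts: "t X Y = dP X Y * slope m i t X Y" if "X \<in> \<Union>V" for X Y
      using slope[where t = t and X = X and Y = Y and i = i, OF th] slide0[OF that, of Y] by simp
    have sh: "homog_poly (m - 1) (slope m i t X)" if X: "X \<in> \<Union>V" for X
    proof -
      obtain q where q: "q \<in> V" "X \<in> q" using X by blast
      show ?thesis
        by (rule eventually_zf_point[OF near_Y_homog[OF slope_near[OF tY[OF q(1)] qp[OF q(1)] q(2) a[OF q] refl]] qp[OF q(1)] q(2)])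
    qed
    have sd: "delta (slope m i t) X Y = 0" if X: "X \<in> \<Union>V" for X Y
    proof -
      have X0: "X \<noteq> 0" by (rule cone_nonzero[OF V X])
      have "t X = alpha d P (slope m i t) X" using ts[OF X] by (auto simp: alpha_dP)
      then have "delta t X = delta (alpha d P (slope m i t)) X" by (rule delta_cong)
      then have dt: "delta t X Y = P X * slope m i t X Y + dP X Y * delta (slope m i t) X Y" for Y
        using delta_alpha[where F = "slope m i t", OF sh[OF X]] by simp
      have h: "homog_poly (m - 1 - 1) (delta (slope m i t) X)" by (rule delta_homog[where F = "slope m i t", OF sh[OF X]])
      \<comment> \<open>With s for the slope, insert t = dP s and \<delta> t = P s + dP \<delta> s
        into P t = dP \<delta> t: the terms P dP s cancel, dP^2 \<delta> s = 0 remains, and dP is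
        cancelled twice.\<close>
      have "dP X Y * (dP X Y * delta (slope m i t) X Y) = 0" for Y
        using z'[of X Y] dt[of Y] ts[OF X, of Y] by (simp add: algebra_simps)
      then have "dP X Y * delta (slope m i t) X Y = 0" for Y
        by (rule dP_density[OF X0 homog_poly_mult[OF dP_homog h]])
      then show ?thesis by (rule dP_density[OF X0 h])
    qed
    have K: "slope m i t \<in> near_K 1 (m - 1) (n - 2 * int d + 1) q" if q: "q \<in> V" for q
    proof -
      obtain Q where Q: "Q \<in> q" using proj_point_nonempty[OF qp[OF q]] by blast
      have "slope m i t \<in> near_Y (m - 1) (n - 2 * int d + 1) q"
        by (rule slope_near[OF tY[OF q] qp[OF q] Q a[OF q Q]]) simp
      moreover have "eventually (\<lambda>X. \<forall>Y. delta (slope m i t) X Y = 0) (zf q)"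
        using eventually_zf_in[OF V q] by eventually_elim (use sd in blast)
      ultimately show ?thesis by (simp add: near_K_def)
    qed
    define s where "s X Y = (if X \<in> \<Union>V then slope m i t X Y else 0)" for X Y
    have "s \<in> carrier (sec (Ker_delta 1 (m - 1) (n - 2 * int d + 1)) V)"
      unfolding s_def[abs_def] by (rule Ker_delta_restrict[OF V K])
    moreover have "alpha d P s = res (Ker_delta 2 m (n - int d)) V t"
      by (intro ext) (simp add: alpha_dP s_def ts)
    moreover have "V \<subseteq> U" by (simp add: V_def)
    ultimately show "\<exists>V. openin (top_of proj_space) V \<and> p \<in> V \<and> V \<subseteq> U \<and>
        (\<exists>s\<in>carrier (sec (Ker_delta 1 (m - 1) (n - 2 * int d + 1)) V). alpha d P s = res (Ker_delta 2 m (n - int d)) V t)"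
      using V pV by (intro exI[of _ V] conjI bexI[of _ s]) simp_all
  qed
qed

end

section \<open>Presented modules\<close>

lemma free_module_simps [simp]:
  "zero (free_module A G) = (\<lambda>_. \<zero>\<^bsub>A\<^esub>)"
  "add (free_module A G) = (\<lambda>u v g. u g \<oplus>\<^bsub>A\<^esub> v g)"
  "smult (free_module A G) = (\<lambda>a u g. a \<otimes>\<^bsub>A\<^esub> u g)"
  by (simp_all add: free_module_def)

lemma in_free_module:
  "u \<in> carrier (free_module A G) \<longleftrightarrow>
    (\<forall>g\<in>G. u g \<in> carrier A) \<and> (\<forall>g. g \<notin> G \<longrightarrow> u g = \<zero>\<^bsub>A\<^esub>) \<and> finite {g. u g \<noteq> \<zero>\<^bsub>A\<^esub>}"
  by (simp add: free_module_def)

lemma module_free_module: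
  assumes "cring A" shows "module A (free_module A G)"
proof -
  interpret cring A by fact
  let ?F = "free_module A G"
  have c: "u g \<in> carrier A" if "u \<in> carrier ?F" for u g
    using that by (cases "g \<in> G") (auto simp: in_free_module)
  have add: "(\<lambda>g. u g \<oplus>\<^bsub>A\<^esub> v g) \<in> carrier ?F" if "u \<in> carrier ?F" "v \<in> carrier ?F" for u v
  proof -
    have "finite {g. u g \<oplus>\<^bsub>A\<^esub> v g \<noteq> \<zero>\<^bsub>A\<^esub>}"
      by (rule finite_subset[of _ "{g. u g \<noteq> \<zero>\<^bsub>A\<^esub>} \<union> {g. v g \<noteq> \<zero>\<^bsub>A\<^esub>}"])
        (use that in \<open>auto simp: in_free_module\<close>)
    then show ?thesis using that by (simp add: in_free_module)
  qed
  have sm: "(\<lambda>g. a \<otimes>\<^bsub>A\<^esub> u g) \<in> carrier ?F" if "a \<in> carrier A" "u \<in> carrier ?F" for a u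
  proof -
    have "finite {g. a \<otimes>\<^bsub>A\<^esub> u g \<noteq> \<zero>\<^bsub>A\<^esub>}"
      by (rule finite_subset[of _ "{g. u g \<noteq> \<zero>\<^bsub>A\<^esub>}"]) (use that in \<open>auto simp: in_free_module\<close>)
    then show ?thesis using that by (simp add: in_free_module)
  qed
  have neg: "(\<lambda>g. \<ominus>\<^bsub>A\<^esub> u g) \<in> carrier ?F" if "u \<in> carrier ?F" for u
  proof -
    have "finite {g. \<ominus>\<^bsub>A\<^esub> u g \<noteq> \<zero>\<^bsub>A\<^esub>}"
      by (rule finite_subset[of _ "{g. u g \<noteq> \<zero>\<^bsub>A\<^esub>}"]) (use that in \<open>auto simp: in_free_module\<close>)
    then show ?thesis using that by (simp add: in_free_module)
  qed
  have z: "(\<lambda>g. \<zero>\<^bsub>A\<^esub>) \<in> carrier ?F" by (simp add: in_free_module)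
  have "abelian_group ?F"
  proof (rule abelian_groupI)
    fix u assume u: "u \<in> carrier ?F"
    show "\<exists>v\<in>carrier ?F. v \<oplus>\<^bsub>?F\<^esub> u = \<zero>\<^bsub>?F\<^esub>"
      by (rule bexI[OF _ neg[OF u]]) (use c[OF u] in \<open>simp add: l_neg\<close>)
  qed (use add z c in \<open>auto simp: a_ac intro!: ext\<close>)
  then show ?thesis
    by (intro moduleI assms) (use sm c in \<open>auto simp: l_distr r_distr m_assoc intro!: ext\<close>)
qed

lemma free_gen_closed: "cring A \<Longrightarrow> g \<in> G \<Longrightarrow> free_gen A g \<in> carrier (free_module A G)"
proof -
  assume "cring A" "g \<in> G"
  then interpret cring A by simp
  have "finite {h. (if h = g then \<one>\<^bsub>A\<^esub> else \<zero>\<^bsub>A\<^esub>) \<noteq> \<zero>\<^bsub>A\<^esub>}"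
    by (rule finite_subset[of _ "{g}"]) auto
  then show ?thesis using \<open>g \<in> G\<close> by (auto simp: in_free_module free_gen_def)
qed

lemma submodule_module_span:
  assumes "module A M" "S \<subseteq> carrier M"
  shows "submodule (module_span A M S) A M"
proof -
  interpret module A M by fact
  \<comment> \<open>The intersection defining the span thus runs over a nonempty family, so it stays
    inside the module.\<close>
  have c: "carrier M \<in> {N. submodule N A M \<and> S \<subseteq> N}" using carrier_is_submodule assms by simp
  show ?thesis unfolding module_span_def
  proof (rule submoduleI)
    show "\<Inter> {N. submodule N A M \<and> S \<subseteq> N} \<subseteq> carrier M" using c by blast
    show "\<zero>\<^bsub>M\<^esub> \<in> \<Inter> {N. submodule N A M \<and> S \<subseteq> N}"
      using subgroup.one_closed[OF submodule.axioms(1)] by fastforce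
  qed (auto dest: submoduleE(3,4,5))
qed

lemma subset_module_span: "S \<subseteq> module_span A M S"
  by (auto simp: module_span_def)

lemma module_span_least: "submodule N A M \<Longrightarrow> S \<subseteq> N \<Longrightarrow> module_span A M S \<subseteq> N"
  by (auto simp: module_span_def)

section \<open>Quotient modules\<close>

locale quotient_module = module A M for A (structure) and M :: "('a, 'm, 's) module_scheme" +
  fixes N assumes N: "submodule N A M"
begin

abbreviation "Q \<equiv> quot_module M N"
abbreviation "proj x \<equiv> N +>\<^bsub>M\<^esub> x"

sublocale abelian_subgroup N M
  by (rule abelian_subgroupI3)
    (use N in \<open>auto simp: additive_subgroup_def submodule_def M.abelian_group_axioms\<close>)

lemma Q_simps [simp]:
  "carrier Q = proj ` carrier M" "zero Q = N" "add Q = set_add M"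
  by (auto simp: quot_module_def A_RCOSETS_def')

lemma proj_eq_iff:
  assumes "x \<in> carrier M" "y \<in> carrier M"
  shows "proj x = proj y \<longleftrightarrow> x \<ominus>\<^bsub>M\<^esub> y \<in> N"
proof
  assume "proj x = proj y"
  then have "x \<in> proj y" using a_rcos_self[OF assms(1)] by simp
  then show "x \<ominus>\<^bsub>M\<^esub> y \<in> N" using a_rcos_module_minus[OF _ assms(2,1)] M.abelian_group_axioms
    by (simp add: a_rcos_module[OF assms(2,1)] a_minus_def)
next
  assume "x \<ominus>\<^bsub>M\<^esub> y \<in> N"
  then have "x \<in> proj y" by (simp add: a_rcos_module[OF assms(2,1)] a_minus_def)
  then show "proj x = proj y" using M.a_repr_independence[OF _ assms(2) a_subgroup] by simp
qed

lemma proj_zero: "proj \<zero>\<^bsub>M\<^esub> = N"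
  using M.a_coset_add_zero[OF a_subset] .

lemma proj_eq_zero_iff: "x \<in> carrier M \<Longrightarrow> proj x = N \<longleftrightarrow> x \<in> N"
  using proj_eq_iff[of x "\<zero>\<^bsub>M\<^esub>"] M.minus_equality[of "\<zero>\<^bsub>M\<^esub>" "\<zero>\<^bsub>M\<^esub>"]
  by (simp add: a_minus_def proj_zero)

lemma proj_add: "x \<in> carrier M \<Longrightarrow> y \<in> carrier M \<Longrightarrow> proj x \<oplus>\<^bsub>Q\<^esub> proj y = proj (x \<oplus>\<^bsub>M\<^esub> y)"
  using a_rcos_sum by simp

text \<open>Scalar multiplication on the quotient is a union over representatives; it is a single
  coset because N is stable under scalars.\<close>

lemma proj_smult:
  assumes a: "a \<in> carrier A" and x: "x \<in> carrier M"
  shows "a \<odot>\<^bsub>Q\<^esub> proj x = proj (a \<odot>\<^bsub>M\<^esub> x)"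
proof -
  have "proj (a \<odot>\<^bsub>M\<^esub> y) = proj (a \<odot>\<^bsub>M\<^esub> x)" if y: "y \<in> proj x" for y
  proof -
    have yM: "y \<in> carrier M" using y a_r_coset_subset_G[OF a_subset x] by blast
    have "y \<ominus>\<^bsub>M\<^esub> x \<in> N" using y a_rcos_module[OF x yM] by (simp add: a_minus_def)
    then have "a \<odot>\<^bsub>M\<^esub> (y \<ominus>\<^bsub>M\<^esub> x) \<in> N" by (rule submodule.smult_closed[OF N a])
    moreover have "a \<odot>\<^bsub>M\<^esub> (y \<ominus>\<^bsub>M\<^esub> x) = a \<odot>\<^bsub>M\<^esub> y \<ominus>\<^bsub>M\<^esub> a \<odot>\<^bsub>M\<^esub> x"
      using a x yM by (simp add: a_minus_def smult_r_distr smult_r_minus)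
    ultimately show ?thesis using proj_eq_iff a x yM by simp
  qed
  then have "(\<Union>y\<in>proj x. proj (a \<odot>\<^bsub>M\<^esub> y)) = proj (a \<odot>\<^bsub>M\<^esub> x)"
    using a_rcos_self[OF x] by blast
  then show ?thesis by (simp add: quot_module_def)
qed

lemma module_Q: "module A Q"
proof (rule moduleI)
  show "cring A" by (rule R.cring_axioms)
  show "abelian_group Q"
  proof (rule abelian_groupI)
    fix C assume "C \<in> carrier Q"
    then obtain x where x: "x \<in> carrier M" "C = proj x" by auto
    have "proj (\<ominus>\<^bsub>M\<^esub> x) \<oplus>\<^bsub>Q\<^esub> proj x = \<zero>\<^bsub>Q\<^esub>"
      using x proj_add[of "\<ominus>\<^bsub>M\<^esub> x" x] proj_eq_zero_iff[of "\<zero>\<^bsub>M\<^esub>"] by (simp add: M.l_neg)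
    then show "\<exists>D\<in>carrier Q. D \<oplus>\<^bsub>Q\<^esub> C = \<zero>\<^bsub>Q\<^esub>" using x by (auto intro!: bexI[of _ "proj (\<ominus>\<^bsub>M\<^esub> x)"])
  next
    fix C D assume "C \<in> carrier Q" "D \<in> carrier Q"
    then obtain x y where xy: "x \<in> carrier M" "C = proj x" "y \<in> carrier M" "D = proj y" by auto
    then show "C \<oplus>\<^bsub>Q\<^esub> D \<in> carrier Q" "C \<oplus>\<^bsub>Q\<^esub> D = D \<oplus>\<^bsub>Q\<^esub> C"
      using proj_add[of x y] proj_add[of y x] by (auto simp: M.a_comm)
  next
    fix C D E assume "C \<in> carrier Q" "D \<in> carrier Q" "E \<in> carrier Q"
    then obtain x y z where "x \<in> carrier M" "C = proj x" "y \<in> carrier M" "D = proj y"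
      "z \<in> carrier M" "E = proj z" by auto
    then show "C \<oplus>\<^bsub>Q\<^esub> D \<oplus>\<^bsub>Q\<^esub> E = C \<oplus>\<^bsub>Q\<^esub> (D \<oplus>\<^bsub>Q\<^esub> E)"
      using proj_add by (simp add: M.a_assoc del: Q_simps)
  next
    show "\<zero>\<^bsub>Q\<^esub> \<in> carrier Q" using proj_eq_zero_iff[of "\<zero>\<^bsub>M\<^esub>"] by (auto intro!: image_eqI[of _ _ "\<zero>\<^bsub>M\<^esub>"])
    fix C assume "C \<in> carrier Q"
    then obtain x where x: "x \<in> carrier M" "C = proj x" by auto
    have "\<zero>\<^bsub>Q\<^esub> = proj \<zero>\<^bsub>M\<^esub>" using proj_eq_zero_iff[of "\<zero>\<^bsub>M\<^esub>"] by simp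
    then show "\<zero>\<^bsub>Q\<^esub> \<oplus>\<^bsub>Q\<^esub> C = C" using x proj_add[of "\<zero>\<^bsub>M\<^esub>" x] by simp
  qed
next
  fix a b C D assume a: "a \<in> carrier A" and b: "b \<in> carrier A" and CD: "C \<in> carrier Q" "D \<in> carrier Q"
  obtain x where x: "x \<in> carrier M" "C = proj x" using CD by auto
  obtain y where y: "y \<in> carrier M" "D = proj y" using CD by auto
  show "a \<odot>\<^bsub>Q\<^esub> (C \<oplus>\<^bsub>Q\<^esub> D) = a \<odot>\<^bsub>Q\<^esub> C \<oplus>\<^bsub>Q\<^esub> a \<odot>\<^bsub>Q\<^esub> D"
    using a x y by (simp add: proj_add proj_smult smult_r_distr del: Q_simps)
next
  fix a C assume "a \<in> carrier A" "C \<in> carrier Q"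
  then show "a \<odot>\<^bsub>Q\<^esub> C \<in> carrier Q" using proj_smult by auto
next
  fix a b C assume a: "a \<in> carrier A" and b: "b \<in> carrier A" and "C \<in> carrier Q"
  then obtain x where x: "x \<in> carrier M" "C = proj x" by auto
  show "(a \<oplus> b) \<odot>\<^bsub>Q\<^esub> C = a \<odot>\<^bsub>Q\<^esub> C \<oplus>\<^bsub>Q\<^esub> b \<odot>\<^bsub>Q\<^esub> C"
    using a b x by (simp add: proj_add proj_smult smult_l_distr del: Q_simps)
  show "(a \<otimes> b) \<odot>\<^bsub>Q\<^esub> C = a \<odot>\<^bsub>Q\<^esub> (b \<odot>\<^bsub>Q\<^esub> C)"
    using a b x by (simp add: proj_smult smult_assoc1 del: Q_simps)
next
  fix C assume "C \<in> carrier Q"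
  then show "\<one> \<odot>\<^bsub>Q\<^esub> C = C" using proj_smult[OF R.one_closed] by auto
qed

lemma proj_closed: "x \<in> carrier M \<Longrightarrow> proj x \<in> carrier Q"
  by simp

lemma submodule_vimage:
  assumes "submodule S A Q"
  shows "submodule {x \<in> carrier M. proj x \<in> S} A M"
proof -
  interpret Qm: module A Q by (rule module_Q)
  note S = Qm.submoduleE[OF assms]
  show ?thesis
  proof (rule submoduleI)
    have "\<zero>\<^bsub>Q\<^esub> \<in> S" using subgroup.one_closed[OF submodule.axioms(1)[OF assms]] by simp
    then show "\<zero>\<^bsub>M\<^esub> \<in> {x \<in> carrier M. proj x \<in> S}" using proj_eq_zero_iff[of "\<zero>\<^bsub>M\<^esub>"] by simp
    fix x assume x: "x \<in> {x \<in> carrier M. proj x \<in> S}"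
    have "proj (\<ominus>\<^bsub>M\<^esub> x) = (\<ominus> \<one>) \<odot>\<^bsub>Q\<^esub> proj x"
      using x by (simp add: proj_smult smult_l_minus del: Q_simps)
    then show "\<ominus>\<^bsub>M\<^esub> x \<in> {x \<in> carrier M. proj x \<in> S}" using x S(4) by simp
  next
    fix x y assume "x \<in> {x \<in> carrier M. proj x \<in> S}" "y \<in> {x \<in> carrier M. proj x \<in> S}"
    then show "x \<oplus>\<^bsub>M\<^esub> y \<in> {x \<in> carrier M. proj x \<in> S}" using proj_add[of x y] S(5)[of "proj x" "proj y"] by (auto simp del: Q_simps)
  next
    fix a x assume "a \<in> carrier A" "x \<in> {x \<in> carrier M. proj x \<in> S}"
    then show "a \<odot>\<^bsub>M\<^esub> x \<in> {x \<in> carrier M. proj x \<in> S}" using proj_smult[of a x] S(4)[of a "proj x"] by (auto simp del: Q_simps)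
  qed auto
qed

end

text \<open>Induction on a finite set containing the support: the component of u at x is split off
  as \<open>u x\<close> times a generator.\<close>

lemma free_module_generated:
  assumes A: "cring A" and N: "submodule N A (free_module A G)" and e: "\<And>g. g \<in> G \<Longrightarrow> free_gen A g \<in> N"
    and u: "u \<in> carrier (free_module A G)"
  shows "u \<in> N"
proof -
  interpret A: cring A by fact
  interpret F: module A "free_module A G" by (rule module_free_module[OF A])
  note NE = F.submoduleE[OF N]
  have "finite T \<Longrightarrow> \<forall>u\<in>carrier (free_module A G). {g. u g \<noteq> \<zero>\<^bsub>A\<^esub>} \<subseteq> T \<longrightarrow> u \<in> N" for T
  proof (induction T rule: finite_induct)
    case empty
    have "\<zero>\<^bsub>free_module A G\<^esub> \<in> N" using subgroup.one_closed[OF submodule.axioms(1)[OF N]] by simp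
    moreover have "u = (\<lambda>_. \<zero>\<^bsub>A\<^esub>)" if "{g. u g \<noteq> \<zero>\<^bsub>A\<^esub>} \<subseteq> {}" for u using that by auto
    ultimately show ?case by auto
  next
    case (insert x T)
    show ?case
    proof (intro ballI impI)
      fix u assume u: "u \<in> carrier (free_module A G)" and s: "{g. u g \<noteq> \<zero>\<^bsub>A\<^esub>} \<subseteq> insert x T"
      have uc: "u g \<in> carrier A" for g using u by (cases "g \<in> G") (auto simp: in_free_module)
      show "u \<in> N"
      proof (cases "x \<in> G")
        case True
        define v where "v g = (if g = x then \<zero>\<^bsub>A\<^esub> else u g)" for g
        have "{g. v g \<noteq> \<zero>\<^bsub>A\<^esub>} \<subseteq> {g. u g \<noteq> \<zero>\<^bsub>A\<^esub>}" by (auto simp: v_def)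
        then have "finite {g. v g \<noteq> \<zero>\<^bsub>A\<^esub>}" using u finite_subset by (auto simp: in_free_module)
        then have v: "v \<in> carrier (free_module A G)" using u by (auto simp: in_free_module v_def)
        have "{g. v g \<noteq> \<zero>\<^bsub>A\<^esub>} \<subseteq> T" using s by (auto simp: v_def)
        then have "v \<in> N" using insert.IH v by blast
        moreover have "u x \<odot>\<^bsub>free_module A G\<^esub> free_gen A x \<in> N" by (rule NE(4)[OF uc e[OF True]])
        ultimately have "v \<oplus>\<^bsub>free_module A G\<^esub> (u x \<odot>\<^bsub>free_module A G\<^esub> free_gen A x) \<in> N" by (rule NE(5))
        moreover have "v \<oplus>\<^bsub>free_module A G\<^esub> (u x \<odot>\<^bsub>free_module A G\<^esub> free_gen A x) = u"
          using uc by (auto simp: v_def free_gen_def)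
        ultimately show ?thesis by simp
      next
        case False
        then have "u x = \<zero>\<^bsub>A\<^esub>" using u by (simp add: in_free_module)
        then show ?thesis using s insert.IH u by auto
      qed
    qed
  qed
  then show ?thesis using u by (auto simp: in_free_module)
qed

section \<open>Modules given by generators and relations, and maps out of them\<close>

locale presentation =
  fixes A :: "('a, 'r) ring_scheme" and G :: "'g set" and R
  assumes A: "cring A" and R: "R \<subseteq> carrier (free_module A G)"
begin

abbreviation "F \<equiv> free_module A G"
abbreviation "PM \<equiv> presented_module A G R"
abbreviation "e \<equiv> free_gen A :: 'g \<Rightarrow> 'g \<Rightarrow> 'a"
abbreviation "S \<equiv> module_span A F R"
abbreviation "gen \<equiv> presented_gen A G R"

sublocale F: module A F by (rule module_free_module[OF A])

sublocale FQ: quotient_module A F S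
  by (intro quotient_module.intro quotient_module_axioms.intro F.module_axioms submodule_module_span R)

lemma PM_eq: "PM = quot_module F S"
  by (simp add: presented_module_def)

lemma module_PM: "module A PM"
  unfolding PM_eq by (rule FQ.module_Q)

sublocale PM: module A PM by (rule module_PM)

lemma e_closed [simp]: "g \<in> G \<Longrightarrow> e g \<in> carrier F"
  by (rule free_gen_closed[OF A])

lemma gen_eq: "gen g = FQ.proj (e g)"
  by (simp add: presented_gen_def)

lemma gen_closed [simp]: "g \<in> G \<Longrightarrow> gen g \<in> carrier PM"
  unfolding gen_eq PM_eq by (rule FQ.proj_closed) simp

lemma proj_add: "u \<in> carrier F \<Longrightarrow> v \<in> carrier F \<Longrightarrow> FQ.proj (u \<oplus>\<^bsub>F\<^esub> v) = FQ.proj u \<oplus>\<^bsub>PM\<^esub> FQ.proj v"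
  unfolding PM_eq by (rule FQ.proj_add[symmetric])

lemma proj_smult: "a \<in> carrier A \<Longrightarrow> u \<in> carrier F \<Longrightarrow> FQ.proj (a \<odot>\<^bsub>F\<^esub> u) = a \<odot>\<^bsub>PM\<^esub> FQ.proj u"
  unfolding PM_eq by (rule FQ.proj_smult[symmetric])

lemma relation_eq:
  assumes "u \<ominus>\<^bsub>F\<^esub> v \<in> R" "u \<in> carrier F" "v \<in> carrier F"
  shows "FQ.proj u = FQ.proj v"
  using FQ.proj_eq_iff[OF assms(2,3)] subsetD[OF subset_module_span assms(1)] by simp

lemma relation_zero: "u \<in> R \<Longrightarrow> FQ.proj u = \<zero>\<^bsub>PM\<^esub>"
proof -
  assume u: "u \<in> R"
  then have "u \<in> S" using subset_module_span[of R A F] by blast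
  then show ?thesis using FQ.proj_eq_zero_iff[of u] u R unfolding PM_eq by (metis FQ.Q_simps(2) subsetD)
qed

text \<open>Induction principle: a property that defines a submodule has to be checked on generators
  only. Applied to the tensor product, the symmetric power and the differentials, it yields the
  surjectivity of \<sigma>.\<close>

lemma generated:
  assumes T: "submodule T A PM" and g: "\<And>g. g \<in> G \<Longrightarrow> gen g \<in> T" and x: "x \<in> carrier PM"
  shows "x \<in> T"
proof -
  obtain u where u: "u \<in> carrier F" "x = FQ.proj u" using x unfolding PM_eq by auto
  have "u \<in> {u \<in> carrier F. FQ.proj u \<in> T}"
    by (rule free_module_generated[OF A FQ.submodule_vimage _ u(1)])
      (use T g in \<open>auto simp: PM_eq gen_eq\<close>)
  then show ?thesis using u by simp
qed

end

text \<open>\<open>Z \<subseteq> W\<close> are spaces of functions on which \<open>A\<close>, through representatives \<open>rep\<close>, acts modulo \<open>Z\<close>;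
  in this way a map out of a presented module can be given without forming \<open>W/Z\<close>.\<close>

locale evaluation = presentation A G R
  for A :: "('a, 'r) ring_scheme" and G :: "'g set" and R +
  fixes W Z :: "('x \<Rightarrow> 'y \<Rightarrow> complex) set" and rep :: "'a \<Rightarrow> 'x \<Rightarrow> complex" and \<phi> :: "'g \<Rightarrow> 'x \<Rightarrow> 'y \<Rightarrow> complex"
  assumes Z_zero: "(\<lambda>x y. 0) \<in> Z"
    and Z_add: "f \<in> Z \<Longrightarrow> g \<in> Z \<Longrightarrow> (\<lambda>x y. f x y + g x y) \<in> Z"
    and Z_neg: "f \<in> Z \<Longrightarrow> (\<lambda>x y. - f x y) \<in> Z"
    and Z_smult: "a \<in> carrier A \<Longrightarrow> f \<in> Z \<Longrightarrow> (\<lambda>x y. rep a x * f x y) \<in> Z"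
    and W_zero: "(\<lambda>x y. 0) \<in> W"
    and W_add: "f \<in> W \<Longrightarrow> g \<in> W \<Longrightarrow> (\<lambda>x y. f x y + g x y) \<in> W"
    and W_smult: "a \<in> carrier A \<Longrightarrow> f \<in> W \<Longrightarrow> (\<lambda>x y. rep a x * f x y) \<in> W"
    and \<phi>: "i \<in> G \<Longrightarrow> \<phi> i \<in> W"
    and rep_zero: "rep \<zero>\<^bsub>A\<^esub> = (\<lambda>x. 0)"
    and rep_add: "a \<in> carrier A \<Longrightarrow> b \<in> carrier A \<Longrightarrow> f \<in> W \<Longrightarrow>
      (\<lambda>x y. (rep (a \<oplus>\<^bsub>A\<^esub> b) x - rep a x - rep b x) * f x y) \<in> Z"
    and rep_mult: "a \<in> carrier A \<Longrightarrow> b \<in> carrier A \<Longrightarrow> f \<in> W \<Longrightarrow>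
      (\<lambda>x y. (rep (a \<otimes>\<^bsub>A\<^esub> b) x - rep a x * rep b x) * f x y) \<in> Z"
    and rep_one: "f \<in> W \<Longrightarrow> (\<lambda>x y. (rep \<one>\<^bsub>A\<^esub> x - 1) * f x y) \<in> Z"
begin

definition eqv :: "('x \<Rightarrow> 'y \<Rightarrow> complex) \<Rightarrow> ('x \<Rightarrow> 'y \<Rightarrow> complex) \<Rightarrow> bool" where
  "eqv f g \<longleftrightarrow> (\<lambda>x y. f x y - g x y) \<in> Z"

lemma eqv_refl [simp]: "eqv f f"
  by (simp add: eqv_def Z_zero)

lemma eqv_sym: "eqv f g \<Longrightarrow> eqv g f"
  unfolding eqv_def by (drule Z_neg) simp

lemma eqv_trans [trans]: "eqv f g \<Longrightarrow> eqv g h \<Longrightarrow> eqv f h"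
  unfolding eqv_def by (drule (1) Z_add) simp

lemma eqv_add: "eqv f f' \<Longrightarrow> eqv g g' \<Longrightarrow> eqv (\<lambda>x y. f x y + g x y) (\<lambda>x y. f' x y + g' x y)"
  unfolding eqv_def by (drule (1) Z_add) (simp add: algebra_simps)

lemma eqv_neg: "eqv f f' \<Longrightarrow> eqv (\<lambda>x y. - f x y) (\<lambda>x y. - f' x y)"
  unfolding eqv_def by (drule Z_neg) simp

lemma eqv_diff: "eqv f f' \<Longrightarrow> eqv g g' \<Longrightarrow> eqv (\<lambda>x y. f x y - g x y) (\<lambda>x y. f' x y - g' x y)"
  using eqv_add[of f f' "\<lambda>x y. - g x y" "\<lambda>x y. - g' x y"] eqv_neg by simp

lemma eqv_smult: "a \<in> carrier A \<Longrightarrow> eqv f f' \<Longrightarrow> eqv (\<lambda>x y. rep a x * f x y) (\<lambda>x y. rep a x * f' x y)"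
  unfolding eqv_def by (drule (1) Z_smult) (simp add: algebra_simps)

lemma eqv_zero: "eqv f g \<Longrightarrow> g \<in> Z \<Longrightarrow> f \<in> Z"
  unfolding eqv_def by (drule (1) Z_add) simp

lemma Z_sum: "finite I \<Longrightarrow> (\<And>i. i \<in> I \<Longrightarrow> f i \<in> Z) \<Longrightarrow> (\<lambda>x y. \<Sum>i\<in>I. f i x y) \<in> Z"
  by (induction I rule: finite_induct) (auto intro: Z_zero Z_add)

text \<open>Representatives of ring elements need not add or multiply exactly, so \<open>ev\<close>
  is linear only modulo Z. The exact rule \<open>rep_zero\<close> allows the support to be enlarged
  to any finite set.\<close>

definition ev :: "('g \<Rightarrow> 'a) \<Rightarrow> 'x \<Rightarrow> 'y \<Rightarrow> complex" where
  "ev u x y = (\<Sum>g | u g \<noteq> \<zero>\<^bsub>A\<^esub>. rep (u g) x * \<phi> g x y)"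

lemma ev_superset:
  assumes "finite T" "{g. u g \<noteq> \<zero>\<^bsub>A\<^esub>} \<subseteq> T"
  shows "ev u = (\<lambda>x y. \<Sum>g\<in>T. rep (u g) x * \<phi> g x y)"
  unfolding ev_def by (intro ext sum.mono_neutral_left) (use assms in \<open>auto simp: rep_zero\<close>)

lemma F_support:
  assumes "u \<in> carrier F"
  shows "finite {g. u g \<noteq> \<zero>\<^bsub>A\<^esub>}" "{g. u g \<noteq> \<zero>\<^bsub>A\<^esub>} \<subseteq> G" "u g \<in> carrier A"
proof -
  show "u g \<in> carrier A"
    using assms by (cases "g \<in> G") (auto simp: in_free_module F.R.zero_closed)
qed (use assms in \<open>auto simp: in_free_module\<close>)

lemma ev_W:
  assumes u: "u \<in> carrier F" shows "ev u \<in> W"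
proof -
  have "finite T \<Longrightarrow> T \<subseteq> G \<Longrightarrow> (\<lambda>x y. \<Sum>g\<in>T. rep (u g) x * \<phi> g x y) \<in> W" for T
    by (induction T rule: finite_induct) (auto intro!: W_zero W_add W_smult \<phi> F_support(3)[OF u])
  then show ?thesis using F_support(1,2)[OF u] unfolding ev_def[abs_def] by blast
qed

lemma ev_add:
  assumes "u \<in> carrier F" "v \<in> carrier F"
  shows "eqv (ev (u \<oplus>\<^bsub>F\<^esub> v)) (\<lambda>x y. ev u x y + ev v x y)"
proof -
  define T where "T = {g. u g \<noteq> \<zero>\<^bsub>A\<^esub>} \<union> {g. v g \<noteq> \<zero>\<^bsub>A\<^esub>}"
  have T: "finite T" "T \<subseteq> G" using F_support(1,2) assms by (auto simp: T_def)
  have s: "{g. (u \<oplus>\<^bsub>F\<^esub> v) g \<noteq> \<zero>\<^bsub>A\<^esub>} \<subseteq> T" by (auto simp: T_def)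
  have "(\<lambda>x y. \<Sum>g\<in>T. (rep (u g \<oplus>\<^bsub>A\<^esub> v g) x - rep (u g) x - rep (v g) x) * \<phi> g x y) \<in> Z"
    by (rule Z_sum[OF T(1) rep_add]) (use T(2) assms in \<open>auto intro: F_support(3) \<phi>\<close>)
  moreover have "ev u = (\<lambda>x y. \<Sum>g\<in>T. rep (u g) x * \<phi> g x y)" "ev v = (\<lambda>x y. \<Sum>g\<in>T. rep (v g) x * \<phi> g x y)"
    by (rule ev_superset[OF T(1)], simp add: T_def)+
  ultimately show ?thesis unfolding eqv_def ev_superset[OF T(1) s]
    by (simp only: left_diff_distrib sum_subtractf diff_diff_eq free_module_simps distrib_right sum.distrib)
qed

lemma ev_smult:
  assumes a: "a \<in> carrier A" and u: "u \<in> carrier F"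
  shows "eqv (ev (a \<odot>\<^bsub>F\<^esub> u)) (\<lambda>x y. rep a x * ev u x y)"
proof -
  define T where "T = {g. u g \<noteq> \<zero>\<^bsub>A\<^esub>}"
  have T: "finite T" "T \<subseteq> G" using F_support(1,2) u by (auto simp: T_def)
  have s: "{g. (a \<odot>\<^bsub>F\<^esub> u) g \<noteq> \<zero>\<^bsub>A\<^esub>} \<subseteq> T" using a by (auto simp: T_def)
  have "(\<lambda>x y. \<Sum>g\<in>T. (rep (a \<otimes>\<^bsub>A\<^esub> u g) x - rep a x * rep (u g) x) * \<phi> g x y) \<in> Z"
    by (rule Z_sum[OF T(1) rep_mult]) (use T(2) a u in \<open>auto intro: F_support(3) \<phi>\<close>)
  then show ?thesis unfolding eqv_def ev_superset[OF T(1) s] ev_def T_def[symmetric]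
    by (simp add: left_diff_distrib sum_subtractf sum_distrib_left mult.assoc)
qed

lemma ev_gen:
  assumes g: "g \<in> G" shows "eqv (ev (e g)) (\<phi> g)"
proof -
  have s: "{h. e g h \<noteq> \<zero>\<^bsub>A\<^esub>} \<subseteq> {g}" by (auto simp: free_gen_def)
  have "ev (e g) = (\<lambda>x y. rep \<one>\<^bsub>A\<^esub> x * \<phi> g x y)"
    by (subst ev_superset[OF _ s]) (simp_all add: free_gen_def)
  then show ?thesis using rep_one[OF \<phi>[OF g]] by (simp add: eqv_def left_diff_distrib)
qed

text \<open>Additivity applied to (u - v) + v = u, since nothing is assumed about representatives of
  negatives.\<close>

lemma ev_minus:
  assumes u: "u \<in> carrier F" and v: "v \<in> carrier F"
  shows "eqv (ev (u \<ominus>\<^bsub>F\<^esub> v)) (\<lambda>x y. ev u x y - ev v x y)"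
proof -
  have "(u \<ominus>\<^bsub>F\<^esub> v) \<oplus>\<^bsub>F\<^esub> v = u"
    using u v by (simp add: a_minus_def F.M.a_assoc F.M.l_neg del: free_module_simps)
  then have "eqv (ev u) (\<lambda>x y. ev (u \<ominus>\<^bsub>F\<^esub> v) x y + ev v x y)"
    using ev_add[of "u \<ominus>\<^bsub>F\<^esub> v" v] u v by (simp del: free_module_simps)
  from eqv_diff[OF this eqv_refl[of "ev v"]] have "eqv (\<lambda>x y. ev u x y - ev v x y) (ev (u \<ominus>\<^bsub>F\<^esub> v))" by simp
  then show ?thesis by (rule eqv_sym)
qed

text \<open>With the rules below, the value of a relation modulo Z is read off from the way in which
  the relation is written.\<close>

definition evaluates :: "('g \<Rightarrow> 'a) \<Rightarrow> ('x \<Rightarrow> 'y \<Rightarrow> complex) \<Rightarrow> bool" where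
  "evaluates u f \<longleftrightarrow> u \<in> carrier F \<and> eqv (ev u) f"

lemma evaluates_gen: "g \<in> G \<Longrightarrow> evaluates (e g) (\<phi> g)"
  by (simp add: evaluates_def ev_gen)

lemma evaluates_add: "evaluates u f \<Longrightarrow> evaluates v g \<Longrightarrow> evaluates (u \<oplus>\<^bsub>F\<^esub> v) (\<lambda>x y. f x y + g x y)"
  unfolding evaluates_def by (elim conjE, intro conjI F.M.a_closed eqv_trans[OF ev_add eqv_add])

lemma evaluates_smult: "a \<in> carrier A \<Longrightarrow> evaluates u f \<Longrightarrow> evaluates (a \<odot>\<^bsub>F\<^esub> u) (\<lambda>x y. rep a x * f x y)"
  unfolding evaluates_def by (elim conjE, intro conjI F.smult_closed eqv_trans[OF ev_smult eqv_smult])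

lemma evaluates_minus: "evaluates u f \<Longrightarrow> evaluates v g \<Longrightarrow> evaluates (u \<ominus>\<^bsub>F\<^esub> v) (\<lambda>x y. f x y - g x y)"
  unfolding evaluates_def by (elim conjE, intro conjI F.M.minus_closed eqv_trans[OF ev_minus eqv_diff])

lemma evaluates_Z: "evaluates u f \<Longrightarrow> f \<in> Z \<Longrightarrow> ev u \<in> Z"
  unfolding evaluates_def by (elim conjE, rule eqv_zero)

end

text \<open>The universal property of the presentation, modulo Z: an assignment on generators
  descends once the relations take values in Z.\<close>

locale lifting = evaluation A G R W Z rep \<phi>
  for A :: "('a, 'r) ring_scheme" and G :: "'g set" and R
    and W Z :: "('x \<Rightarrow> 'y \<Rightarrow> complex) set" and rep and \<phi> +
  assumes relations: "\<And>r. r \<in> R \<Longrightarrow> ev r \<in> Z"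
begin

lemma ev_span: "u \<in> S \<Longrightarrow> ev u \<in> Z"
proof -
  have "submodule {u \<in> carrier F. ev u \<in> Z} A F"
  proof (rule F.submoduleI)
    have "ev \<zero>\<^bsub>F\<^esub> = (\<lambda>x y. 0)" by (intro ext) (simp add: ev_def)
    then show "\<zero>\<^bsub>F\<^esub> \<in> {u \<in> carrier F. ev u \<in> Z}" using Z_zero F.M.zero_closed by simp
  next
    fix u assume u: "u \<in> {u \<in> carrier F. ev u \<in> Z}"
    have z: "ev \<zero>\<^bsub>F\<^esub> = (\<lambda>x y. 0)" by (intro ext) (simp add: ev_def)
    have "eqv (ev (\<zero>\<^bsub>F\<^esub> \<ominus>\<^bsub>F\<^esub> u)) (\<lambda>x y. - ev u x y)"
      using ev_minus[of "\<zero>\<^bsub>F\<^esub>" u] u unfolding z by (simp del: free_module_simps)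
    moreover have "\<zero>\<^bsub>F\<^esub> \<ominus>\<^bsub>F\<^esub> u = \<ominus>\<^bsub>F\<^esub> u" using u by (simp add: a_minus_def del: free_module_simps)
    ultimately have "ev (\<ominus>\<^bsub>F\<^esub> u) \<in> Z" using Z_neg u by (auto intro: eqv_zero)
    then show "\<ominus>\<^bsub>F\<^esub> u \<in> {u \<in> carrier F. ev u \<in> Z}" using u by (simp del: free_module_simps)
  next
    fix u v assume "u \<in> {u \<in> carrier F. ev u \<in> Z}" "v \<in> {u \<in> carrier F. ev u \<in> Z}"
    then show "u \<oplus>\<^bsub>F\<^esub> v \<in> {u \<in> carrier F. ev u \<in> Z}"
      using eqv_zero[OF ev_add Z_add, of u v] by (simp del: free_module_simps)
  next
    fix a u assume "a \<in> carrier A" "u \<in> {u \<in> carrier F. ev u \<in> Z}"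
    then show "a \<odot>\<^bsub>F\<^esub> u \<in> {u \<in> carrier F. ev u \<in> Z}"
      using eqv_zero[OF ev_smult Z_smult, of a u] by (simp del: free_module_simps)
  qed auto
  then have "S \<subseteq> {u \<in> carrier F. ev u \<in> Z}"
    by (rule module_span_least) (use R relations in auto)
  then show "u \<in> S \<Longrightarrow> ev u \<in> Z" by blast
qed

text \<open>Depends on the chosen representative of the coset, but only up to Z, by
  \<open>ev_span\<close>.\<close>

definition lift :: "('g \<Rightarrow> 'a) set \<Rightarrow> 'x \<Rightarrow> 'y \<Rightarrow> complex" where
  "lift C = ev (SOME u. u \<in> carrier F \<and> FQ.proj u = C)"

lemma lift_proj:
  assumes u: "u \<in> carrier F" shows "eqv (lift (FQ.proj u)) (ev u)"
proof -
  define v where "v = (SOME v. v \<in> carrier F \<and> FQ.proj v = FQ.proj u)"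
  have v: "v \<in> carrier F \<and> FQ.proj v = FQ.proj u" unfolding v_def by (rule someI[of _ u]) (use u in simp)
  then have "v \<ominus>\<^bsub>F\<^esub> u \<in> S" using FQ.proj_eq_iff u by blast
  then have "ev (v \<ominus>\<^bsub>F\<^esub> u) \<in> Z" by (rule ev_span)
  then have "(\<lambda>x y. ev v x y - ev u x y) \<in> Z"
    using eqv_zero[OF eqv_sym[OF ev_minus]] v u by blast
  then show ?thesis by (simp add: lift_def v_def eqv_def)
qed

lemma lift_W: "C \<in> carrier PM \<Longrightarrow> lift C \<in> W"
proof -
  assume "C \<in> carrier PM"
  then obtain u where u: "u \<in> carrier F" "C = FQ.proj u" unfolding PM_eq by auto
  have "(SOME u. u \<in> carrier F \<and> FQ.proj u = C) \<in> carrier F \<and> FQ.proj (SOME u. u \<in> carrier F \<and> FQ.proj u = C) = C"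
    by (rule someI[of _ u]) (use u in simp)
  then show ?thesis unfolding lift_def by (intro ev_W) simp
qed

lemma lift_gen: "g \<in> G \<Longrightarrow> eqv (lift (gen g)) (\<phi> g)"
  unfolding gen_eq using eqv_trans[OF lift_proj ev_gen] by simp

lemma lift_add:
  assumes "C \<in> carrier PM" "D \<in> carrier PM"
  shows "eqv (lift (C \<oplus>\<^bsub>PM\<^esub> D)) (\<lambda>x y. lift C x y + lift D x y)"
proof -
  obtain u where u: "u \<in> carrier F" "C = FQ.proj u" using assms(1) unfolding PM_eq by auto
  obtain v where v: "v \<in> carrier F" "D = FQ.proj v" using assms(2) unfolding PM_eq by auto
  have "eqv (lift (C \<oplus>\<^bsub>PM\<^esub> D)) (ev (u \<oplus>\<^bsub>F\<^esub> v))"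
    unfolding u v proj_add[OF u(1) v(1), symmetric] by (rule lift_proj) (use u v in \<open>simp del: free_module_simps\<close>)
  also have "eqv (ev (u \<oplus>\<^bsub>F\<^esub> v)) (\<lambda>x y. ev u x y + ev v x y)" by (rule ev_add[OF u(1) v(1)])
  also have "eqv (\<lambda>x y. ev u x y + ev v x y) (\<lambda>x y. lift C x y + lift D x y)"
    unfolding u v by (rule eqv_add[OF eqv_sym[OF lift_proj[OF u(1)]] eqv_sym[OF lift_proj[OF v(1)]]])
  finally show ?thesis .
qed

lemma lift_smult:
  assumes a: "a \<in> carrier A" and C: "C \<in> carrier PM"
  shows "eqv (lift (a \<odot>\<^bsub>PM\<^esub> C)) (\<lambda>x y. rep a x * lift C x y)"
proof -
  obtain u where u: "u \<in> carrier F" "C = FQ.proj u" using C unfolding PM_eq by auto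
  have "eqv (lift (a \<odot>\<^bsub>PM\<^esub> C)) (ev (a \<odot>\<^bsub>F\<^esub> u))"
    unfolding u proj_smult[OF a u(1), symmetric] by (rule lift_proj) (use a u in \<open>simp del: free_module_simps\<close>)
  also have "eqv (ev (a \<odot>\<^bsub>F\<^esub> u)) (\<lambda>x y. rep a x * ev u x y)" by (rule ev_smult[OF a u(1)])
  also have "eqv (\<lambda>x y. rep a x * ev u x y) (\<lambda>x y. rep a x * lift C x y)"
    unfolding u by (rule eqv_smult[OF a eqv_sym[OF lift_proj[OF u(1)]]])
  finally show ?thesis .
qed

lemma lift_zero: "lift \<zero>\<^bsub>PM\<^esub> \<in> Z"
proof -
  have "eqv (lift (FQ.proj \<zero>\<^bsub>F\<^esub>)) (ev \<zero>\<^bsub>F\<^esub>)" by (rule lift_proj) (rule F.M.zero_closed)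
  moreover have "FQ.proj \<zero>\<^bsub>F\<^esub> = \<zero>\<^bsub>PM\<^esub>" unfolding PM_eq using FQ.proj_zero by simp
  moreover have "ev \<zero>\<^bsub>F\<^esub> = (\<lambda>x y. 0)" by (intro ext) (simp add: ev_def)
  ultimately show ?thesis using Z_zero by (auto intro: eqv_zero)
qed

lemma lift_finsum:
  assumes "finite I" "C \<in> I \<rightarrow> carrier PM"
  shows "eqv (lift (finsum PM C I)) (\<lambda>x y. \<Sum>i\<in>I. lift (C i) x y)"
  using assms
proof (induction I rule: finite_induct)
  case empty
  then show ?case using lift_zero by (simp add: eqv_def PM.finsum_empty)
next
  case (insert i I)
  have s: "finsum PM C (insert i I) = C i \<oplus>\<^bsub>PM\<^esub> finsum PM C I"
    using insert by (subst PM.finsum_insert) auto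
  have "eqv (lift (finsum PM C (insert i I))) (\<lambda>x y. lift (C i) x y + lift (finsum PM C I) x y)"
    unfolding s by (rule lift_add) (use insert in \<open>auto intro: PM.finsum_closed\<close>)
  also have "eqv (\<lambda>x y. lift (C i) x y + lift (finsum PM C I) x y) (\<lambda>x y. lift (C i) x y + (\<Sum>i\<in>I. lift (C i) x y))"
    by (rule eqv_add[OF eqv_refl insert.IH]) (use insert in auto)
  finally show ?case using insert by simp
qed

end

section \<open>The local ring of the hypersurface\<close>

definition dY :: "(complex ^ 'n::finite \<Rightarrow> complex) \<Rightarrow> complex ^ 'n \<Rightarrow> complex ^ 'n \<Rightarrow> complex" where
  "dY f X Y = (\<Sum>i\<in>UNIV. partial i f X * Y $ i)"

lemma dY_near: "f \<in> near_regular n p \<Longrightarrow> p \<in> proj_points \<Longrightarrow> dY f \<in> near_Y 1 (n - 1) p"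
  unfolding dY_def[abs_def]
  by (intro near_Y_sum near_Y_smult_deg[OF near_regular_pd(2) near_Y_var]) auto

lemma delta_dY: "delta (dY f) X Y = (\<Sum>i\<in>UNIV. X $ i * partial i f X)"
proof -
  have "has_pd (dY f X) (\<lambda>i. \<Sum>j\<in>UNIV. partial j f X * (if i = j then 1 else 0)) Y"
    unfolding dY_def[abs_def] by (intro has_pd_cmult has_pd_sum has_pd_coord)
  then show ?thesis by (subst delta_eqI) (auto simp: if_distrib[of "\<lambda>x. _ * x"] cong: if_cong)
qed

lemma dY_cong:
  assumes "f \<in> near_regular n p" "eventually (\<lambda>X. f X = g X) (zf p)" "p \<in> proj_points"
  shows "eventually (\<lambda>X. \<forall>Y. dY f X Y = dY g X Y) (zf p)"
  using partial_cong[OF assms] by eventually_elim (simp add: dY_def)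

lemma dY_add:
  assumes "f \<in> near_regular n p" "g \<in> near_regular n p" "p \<in> proj_points"
  shows "eventually (\<lambda>X. \<forall>Y. dY (\<lambda>X. f X + g X) X Y = dY f X Y + dY g X Y) (zf p)"
  using partial_add[OF assms] by eventually_elim (simp add: dY_def distrib_right sum.distrib)

lemma dY_mult:
  assumes "f \<in> near_regular n p" "g \<in> near_regular n' p" "p \<in> proj_points"
  shows "eventually (\<lambda>X. \<forall>Y. dY (\<lambda>X. f X * g X) X Y = f X * dY g X Y + g X * dY f X Y) (zf p)"
  using partial_mult[OF assms]
  by eventually_elim (simp add: dY_def distrib_right distrib_left sum.distrib sum_distrib_left mult_ac add_ac)

lemma dY_const: "dY (\<lambda>X. c) = (\<lambda>X Y. 0)"
  by (simp add: dY_def[abs_def])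

text \<open>\<open>dY f\<close> is df with Y written for dX. Euler's formula in degree 0 says that
  \<delta> kills it, and differentiation lowers the degree in X by one.\<close>

lemma dY_near_K:
  assumes "f \<in> near_regular 0 p" "p \<in> proj_points"
  shows "dY f \<in> near_K 1 1 (-1) p"
proof -
  have "eventually (\<lambda>X. \<forall>Y. delta (dY f) X Y = 0) (zf p)"
    using near_regular_pd(3)[OF assms] by eventually_elim (simp add: delta_dY)
  then show ?thesis using dY_near[OF assms] by (simp add: near_K_def)
qed

locale stalk = smooth_hypersurface_context d P for d and P :: "complex ^ 'n::finite \<Rightarrow> complex" +
  fixes p :: "'n point"
  assumes p: "p \<in> proj_points"
begin

text \<open>Congruence modulo P O(k - d), that is, equality in O_H(k), phrased with the filter
  \<open>zf p\<close>; by \<open>germ_eq\<close> the classes are the \<open>OH_germ\<close>.\<close>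

definition cong :: "int \<Rightarrow> (complex ^ 'n \<Rightarrow> complex) \<Rightarrow> (complex ^ 'n \<Rightarrow> complex) \<Rightarrow> bool" where
  "cong k f g \<longleftrightarrow> (\<exists>h\<in>near_regular (k - int d) p. eventually (\<lambda>X. g X = f X + P X * h X) (zf p))"

abbreviation "germ k f \<equiv> OH_germ d P p k f"

lemma germ_eq: "germ k f = {g \<in> near_regular k p. cong k f g}"
proof -
  have "(\<exists>V h. openin zariski V \<and> p \<in> V \<and> regular_on (k - int d) V h \<and> (\<forall>X\<in>\<Union>V. g X = f X + P X * h X))
      \<longleftrightarrow> cong k f g" for g
  proof
    assume "\<exists>V h. openin zariski V \<and> p \<in> V \<and> regular_on (k - int d) V h \<and> (\<forall>X\<in>\<Union>V. g X = f X + P X * h X)"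
    then obtain V h where V: "openin zariski V" "p \<in> V" "regular_on (k - int d) V h"
      "\<forall>X\<in>\<Union>V. g X = f X + P X * h X" by blast
    show "cong k f g" unfolding cong_def
      by (rule bexI[OF eventually_zfI[OF V(1,2)] regular_on_imp_near_regular[OF V(3,1,2)]]) (use V(4) in blast)
  next
    assume "cong k f g"
    then obtain h where h: "h \<in> near_regular (k - int d) p" "eventually (\<lambda>X. g X = f X + P X * h X) (zf p)"
      by (auto simp: cong_def)
    then obtain U where U: "openin zariski U" "p \<in> U" "regular_on (k - int d) U h"
      by (auto simp: near_regular_def)
    obtain V where V: "openin zariski V" "p \<in> V" "V \<subseteq> U" "\<forall>X\<in>\<Union>V. g X = f X + P X * h X"
      by (rule eventually_zfE[OF h(2) U(1,2)])
    have "regular_on (k - int d) V h"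
      using U V by (auto simp: regular_on_iff)
    then show "\<exists>V h. openin zariski V \<and> p \<in> V \<and> regular_on (k - int d) V h \<and> (\<forall>X\<in>\<Union>V. g X = f X + P X * h X)"
      using V by blast
  qed
  then show ?thesis by (simp add: OH_germ_def)
qed

lemma cong_eventually: "eventually (\<lambda>X. f X = g X) (zf p) \<Longrightarrow> cong k f g"
  unfolding cong_def by (rule bexI[OF _ near_regular_zero[OF p]]) (erule eventually_mono, simp)

lemma cong_refl: "cong k f f"
  by (rule cong_eventually) simp

lemma cong_sym: "cong k f g \<Longrightarrow> cong k g f"
  unfolding cong_def
proof (elim bexE)
  fix h assume h: "h \<in> near_regular (k - int d) p" "eventually (\<lambda>X. g X = f X + P X * h X) (zf p)"
  show "\<exists>h\<in>near_regular (k - int d) p. eventually (\<lambda>X. f X = g X + P X * h X) (zf p)"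
    by (rule bexI[OF _ near_regular_uminus[OF h(1) p]]) (use h(2) in eventually_elim, simp)
qed

lemma cong_trans: "cong k f g \<Longrightarrow> cong k g u \<Longrightarrow> cong k f u"
  unfolding cong_def
proof (elim bexE)
  fix h h' assume h: "h \<in> near_regular (k - int d) p" "eventually (\<lambda>X. g X = f X + P X * h X) (zf p)"
    "h' \<in> near_regular (k - int d) p" "eventually (\<lambda>X. u X = g X + P X * h' X) (zf p)"
  show "\<exists>h\<in>near_regular (k - int d) p. eventually (\<lambda>X. u X = f X + P X * h X) (zf p)"
    by (rule bexI[OF _ near_regular_add[OF h(1,3) p]])
      (use h(2,4) in eventually_elim, simp add: algebra_simps)
qed

lemma cong_add: "cong k f f' \<Longrightarrow> cong k g g' \<Longrightarrow> cong k (\<lambda>X. f X + g X) (\<lambda>X. f' X + g' X)"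
  unfolding cong_def
proof (elim bexE)
  fix h h' assume h: "h \<in> near_regular (k - int d) p" "eventually (\<lambda>X. f' X = f X + P X * h X) (zf p)"
    "h' \<in> near_regular (k - int d) p" "eventually (\<lambda>X. g' X = g X + P X * h' X) (zf p)"
  show "\<exists>h\<in>near_regular (k - int d) p. eventually (\<lambda>X. f' X + g' X = f X + g X + P X * h X) (zf p)"
    by (rule bexI[OF _ near_regular_add[OF h(1,3) p]])
      (use h(2,4) in eventually_elim, simp add: algebra_simps)
qed

lemma cong_mult:
  assumes "f \<in> near_regular k p" "g \<in> near_regular l p" "cong k f f'" "cong l g g'" "k + l = n"
  shows "cong n (\<lambda>X. f X * g X) (\<lambda>X. f' X * g' X)"
proof -
  obtain h where h: "h \<in> near_regular (k - int d) p" "eventually (\<lambda>X. f' X = f X + P X * h X) (zf p)"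
    using assms(3) by (auto simp: cong_def)
  obtain h' where h': "h' \<in> near_regular (l - int d) p" "eventually (\<lambda>X. g' X = g X + P X * h' X) (zf p)"
    using assms(4) by (auto simp: cong_def)
  have Ph: "(\<lambda>X. P X * h X) \<in> near_regular k p"
    by (rule near_regular_mult_deg[OF P_near[OF p] h(1) p]) simp
  \<comment> \<open>The cofactor of P in (f + P h)(g + P h') - f g.\<close>
  have a: "(\<lambda>X. f X * h' X + h X * g X + (P X * h X) * h' X) \<in> near_regular (n - int d) p"
    by (intro near_regular_add p near_regular_mult_deg[OF assms(1) h'(1)]
        near_regular_mult_deg[OF h(1) assms(2)] near_regular_mult_deg[OF Ph h'(1)])
      (use assms(5) in auto)
  show ?thesis unfolding cong_def
    by (rule bexI[OF _ a]) (use h(2) h'(2) in eventually_elim, simp add: algebra_simps)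
qed

lemma germ_eq_iff:
  assumes "f \<in> near_regular k p" "g \<in> near_regular k p"
  shows "germ k f = germ k g \<longleftrightarrow> cong k f g"
  unfolding germ_eq using assms cong_refl cong_sym cong_trans by blast

lemma germ_self: "f \<in> near_regular k p \<Longrightarrow> f \<in> germ k f"
  by (simp add: germ_eq cong_refl)

lemma germ_eqI: "f \<in> near_regular k p \<Longrightarrow> eventually (\<lambda>X. f X = g X) (zf p) \<Longrightarrow> germ k f = germ k g"
  using germ_eq_iff[OF _ near_regular_cong[OF _ _ p]] cong_eventually by blast

text \<open>The operations of the stalk are unions over all representatives. Once the resulting germ
  does not depend on them, the union collapses to one germ.\<close>

lemma germ_UN:
  assumes f: "f \<in> near_regular k p" and g: "g \<in> near_regular l p"
    and c: "\<And>f' g'. f' \<in> near_regular k p \<Longrightarrow> g' \<in> near_regular l p \<Longrightarrow> cong k f f' \<Longrightarrow> cong l g g' \<Longrightarrow>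
      germ n (op f' g') = germ n (op f g)"
  shows "(\<Union>f'\<in>germ k f. \<Union>g'\<in>germ l g. germ n (op f' g')) = germ n (op f g)"
proof -
  have "germ n (op f' g') = germ n (op f g)" if "f' \<in> germ k f" "g' \<in> germ l g" for f' g'
    using that c unfolding germ_eq by blast
  then show ?thesis using germ_self[OF f] germ_self[OF g] by blast
qed

lemma germ_add_UN:
  assumes f: "f \<in> near_regular k p" and g: "g \<in> near_regular k p"
  shows "(\<Union>f'\<in>germ k f. \<Union>g'\<in>germ k g. germ k (\<lambda>X. f' X + g' X)) = germ k (\<lambda>X. f X + g X)"
proof (rule germ_UN[where op = "\<lambda>f g X. f X + g X", OF f g])
  fix f' g' assume "f' \<in> near_regular k p" "g' \<in> near_regular k p" "cong k f f'" "cong k g g'"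
  then show "germ k (\<lambda>X. f' X + g' X) = germ k (\<lambda>X. f X + g X)"
    using f g cong_add cong_sym near_regular_add p by (subst germ_eq_iff) auto
qed

lemma germ_mult_UN:
  assumes f: "f \<in> near_regular k p" and g: "g \<in> near_regular l p" and n: "k + l = n"
  shows "(\<Union>f'\<in>germ k f. \<Union>g'\<in>germ l g. germ n (\<lambda>X. f' X * g' X)) = germ n (\<lambda>X. f X * g X)"
proof (rule germ_UN[where op = "\<lambda>f g X. f X * g X", OF f g])
  fix f' g' assume a: "f' \<in> near_regular k p" "g' \<in> near_regular l p" "cong k f f'" "cong l g g'"
  have "cong n (\<lambda>X. f' X * g' X) (\<lambda>X. f X * g X)"
    by (rule cong_sym[OF cong_mult[OF f g a(3,4) n]])
  then show "germ n (\<lambda>X. f' X * g' X) = germ n (\<lambda>X. f X * g X)"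
    using germ_eq_iff[OF near_regular_mult_deg[OF a(1,2) p n] near_regular_mult_deg[OF f g p n]] by simp
qed

abbreviation "A \<equiv> OH_stalk d P p"
abbreviation "T k \<equiv> OH_twist_stalk d P p k"

lemma A_simps:
  "carrier A = germ 0 ` near_regular 0 p" "one A = germ 0 (\<lambda>X. 1)" "zero A = germ 0 (\<lambda>X. 0)"
  by (simp_all add: OH_stalk_def)

lemma A_add: "f \<in> near_regular 0 p \<Longrightarrow> g \<in> near_regular 0 p \<Longrightarrow> germ 0 f \<oplus>\<^bsub>A\<^esub> germ 0 g = germ 0 (\<lambda>X. f X + g X)"
  using germ_add_UN[of f 0 g] by (simp add: OH_stalk_def)

lemma A_mult: "f \<in> near_regular 0 p \<Longrightarrow> g \<in> near_regular 0 p \<Longrightarrow> germ 0 f \<otimes>\<^bsub>A\<^esub> germ 0 g = germ 0 (\<lambda>X. f X * g X)"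
  using germ_mult_UN[of f 0 g 0 0] by (simp add: OH_stalk_def)

lemma T_simps:
  "carrier (T k) = germ k ` near_regular k p" "zero (T k) = germ k (\<lambda>X. 0)"
  by (simp_all add: OH_twist_stalk_def)

lemma T_add: "f \<in> near_regular k p \<Longrightarrow> g \<in> near_regular k p \<Longrightarrow> germ k f \<oplus>\<^bsub>T k\<^esub> germ k g = germ k (\<lambda>X. f X + g X)"
  using germ_add_UN[of f k g] by (simp add: OH_twist_stalk_def)

lemma T_smult: "f \<in> near_regular 0 p \<Longrightarrow> g \<in> near_regular k p \<Longrightarrow> germ 0 f \<odot>\<^bsub>T k\<^esub> germ k g = germ k (\<lambda>X. f X * g X)"
  using germ_mult_UN[of f 0 g k k] by (simp add: OH_twist_stalk_def)

lemmas near_rules = near_regular_add near_regular_mult near_regular_zero near_regular_const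
  near_regular_mult[of _ 0 _ _ 0, simplified] near_regular_uminus near_regular_mult[of _ 0 _ _ n for n, simplified] p

lemma germ_closed: "f \<in> near_regular 0 p \<Longrightarrow> germ 0 f \<in> carrier A"
  by (simp add: A_simps)

lemma germ_T_closed: "f \<in> near_regular k p \<Longrightarrow> germ k f \<in> carrier (T k)"
  by (simp add: T_simps)

lemma cring_A: "cring A"
proof (rule cringI)
  show "abelian_group A"
  proof (rule abelian_groupI)
    fix x assume "x \<in> carrier A"
    then obtain f where f: "f \<in> near_regular 0 p" "x = germ 0 f" by (auto simp: A_simps)
    have "germ 0 (\<lambda>X. - f X) \<oplus>\<^bsub>A\<^esub> x = \<zero>\<^bsub>A\<^esub>"
      using f near_regular_uminus[OF f(1) p] by (simp add: A_add A_simps)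
    then show "\<exists>y\<in>carrier A. y \<oplus>\<^bsub>A\<^esub> x = \<zero>\<^bsub>A\<^esub>"
      using near_regular_uminus[OF f(1) p] germ_closed by blast
  qed (auto simp: A_simps A_add near_rules add_ac intro!: imageI)
  show "comm_monoid A"
    by (rule comm_monoidI) (auto simp: A_simps A_mult near_rules mult_ac intro!: imageI)
qed (auto simp: A_simps A_mult A_add near_rules algebra_simps)

lemma module_T: "module A (T k)"
proof (rule moduleI[OF cring_A])
  show "abelian_group (T k)"
  proof (rule abelian_groupI)
    fix x assume "x \<in> carrier (T k)"
    then obtain f where f: "f \<in> near_regular k p" "x = germ k f" by (auto simp: T_simps)
    have "germ k (\<lambda>X. - f X) \<oplus>\<^bsub>T k\<^esub> x = \<zero>\<^bsub>T k\<^esub>"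
      using f near_regular_uminus[OF f(1) p] by (simp add: T_add T_simps)
    then show "\<exists>y\<in>carrier (T k). y \<oplus>\<^bsub>T k\<^esub> x = \<zero>\<^bsub>T k\<^esub>"
      using near_regular_uminus[OF f(1) p] germ_T_closed by blast
  qed (auto simp: T_simps T_add near_rules add_ac intro!: imageI)
qed (auto simp: A_simps T_simps A_add T_add A_mult T_smult near_rules algebra_simps intro!: imageI)

text \<open>The zero class is given the zero function itself, since maps out of presentations
  require \<open>rep\<close> of zero to vanish exactly; the other representatives are
  arbitrary.\<close>

definition rep :: "(complex ^ 'n \<Rightarrow> complex) set \<Rightarrow> complex ^ 'n \<Rightarrow> complex" where
  "rep C = (if C = zero A then (\<lambda>X. 0) else SOME f. f \<in> near_regular 0 p \<and> germ 0 f = C)"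

lemma rep:
  assumes "C \<in> carrier A" shows "rep C \<in> near_regular 0 p" "germ 0 (rep C) = C"
proof -
  obtain f where f: "f \<in> near_regular 0 p" "C = germ 0 f" using assms by (auto simp: A_simps)
  have "(SOME f. f \<in> near_regular 0 p \<and> germ 0 f = C) \<in> near_regular 0 p \<and>
      germ 0 (SOME f. f \<in> near_regular 0 p \<and> germ 0 f = C) = C"
    by (rule someI[of _ f]) (use f in simp)
  then show "rep C \<in> near_regular 0 p" "germ 0 (rep C) = C"
    using near_regular_zero[OF p] by (auto simp: rep_def A_simps)
qed

lemma rep_zero: "rep (zero A) = (\<lambda>X. 0)"
  by (simp add: rep_def)

lemma rep_cong: "C \<in> carrier A \<Longrightarrow> f \<in> near_regular 0 p \<Longrightarrow> C = germ 0 f \<Longrightarrow> cong 0 f (rep C)"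
  using rep[of C] germ_eq_iff[of f 0 "rep C"] by simp

definition repT :: "int \<Rightarrow> (complex ^ 'n \<Rightarrow> complex) set \<Rightarrow> complex ^ 'n \<Rightarrow> complex" where
  "repT k C = (SOME f. f \<in> near_regular k p \<and> germ k f = C)"

lemma repT:
  assumes "C \<in> carrier (T k)" shows "repT k C \<in> near_regular k p" "germ k (repT k C) = C"
proof -
  obtain f where f: "f \<in> near_regular k p" "C = germ k f" using assms by (auto simp: T_simps)
  have "repT k C \<in> near_regular k p \<and> germ k (repT k C) = C" unfolding repT_def
    by (rule someI[of _ f]) (use f in simp)
  then show "repT k C \<in> near_regular k p" "germ k (repT k C) = C" by auto
qed

lemma repT_cong: "C \<in> carrier (T k) \<Longrightarrow> f \<in> near_regular k p \<Longrightarrow> C = germ k f \<Longrightarrow> cong k f (repT k C)"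
  using repT[of C k] germ_eq_iff[of f k "repT k C"] by simp

section \<open>Germs of sections modulo the image of \<open>\<beta>(P)\<close>\<close>

abbreviation "W m n \<equiv> near_K 1 m n p"

text \<open>The stalk at p of the image of \<beta>(P); the shift by d is the degree of P.\<close>

definition Z :: "nat \<Rightarrow> int \<Rightarrow> (complex ^ 'n \<Rightarrow> complex ^ 'n \<Rightarrow> complex) set" where
  "Z m n = {F. \<exists>B\<in>near_K 2 m (n - int d) p. eventually (\<lambda>X. \<forall>Y. F X Y = beta d P B X Y) (zf p)}"

lemma ZI: "B \<in> near_K 2 m (n - int d) p \<Longrightarrow> eventually (\<lambda>X. \<forall>Y. F X Y = beta d P B X Y) (zf p) \<Longrightarrow> F \<in> Z m n"
  unfolding Z_def by blast

lemma ZE: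
  assumes "F \<in> Z m n"
  obtains B where "B \<in> near_K 2 m (n - int d) p" "eventually (\<lambda>X. \<forall>Y. F X Y = beta d P B X Y) (zf p)"
  using assms unfolding Z_def by blast

lemma near_K_near_Y: "F \<in> near_K k m n p \<Longrightarrow> F \<in> near_Y m n p"
  by (simp add: near_K_def)

lemma near_K_eq2: "F \<in> near_K 2 m n p \<longleftrightarrow> F \<in> near_Y m n p \<and> eventually (\<lambda>X. \<forall>Y. delta (delta F) X Y = 0) (zf p)"
  by (simp add: near_K_def numeral_2_eq_2)

lemma near_K_eq1: "F \<in> near_K 1 m n p \<longleftrightarrow> F \<in> near_Y m n p \<and> eventually (\<lambda>X. \<forall>Y. delta F X Y = 0) (zf p)"
  by (simp add: near_K_def)

lemma Z_cong: "F \<in> Z m n \<Longrightarrow> eventually (\<lambda>X. \<forall>Y. F X Y = G X Y) (zf p) \<Longrightarrow> G \<in> Z m n"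
proof (erule ZE)
  fix B assume B: "B \<in> near_K 2 m (n - int d) p" "eventually (\<lambda>X. \<forall>Y. F X Y = beta d P B X Y) (zf p)"
    and G: "eventually (\<lambda>X. \<forall>Y. F X Y = G X Y) (zf p)"
  show "G \<in> Z m n" by (rule ZI[OF B(1)]) (use B(2) G in eventually_elim, simp)
qed

lemma Z_zero: "(\<lambda>X Y. 0) \<in> Z m n"
  by (rule ZI[OF near_K_zero[OF p]]) (simp add: beta_dP delta_zero)

lemma Z_add:
  assumes "F \<in> Z m n" "G \<in> Z m n" shows "(\<lambda>X Y. F X Y + G X Y) \<in> Z m n"
proof -
  obtain B where B: "B \<in> near_K 2 m (n - int d) p" "eventually (\<lambda>X. \<forall>Y. F X Y = beta d P B X Y) (zf p)"
    by (rule ZE[OF assms(1)])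
  obtain C where C: "C \<in> near_K 2 m (n - int d) p" "eventually (\<lambda>X. \<forall>Y. G X Y = beta d P C X Y) (zf p)"
    by (rule ZE[OF assms(2)])
  show ?thesis
  proof (rule ZI[OF near_K_add[OF B(1) C(1) p]])
    show "eventually (\<lambda>X. \<forall>Y. F X Y + G X Y = beta d P (\<lambda>X Y. B X Y + C X Y) X Y) (zf p)"
      using near_Y_homog[OF near_K_near_Y[OF B(1)]] near_Y_homog[OF near_K_near_Y[OF C(1)]] B(2) C(2)
    proof eventually_elim
      case (elim X)
      show ?case
        by (simp only: elim(3,4)[rule_format] beta_dP delta_add[where F = B and G = C, OF elim(1,2)])
          (simp add: algebra_simps)
    qed
  qed
qed

lemma Z_smult:
  assumes f: "f \<in> near_regular i p" and F: "F \<in> Z m n" and N: "i + n = N"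
  shows "(\<lambda>X Y. f X * F X Y) \<in> Z m N"
proof -
  obtain B where B: "B \<in> near_K 2 m (n - int d) p" "eventually (\<lambda>X. \<forall>Y. F X Y = beta d P B X Y) (zf p)"
    by (rule ZE[OF F])
  have "(\<lambda>X Y. f X * B X Y) \<in> near_K 2 m (N - int d) p"
    using near_K_smult[OF f B(1) p] N by (simp add: algebra_simps)
  then show ?thesis
  proof (rule ZI)
    show "eventually (\<lambda>X. \<forall>Y. f X * F X Y = beta d P (\<lambda>X Y. f X * B X Y) X Y) (zf p)"
      using near_Y_homog[OF near_K_near_Y[OF B(1)]] B(2)
    proof eventually_elim
      case (elim X)
      show ?case
        by (simp only: elim(2)[rule_format] beta_dP delta_smult[where F = B and f = f, OF elim(1)])
          (simp add: algebra_simps)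
    qed
  qed
qed

lemma Z_neg: "F \<in> Z m n \<Longrightarrow> (\<lambda>X Y. - F X Y) \<in> Z m n"
  using Z_smult[OF near_regular_const[OF p, of "-1"], of F m n n] by simp

lemma W_mult:
  assumes F: "F \<in> W m n" and G: "G \<in> W m' n'" and M: "m + m' = M" "n + n' = N"
  shows "(\<lambda>X Y. F X Y * G X Y) \<in> W M N"
proof -
  have F': "F \<in> near_Y m n p" "eventually (\<lambda>X. \<forall>Y. delta F X Y = 0) (zf p)" using F unfolding near_K_eq1 by auto
  have G': "G \<in> near_Y m' n' p" "eventually (\<lambda>X. \<forall>Y. delta G X Y = 0) (zf p)" using G unfolding near_K_eq1 by auto
  show ?thesis unfolding near_K_eq1
  proof
    show "(\<lambda>X Y. F X Y * G X Y) \<in> near_Y M N p" by (rule near_Y_mult_deg[OF F'(1) G'(1) p M])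
    show "eventually (\<lambda>X. \<forall>Y. delta (\<lambda>X Y. F X Y * G X Y) X Y = 0) (zf p)"
      using near_Y_homog[OF F'(1)] near_Y_homog[OF G'(1)] F'(2) G'(2)
    proof eventually_elim
      case (elim X)
      then show ?case using delta_mult[where F = F and G = G, OF elim(1,2)] by simp
    qed
  qed
qed

lemma W_smult: "f \<in> near_regular i p \<Longrightarrow> F \<in> W m n \<Longrightarrow> i + n = N \<Longrightarrow> (\<lambda>X Y. f X * F X Y) \<in> W m N"
  using near_K_smult[of f i p F 1 m n] p by simp

text \<open>If \<delta> G = 0, then \<delta>(B G) = (\<delta> B) G, hence \<beta>(P)(B) G =
  \<beta>(P)(B G). Thus Z is an ideal in the bi-graded ring formed by the W, and this allows
  symmetric products to be computed modulo Z.\<close>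

lemma Z_mult:
  assumes F: "F \<in> Z m n" and G: "G \<in> W m' n'" and M: "m + m' = M" "n + n' = N"
  shows "(\<lambda>X Y. F X Y * G X Y) \<in> Z M N"
proof -
  obtain B where B: "B \<in> near_K 2 m (n - int d) p" "eventually (\<lambda>X. \<forall>Y. F X Y = beta d P B X Y) (zf p)"
    by (rule ZE[OF F])
  have B': "B \<in> near_Y m (n - int d) p" "eventually (\<lambda>X. \<forall>Y. delta (delta B) X Y = 0) (zf p)"
    using B(1) unfolding near_K_eq2 by auto
  have G': "G \<in> near_Y m' n' p" "eventually (\<lambda>X. \<forall>Y. delta G X Y = 0) (zf p)" using G unfolding near_K_eq1 by auto
  have dB: "eventually (\<lambda>X. \<forall>Y. delta (\<lambda>X Y. B X Y * G X Y) X Y = delta B X Y * G X Y) (zf p)"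
    using near_Y_homog[OF B'(1)] near_Y_homog[OF G'(1)] G'(2)
  proof eventually_elim
    case (elim X)
    then show ?case using delta_mult[where F = B and G = G, OF elim(1,2)] by simp
  qed
  have "(\<lambda>X Y. B X Y * G X Y) \<in> near_K 2 M (N - int d) p"
    unfolding near_K_eq2
  proof
    show "(\<lambda>X Y. B X Y * G X Y) \<in> near_Y M (N - int d) p"
      by (rule near_Y_mult_deg[OF B'(1) G'(1) p M(1)]) (use M(2) in simp)
    show "eventually (\<lambda>X. \<forall>Y. delta (delta (\<lambda>X Y. B X Y * G X Y)) X Y = 0) (zf p)"
      using near_Y_homog[OF B'(1)] near_Y_homog[OF G'(1)] G'(2) B'(2) dB
    proof eventually_elim
      case (elim X)
      have "delta (\<lambda>X Y. B X Y * G X Y) X = (\<lambda>X Y. delta B X Y * G X Y) X" using elim(5) by auto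
      then have "delta (delta (\<lambda>X Y. B X Y * G X Y)) X = delta (\<lambda>X Y. delta B X Y * G X Y) X" by (rule delta_cong)
      then show ?case
        using delta_mult[where F = "delta B" and G = G, OF delta_homog[where F = B, OF elim(1)] elim(2)] elim(3,4) by simp
    qed
  qed
  then show ?thesis
  proof (rule ZI)
    show "eventually (\<lambda>X. \<forall>Y. F X Y * G X Y = beta d P (\<lambda>X Y. B X Y * G X Y) X Y) (zf p)"
      using B(2) dB
    proof eventually_elim
      case (elim X)
      show ?case by (simp only: elim[rule_format] beta_dP) (simp add: algebra_simps)
    qed
  qed
qed

text \<open>On Ker \<delta> the map \<beta>(P) is multiplication by P, so P h F is its value at h
  F.\<close>

lemma P_mult_Z:
  assumes h: "h \<in> near_regular i p" and F: "F \<in> W m n" and N: "i + n + int d = N"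
  shows "(\<lambda>X Y. P X * h X * F X Y) \<in> Z m N"
proof -
  have 1: "(\<lambda>X Y. h X * F X Y) \<in> W m (N - int d)" by (rule W_smult[OF h F]) (use N in simp)
  then have z: "eventually (\<lambda>X. \<forall>Y. delta (\<lambda>X Y. h X * F X Y) X Y = 0) (zf p)" unfolding near_K_eq1 by simp
  have "(\<lambda>X Y. h X * F X Y) \<in> near_K 2 m (N - int d) p"
    unfolding near_K_eq2
  proof
    show "(\<lambda>X Y. h X * F X Y) \<in> near_Y m (N - int d) p" using 1 unfolding near_K_eq1 by simp
    show "eventually (\<lambda>X. \<forall>Y. delta (delta (\<lambda>X Y. h X * F X Y)) X Y = 0) (zf p)"
      using z
    proof eventually_elim
      case (elim X)
      then have "delta (\<lambda>X Y. h X * F X Y) X = (\<lambda>X Y. 0) X" by auto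
      then have "delta (delta (\<lambda>X Y. h X * F X Y)) X = delta (\<lambda>X Y. 0) X" by (rule delta_cong)
      then show ?case by (simp add: delta_zero)
    qed
  qed
  then show ?thesis
    by (rule ZI) (use z in eventually_elim, simp add: beta_dP algebra_simps)
qed

lemma cong_mult_Z:
  assumes c: "cong i f g" and F: "F \<in> W m n" and N: "i + n = N"
  shows "(\<lambda>X Y. (g X - f X) * F X Y) \<in> Z m N"
proof -
  obtain h where h: "h \<in> near_regular (i - int d) p" "eventually (\<lambda>X. g X = f X + P X * h X) (zf p)"
    using c by (auto simp: cong_def)
  have "(\<lambda>X Y. P X * h X * F X Y) \<in> Z m N" by (rule P_mult_Z[OF h(1) F]) (use N in simp)
  then show ?thesis by (rule Z_cong) (use h(2) in eventually_elim, simp)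
qed

text \<open>Since h has degree \<open>- d\<close>, Euler's formula turns \<delta> of
  \<open>dY h\<close> into \<open>- d h\<close>. So \<beta>(P) of \<open>dY h\<close> is P
  \<open>dY h\<close> plus h times \<open>d dP\<close>, and \<open>d dP\<close> is the unnormalised
  differential \<open>dY P\<close>: together the differential of P h. Thus the conormal relation
  lies in the image of \<beta>(P).\<close>

lemma dY_P_Z:
  assumes h: "h \<in> near_regular (- int d) p"
  shows "dY (\<lambda>X. P X * h X) \<in> Z 1 (-1)"
proof -
  have "- int d - 1 = - 1 - int d" by simp
  with dY_near[OF h p] have Y: "dY h \<in> near_Y 1 (- 1 - int d) p" by (simp only:)
  have e: "eventually (\<lambda>X. (\<Sum>i\<in>UNIV. X $ i * partial i h X) = - of_nat d * h X) (zf p)"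
    using near_regular_pd(3)[OF h p] by simp
  have "dY h \<in> near_K 2 1 (- 1 - int d) p"
    unfolding near_K_eq2
  proof
    show "eventually (\<lambda>X. \<forall>Y. delta (delta (dY h)) X Y = 0) (zf p)"
    proof -
      have "delta (dY h) = (\<lambda>X Y. \<Sum>i\<in>UNIV. X $ i * partial i h X)" by (intro ext) (rule delta_dY)
      then show ?thesis by (simp only:) (simp add: delta_def)
    qed
  qed (rule Y)
  then show ?thesis
  proof (rule ZI)
    show "eventually (\<lambda>X. \<forall>Y. dY (\<lambda>X. P X * h X) X Y = beta d P (dY h) X Y) (zf p)"
      using dY_mult[OF P_near[OF p] h p] e
    proof eventually_elim
      case (elim X)
      have "dP X Y * of_nat d = dY P X Y" for Y using d by (simp add: dP_def dY_def)
      then show ?case using elim by (simp add: beta_dP delta_dY algebra_simps)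
    qed
  qed
qed

text \<open>This makes the differential well defined on germs of O_H, modulo Z.\<close>

lemma dY_cong_Z:
  assumes f: "f \<in> near_regular 0 p" and c: "cong 0 f g"
  shows "(\<lambda>X Y. dY g X Y - dY f X Y) \<in> Z 1 (-1)"
proof -
  obtain h where h: "h \<in> near_regular (0 - int d) p" "eventually (\<lambda>X. g X = f X + P X * h X) (zf p)"
    using c by (auto simp: cong_def)
  have Ph: "(\<lambda>X. P X * h X) \<in> near_regular 0 p" by (rule near_regular_mult_deg[OF P_near[OF p] h(1) p]) simp
  have s: "(\<lambda>X. f X + P X * h X) \<in> near_regular 0 p" by (rule near_regular_add[OF f Ph p])
  have g': "eventually (\<lambda>X. f X + P X * h X = g X) (zf p)" using h(2) by eventually_elim simp
  have "dY (\<lambda>X. P X * h X) \<in> Z 1 (-1)" by (rule dY_P_Z) (use h(1) in simp)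
  then show ?thesis
  proof (rule Z_cong)
    show "eventually (\<lambda>X. \<forall>Y. dY (\<lambda>X. P X * h X) X Y = dY g X Y - dY f X Y) (zf p)"
      using dY_cong[OF s g' p] dY_add[OF f Ph p]
    proof eventually_elim
      case (elim X)
      show ?case by (simp only: elim(1)[rule_format, symmetric] elim(2)[rule_format]) simp
    qed
  qed
qed

text \<open>Serves the presentations of differentials, symmetric powers and tensor products alike:
  representatives of sums, products and 1 are congruent modulo P to the expected functions, and a
  multiple of P times an element of W lies in Z.\<close>

lemma evaluation_W:
  assumes "presentation A G R" "\<And>g. g \<in> G \<Longrightarrow> \<phi> g \<in> W m n"
  shows "evaluation A G R (W m n) (Z m n) rep \<phi>"
proof -
  interpret presentation A G R by fact
  show ?thesis
  proof unfold_locales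
    fix a b f assume ab: "a \<in> carrier A" "b \<in> carrier A" and f: "f \<in> W m n"
    note ra = rep[OF ab(1)] and rb = rep[OF ab(2)]
    have "cong 0 (\<lambda>X. rep a X + rep b X) (rep (a \<oplus>\<^bsub>A\<^esub> b))"
      by (rule rep_cong) (use ra rb A_add[OF ra(1) rb(1)] near_regular_add[OF ra(1) rb(1) p] F.R.a_closed[OF ab] in auto)
    from cong_mult_Z[OF this f, of n]
    show "(\<lambda>x y. (rep (a \<oplus>\<^bsub>A\<^esub> b) x - rep a x - rep b x) * f x y) \<in> Z m n" by (simp add: diff_diff_eq)
    have "cong 0 (\<lambda>X. rep a X * rep b X) (rep (a \<otimes>\<^bsub>A\<^esub> b))"
      by (rule rep_cong) (use ra rb A_mult[OF ra(1) rb(1)] near_regular_mult[OF ra(1) rb(1) p] F.R.m_closed[OF ab] in auto)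
    from cong_mult_Z[OF this f, of n]
    show "(\<lambda>x y. (rep (a \<otimes>\<^bsub>A\<^esub> b) x - rep a x * rep b x) * f x y) \<in> Z m n" by simp
  next
    fix f assume f: "f \<in> W m n"
    have "cong 0 (\<lambda>X. 1) (rep \<one>\<^bsub>A\<^esub>)"
      by (rule rep_cong) (use F.R.one_closed near_regular_const[OF p] in \<open>auto simp: A_simps\<close>)
    from cong_mult_Z[OF this f, of n] show "(\<lambda>x y. (rep \<one>\<^bsub>A\<^esub> x - 1) * f x y) \<in> Z m n" by simp
  next
    fix a f assume a: "a \<in> carrier A"
    show "f \<in> Z m n \<Longrightarrow> (\<lambda>x y. rep a x * f x y) \<in> Z m n" by (rule Z_smult[OF rep(1)[OF a]]) auto
    show "f \<in> W m n \<Longrightarrow> (\<lambda>x y. rep a x * f x y) \<in> W m n" by (rule W_smult[OF rep(1)[OF a]]) auto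
  qed (use assms(2) p Z_zero Z_add Z_neg near_K_zero near_K_add rep_zero in auto)
qed

end

section \<open>Symmetric differentials at a point\<close>

context stalk
begin

abbreviation "Kc \<equiv> OH_constants d P p"

lemma Kc_closed: "Kc \<subseteq> carrier A"
  using near_regular_const[OF p] germ_closed by (auto simp: OH_constants_def)

lemma presentation_kaehler: "presentation A (carrier A) (kaehler_rels A Kc)"
proof (rule presentation.intro[OF cring_A])
  interpret F: module A "free_module A (carrier A)" by (rule module_free_module[OF cring_A])
  note e = free_gen_closed[OF cring_A, of _ "carrier A"]
  show "kaehler_rels A Kc \<subseteq> carrier (free_module A (carrier A))"
  proof
    fix r assume "r \<in> kaehler_rels A Kc"
    then consider (add) a b where "a \<in> carrier A" "b \<in> carrier A"
        "r = free_gen A (a \<oplus>\<^bsub>A\<^esub> b) \<ominus>\<^bsub>free_module A (carrier A)\<^esub> (free_gen A a \<oplus>\<^bsub>free_module A (carrier A)\<^esub> free_gen A b)"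
      | (mult) a b where "a \<in> carrier A" "b \<in> carrier A"
        "r = free_gen A (a \<otimes>\<^bsub>A\<^esub> b) \<ominus>\<^bsub>free_module A (carrier A)\<^esub>
          (a \<odot>\<^bsub>free_module A (carrier A)\<^esub> free_gen A b \<oplus>\<^bsub>free_module A (carrier A)\<^esub> b \<odot>\<^bsub>free_module A (carrier A)\<^esub> free_gen A a)"
      | (const) c where "c \<in> Kc" "r = free_gen A c"
      unfolding kaehler_rels_def Let_def by blast
    then show "r \<in> carrier (free_module A (carrier A))"
    proof cases
      case add then show ?thesis
        by (simp only:) (intro F.M.minus_closed F.M.a_closed e F.R.a_closed)
    next
      case mult then show ?thesis
        by (simp only:) (intro F.M.minus_closed F.M.a_closed F.smult_closed e F.R.m_closed)
    next
      case const then show ?thesis using Kc_closed e by auto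
    qed
  qed
qed

lemma evaluation_kaehler: "evaluation A (carrier A) (kaehler_rels A Kc) (W 1 (-1)) (Z 1 (-1)) rep (\<lambda>a. dY (rep a))"
  by (rule evaluation_W[OF presentation_kaehler]) (rule dY_near_K[OF rep(1) p])

lemma dY_rep_Z: "f \<in> near_regular 0 p \<Longrightarrow> (\<lambda>X Y. dY (rep (germ 0 f)) X Y - dY f X Y) \<in> Z 1 (-1)"
  by (rule dY_cong_Z) (auto intro: rep_cong germ_closed)

text \<open>Modulo Z, \<open>dY\<close> of a representative is additive, obeys the Leibniz rule and
  kills constants; these are the relations that define the differentials.\<close>

lemma lifting_kaehler: "lifting A (carrier A) (kaehler_rels A Kc) (W 1 (-1)) (Z 1 (-1)) rep (\<lambda>a. dY (rep a))"
proof (intro lifting.intro lifting_axioms.intro evaluation_kaehler)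
  interpret E: evaluation A "carrier A" "kaehler_rels A Kc" "W 1 (-1)" "Z 1 (-1)" rep "\<lambda>a. dY (rep a)"
    by (rule evaluation_kaehler)
  fix r assume "r \<in> kaehler_rels A Kc"
  then consider (add) a b where "a \<in> carrier A" "b \<in> carrier A" "r = E.e (a \<oplus>\<^bsub>A\<^esub> b) \<ominus>\<^bsub>E.F\<^esub> (E.e a \<oplus>\<^bsub>E.F\<^esub> E.e b)"
    | (mult) a b where "a \<in> carrier A" "b \<in> carrier A"
        "r = E.e (a \<otimes>\<^bsub>A\<^esub> b) \<ominus>\<^bsub>E.F\<^esub> (a \<odot>\<^bsub>E.F\<^esub> E.e b \<oplus>\<^bsub>E.F\<^esub> b \<odot>\<^bsub>E.F\<^esub> E.e a)"
    | (const) c where "c \<in> Kc" "r = E.e c"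
    unfolding kaehler_rels_def Let_def by blast
  then show "E.ev r \<in> Z 1 (-1)"
  proof cases
    case add
    note ra = rep[OF add(1)] and rb = rep[OF add(2)]
    have s: "(\<lambda>X. rep a X + rep b X) \<in> near_regular 0 p" by (rule near_regular_add[OF ra(1) rb(1) p])
    have "(\<lambda>X Y. dY (rep (a \<oplus>\<^bsub>A\<^esub> b)) X Y - dY (\<lambda>X. rep a X + rep b X) X Y) \<in> Z 1 (-1)"
      using dY_rep_Z[OF s] A_add[OF ra(1) rb(1)] ra(2) rb(2) by simp
    then have "(\<lambda>X Y. dY (rep (a \<oplus>\<^bsub>A\<^esub> b)) X Y - (dY (rep a) X Y + dY (rep b) X Y)) \<in> Z 1 (-1)"
      by (rule Z_cong) (use dY_add[OF ra(1) rb(1) p] in eventually_elim, simp)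
    moreover have "E.evaluates r (\<lambda>X Y. dY (rep (a \<oplus>\<^bsub>A\<^esub> b)) X Y - (dY (rep a) X Y + dY (rep b) X Y))"
      unfolding add(3) by (intro E.evaluates_minus E.evaluates_add E.evaluates_gen E.F.R.a_closed add)
    ultimately show ?thesis by (rule E.evaluates_Z[rotated])
  next
    case mult
    note ra = rep[OF mult(1)] and rb = rep[OF mult(2)]
    have s: "(\<lambda>X. rep a X * rep b X) \<in> near_regular 0 p" by (rule near_regular_mult_deg[OF ra(1) rb(1) p]) simp
    have "(\<lambda>X Y. dY (rep (a \<otimes>\<^bsub>A\<^esub> b)) X Y - dY (\<lambda>X. rep a X * rep b X) X Y) \<in> Z 1 (-1)"
      using dY_rep_Z[OF s] A_mult[OF ra(1) rb(1)] ra(2) rb(2) by simp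
    then have "(\<lambda>X Y. dY (rep (a \<otimes>\<^bsub>A\<^esub> b)) X Y - (rep a X * dY (rep b) X Y + rep b X * dY (rep a) X Y)) \<in> Z 1 (-1)"
      by (rule Z_cong) (use dY_mult[OF ra(1) rb(1) p] in eventually_elim, simp)
    moreover have "E.evaluates r (\<lambda>X Y. dY (rep (a \<otimes>\<^bsub>A\<^esub> b)) X Y - (rep a X * dY (rep b) X Y + rep b X * dY (rep a) X Y))"
      unfolding mult(3)
      by (rule E.evaluates_minus[OF E.evaluates_gen[OF E.F.R.m_closed[OF mult(1,2)]]
            E.evaluates_add[OF E.evaluates_smult[OF mult(1) E.evaluates_gen[OF mult(2)]]
              E.evaluates_smult[OF mult(2) E.evaluates_gen[OF mult(1)]]]])
    ultimately show ?thesis by (rule E.evaluates_Z[rotated])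
  next
    case const
    then obtain c' where c': "c = germ 0 (\<lambda>X. c')" by (auto simp: OH_constants_def)
    have "dY (rep c) \<in> Z 1 (-1)" using dY_rep_Z[OF near_regular_const[OF p, of c']] by (simp add: c' dY_const)
    moreover have "E.evaluates r (dY (rep c))" unfolding const(2) by (rule E.evaluates_gen) (use const(1) Kc_closed in blast)
    ultimately show ?thesis by (rule E.evaluates_Z[rotated])
  qed
qed

sublocale Om: lifting A "carrier A" "kaehler_rels A Kc" "W 1 (-1)" "Z 1 (-1)" rep "\<lambda>a. dY (rep a)"
  by (rule lifting_kaehler)

lemma Omega_eq: "Omega_stalk d P p = Om.PM"
  by (simp add: Omega_stalk_def kaehler_def)

abbreviation "dd f \<equiv> Om.gen (germ 0 f)"

lemma dd_closed: "f \<in> near_regular 0 p \<Longrightarrow> dd f \<in> carrier Om.PM"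
  by (rule Om.gen_closed) (rule germ_closed)

lemma dd_add:
  assumes f: "f \<in> near_regular 0 p" and g: "g \<in> near_regular 0 p"
  shows "dd (\<lambda>X. f X + g X) = dd f \<oplus>\<^bsub>Om.PM\<^esub> dd g"
proof -
  let ?a = "germ 0 f" and ?b = "germ 0 g"
  note ab = germ_closed[OF f] germ_closed[OF g]
  have "Om.e (?a \<oplus>\<^bsub>A\<^esub> ?b) \<ominus>\<^bsub>Om.F\<^esub> (Om.e ?a \<oplus>\<^bsub>Om.F\<^esub> Om.e ?b) \<in> kaehler_rels A Kc"
    unfolding kaehler_rels_def Let_def using ab by blast
  from Om.relation_eq[OF this Om.e_closed[OF Om.F.R.a_closed[OF ab]] Om.F.M.a_closed[OF Om.e_closed[OF ab(1)] Om.e_closed[OF ab(2)]]]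
  show ?thesis using A_add[OF f g] Om.proj_add[OF Om.e_closed[OF ab(1)] Om.e_closed[OF ab(2)]]
    by (simp add: Om.gen_eq)
qed

lemma dd_mult:
  assumes f: "f \<in> near_regular 0 p" and g: "g \<in> near_regular 0 p"
  shows "dd (\<lambda>X. f X * g X) = germ 0 f \<odot>\<^bsub>Om.PM\<^esub> dd g \<oplus>\<^bsub>Om.PM\<^esub> germ 0 g \<odot>\<^bsub>Om.PM\<^esub> dd f"
proof -
  let ?a = "germ 0 f" and ?b = "germ 0 g"
  note ab = germ_closed[OF f] germ_closed[OF g]
  note c1 = Om.F.smult_closed[OF ab(1) Om.e_closed[OF ab(2)]]
  note c2 = Om.F.smult_closed[OF ab(2) Om.e_closed[OF ab(1)]]
  have "Om.e (?a \<otimes>\<^bsub>A\<^esub> ?b) \<ominus>\<^bsub>Om.F\<^esub> (?a \<odot>\<^bsub>Om.F\<^esub> Om.e ?b \<oplus>\<^bsub>Om.F\<^esub> ?b \<odot>\<^bsub>Om.F\<^esub> Om.e ?a) \<in> kaehler_rels A Kc"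
    unfolding kaehler_rels_def Let_def using ab by blast
  from Om.relation_eq[OF this Om.e_closed[OF Om.F.R.m_closed[OF ab]] Om.F.M.a_closed[OF c1 c2]]
  show ?thesis
    unfolding Om.gen_eq A_mult[OF f g] Om.proj_add[OF c1 c2] Om.proj_smult[OF ab(1) Om.e_closed[OF ab(2)]]
      Om.proj_smult[OF ab(2) Om.e_closed[OF ab(1)]] .
qed

lemma dd_const: "dd (\<lambda>X. c) = \<zero>\<^bsub>Om.PM\<^esub>"
proof -
  have "Om.e (germ 0 (\<lambda>X. c)) \<in> kaehler_rels A Kc"
    unfolding kaehler_rels_def Let_def OH_constants_def by blast
  then show ?thesis unfolding Om.gen_eq by (rule Om.relation_zero)
qed

lemma near_K_const: "f \<in> near_regular n p \<Longrightarrow> (\<lambda>X Y. f X) \<in> W 0 n"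
proof -
  assume f: "f \<in> near_regular n p"
  have "delta (\<lambda>X Y. f X) X Y = 0" for X Y by (simp add: delta_def)
  then show ?thesis unfolding near_K_eq1 using near_Y_const[OF f p] by simp
qed

definition prodl :: "(((complex ^ 'n \<Rightarrow> complex) set \<Rightarrow> (complex ^ 'n \<Rightarrow> complex) set) set) list
    \<Rightarrow> complex ^ 'n \<Rightarrow> complex ^ 'n \<Rightarrow> complex" where
  "prodl xs X Y = (\<Prod>x\<leftarrow>xs. Om.lift x X Y)"

lemma prodl_append: "prodl (xs @ ys) X Y = prodl xs X Y * prodl ys X Y"
  by (simp add: prodl_def)

lemma prodl_single: "prodl [x] X Y = Om.lift x X Y"
  by (simp add: prodl_def)

lemma prodl_W: "set xs \<subseteq> carrier Om.PM \<Longrightarrow> prodl xs \<in> W (length xs) (- int (length xs))"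
proof (induction xs)
  case Nil
  show ?case using near_K_const[OF near_regular_const[OF p, of 1]] by (simp add: prodl_def[abs_def])
next
  case (Cons x xs)
  have "(\<lambda>X Y. Om.lift x X Y * prodl xs X Y) \<in> W (length (x # xs)) (- int (length (x # xs)))"
    by (rule W_mult[OF Om.lift_W Cons.IH]) (use Cons.prems in auto)
  then show ?case by (simp add: prodl_def[abs_def])
qed

text \<open>The linearity relations of the symmetric power change one factor of a product. As Z is
  an ideal, it suffices that this factor changes by an element of Z.\<close>

lemma prodl_middle_Z:
  assumes F: "F \<in> Z 1 (-1)" and xs: "set xs \<subseteq> carrier Om.PM" "set ys \<subseteq> carrier Om.PM" "m = length xs + 1 + length ys"
  shows "(\<lambda>X Y. prodl xs X Y * F X Y * prodl ys X Y) \<in> Z m (- int m)"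
proof -
  have "(\<lambda>X Y. (F X Y * prodl xs X Y) * prodl ys X Y) \<in> Z m (- int m)"
    by (rule Z_mult[OF Z_mult[OF F prodl_W[OF xs(1)] refl refl] prodl_W[OF xs(2)]]) (use xs(3) in auto)
  then show ?thesis by (simp add: mult_ac)
qed

text \<open>The second conjunct is carried through the induction because Z may only be multiplied by
  elements of W.\<close>

lemma prodl_dd:
  "(\<And>f. f \<in> set fs \<Longrightarrow> f \<in> near_regular 0 p) \<Longrightarrow>
    (\<lambda>X Y. prodl (map dd fs) X Y - (\<Prod>f\<leftarrow>fs. dY f X Y)) \<in> Z (length fs) (- int (length fs))
    \<and> (\<lambda>X Y. \<Prod>f\<leftarrow>fs. dY f X Y) \<in> W (length fs) (- int (length fs))"
proof (induction fs)
  case Nil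
  show ?case using near_K_const[OF near_regular_const[OF p, of 1]] Z_zero by (simp add: prodl_def)
next
  case (Cons f fs)
  let ?n = "length (f # fs)"
  note f = Cons.prems[of f, simplified]
  define G where "G X Y = (\<Prod>f\<leftarrow>fs. dY f X Y)" for X Y
  have IH: "(\<lambda>X Y. prodl (map dd fs) X Y - G X Y) \<in> Z (length fs) (- int (length fs))"
    "G \<in> W (length fs) (- int (length fs))"
    using Cons unfolding G_def[abs_def] by auto
  have W1: "(\<lambda>X Y. dY f X Y * G X Y) \<in> W ?n (- int ?n)"
    by (rule W_mult[OF dY_near_K[OF f p] IH(2)]) auto
  have "(\<lambda>X Y. Om.lift (dd f) X Y - dY (rep (germ 0 f)) X Y) \<in> Z 1 (-1)"
    by (rule Om.lift_gen[OF germ_closed[OF f], unfolded Om.eqv_def])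
  from Z_add[OF this dY_rep_Z[OF f]] have "(\<lambda>X Y. Om.lift (dd f) X Y - dY f X Y) \<in> Z 1 (-1)" by simp
  then have 1: "(\<lambda>X Y. (Om.lift (dd f) X Y - dY f X Y) * G X Y) \<in> Z ?n (- int ?n)"
    by (rule Z_mult[OF _ IH(2)]) auto
  have 2: "(\<lambda>X Y. (prodl (map dd fs) X Y - G X Y) * Om.lift (dd f) X Y) \<in> Z ?n (- int ?n)"
    by (rule Z_mult[OF IH(1) Om.lift_W[OF dd_closed[OF f]]]) auto
  \<comment> \<open>Telescoping for two factors: l p - l' p' = (l - l') p' + (p - p') l.\<close>
  from Z_add[OF 1 2]
  have "(\<lambda>X Y. Om.lift (dd f) X Y * prodl (map dd fs) X Y - dY f X Y * G X Y) \<in> Z ?n (- int ?n)"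
    by (simp add: algebra_simps)
  then show ?case using W1 by (simp add: prodl_def G_def)
qed

end

section \<open>Symmetric powers, twists and symbols at a point\<close>

locale symbol_stalk = stalk d P p for d and P :: "complex ^ 'n::finite \<Rightarrow> complex" and p +
  fixes m :: nat and k :: int
begin

abbreviation "gens \<equiv> sym_gens m Om.PM"

lemma sym_rels_cases:
  assumes "r \<in> sym_rels A m Om.PM"
  obtains (add) xs x y ys where "x \<in> carrier Om.PM" "y \<in> carrier Om.PM" "xs @ [x] @ ys \<in> gens"
      "xs @ [y] @ ys \<in> gens" "xs @ [x \<oplus>\<^bsub>Om.PM\<^esub> y] @ ys \<in> gens"
      "r = free_gen A (xs @ [x \<oplus>\<^bsub>Om.PM\<^esub> y] @ ys) \<ominus>\<^bsub>free_module A gens\<^esub>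
        (free_gen A (xs @ [x] @ ys) \<oplus>\<^bsub>free_module A gens\<^esub> free_gen A (xs @ [y] @ ys))"
  | (smult) a xs x ys where "a \<in> carrier A" "x \<in> carrier Om.PM" "xs @ [x] @ ys \<in> gens" "xs @ [a \<odot>\<^bsub>Om.PM\<^esub> x] @ ys \<in> gens"
      "r = free_gen A (xs @ [a \<odot>\<^bsub>Om.PM\<^esub> x] @ ys) \<ominus>\<^bsub>free_module A gens\<^esub> a \<odot>\<^bsub>free_module A gens\<^esub> free_gen A (xs @ [x] @ ys)"
  | (swap) xs x y ys where "xs @ [x, y] @ ys \<in> gens" "xs @ [y, x] @ ys \<in> gens"
      "r = free_gen A (xs @ [x, y] @ ys) \<ominus>\<^bsub>free_module A gens\<^esub> free_gen A (xs @ [y, x] @ ys)"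
  using assms unfolding sym_rels_def Let_def
proof (elim UnE CollectE exE conjE)
  fix xs x y ys
  assume r: "r = free_gen A (xs @ [x \<oplus>\<^bsub>Om.PM\<^esub> y] @ ys) \<ominus>\<^bsub>free_module A gens\<^esub>
        (free_gen A (xs @ [x] @ ys) \<oplus>\<^bsub>free_module A gens\<^esub> free_gen A (xs @ [y] @ ys))"
    and xy: "x \<in> carrier Om.PM" "y \<in> carrier Om.PM" "xs @ [x] @ ys \<in> gens"
  have "xs @ [y] @ ys \<in> gens" "xs @ [x \<oplus>\<^bsub>Om.PM\<^esub> y] @ ys \<in> gens"
    using xy Om.PM.M.a_closed[OF xy(1,2)] by (auto simp: sym_gens_def)
  then show thesis by (rule add[OF xy _ _ r])
next
  fix a xs x ys
  assume r: "r = free_gen A (xs @ [a \<odot>\<^bsub>Om.PM\<^esub> x] @ ys) \<ominus>\<^bsub>free_module A gens\<^esub> a \<odot>\<^bsub>free_module A gens\<^esub> free_gen A (xs @ [x] @ ys)"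
    and a: "a \<in> carrier A" and x: "xs @ [x] @ ys \<in> gens"
  then have x': "x \<in> carrier Om.PM" by (simp add: sym_gens_def)
  then have "xs @ [a \<odot>\<^bsub>Om.PM\<^esub> x] @ ys \<in> gens"
    using x Om.PM.smult_closed[OF a x'] by (auto simp: sym_gens_def)
  then show thesis by (rule smult[OF a x' x _ r])
next
  fix xs x y ys
  assume r: "r = free_gen A (xs @ [x, y] @ ys) \<ominus>\<^bsub>free_module A gens\<^esub> free_gen A (xs @ [y, x] @ ys)"
    and x: "xs @ [x, y] @ ys \<in> gens"
  then have "xs @ [y, x] @ ys \<in> gens" by (auto simp: sym_gens_def)
  then show thesis by (rule swap[OF x _ r])
qed

lemma presentation_sym: "presentation A gens (sym_rels A m Om.PM)"
proof (rule presentation.intro[OF cring_A])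
  interpret F: module A "free_module A gens" by (rule module_free_module[OF cring_A])
  note e = free_gen_closed[OF cring_A, of _ gens]
  show "sym_rels A m Om.PM \<subseteq> carrier (free_module A gens)"
  proof
    fix r assume "r \<in> sym_rels A m Om.PM"
    then show "r \<in> carrier (free_module A gens)"
    proof (cases rule: sym_rels_cases)
      case add then show ?thesis by (simp only:) (intro F.M.minus_closed F.M.a_closed e)
    next
      case smult then show ?thesis by (simp only:) (intro F.M.minus_closed F.smult_closed e)
    next
      case swap then show ?thesis by (simp only:) (intro F.M.minus_closed e)
    qed
  qed
qed

lemma evaluation_sym: "evaluation A gens (sym_rels A m Om.PM) (W m (- int m)) (Z m (- int m)) rep prodl"
  by (rule evaluation_W[OF presentation_sym]) (use prodl_W in \<open>auto simp: sym_gens_def\<close>)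

lemma lifting_sym: "lifting A gens (sym_rels A m Om.PM) (W m (- int m)) (Z m (- int m)) rep prodl"
proof (intro lifting.intro lifting_axioms.intro evaluation_sym)
  interpret E: evaluation A gens "sym_rels A m Om.PM" "W m (- int m)" "Z m (- int m)" rep prodl
    by (rule evaluation_sym)
  fix r assume "r \<in> sym_rels A m Om.PM"
  then show "E.ev r \<in> Z m (- int m)"
  proof (cases rule: sym_rels_cases)
    case (add xs x y ys)
    have "(\<lambda>X Y. prodl xs X Y * (Om.lift (x \<oplus>\<^bsub>Om.PM\<^esub> y) X Y - (Om.lift x X Y + Om.lift y X Y)) * prodl ys X Y) \<in> Z m (- int m)"
      by (rule prodl_middle_Z[OF Om.lift_add[OF add(1,2), unfolded Om.eqv_def]]) (use add(3) in \<open>auto simp: sym_gens_def\<close>)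
    then have "(\<lambda>X Y. prodl (xs @ [x \<oplus>\<^bsub>Om.PM\<^esub> y] @ ys) X Y - (prodl (xs @ [x] @ ys) X Y + prodl (xs @ [y] @ ys) X Y)) \<in> Z m (- int m)"
      unfolding prodl_append prodl_single by (simp add: algebra_simps)
    moreover have "E.evaluates r (\<lambda>X Y. prodl (xs @ [x \<oplus>\<^bsub>Om.PM\<^esub> y] @ ys) X Y - (prodl (xs @ [x] @ ys) X Y + prodl (xs @ [y] @ ys) X Y))"
      unfolding add(6) by (intro E.evaluates_minus E.evaluates_add E.evaluates_gen add)
    ultimately show ?thesis by (rule E.evaluates_Z[rotated])
  next
    case (smult a xs x ys)
    have "(\<lambda>X Y. prodl xs X Y * (Om.lift (a \<odot>\<^bsub>Om.PM\<^esub> x) X Y - rep a X * Om.lift x X Y) * prodl ys X Y) \<in> Z m (- int m)"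
      by (rule prodl_middle_Z[OF Om.lift_smult[OF smult(1,2), unfolded Om.eqv_def]]) (use smult(3) in \<open>auto simp: sym_gens_def\<close>)
    then have "(\<lambda>X Y. prodl (xs @ [a \<odot>\<^bsub>Om.PM\<^esub> x] @ ys) X Y - rep a X * prodl (xs @ [x] @ ys) X Y) \<in> Z m (- int m)"
      unfolding prodl_append prodl_single by (simp add: algebra_simps)
    moreover have "E.evaluates r (\<lambda>X Y. prodl (xs @ [a \<odot>\<^bsub>Om.PM\<^esub> x] @ ys) X Y - rep a X * prodl (xs @ [x] @ ys) X Y)"
      unfolding smult(5) by (rule E.evaluates_minus[OF E.evaluates_gen[OF smult(4)] E.evaluates_smult[OF smult(1) E.evaluates_gen[OF smult(3)]]])
    ultimately show ?thesis by (rule E.evaluates_Z[rotated])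
  next
    case (swap xs x y ys)
    have "(\<lambda>X Y. prodl (xs @ [x, y] @ ys) X Y - prodl (xs @ [y, x] @ ys) X Y) = (\<lambda>X Y. 0)"
      by (simp add: prodl_def)
    then have "(\<lambda>X Y. prodl (xs @ [x, y] @ ys) X Y - prodl (xs @ [y, x] @ ys) X Y) \<in> Z m (- int m)" using Z_zero by simp
    moreover have "E.evaluates r (\<lambda>X Y. prodl (xs @ [x, y] @ ys) X Y - prodl (xs @ [y, x] @ ys) X Y)"
      unfolding swap(3) by (intro E.evaluates_minus E.evaluates_gen swap)
    ultimately show ?thesis by (rule E.evaluates_Z[rotated])
  qed
qed

sublocale Sy: lifting A gens "sym_rels A m Om.PM" "W m (- int m)" "Z m (- int m)" rep prodl
  by (rule lifting_sym)

abbreviation "sprod xs \<equiv> Sy.gen xs"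

lemma sprod_add:
  assumes x: "x \<in> carrier Om.PM" "y \<in> carrier Om.PM" and xs: "xs @ [x] @ ys \<in> gens"
  shows "sprod (xs @ [x \<oplus>\<^bsub>Om.PM\<^esub> y] @ ys) = sprod (xs @ [x] @ ys) \<oplus>\<^bsub>Sy.PM\<^esub> sprod (xs @ [y] @ ys)"
proof -
  have g: "xs @ [y] @ ys \<in> gens" "xs @ [x \<oplus>\<^bsub>Om.PM\<^esub> y] @ ys \<in> gens"
    using xs x Om.PM.M.a_closed[OF x] by (auto simp: sym_gens_def)
  note e = Sy.e_closed[OF xs] Sy.e_closed[OF g(1)] Sy.e_closed[OF g(2)]
  have "Sy.e (xs @ [x \<oplus>\<^bsub>Om.PM\<^esub> y] @ ys) \<ominus>\<^bsub>Sy.F\<^esub> (Sy.e (xs @ [x] @ ys) \<oplus>\<^bsub>Sy.F\<^esub> Sy.e (xs @ [y] @ ys)) \<in> sym_rels A m Om.PM"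
    unfolding sym_rels_def Let_def using x xs by blast
  from Sy.relation_eq[OF this e(3) Sy.F.M.a_closed[OF e(1,2)]] show ?thesis
    unfolding Sy.gen_eq Sy.proj_add[OF e(1,2)] .
qed

lemma sprod_smult:
  assumes a: "a \<in> carrier A" and xs: "xs @ [x] @ ys \<in> gens"
  shows "sprod (xs @ [a \<odot>\<^bsub>Om.PM\<^esub> x] @ ys) = a \<odot>\<^bsub>Sy.PM\<^esub> sprod (xs @ [x] @ ys)"
proof -
  have g: "xs @ [a \<odot>\<^bsub>Om.PM\<^esub> x] @ ys \<in> gens"
    using xs Om.PM.smult_closed[OF a, of x] by (auto simp: sym_gens_def)
  note e = Sy.e_closed[OF xs] Sy.e_closed[OF g]
  have "Sy.e (xs @ [a \<odot>\<^bsub>Om.PM\<^esub> x] @ ys) \<ominus>\<^bsub>Sy.F\<^esub> a \<odot>\<^bsub>Sy.F\<^esub> Sy.e (xs @ [x] @ ys) \<in> sym_rels A m Om.PM"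
    unfolding sym_rels_def Let_def using a xs by blast
  from Sy.relation_eq[OF this e(2) Sy.F.smult_closed[OF a e(1)]] show ?thesis
    unfolding Sy.gen_eq Sy.proj_smult[OF a e(1)] .
qed

lemma sprod_swap:
  assumes xs: "xs @ [x, y] @ ys \<in> gens"
  shows "sprod (xs @ [x, y] @ ys) = sprod (xs @ [y, x] @ ys)"
proof -
  have g: "xs @ [y, x] @ ys \<in> gens" using xs by (auto simp: sym_gens_def)
  have "Sy.e (xs @ [x, y] @ ys) \<ominus>\<^bsub>Sy.F\<^esub> Sy.e (xs @ [y, x] @ ys) \<in> sym_rels A m Om.PM"
    unfolding sym_rels_def Let_def using xs by blast
  from Sy.relation_eq[OF this Sy.e_closed[OF xs] Sy.e_closed[OF g]] show ?thesis unfolding Sy.gen_eq .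
qed

abbreviation "Tk \<equiv> OH_twist_stalk d P p k"

sublocale Tk: module A Tk by (rule module_T)

lemma tensor_rels_cases:
  assumes "r \<in> tensor_rels A Sy.PM Tk"
  obtains (add1) x y z where "x \<in> carrier Sy.PM" "y \<in> carrier Sy.PM" "z \<in> carrier Tk"
      "r = free_gen A (x \<oplus>\<^bsub>Sy.PM\<^esub> y, z) \<ominus>\<^bsub>free_module A (carrier Sy.PM \<times> carrier Tk)\<^esub>
        (free_gen A (x, z) \<oplus>\<^bsub>free_module A (carrier Sy.PM \<times> carrier Tk)\<^esub> free_gen A (y, z))"
  | (add2) x z w where "x \<in> carrier Sy.PM" "z \<in> carrier Tk" "w \<in> carrier Tk"
      "r = free_gen A (x, z \<oplus>\<^bsub>Tk\<^esub> w) \<ominus>\<^bsub>free_module A (carrier Sy.PM \<times> carrier Tk)\<^esub>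
        (free_gen A (x, z) \<oplus>\<^bsub>free_module A (carrier Sy.PM \<times> carrier Tk)\<^esub> free_gen A (x, w))"
  | (smult1) a x z where "a \<in> carrier A" "x \<in> carrier Sy.PM" "z \<in> carrier Tk"
      "r = free_gen A (a \<odot>\<^bsub>Sy.PM\<^esub> x, z) \<ominus>\<^bsub>free_module A (carrier Sy.PM \<times> carrier Tk)\<^esub>
        a \<odot>\<^bsub>free_module A (carrier Sy.PM \<times> carrier Tk)\<^esub> free_gen A (x, z)"
  | (smult2) a x z where "a \<in> carrier A" "x \<in> carrier Sy.PM" "z \<in> carrier Tk"
      "r = free_gen A (x, a \<odot>\<^bsub>Tk\<^esub> z) \<ominus>\<^bsub>free_module A (carrier Sy.PM \<times> carrier Tk)\<^esub>
        a \<odot>\<^bsub>free_module A (carrier Sy.PM \<times> carrier Tk)\<^esub> free_gen A (x, z)"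
  using assms unfolding tensor_rels_def Let_def
  by (elim UnE CollectE exE conjE) (rule add1 add2 smult1 smult2; assumption)+

lemma presentation_tensor: "presentation A (carrier Sy.PM \<times> carrier Tk) (tensor_rels A Sy.PM Tk)"
proof (rule presentation.intro[OF cring_A])
  interpret F: module A "free_module A (carrier Sy.PM \<times> carrier Tk)" by (rule module_free_module[OF cring_A])
  have e: "free_gen A (x, z) \<in> carrier (free_module A (carrier Sy.PM \<times> carrier Tk))" if "x \<in> carrier Sy.PM" "z \<in> carrier Tk" for x z
    by (rule free_gen_closed[OF cring_A]) (use that in simp)
  show "tensor_rels A Sy.PM Tk \<subseteq> carrier (free_module A (carrier Sy.PM \<times> carrier Tk))"
  proof
    fix r assume "r \<in> tensor_rels A Sy.PM Tk"
    then show "r \<in> carrier (free_module A (carrier Sy.PM \<times> carrier Tk))"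
    proof (cases rule: tensor_rels_cases)
      case add1 then show ?thesis by (simp only:) (intro F.M.minus_closed F.M.a_closed e Sy.PM.M.a_closed)
    next
      case add2 then show ?thesis by (simp only:) (intro F.M.minus_closed F.M.a_closed e Tk.M.a_closed)
    next
      case smult1 then show ?thesis by (simp only:) (intro F.M.minus_closed F.smult_closed e Sy.PM.smult_closed)
    next
      case smult2 then show ?thesis by (simp only:) (intro F.M.minus_closed F.smult_closed e Tk.smult_closed)
    qed
  qed
qed

text \<open>Every differential has degree -1 in X, so m of them times a germ of degree k have degree
  k - m. With k = m + n this is n, which accounts for the twist m + n in the theorem.\<close>

definition tphi where
  "tphi sC X Y = repT k (snd sC) X * Sy.lift (fst sC) X Y"

lemma tphi_W: "s \<in> carrier Sy.PM \<Longrightarrow> C \<in> carrier Tk \<Longrightarrow> tphi (s, C) \<in> W m (k - int m)"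
  unfolding tphi_def[abs_def] using W_smult[OF repT(1)[of C k] Sy.lift_W[of s]] by simp

lemma evaluation_tensor: "evaluation A (carrier Sy.PM \<times> carrier Tk) (tensor_rels A Sy.PM Tk) (W m (k - int m)) (Z m (k - int m)) rep tphi"
  by (rule evaluation_W[OF presentation_tensor]) (use tphi_W in auto)

lemma repT_mult_Z:
  assumes "C \<in> carrier Tk" "f \<in> near_regular k p" "C = germ k f" "s \<in> carrier Sy.PM"
  shows "(\<lambda>X Y. (repT k C X - f X) * Sy.lift s X Y) \<in> Z m (k - int m)"
  by (rule cong_mult_Z[OF repT_cong[OF assms(1-3)] Sy.lift_W[OF assms(4)]]) simp

lemma lifting_tensor: "lifting A (carrier Sy.PM \<times> carrier Tk) (tensor_rels A Sy.PM Tk) (W m (k - int m)) (Z m (k - int m)) rep tphi"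
proof (intro lifting.intro lifting_axioms.intro evaluation_tensor)
  interpret E: evaluation A "carrier Sy.PM \<times> carrier Tk" "tensor_rels A Sy.PM Tk" "W m (k - int m)" "Z m (k - int m)" rep tphi
    by (rule evaluation_tensor)
  have eg: "E.evaluates (E.e (x, z)) (tphi (x, z))" if "x \<in> carrier Sy.PM" "z \<in> carrier Tk" for x z
    by (rule E.evaluates_gen) (use that in simp)
  fix r assume "r \<in> tensor_rels A Sy.PM Tk"
  then show "E.ev r \<in> Z m (k - int m)"
  proof (cases rule: tensor_rels_cases)
    case (add1 x y z)
    have "(\<lambda>X Y. repT k z X * (Sy.lift (x \<oplus>\<^bsub>Sy.PM\<^esub> y) X Y - (Sy.lift x X Y + Sy.lift y X Y))) \<in> Z m (k - int m)"
      by (rule Z_smult[OF repT(1)[OF add1(3)]]) (use Sy.lift_add[OF add1(1,2)] in \<open>auto simp: Sy.eqv_def\<close>)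
    then have "(\<lambda>X Y. tphi (x \<oplus>\<^bsub>Sy.PM\<^esub> y, z) X Y - (tphi (x, z) X Y + tphi (y, z) X Y)) \<in> Z m (k - int m)"
      by (simp add: tphi_def algebra_simps)
    moreover have "E.evaluates r (\<lambda>X Y. tphi (x \<oplus>\<^bsub>Sy.PM\<^esub> y, z) X Y - (tphi (x, z) X Y + tphi (y, z) X Y))"
      unfolding add1(4) by (intro E.evaluates_minus E.evaluates_add eg Sy.PM.M.a_closed add1)
    ultimately show ?thesis by (rule E.evaluates_Z[rotated])
  next
    case (add2 x z w)
    note rz = repT[OF add2(2)] and rw = repT[OF add2(3)]
    have "(\<lambda>X Y. (repT k (z \<oplus>\<^bsub>Tk\<^esub> w) X - (repT k z X + repT k w X)) * Sy.lift x X Y) \<in> Z m (k - int m)"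
      by (rule repT_mult_Z[OF Tk.M.a_closed[OF add2(2,3)] near_regular_add[OF rz(1) rw(1) p] _ add2(1)])
        (use T_add[OF rz(1) rw(1)] rz(2) rw(2) in simp)
    then have "(\<lambda>X Y. tphi (x, z \<oplus>\<^bsub>Tk\<^esub> w) X Y - (tphi (x, z) X Y + tphi (x, w) X Y)) \<in> Z m (k - int m)"
      by (simp add: tphi_def algebra_simps)
    moreover have "E.evaluates r (\<lambda>X Y. tphi (x, z \<oplus>\<^bsub>Tk\<^esub> w) X Y - (tphi (x, z) X Y + tphi (x, w) X Y))"
      unfolding add2(4) by (intro E.evaluates_minus E.evaluates_add eg Tk.M.a_closed add2)
    ultimately show ?thesis by (rule E.evaluates_Z[rotated])
  next
    case (smult1 a x z)
    have "(\<lambda>X Y. repT k z X * (Sy.lift (a \<odot>\<^bsub>Sy.PM\<^esub> x) X Y - rep a X * Sy.lift x X Y)) \<in> Z m (k - int m)"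
      by (rule Z_smult[OF repT(1)[OF smult1(3)]]) (use Sy.lift_smult[OF smult1(1,2)] in \<open>auto simp: Sy.eqv_def\<close>)
    then have "(\<lambda>X Y. tphi (a \<odot>\<^bsub>Sy.PM\<^esub> x, z) X Y - rep a X * tphi (x, z) X Y) \<in> Z m (k - int m)"
      by (simp add: tphi_def algebra_simps)
    moreover have "E.evaluates r (\<lambda>X Y. tphi (a \<odot>\<^bsub>Sy.PM\<^esub> x, z) X Y - rep a X * tphi (x, z) X Y)"
      unfolding smult1(4)
      by (rule E.evaluates_minus[OF eg E.evaluates_smult[OF smult1(1) eg]]) (use smult1 Sy.PM.smult_closed in auto)
    ultimately show ?thesis by (rule E.evaluates_Z[rotated])
  next
    case (smult2 a x z)
    note ra = rep[OF smult2(1)] and rz = repT[OF smult2(3)]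
    have "(\<lambda>X Y. (repT k (a \<odot>\<^bsub>Tk\<^esub> z) X - rep a X * repT k z X) * Sy.lift x X Y) \<in> Z m (k - int m)"
      by (rule repT_mult_Z[OF Tk.smult_closed[OF smult2(1,3)] near_regular_mult_deg[OF ra(1) rz(1) p] _ smult2(2)])
        (use T_smult[OF ra(1) rz(1)] ra(2) rz(2) in simp_all)
    then have "(\<lambda>X Y. tphi (x, a \<odot>\<^bsub>Tk\<^esub> z) X Y - rep a X * tphi (x, z) X Y) \<in> Z m (k - int m)"
      by (simp add: tphi_def algebra_simps)
    moreover have "E.evaluates r (\<lambda>X Y. tphi (x, a \<odot>\<^bsub>Tk\<^esub> z) X Y - rep a X * tphi (x, z) X Y)"
      unfolding smult2(4)
      by (rule E.evaluates_minus[OF eg E.evaluates_smult[OF smult2(1) eg]]) (use smult2 Tk.smult_closed in auto)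
    ultimately show ?thesis by (rule E.evaluates_Z[rotated])
  qed
qed

sublocale Te: lifting A "carrier Sy.PM \<times> carrier Tk" "tensor_rels A Sy.PM Tk" "W m (k - int m)" "Z m (k - int m)" rep tphi
  by (rule lifting_tensor)

lemma Sym_Omega_stalk_eq: "Sym_Omega_stalk d P m k p = Te.PM"
  by (simp add: Sym_Omega_stalk_def tensor_def sym_power_def Omega_eq)

abbreviation "ten x z \<equiv> Te.gen (x, z)"

lemma ten_closed: "x \<in> carrier Sy.PM \<Longrightarrow> z \<in> carrier Tk \<Longrightarrow> ten x z \<in> carrier Te.PM"
  by (rule Te.gen_closed) simp

lemma ten_e_closed: "x \<in> carrier Sy.PM \<Longrightarrow> z \<in> carrier Tk \<Longrightarrow> Te.e (x, z) \<in> carrier Te.F"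
  by (rule Te.e_closed) simp

lemma ten_add1:
  assumes x: "x \<in> carrier Sy.PM" "y \<in> carrier Sy.PM" and z: "z \<in> carrier Tk"
  shows "ten (x \<oplus>\<^bsub>Sy.PM\<^esub> y) z = ten x z \<oplus>\<^bsub>Te.PM\<^esub> ten y z"
proof -
  note e = ten_e_closed[OF x(1) z] ten_e_closed[OF x(2) z] ten_e_closed[OF Sy.PM.M.a_closed[OF x] z]
  have "Te.e (x \<oplus>\<^bsub>Sy.PM\<^esub> y, z) \<ominus>\<^bsub>Te.F\<^esub> (Te.e (x, z) \<oplus>\<^bsub>Te.F\<^esub> Te.e (y, z)) \<in> tensor_rels A Sy.PM Tk"
    unfolding tensor_rels_def Let_def using x z by blast
  from Te.relation_eq[OF this e(3) Te.F.M.a_closed[OF e(1,2)]] show ?thesis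
    unfolding Te.gen_eq Te.proj_add[OF e(1,2)] .
qed

lemma ten_add2:
  assumes x: "x \<in> carrier Sy.PM" and z: "z \<in> carrier Tk" "w \<in> carrier Tk"
  shows "ten x (z \<oplus>\<^bsub>Tk\<^esub> w) = ten x z \<oplus>\<^bsub>Te.PM\<^esub> ten x w"
proof -
  note e = ten_e_closed[OF x z(1)] ten_e_closed[OF x z(2)] ten_e_closed[OF x Tk.M.a_closed[OF z]]
  have "Te.e (x, z \<oplus>\<^bsub>Tk\<^esub> w) \<ominus>\<^bsub>Te.F\<^esub> (Te.e (x, z) \<oplus>\<^bsub>Te.F\<^esub> Te.e (x, w)) \<in> tensor_rels A Sy.PM Tk"
    unfolding tensor_rels_def Let_def using x z by blast
  from Te.relation_eq[OF this e(3) Te.F.M.a_closed[OF e(1,2)]] show ?thesis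
    unfolding Te.gen_eq Te.proj_add[OF e(1,2)] .
qed

lemma ten_smult1:
  assumes a: "a \<in> carrier A" and x: "x \<in> carrier Sy.PM" and z: "z \<in> carrier Tk"
  shows "ten (a \<odot>\<^bsub>Sy.PM\<^esub> x) z = a \<odot>\<^bsub>Te.PM\<^esub> ten x z"
proof -
  note e = ten_e_closed[OF x z] ten_e_closed[OF Sy.PM.smult_closed[OF a x] z]
  have "Te.e (a \<odot>\<^bsub>Sy.PM\<^esub> x, z) \<ominus>\<^bsub>Te.F\<^esub> a \<odot>\<^bsub>Te.F\<^esub> Te.e (x, z) \<in> tensor_rels A Sy.PM Tk"
    unfolding tensor_rels_def Let_def using a x z by blast
  from Te.relation_eq[OF this e(2) Te.F.smult_closed[OF a e(1)]] show ?thesis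
    unfolding Te.gen_eq Te.proj_smult[OF a e(1)] .
qed

lemma ten_smult2:
  assumes a: "a \<in> carrier A" and x: "x \<in> carrier Sy.PM" and z: "z \<in> carrier Tk"
  shows "ten x (a \<odot>\<^bsub>Tk\<^esub> z) = a \<odot>\<^bsub>Te.PM\<^esub> ten x z"
proof -
  note e = ten_e_closed[OF x z] ten_e_closed[OF x Tk.smult_closed[OF a z]]
  have "Te.e (x, a \<odot>\<^bsub>Tk\<^esub> z) \<ominus>\<^bsub>Te.F\<^esub> a \<odot>\<^bsub>Te.F\<^esub> Te.e (x, z) \<in> tensor_rels A Sy.PM Tk"
    unfolding tensor_rels_def Let_def using a x z by blast
  from Te.relation_eq[OF this e(2) Te.F.smult_closed[OF a e(1)]] show ?thesis
    unfolding Te.gen_eq Te.proj_smult[OF a e(1)] .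
qed

definition symb where
  "symb fs h = ten (sprod (map dd fs)) (germ k h)"

lemma Sym_Omega_elem_eq: "Sym_Omega_elem d P m k p fs h = symb fs h"
  by (simp add: Sym_Omega_elem_def tensor_elem_def sym_prod_def sym_power_def Omega_eq kaehler_d_def symb_def)

definition near_list :: "(complex ^ 'n \<Rightarrow> complex) list \<Rightarrow> bool" where
  "near_list fs \<longleftrightarrow> length fs = m \<and> (\<forall>f\<in>set fs. f \<in> near_regular 0 p)"

lemma near_list_gens: "near_list fs \<Longrightarrow> map dd fs \<in> gens"
  by (auto simp: near_list_def sym_gens_def dd_closed)

lemma symb_closed: "near_list fs \<Longrightarrow> h \<in> near_regular k p \<Longrightarrow> symb fs h \<in> carrier Te.PM"
  unfolding symb_def by (intro ten_closed Sy.gen_closed near_list_gens germ_T_closed)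

text \<open>Four choices are undone in turn, each at the price of an element of Z: the
  representative of the tensor, that of the germ of h, that of the symmetric product, and those of
  the differentials. The four differences telescope.\<close>

lemma lift_symb:
  assumes fs: "near_list fs" and h: "h \<in> near_regular k p"
  shows "(\<lambda>X Y. Te.lift (symb fs h) X Y - h X * (\<Prod>f\<leftarrow>fs. dY f X Y)) \<in> Z m (k - int m)"
proof -
  let ?s = "sprod (map dd fs)" and ?C = "germ k h"
  have s: "?s \<in> carrier Sy.PM" by (rule Sy.gen_closed[OF near_list_gens[OF fs]])
  note C = germ_T_closed[OF h]
  have "(\<lambda>X Y. Te.lift (symb fs h) X Y - repT k ?C X * Sy.lift ?s X Y) \<in> Z m (k - int m)"
    using Te.lift_gen[of "(?s, ?C)"] s C by (simp add: Te.eqv_def symb_def tphi_def)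
  moreover have "(\<lambda>X Y. (repT k ?C X - h X) * Sy.lift ?s X Y) \<in> Z m (k - int m)"
    by (rule repT_mult_Z[OF C h refl s])
  moreover have "(\<lambda>X Y. h X * (Sy.lift ?s X Y - prodl (map dd fs) X Y)) \<in> Z m (k - int m)"
    by (rule Z_smult[OF h]) (use Sy.lift_gen[OF near_list_gens[OF fs]] in \<open>auto simp: Sy.eqv_def\<close>)
  moreover have "(\<lambda>X Y. h X * (prodl (map dd fs) X Y - (\<Prod>f\<leftarrow>fs. dY f X Y))) \<in> Z m (k - int m)"
    by (rule Z_smult[OF h]) (use prodl_dd[of fs] fs in \<open>auto simp: near_list_def\<close>)
  ultimately have "(\<lambda>X Y. (Te.lift (symb fs h) X Y - repT k ?C X * Sy.lift ?s X Y)
     + ((repT k ?C X - h X) * Sy.lift ?s X Y + (h X * (Sy.lift ?s X Y - prodl (map dd fs) X Y)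
     + h X * (prodl (map dd fs) X Y - (\<Prod>f\<leftarrow>fs. dY f X Y))))) \<in> Z m (k - int m)"
    by (intro Z_add)
  then show ?thesis by (simp add: algebra_simps)
qed

end

section \<open>Finite sums in modules, and lists with prescribed multiplicities\<close>

lemma abelian_group_l_cancel:
  assumes "abelian_group M" "x \<in> carrier M" "y \<in> carrier M" "z \<in> carrier M" "x \<oplus>\<^bsub>M\<^esub> y = x \<oplus>\<^bsub>M\<^esub> z"
  shows "y = z"
proof -
  interpret abelian_group M by fact
  have "y = \<ominus>\<^bsub>M\<^esub> x \<oplus>\<^bsub>M\<^esub> (x \<oplus>\<^bsub>M\<^esub> y)" by (rule r_neg1[OF assms(2,3), symmetric])
  also have "\<dots> = z" unfolding assms(5) by (rule r_neg1[OF assms(2,4)])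
  finally show ?thesis .
qed

lemma finsum_hom:
  assumes "abelian_group M" "abelian_group N" and I: "finite I" "f \<in> I \<rightarrow> carrier M"
    and c: "\<And>x. x \<in> carrier M \<Longrightarrow> \<psi> x \<in> carrier N"
    and add: "\<And>x y. x \<in> carrier M \<Longrightarrow> y \<in> carrier M \<Longrightarrow> \<psi> (x \<oplus>\<^bsub>M\<^esub> y) = \<psi> x \<oplus>\<^bsub>N\<^esub> \<psi> y"
  shows "\<psi> (finsum M f I) = finsum N (\<lambda>i. \<psi> (f i)) I"
proof -
  interpret M: abelian_group M by fact
  interpret N: abelian_group N by fact
  have z: "\<psi> \<zero>\<^bsub>M\<^esub> = \<zero>\<^bsub>N\<^esub>"
    using add[OF M.zero_closed M.zero_closed] c[OF M.zero_closed] N.add.r_cancel_one' M.l_zero[OF M.zero_closed]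
    by (metis N.add.r_cancel_one)
  show ?thesis using I
  proof (induction I rule: finite_induct)
    case (insert x I)
    have "finsum M f (insert x I) = f x \<oplus>\<^bsub>M\<^esub> finsum M f I"
      by (rule M.finsum_insert) (use insert in auto)
    moreover have "finsum N (\<lambda>i. \<psi> (f i)) (insert x I) = \<psi> (f x) \<oplus>\<^bsub>N\<^esub> finsum N (\<lambda>i. \<psi> (f i)) I"
      by (rule N.finsum_insert) (use insert c in auto)
    ultimately show ?case using insert add M.finsum_closed by auto
  qed (simp add: z)
qed

lemma finsum_submodule:
  assumes M: "module A M" and N: "submodule N A M" and I: "finite I" "f \<in> I \<rightarrow> N"
  shows "finsum M f I \<in> N"
proof -
  interpret module A M by fact
  note E = submoduleE[OF N]
  show ?thesis using I
  proof (induction I rule: finite_induct)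
    case empty
    show ?case using subgroup.one_closed[OF submodule.axioms(1)[OF N]] by simp
  next
    case (insert x I)
    have "finsum M f (insert x I) = f x \<oplus>\<^bsub>M\<^esub> finsum M f I"
      by (rule M.finsum_insert) (use insert E(1) in auto)
    then show ?case using insert E(5) by auto
  qed
qed

lemma prod_list_count: "(\<Prod>j\<leftarrow>js. g j) = (\<Prod>j\<in>UNIV. g j ^ count (mset js) j)"
  for g :: "'n::finite \<Rightarrow> complex"
proof (induction js)
  case (Cons a js)
  have "(\<Prod>j\<in>UNIV. g j ^ count (mset (a # js)) j)
      = (\<Prod>j\<in>UNIV. g j ^ count (mset js) j * (if j = a then g a else 1))"
    by (rule prod.cong) auto
  then show ?case using Cons by (simp add: prod.distrib)
qed simp

text \<open>Monomials are exponent functions, whereas generators of symmetric powers are lists; this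
  picks a list with the given multiplicities. Its order is immaterial by
  \<open>sprod_perm\<close>.\<close>

definition lst :: "('n::finite \<Rightarrow> nat) \<Rightarrow> 'n list" where
  "lst e = (SOME xs. count (mset xs) = e)"

lemma count_lst: "count (mset (lst e)) = e"
proof -
  obtain xs where xs: "mset xs = Abs_multiset e" using ex_mset by blast
  have "count (mset xs) = e" unfolding xs by (rule count_Abs_multiset) simp
  then show ?thesis unfolding lst_def by (rule someI)
qed

lemma length_eq_sum_count: "length xs = (\<Sum>j\<in>UNIV. count (mset xs) (j :: 'n::finite))"
proof (induction xs)
  case (Cons a xs)
  have "(\<Sum>j\<in>UNIV. count (mset (a # xs)) j) = (\<Sum>j\<in>UNIV. count (mset xs) j + (if j = a then 1 else 0))"
    by (rule sum.cong) auto
  then show ?case using Cons by (simp add: sum.distrib)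
qed simp

lemma length_lst: "e \<in> exponents m \<Longrightarrow> length (lst e) = m"
  by (simp add: length_eq_sum_count count_lst exponents_def)

lemma partial_independent: "j \<noteq> i \<Longrightarrow> partial j (\<lambda>X. g (X $ i)) X = 0"
  by (simp add: partial_def)

section \<open>Rules of calculation for symbols\<close>

context symbol_stalk
begin

lemma sprod_move: "zs @ ys @ [x] @ us \<in> gens \<Longrightarrow> sprod (zs @ ys @ [x] @ us) = sprod (zs @ [x] @ ys @ us)"
proof (induction ys arbitrary: zs)
  case (Cons y ys)
  have "sprod ((zs @ [y]) @ ys @ [x] @ us) = sprod ((zs @ [y]) @ [x] @ ys @ us)"
    by (rule Cons.IH) (use Cons.prems in simp)
  also have "\<dots> = sprod (zs @ [y, x] @ (ys @ us))" by simp
  also have "\<dots> = sprod (zs @ [x, y] @ (ys @ us))"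
    by (rule sprod_swap) (use Cons.prems in \<open>auto simp: sym_gens_def\<close>)
  finally show ?case by simp
qed simp

text \<open>The relations provide adjacent transpositions only. The prefix zs collects the entries
  already in place, so that the induction can proceed on the tail.\<close>

lemma sprod_perm: "mset xs = mset ys \<Longrightarrow> zs @ xs \<in> gens \<Longrightarrow> sprod (zs @ xs) = sprod (zs @ ys)"
proof (induction xs arbitrary: ys zs)
  case (Cons x xs)
  have "x \<in> set ys" using Cons.prems(1) by (metis list.set_intros(1) set_mset_mset)
  then obtain us vs where ys: "ys = us @ x # vs" using split_list by metis
  have m: "mset xs = mset (us @ vs)" using Cons.prems(1) ys by simp
  have "sprod ((zs @ [x]) @ xs) = sprod ((zs @ [x]) @ (us @ vs))"
    by (rule Cons.IH[OF m]) (use Cons.prems in simp)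
  also have "\<dots> = sprod (zs @ [x] @ us @ vs)" by simp
  also have "\<dots> = sprod (zs @ us @ [x] @ vs)"
  proof (rule sprod_move[symmetric])
    have "set ys = set (x # xs)" "length ys = length (x # xs)"
      using Cons.prems(1) mset_eq_setD mset_eq_length by metis+
    then show "zs @ us @ [x] @ vs \<in> gens" using Cons.prems(2) ys by (auto simp: sym_gens_def)
  qed
  finally show ?case by (simp add: ys)
qed simp

text \<open>The zero entry is written as 0 times 0, and the scalar is pulled out of the
  product.\<close>

lemma sprod_zero:
  assumes "xs @ [\<zero>\<^bsub>Om.PM\<^esub>] @ ys \<in> gens" shows "sprod (xs @ [\<zero>\<^bsub>Om.PM\<^esub>] @ ys) = \<zero>\<^bsub>Sy.PM\<^esub>"
proof -
  have "sprod (xs @ [\<zero>\<^bsub>A\<^esub> \<odot>\<^bsub>Om.PM\<^esub> \<zero>\<^bsub>Om.PM\<^esub>] @ ys) = \<zero>\<^bsub>A\<^esub> \<odot>\<^bsub>Sy.PM\<^esub> sprod (xs @ [\<zero>\<^bsub>Om.PM\<^esub>] @ ys)"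
    by (rule sprod_smult[OF Om.F.R.zero_closed assms])
  then show ?thesis using Om.PM.smult_l_null[OF Om.PM.M.zero_closed] Sy.PM.smult_l_null[OF Sy.gen_closed[OF assms]] by simp
qed

lemma ten_zero: "z \<in> carrier Tk \<Longrightarrow> ten \<zero>\<^bsub>Sy.PM\<^esub> z = \<zero>\<^bsub>Te.PM\<^esub>"
  using ten_smult1[OF Om.F.R.zero_closed Sy.PM.M.zero_closed, of z]
    Sy.PM.smult_l_null[OF Sy.PM.M.zero_closed] Te.PM.smult_l_null[OF ten_closed[OF Sy.PM.M.zero_closed, of z]] by simp

lemma symb_add:
  assumes "near_list fs" "h \<in> near_regular k p" "h' \<in> near_regular k p"
  shows "symb fs (\<lambda>X. h X + h' X) = symb fs h \<oplus>\<^bsub>Te.PM\<^esub> symb fs h'"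
  unfolding symb_def T_add[OF assms(2,3), symmetric]
  by (rule ten_add2[OF Sy.gen_closed[OF near_list_gens[OF assms(1)]] germ_T_closed[OF assms(2)] germ_T_closed[OF assms(3)]])

lemma symb_smult:
  assumes "near_list fs" "f \<in> near_regular 0 p" "h \<in> near_regular k p"
  shows "symb fs (\<lambda>X. f X * h X) = germ 0 f \<odot>\<^bsub>Te.PM\<^esub> symb fs h"
  unfolding symb_def T_smult[OF assms(2,3), symmetric]
  by (rule ten_smult2[OF germ_closed[OF assms(2)] Sy.gen_closed[OF near_list_gens[OF assms(1)]] germ_T_closed[OF assms(3)]])

lemma symb_cong: "h \<in> near_regular k p \<Longrightarrow> eventually (\<lambda>X. h X = h' X) (zf p) \<Longrightarrow> symb fs h = symb fs h'"
  unfolding symb_def by (simp add: germ_eqI)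

lemma symb_zero: "near_list fs \<Longrightarrow> symb fs (\<lambda>X. 0) = \<zero>\<^bsub>Te.PM\<^esub>"
  using symb_smult[OF _ near_regular_zero[OF p] near_regular_zero[OF p], of fs]
    Te.PM.smult_l_null[OF symb_closed[OF _ near_regular_zero[OF p]], of fs] A_simps(3) by simp

lemma symb_P:
  assumes "near_list fs" "h \<in> near_regular (k - int d) p"
  shows "symb fs (\<lambda>X. P X * h X) = \<zero>\<^bsub>Te.PM\<^esub>"
proof -
  have h: "(\<lambda>X. P X * h X) \<in> near_regular k p" by (rule near_regular_mult_deg[OF P_near[OF p] assms(2) p]) simp
  have "cong k (\<lambda>X. 0) (\<lambda>X. P X * h X)" unfolding cong_def by (rule bexI[OF _ assms(2)]) simp
  then have "germ k (\<lambda>X. P X * h X) = germ k (\<lambda>X. 0)" using germ_eq_iff[OF near_regular_zero[OF p] h] by simp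
  then have "symb fs (\<lambda>X. P X * h X) = symb fs (\<lambda>X. 0)" by (simp add: symb_def)
  then show ?thesis using symb_zero[OF assms(1)] by simp
qed

end

section \<open>Differentials in an affine chart\<close>

locale chart_stalk = symbol_stalk d P p m k for d and P :: "complex ^ 'n::finite \<Rightarrow> complex" and p m k +
  fixes i :: 'n
  assumes pi: "p \<in> chart i" and m: "m \<ge> 1"
begin

definition x :: "'n \<Rightarrow> complex ^ 'n \<Rightarrow> complex" where
  "x j X = X $ j / X $ i"

lemma x_near: "x j \<in> near_regular 0 p"
  unfolding x_def[abs_def] by (rule near_regular_ratio[OF pi])

lemmas Xi_nz = in_chart_eventually[OF pi]

lemma Xi_powi: "(\<lambda>X. X $ i powi l) \<in> near_regular l p"
  by (rule near_regular_powi_coord[OF pi])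

lemma x_i: "eventually (\<lambda>X. x i X = 1) (zf p)"
  using Xi_nz by eventually_elim (simp add: x_def)

text \<open>For f of degree 0 and j \<noteq> i this is the derivative of f with respect to the
  affine coordinate \<open>x j\<close>.\<close>

definition c :: "'n \<Rightarrow> (complex ^ 'n \<Rightarrow> complex) \<Rightarrow> complex ^ 'n \<Rightarrow> complex" where
  "c j f X = X $ i * partial j f X"

lemma c_near: "f \<in> near_regular 0 p \<Longrightarrow> c j f \<in> near_regular 0 p"
  unfolding c_def[abs_def]
  by (rule near_regular_mult_deg[OF near_regular_coord[OF p] near_regular_pd(2)[OF _ p] p]) auto

definition D where
  "D f = (\<Oplus>\<^bsub>Om.PM\<^esub>j\<in>UNIV - {i}. germ 0 (c j f) \<odot>\<^bsub>Om.PM\<^esub> dd (x j))"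

lemma D_term: "f \<in> near_regular 0 p \<Longrightarrow> germ 0 (c j f) \<odot>\<^bsub>Om.PM\<^esub> dd (x j) \<in> carrier Om.PM"
  by (intro Om.PM.smult_closed germ_closed c_near dd_closed x_near)

lemma D_closed: "f \<in> near_regular 0 p \<Longrightarrow> D f \<in> carrier Om.PM"
  unfolding D_def by (rule Om.PM.M.finsum_closed) (auto intro: D_term)

lemma D_cong:
  assumes "f \<in> near_regular 0 p" "eventually (\<lambda>X. f X = g X) (zf p)"
  shows "D f = D g"
proof -
  have "germ 0 (c j f) = germ 0 (c j g)" for j
    by (rule germ_eqI[OF c_near[OF assms(1)]])
      (use partial_cong[OF assms p] in eventually_elim, simp add: c_def)
  then show ?thesis by (simp add: D_def)
qed

lemma D_add:
  assumes f: "f \<in> near_regular 0 p" and g: "g \<in> near_regular 0 p"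
  shows "D (\<lambda>X. f X + g X) = D f \<oplus>\<^bsub>Om.PM\<^esub> D g"
proof -
  have "germ 0 (c j (\<lambda>X. f X + g X)) = germ 0 (c j f) \<oplus>\<^bsub>A\<^esub> germ 0 (c j g)" for j
    unfolding A_add[OF c_near[OF f] c_near[OF g]]
    by (rule germ_eqI[OF c_near[OF near_regular_add[OF f g p]]])
      (use partial_add[OF f g p] in eventually_elim, simp add: c_def distrib_left)
  then have "D (\<lambda>X. f X + g X) = (\<Oplus>\<^bsub>Om.PM\<^esub>j\<in>UNIV - {i}.
      germ 0 (c j f) \<odot>\<^bsub>Om.PM\<^esub> dd (x j) \<oplus>\<^bsub>Om.PM\<^esub> germ 0 (c j g) \<odot>\<^bsub>Om.PM\<^esub> dd (x j))"
    unfolding D_def by (simp add: Om.PM.smult_l_distr germ_closed c_near f g dd_closed x_near)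
  also have "\<dots> = D f \<oplus>\<^bsub>Om.PM\<^esub> D g"
    unfolding D_def by (rule Om.PM.M.finsum_addf) (auto intro: D_term f g)
  finally show ?thesis .
qed

lemma D_mult:
  assumes f: "f \<in> near_regular 0 p" and g: "g \<in> near_regular 0 p"
  shows "D (\<lambda>X. f X * g X) = germ 0 f \<odot>\<^bsub>Om.PM\<^esub> D g \<oplus>\<^bsub>Om.PM\<^esub> germ 0 g \<odot>\<^bsub>Om.PM\<^esub> D f"
proof -
  note fg = near_regular_mult_deg[OF f g p, of 0, simplified]
  have "germ 0 (c j (\<lambda>X. f X * g X)) = germ 0 f \<otimes>\<^bsub>A\<^esub> germ 0 (c j g) \<oplus>\<^bsub>A\<^esub> germ 0 g \<otimes>\<^bsub>A\<^esub> germ 0 (c j f)" for j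
  proof -
    have 1: "(\<lambda>X. f X * c j g X) \<in> near_regular 0 p" "(\<lambda>X. g X * c j f X) \<in> near_regular 0 p"
      using near_regular_mult_deg[OF f c_near[OF g] p] near_regular_mult_deg[OF g c_near[OF f] p] by auto
    show ?thesis unfolding A_mult[OF f c_near[OF g]] A_mult[OF g c_near[OF f]] A_add[OF 1]
      by (rule germ_eqI[OF c_near[OF fg]])
        (use partial_mult[OF f g p] in eventually_elim, simp add: c_def algebra_simps)
  qed
  then have "germ 0 (c j (\<lambda>X. f X * g X)) \<odot>\<^bsub>Om.PM\<^esub> dd (x j) =
      germ 0 f \<odot>\<^bsub>Om.PM\<^esub> (germ 0 (c j g) \<odot>\<^bsub>Om.PM\<^esub> dd (x j)) \<oplus>\<^bsub>Om.PM\<^esub> germ 0 g \<odot>\<^bsub>Om.PM\<^esub> (germ 0 (c j f) \<odot>\<^bsub>Om.PM\<^esub> dd (x j))" for j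
    using germ_closed[OF f] germ_closed[OF g] germ_closed[OF c_near[OF f]] germ_closed[OF c_near[OF g]] dd_closed[OF x_near]
    by (simp add: Om.PM.smult_l_distr Om.PM.smult_assoc1)
  then have "D (\<lambda>X. f X * g X) = (\<Oplus>\<^bsub>Om.PM\<^esub>j\<in>UNIV - {i}. germ 0 f \<odot>\<^bsub>Om.PM\<^esub> (germ 0 (c j g) \<odot>\<^bsub>Om.PM\<^esub> dd (x j))
      \<oplus>\<^bsub>Om.PM\<^esub> germ 0 g \<odot>\<^bsub>Om.PM\<^esub> (germ 0 (c j f) \<odot>\<^bsub>Om.PM\<^esub> dd (x j)))"
    by (simp add: D_def)
  also have "\<dots> = (\<Oplus>\<^bsub>Om.PM\<^esub>j\<in>UNIV - {i}. germ 0 f \<odot>\<^bsub>Om.PM\<^esub> (germ 0 (c j g) \<odot>\<^bsub>Om.PM\<^esub> dd (x j)))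
      \<oplus>\<^bsub>Om.PM\<^esub> (\<Oplus>\<^bsub>Om.PM\<^esub>j\<in>UNIV - {i}. germ 0 g \<odot>\<^bsub>Om.PM\<^esub> (germ 0 (c j f) \<odot>\<^bsub>Om.PM\<^esub> dd (x j)))"
    by (rule Om.PM.M.finsum_addf) (auto intro!: Om.PM.smult_closed germ_closed D_term f g)
  also have "\<dots> = germ 0 f \<odot>\<^bsub>Om.PM\<^esub> D g \<oplus>\<^bsub>Om.PM\<^esub> germ 0 g \<odot>\<^bsub>Om.PM\<^esub> D f"
    unfolding D_def
    by (subst (1 2) Om.PM.finsum_smult_ldistr) (auto intro: D_term f g germ_closed)
  finally show ?thesis .
qed

definition good where
  "good f \<longleftrightarrow> f \<in> near_regular 0 p \<and> dd f = D f"

lemma good_cong: "good f \<Longrightarrow> eventually (\<lambda>X. f X = g X) (zf p) \<Longrightarrow> good g"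
  unfolding good_def using near_regular_cong[OF _ _ p, of f 0 g] D_cong[of f g] germ_eqI[of f 0 g] by simp

lemma good_add: "good f \<Longrightarrow> good g \<Longrightarrow> good (\<lambda>X. f X + g X)"
  unfolding good_def using near_regular_add[OF _ _ p, of f 0 g] D_add[of f g] dd_add[of f g] by simp

lemma good_mult: "good f \<Longrightarrow> good g \<Longrightarrow> good (\<lambda>X. f X * g X)"
  unfolding good_def using near_regular_mult[OF _ _ p, of f 0 g 0] D_mult[of f g] dd_mult[of f g] by simp

lemma good_const: "good (\<lambda>X. a)"
proof -
  have "c j (\<lambda>X. a) = (\<lambda>X. 0)" for j by (simp add: c_def[abs_def])
  then have "D (\<lambda>X. a) = \<zero>\<^bsub>Om.PM\<^esub>"
    unfolding D_def using dd_closed[OF x_near] by (simp add: A_simps(3)[symmetric] Om.PM.M.finsum_zero)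
  then show ?thesis unfolding good_def using near_regular_const[OF p] dd_const by simp
qed

lemma good_x: "good (x j)"
proof (cases "j = i")
  case True
  \<comment> \<open>The coordinate \<open>x i\<close> is the constant 1 near p.\<close>
  show ?thesis by (rule good_cong[OF good_const[of 1]]) (use x_i True in \<open>auto elim: eventually_mono\<close>)
next
  case False
  have "germ 0 (c l (x j)) \<odot>\<^bsub>Om.PM\<^esub> dd (x l) = (if j = l then dd (x l) else \<zero>\<^bsub>Om.PM\<^esub>)" if l: "l \<noteq> i" for l
  proof -
    have "eventually (\<lambda>X. c l (x j) X = (if j = l then 1 else 0)) (zf p)"
      using Xi_nz
    proof eventually_elim
      case (elim X)
      have "has_pd (\<lambda>X. X $ j / X $ i) (\<lambda>l. ((if l = j then 1 else 0) * X $ i - X $ j * (if l = i then 1 else 0)) / (X $ i * X $ i)) X"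
        by (intro has_pd_divide has_pd_coord elim)
      from has_pd_partial[OF this, of l] show ?case using elim l by (auto simp: c_def x_def[abs_def])
    qed
    from germ_eqI[OF c_near[OF x_near] this]
    have "germ 0 (c l (x j)) = (if j = l then \<one>\<^bsub>A\<^esub> else \<zero>\<^bsub>A\<^esub>)" by (simp add: A_simps)
    then show ?thesis using dd_closed[OF x_near[of l]] by simp
  qed
  then have "D (x j) = (\<Oplus>\<^bsub>Om.PM\<^esub>l\<in>UNIV - {i}. if j = l then dd (x l) else \<zero>\<^bsub>Om.PM\<^esub>)"
    unfolding D_def by (intro Om.PM.M.finsum_cong') (auto simp: dd_closed x_near)
  also have "\<dots> = dd (x j)"
    by (rule Om.PM.M.finsum_singleton) (use False in \<open>auto intro: dd_closed x_near\<close>)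
  finally show ?thesis using x_near by (simp add: good_def)
qed

lemma good_power: "good f \<Longrightarrow> good (\<lambda>X. f X ^ n)"
  by (induction n) (auto intro: good_const good_mult)

lemma good_prod: "finite I \<Longrightarrow> (\<And>j. j \<in> I \<Longrightarrow> good (f j)) \<Longrightarrow> good (\<lambda>X. \<Prod>j\<in>I. f j X)"
  by (induction I rule: finite_induct) (auto intro: good_const good_mult)

lemma good_sum: "finite I \<Longrightarrow> (\<And>j. j \<in> I \<Longrightarrow> good (f j)) \<Longrightarrow> good (\<lambda>X. \<Sum>j\<in>I. f j X)"
  by (induction I rule: finite_induct) (auto intro: good_const good_add)

text \<open>Division by X_i^l turns a homogeneous polynomial of degree l into a polynomial in the
  affine coordinates.\<close>

lemma good_homog:
  assumes "homog_poly l a" shows "good (\<lambda>X. a X / X $ i ^ l)"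
proof -
  obtain b where b: "a = (\<lambda>X. \<Sum>e\<in>exponents l. b e * monomial e X)"
    using assms unfolding homog_poly_def by auto
  have "good (\<lambda>X. \<Sum>e\<in>exponents l. b e * (\<Prod>j\<in>UNIV. x j X ^ e j))"
    by (intro good_sum good_mult good_const good_prod good_power good_x) auto
  moreover have "(\<Prod>j\<in>UNIV. x j X ^ e j) = monomial e X / X $ i ^ l" if "e \<in> exponents l" for e X
  proof -
    have "(\<Prod>j\<in>UNIV. X $ i ^ e j) = X $ i ^ l" using that by (simp add: exponents_def flip: power_sum)
    then show ?thesis by (simp add: x_def power_divide prod_dividef monomial_def)
  qed
  then have "(\<Sum>e\<in>exponents l. b e * (\<Prod>j\<in>UNIV. x j X ^ e j)) = a X / X $ i ^ l" for X
    by (simp add: b sum_divide_distrib)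
  ultimately show ?thesis by simp
qed

text \<open>The Leibniz rules of \<open>dd\<close> and \<open>D\<close>, applied to f b = a, give b
  \<open>dd f\<close> = b \<open>D f\<close>; since b does not vanish at p, its germ is a
  unit.\<close>

lemma good_quotient:
  assumes a: "good a" and b: "good b" and f: "f \<in> near_regular 0 p" and Q: "Q \<in> p" "b Q \<noteq> 0"
    and e: "eventually (\<lambda>X. f X * b X = a X) (zf p)"
  shows "good f"
proof -
  have bn: "b \<in> near_regular 0 p" "dd b = D b" using b by (auto simp: good_def)
  have fb: "(\<lambda>X. f X * b X) \<in> near_regular 0 p" using near_regular_mult[OF f bn(1) p] by simp
  have "good (\<lambda>X. f X * b X)" by (rule good_cong[OF a]) (use e in eventually_elim, simp)
  then have "dd (\<lambda>X. f X * b X) = D (\<lambda>X. f X * b X)" by (simp add: good_def)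
  then have eq: "germ 0 f \<odot>\<^bsub>Om.PM\<^esub> dd b \<oplus>\<^bsub>Om.PM\<^esub> germ 0 b \<odot>\<^bsub>Om.PM\<^esub> dd f
      = germ 0 f \<odot>\<^bsub>Om.PM\<^esub> D b \<oplus>\<^bsub>Om.PM\<^esub> germ 0 b \<odot>\<^bsub>Om.PM\<^esub> D f"
    unfolding dd_mult[OF f bn(1)] D_mult[OF f bn(1)] .
  have cl: "germ 0 f \<odot>\<^bsub>Om.PM\<^esub> D b \<in> carrier Om.PM" "germ 0 b \<odot>\<^bsub>Om.PM\<^esub> dd f \<in> carrier Om.PM" "germ 0 b \<odot>\<^bsub>Om.PM\<^esub> D f \<in> carrier Om.PM"
    by (auto intro!: Om.PM.smult_closed germ_closed f bn D_closed dd_closed)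
  have bdf: "germ 0 b \<odot>\<^bsub>Om.PM\<^esub> dd f = germ 0 b \<odot>\<^bsub>Om.PM\<^esub> D f"
    using eq unfolding bn(2) by (rule abelian_group_l_cancel[OF Om.PM.M.abelian_group_axioms cl(1,2,3)])
  define u where "u X = inverse (b X)" for X
  have u: "u \<in> near_regular 0 p"
    using near_regular_inverse[OF bn(1) p Q] by (simp add: u_def[abs_def])
  have ub: "germ 0 u \<otimes>\<^bsub>A\<^esub> germ 0 b = \<one>\<^bsub>A\<^esub>"
    unfolding A_mult[OF u bn(1)] A_simps
    by (rule germ_eqI[OF near_regular_mult_deg[OF u bn(1) p]])
      (simp, use near_regular_nonzero[OF bn(1) p Q] in eventually_elim, simp add: u_def)
  have inv: "germ 0 u \<odot>\<^bsub>Om.PM\<^esub> (germ 0 b \<odot>\<^bsub>Om.PM\<^esub> y) = y" if "y \<in> carrier Om.PM" for y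
    unfolding Om.PM.smult_assoc1[OF germ_closed[OF u] germ_closed[OF bn(1)] that, symmetric] ub
    by (rule Om.PM.smult_one[OF that])
  have "dd f = germ 0 u \<odot>\<^bsub>Om.PM\<^esub> (germ 0 b \<odot>\<^bsub>Om.PM\<^esub> dd f)" by (rule inv[OF dd_closed[OF f], symmetric])
  also have "\<dots> = D f" unfolding bdf by (rule inv[OF D_closed[OF f]])
  finally have "dd f = D f" .
  with f show ?thesis by (simp add: good_def)
qed

text \<open>The class of functions satisfying \<open>df = \<Sum>\<^sub>j X\<^sub>i \<partial>\<^sub>jf dx\<^sub>j\<close> contains the polynomials in the
  affine coordinates and is closed under division.\<close>

lemma dd_eq_D:
  assumes f: "f \<in> near_regular 0 p" shows "dd f = D f"
proof -
  obtain a b l l' where ab: "homog_poly l a" "homog_poly l' b" "int l - int l' = 0"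
    "eventually (\<lambda>X. b X \<noteq> 0 \<and> f X = a X / b X) (zf p)"
    by (rule near_regularE[OF f p])
  then have l: "l' = l" by simp
  obtain Q where Q: "Q \<in> p" using proj_point_nonempty[OF p] by blast
  have "good f"
  proof (rule good_quotient[OF good_homog[OF ab(1)] good_homog[OF ab(2)] f Q])
    show "b Q / Q $ i ^ l' \<noteq> 0"
      using eventually_zf_point[OF ab(4) p Q] eventually_zf_point[OF Xi_nz p Q] by simp
    show "eventually (\<lambda>X. f X * (b X / X $ i ^ l') = a X / X $ i ^ l) (zf p)"
      using ab(4) by eventually_elim (simp add: l)
  qed
  then show ?thesis by (simp add: good_def)
qed

text \<open>The local equation P / X_i^d of H has class zero in O_H, so its differential vanishes;
  \<open>dd_eq_D\<close> expands that differential in the affine coordinates.\<close>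

lemma conormal_relation:
  "(\<Oplus>\<^bsub>Om.PM\<^esub>j\<in>UNIV - {i}. germ 0 (\<lambda>X. partial j P X * X $ i powi (1 - int d)) \<odot>\<^bsub>Om.PM\<^esub> dd (x j)) = \<zero>\<^bsub>Om.PM\<^esub>"
proof -
  define f where "f X = P X * X $ i powi (- int d)" for X
  have f: "f \<in> near_regular 0 p"
    unfolding f_def[abs_def] by (rule near_regular_mult_deg[OF P_near[OF p] Xi_powi p]) simp
  have "cong 0 (\<lambda>X. 0) f" unfolding cong_def
    by (rule bexI[of _ "\<lambda>X. X $ i powi (- int d)"]) (use Xi_powi[of "- int d"] in \<open>auto simp: f_def\<close>)
  then have "germ 0 f = germ 0 (\<lambda>X. 0)" using germ_eq_iff[OF near_regular_zero[OF p] f] by simp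
  then have "dd f = \<zero>\<^bsub>Om.PM\<^esub>" using dd_const[of 0] by simp
  moreover have "germ 0 (c j f) = germ 0 (\<lambda>X. partial j P X * X $ i powi (1 - int d))" if j: "j \<noteq> i" for j
  proof (rule germ_eqI[OF c_near[OF f]])
    show "eventually (\<lambda>X. c j f X = partial j P X * X $ i powi (1 - int d)) (zf p)"
      using partial_mult[OF P_near[OF p] Xi_powi[of "- int d"] p] Xi_nz
    proof eventually_elim
      case (elim X)
      \<comment> \<open>For j \<noteq> i the factor X_i^(-d) is constant in the direction j.\<close>
      have "partial j f X = partial j P X * X $ i powi (- int d)"
        using elim(1) partial_independent[OF j, of "\<lambda>t. t powi (- int d)"] by (simp add: f_def[abs_def])
      moreover have "X $ i powi (1 - int d) = X $ i * X $ i powi (- int d)"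
        using power_int_add[of "X $ i" 1 "- int d"] elim(2) by simp
      ultimately show ?case by (simp add: c_def)
    qed
  qed
  ultimately have "(\<Oplus>\<^bsub>Om.PM\<^esub>j\<in>UNIV - {i}. germ 0 (\<lambda>X. partial j P X * X $ i powi (1 - int d)) \<odot>\<^bsub>Om.PM\<^esub> dd (x j)) = D f"
    unfolding D_def by (intro Om.PM.M.finsum_cong') (auto intro: D_term[OF f])
  then show ?thesis using dd_eq_D[OF f] \<open>dd f = \<zero>\<^bsub>Om.PM\<^esub>\<close> by simp
qed

section \<open>The map \<sigma> from polynomials in Y to symbols\<close>

definition B :: "('n \<Rightarrow> nat) set" where
  "B = {e \<in> exponents m. e i = 0}"

lemma finite_B: "finite B" and B_exponents: "e \<in> B \<Longrightarrow> e \<in> exponents m"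
  by (auto simp: B_def)

lemma near_list_x: "length js = m \<Longrightarrow> near_list (map x js)"
  by (auto simp: near_list_def x_near)

lemma near_list_lst: "e \<in> B \<Longrightarrow> near_list (map x (lst e))"
  by (simp add: near_list_x length_lst B_def)

abbreviation "cf F e X \<equiv> chart_coeff m i F e X * X $ i ^ m"

text \<open>As the j-th coordinate of \<open>zeta\<close> stands for X_i d(X_j / X_i), a monomial of
  degree m acquires the factor X_i^m. Monomials involving the i-th coordinate are dropped, so
  \<sigma> is linear on all polynomials in Y; on Ker \<delta> nothing is dropped, by
  \<open>chart_coeff_vanish\<close>.\<close>

definition \<sigma> where
  "\<sigma> F = (\<Oplus>\<^bsub>Te.PM\<^esub>e\<in>B. symb (map x (lst e)) (\<lambda>X. cf F e X))"

lemma cf_near: "F \<in> near_Y m (k - int m) p \<Longrightarrow> e \<in> B \<Longrightarrow> (\<lambda>X. cf F e X) \<in> near_regular k p"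
  by (rule near_regular_mult_deg[OF near_regular_chart_coeff[OF _ pi B_exponents] near_regular_power[OF near_regular_coord[OF p] p] p]) auto

lemma \<sigma>_term: "F \<in> near_Y m (k - int m) p \<Longrightarrow> e \<in> B \<Longrightarrow> symb (map x (lst e)) (\<lambda>X. cf F e X) \<in> carrier Te.PM"
  by (rule symb_closed[OF near_list_lst cf_near])

lemma \<sigma>_closed: "F \<in> near_Y m (k - int m) p \<Longrightarrow> \<sigma> F \<in> carrier Te.PM"
  unfolding \<sigma>_def by (rule Te.PM.M.finsum_closed) (auto intro: \<sigma>_term)

lemma \<sigma>_cong:
  assumes "F \<in> near_Y m (k - int m) p" "eventually (\<lambda>X. \<forall>Y. F X Y = G X Y) (zf p)"
  shows "\<sigma> F = \<sigma> G"
  unfolding \<sigma>_def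
proof (rule Te.PM.M.finsum_cong')
  note G = near_Y_cong[OF assms]
  show "(\<lambda>e. symb (map x (lst e)) (\<lambda>X. cf G e X)) \<in> B \<rightarrow> carrier Te.PM" using \<sigma>_term[OF G] by blast
  fix e assume e: "e \<in> B"
  show "symb (map x (lst e)) (\<lambda>X. cf F e X) = symb (map x (lst e)) (\<lambda>X. cf G e X)"
  proof (rule symb_cong[OF cf_near[OF assms(1) e]])
    show "eventually (\<lambda>X. cf F e X = cf G e X) (zf p)"
      using assms(2)
    proof eventually_elim
      case (elim X)
      then have "F X = G X" by auto
      then show ?case by (simp add: chart_coeff_def)
    qed
  qed
qed simp

lemma \<sigma>_add:
  assumes F: "F \<in> near_Y m (k - int m) p" and G: "G \<in> near_Y m (k - int m) p"
  shows "\<sigma> (\<lambda>X Y. F X Y + G X Y) = \<sigma> F \<oplus>\<^bsub>Te.PM\<^esub> \<sigma> G"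
proof -
  have "symb (map x (lst e)) (\<lambda>X. cf (\<lambda>X Y. F X Y + G X Y) e X)
      = symb (map x (lst e)) (\<lambda>X. cf F e X) \<oplus>\<^bsub>Te.PM\<^esub> symb (map x (lst e)) (\<lambda>X. cf G e X)" if e: "e \<in> B" for e
  proof -
    have "symb (map x (lst e)) (\<lambda>X. cf (\<lambda>X Y. F X Y + G X Y) e X) = symb (map x (lst e)) (\<lambda>X. cf F e X + cf G e X)"
    proof (rule symb_cong[OF cf_near[OF near_Y_add[OF F G p] e]])
      show "eventually (\<lambda>X. cf (\<lambda>X Y. F X Y + G X Y) e X = cf F e X + cf G e X) (zf p)"
        using near_Y_homog[OF F] near_Y_homog[OF G]
      proof eventually_elim
        case (elim X)
        show ?case unfolding chart_coeff_def
          using coeffs_of_add[OF homog_poly_eta[OF elim(1)] homog_poly_eta[OF elim(2)] B_exponents[OF e]]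
          by (simp add: distrib_right)
      qed
    qed
    then show ?thesis using symb_add[OF near_list_lst[OF e] cf_near[OF F e] cf_near[OF G e]] by simp
  qed
  then have "\<sigma> (\<lambda>X Y. F X Y + G X Y) = (\<Oplus>\<^bsub>Te.PM\<^esub>e\<in>B. symb (map x (lst e)) (\<lambda>X. cf F e X) \<oplus>\<^bsub>Te.PM\<^esub> symb (map x (lst e)) (\<lambda>X. cf G e X))"
    unfolding \<sigma>_def by (intro Te.PM.M.finsum_cong') (auto intro: \<sigma>_term F G)
  also have "\<dots> = \<sigma> F \<oplus>\<^bsub>Te.PM\<^esub> \<sigma> G"
    unfolding \<sigma>_def by (rule Te.PM.M.finsum_addf) (auto intro: \<sigma>_term F G)
  finally show ?thesis .
qed

lemma \<sigma>_smult:
  assumes f: "f \<in> near_regular 0 p" and F: "F \<in> near_Y m (k - int m) p"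
  shows "\<sigma> (\<lambda>X Y. f X * F X Y) = germ 0 f \<odot>\<^bsub>Te.PM\<^esub> \<sigma> F"
proof -
  have fF: "(\<lambda>X Y. f X * F X Y) \<in> near_Y m (k - int m) p" using near_Y_smult[OF f F p] by simp
  have "symb (map x (lst e)) (\<lambda>X. cf (\<lambda>X Y. f X * F X Y) e X)
      = germ 0 f \<odot>\<^bsub>Te.PM\<^esub> symb (map x (lst e)) (\<lambda>X. cf F e X)" if e: "e \<in> B" for e
  proof -
    have "symb (map x (lst e)) (\<lambda>X. cf (\<lambda>X Y. f X * F X Y) e X) = symb (map x (lst e)) (\<lambda>X. f X * cf F e X)"
    proof (rule symb_cong[OF cf_near[OF fF e]])
      show "eventually (\<lambda>X. cf (\<lambda>X Y. f X * F X Y) e X = f X * cf F e X) (zf p)"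
        using near_Y_homog[OF F]
      proof eventually_elim
        case (elim X)
        show ?case unfolding chart_coeff_def
          using coeffs_of_cmult[OF homog_poly_eta[OF elim] B_exponents[OF e]] by simp
      qed
    qed
    then show ?thesis using symb_smult[OF near_list_lst[OF e] f cf_near[OF F e]] by simp
  qed
  then have "\<sigma> (\<lambda>X Y. f X * F X Y) = (\<Oplus>\<^bsub>Te.PM\<^esub>e\<in>B. germ 0 f \<odot>\<^bsub>Te.PM\<^esub> symb (map x (lst e)) (\<lambda>X. cf F e X))"
    unfolding \<sigma>_def by (intro Te.PM.M.finsum_cong') (auto intro!: Te.PM.smult_closed \<sigma>_term F germ_closed f)
  also have "\<dots> = germ 0 f \<odot>\<^bsub>Te.PM\<^esub> \<sigma> F"
    unfolding \<sigma>_def by (rule Te.PM.finsum_smult_ldistr[symmetric]) (auto intro: \<sigma>_term F germ_closed f finite_B)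
  finally show ?thesis .
qed

lemma \<sigma>_zero: "\<sigma> (\<lambda>X Y. 0) = \<zero>\<^bsub>Te.PM\<^esub>"
  using \<sigma>_smult[OF near_regular_zero[OF p] near_Y_zero[OF p]] Te.PM.smult_l_null[OF \<sigma>_closed[OF near_Y_zero[OF p]]] A_simps(3)
  by simp

lemma \<sigma>_sum:
  assumes "finite I" "\<And>j. j \<in> I \<Longrightarrow> F j \<in> near_Y m (k - int m) p"
  shows "\<sigma> (\<lambda>X Y. \<Sum>j\<in>I. F j X Y) = (\<Oplus>\<^bsub>Te.PM\<^esub>j\<in>I. \<sigma> (F j))"
  using assms
proof (induction I rule: finite_induct)
  case empty
  show ?case by (simp add: \<sigma>_zero)
next
  case (insert a I)
  have "\<sigma> (\<lambda>X Y. F a X Y + (\<Sum>j\<in>I. F j X Y)) = \<sigma> (F a) \<oplus>\<^bsub>Te.PM\<^esub> \<sigma> (\<lambda>X Y. \<Sum>j\<in>I. F j X Y)"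
    by (rule \<sigma>_add) (use insert near_Y_sum[OF _ p, of I F] in auto)
  moreover have "(\<Oplus>\<^bsub>Te.PM\<^esub>j\<in>insert a I. \<sigma> (F j)) = \<sigma> (F a) \<oplus>\<^bsub>Te.PM\<^esub> (\<Oplus>\<^bsub>Te.PM\<^esub>j\<in>I. \<sigma> (F j))"
    by (rule Te.PM.M.finsum_insert) (use insert \<sigma>_closed in auto)
  ultimately show ?case using insert by simp
qed

lemma basis_near:
  assumes "f \<in> near_regular n p" "e \<in> exponents l"
  shows "(\<lambda>X Y. f X * monomial e (zeta i X Y)) \<in> near_Y l n p"
  using near_Y_subst[OF near_Y_term[OF assms p] near_Y_zeta[OF pi] p] by simp

lemma \<sigma>_basis:
  assumes f: "f \<in> near_regular (k - int m) p" and e: "e \<in> exponents m"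
  shows "\<sigma> (\<lambda>X Y. f X * monomial e (zeta i X Y)) =
    (if e i = 0 then symb (map x (lst e)) (\<lambda>X. f X * X $ i ^ m) else \<zero>\<^bsub>Te.PM\<^esub>)"
proof -
  note F = basis_near[OF f e]
  define h where "h e' = symb (map x (lst e')) (\<lambda>X. f X * X $ i ^ m)" for e'
  have fm: "(\<lambda>X. f X * X $ i ^ m) \<in> near_regular k p"
    by (rule near_regular_mult_deg[OF f near_regular_power[OF near_regular_coord[OF p] p] p]) simp
  have h: "h e' \<in> carrier Te.PM" if "e' \<in> B" for e' unfolding h_def by (rule symb_closed[OF near_list_lst[OF that] fm])
  have "symb (map x (lst e')) (\<lambda>X. cf (\<lambda>X Y. f X * monomial e (zeta i X Y)) e' X) = (if e = e' then h e' else \<zero>\<^bsub>Te.PM\<^esub>)"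
    if e': "e' \<in> B" for e'
  proof -
    have "chart_coeff m i (\<lambda>X Y. f X * monomial e (zeta i X Y)) e' X = (if e = e' then f X else 0)" for X
      unfolding chart_coeff_def
      by (rule coeffs_of_unique[where c = "\<lambda>e'. if e = e' then f X else 0"])
        (use e e' in \<open>auto simp: if_distrib[of "\<lambda>x. x * _"] B_def cong: if_cong\<close>)
    then show ?thesis using symb_zero[OF near_list_lst[OF e']] by (simp add: h_def)
  qed
  then have 1: "\<sigma> (\<lambda>X Y. f X * monomial e (zeta i X Y)) = (\<Oplus>\<^bsub>Te.PM\<^esub>e'\<in>B. if e = e' then h e' else \<zero>\<^bsub>Te.PM\<^esub>)"
    unfolding \<sigma>_def by (intro Te.PM.M.finsum_cong') (auto simp: h)
  show ?thesis
  proof (cases "e i = 0")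
    case True
    then have "e \<in> B" using e by (simp add: B_def)
    then have "(\<Oplus>\<^bsub>Te.PM\<^esub>e'\<in>B. if e = e' then h e' else \<zero>\<^bsub>Te.PM\<^esub>) = h e"
      by (intro Te.PM.M.finsum_singleton) (auto intro: h finite_B)
    then show ?thesis using True 1 by (simp add: h_def)
  next
    case False
    then have "e \<noteq> e'" if "e' \<in> B" for e' using that by (auto simp: B_def)
    then have "(\<Oplus>\<^bsub>Te.PM\<^esub>e'\<in>B. if e = e' then h e' else \<zero>\<^bsub>Te.PM\<^esub>) = (\<Oplus>\<^bsub>Te.PM\<^esub>e'\<in>B. \<zero>\<^bsub>Te.PM\<^esub>)"
      by (intro Te.PM.M.finsum_cong') auto
    then show ?thesis using False 1 by (simp add: Te.PM.M.finsum_zero)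
  qed
qed

end

section \<open>The map \<sigma> on the image of \<beta>(P), and its composition with the
  lift\<close>

context chart_stalk
begin

definition \<psi> where
  "\<psi> L C \<omega> = ten (sprod (fst L @ [\<omega>] @ snd L)) C"

lemma \<psi>_linear:
  assumes L: "set (fst L) \<subseteq> carrier Om.PM" "set (snd L) \<subseteq> carrier Om.PM" "length (fst L) + 1 + length (snd L) = m"
    and C: "C \<in> carrier Tk"
  shows "\<omega> \<in> carrier Om.PM \<Longrightarrow> \<psi> L C \<omega> \<in> carrier Te.PM"
    and "\<omega> \<in> carrier Om.PM \<Longrightarrow> \<omega>' \<in> carrier Om.PM \<Longrightarrow> \<psi> L C (\<omega> \<oplus>\<^bsub>Om.PM\<^esub> \<omega>') = \<psi> L C \<omega> \<oplus>\<^bsub>Te.PM\<^esub> \<psi> L C \<omega>'"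
    and "a \<in> carrier A \<Longrightarrow> \<omega> \<in> carrier Om.PM \<Longrightarrow> \<psi> L C (a \<odot>\<^bsub>Om.PM\<^esub> \<omega>) = a \<odot>\<^bsub>Te.PM\<^esub> \<psi> L C \<omega>"
proof -
  have g: "fst L @ [\<omega>] @ snd L \<in> gens" if "\<omega> \<in> carrier Om.PM" for \<omega>
    using L that by (auto simp: sym_gens_def)
  note s = Sy.gen_closed[OF g]
  show "\<omega> \<in> carrier Om.PM \<Longrightarrow> \<psi> L C \<omega> \<in> carrier Te.PM"
    unfolding \<psi>_def by (rule ten_closed[OF s C])
  show "\<omega> \<in> carrier Om.PM \<Longrightarrow> \<omega>' \<in> carrier Om.PM \<Longrightarrow> \<psi> L C (\<omega> \<oplus>\<^bsub>Om.PM\<^esub> \<omega>') = \<psi> L C \<omega> \<oplus>\<^bsub>Te.PM\<^esub> \<psi> L C \<omega>'"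
    unfolding \<psi>_def by (simp only: sprod_add[OF _ _ g] ten_add1[OF s s C])
  show "a \<in> carrier A \<Longrightarrow> \<omega> \<in> carrier Om.PM \<Longrightarrow> \<psi> L C (a \<odot>\<^bsub>Om.PM\<^esub> \<omega>) = a \<odot>\<^bsub>Te.PM\<^esub> \<psi> L C \<omega>"
    unfolding \<psi>_def by (simp only: sprod_smult[OF _ g] ten_smult1[OF _ s C])
qed

text \<open>The conormal relation multiplied by further differentials and by h: as a function of its
  first factor the symbol is the linear map \<open>\<psi>\<close>, which sends the relation, being
  zero, to zero.\<close>

lemma symb_relation:
  assumes L: "length L + 1 = m" and h: "h \<in> near_regular k p"
  shows "(\<Oplus>\<^bsub>Te.PM\<^esub>j\<in>UNIV - {i}. symb (map x (j # L)) (\<lambda>X. (partial j P X * X $ i powi (1 - int d)) * h X)) = \<zero>\<^bsub>Te.PM\<^esub>"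
proof -
  let ?L = "([], map dd (map x L))"
  let ?\<psi> = "\<psi> ?L (germ k h)"
  have L': "set (fst ?L) \<subseteq> carrier Om.PM" "set (snd ?L) \<subseteq> carrier Om.PM" "length (fst ?L) + 1 + length (snd ?L) = m"
    using L dd_closed[OF x_near] by auto
  note lin = \<psi>_linear[OF L' germ_T_closed[OF h]]
  have q: "(\<lambda>X. partial j P X * X $ i powi (1 - int d)) \<in> near_regular 0 p" for j
    by (rule near_regular_mult_deg[OF partial_P_near[OF p] Xi_powi p]) simp
  have t: "germ 0 (\<lambda>X. partial j P X * X $ i powi (1 - int d)) \<odot>\<^bsub>Om.PM\<^esub> dd (x j) \<in> carrier Om.PM" for j
    by (rule Om.PM.smult_closed[OF germ_closed[OF q] dd_closed[OF x_near]])
  have "symb (map x (j # L)) (\<lambda>X. (partial j P X * X $ i powi (1 - int d)) * h X)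
      = ?\<psi> (germ 0 (\<lambda>X. partial j P X * X $ i powi (1 - int d)) \<odot>\<^bsub>Om.PM\<^esub> dd (x j))" for j
    unfolding symb_smult[OF near_list_x[of "j # L", simplified, OF L[simplified]] q h, simplified]
      lin(3)[OF germ_closed[OF q] dd_closed[OF x_near]]
    using symb_smult[OF near_list_x[of "j # L"] q h] L by (simp add: \<psi>_def symb_def)
  then have "(\<Oplus>\<^bsub>Te.PM\<^esub>j\<in>UNIV - {i}. symb (map x (j # L)) (\<lambda>X. (partial j P X * X $ i powi (1 - int d)) * h X))
      = (\<Oplus>\<^bsub>Te.PM\<^esub>j\<in>UNIV - {i}. ?\<psi> (germ 0 (\<lambda>X. partial j P X * X $ i powi (1 - int d)) \<odot>\<^bsub>Om.PM\<^esub> dd (x j)))"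
    by (simp only:)
  also have "\<dots> = ?\<psi> (\<Oplus>\<^bsub>Om.PM\<^esub>j\<in>UNIV - {i}. germ 0 (\<lambda>X. partial j P X * X $ i powi (1 - int d)) \<odot>\<^bsub>Om.PM\<^esub> dd (x j))"
    by (rule finsum_hom[symmetric, where \<psi> = ?\<psi>, OF Om.PM.M.abelian_group_axioms Te.PM.M.abelian_group_axioms _ _ lin(1,2)])
      (use t in auto)
  also have "\<dots> = ?\<psi> \<zero>\<^bsub>Om.PM\<^esub>" unfolding conormal_relation ..
  also have "\<dots> = \<zero>\<^bsub>Te.PM\<^esub>"
    using lin(3)[OF Om.F.R.zero_closed Om.PM.M.zero_closed] Om.PM.smult_l_null[OF Om.PM.M.zero_closed]
      Te.PM.smult_l_null[OF lin(1)[OF Om.PM.M.zero_closed]] by simp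
  finally show ?thesis .
qed

text \<open>Both lists have the same multiset of entries, so \<open>sprod_perm\<close>
  applies.\<close>

lemma cons_lst: "e \<in> exponents (m - 1) \<Longrightarrow> h \<in> near_regular k p \<Longrightarrow>
  symb (map x (lst (\<lambda>l. e l + unit_exp j l))) h = symb (map x (j # lst e)) h"
proof -
  assume e: "e \<in> exponents (m - 1)" and h: "h \<in> near_regular k p"
  have len: "length (j # lst e) = m" using length_lst[OF e] m by simp
  have "count (mset (lst (\<lambda>l. e l + unit_exp j l))) = count (mset (j # lst e))"
    unfolding count_lst by (auto simp: count_lst unit_exp_def fun_eq_iff)
  then have "mset (lst (\<lambda>l. e l + unit_exp j l)) = mset (j # lst e)" by (simp only: count_inject)
  then have ms: "mset (map dd (map x (j # lst e))) = mset (map dd (map x (lst (\<lambda>l. e l + unit_exp j l))))"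
    by (simp only: mset_map)
  have "sprod ([] @ map dd (map x (j # lst e))) = sprod ([] @ map dd (map x (lst (\<lambda>l. e l + unit_exp j l))))"
    by (rule sprod_perm[OF ms]) (use near_list_gens[OF near_list_x[OF len]] in simp)
  then show ?thesis by (simp add: symb_def)
qed

text \<open>In the coordinates \<open>\<zeta>\<close>, the part of \<open>dP\<close> not involving \<open>\<zeta>\<^sub>i\<close> is
  \<open>\<Sum>\<^sub>j \<partial>\<^sub>jP \<zeta>\<^sub>j / d\<close>, which \<open>\<sigma>\<close> maps to the conormal relation.\<close>

definition r where
  "r X = 1 / of_nat d * (\<Sum>j\<in>UNIV. partial j P X * x j X)"

lemma r_near: "r \<in> near_regular (int d - 1) p"
  unfolding r_def[abs_def]
  by (intro near_regular_cmult near_regular_sum near_regular_mult_deg[OF partial_P_near x_near] p) simp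

lemma dP_zeta:
  assumes "X $ i \<noteq> 0"
  shows "dP X Y = (\<Sum>j\<in>UNIV - {i}. (1 / of_nat d * partial j P X) * zeta i X Y $ j) + r X * zeta i X Y $ i"
proof -
  \<comment> \<open>The inverse of the change of coordinates; at j = i it uses
    \<open>x i X = 1\<close> and that \<open>zeta\<close> keeps the i-th entry.\<close>
  have Y: "Y $ j = (if j = i then 0 else zeta i X Y $ j) + x j X * zeta i X Y $ i" for j
    using assms by (simp add: zeta_def x_def)
  have "(\<Sum>j\<in>UNIV. partial j P X * Y $ j)
      = (\<Sum>j\<in>UNIV. (if j = i then 0 else partial j P X * zeta i X Y $ j) + partial j P X * x j X * zeta i X Y $ i)"
    by (rule sum.cong) (auto simp: Y distrib_left)
  also have "\<dots> = (\<Sum>j\<in>UNIV. if j = i then 0 else partial j P X * zeta i X Y $ j)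
      + (\<Sum>j\<in>UNIV. partial j P X * x j X) * zeta i X Y $ i"
    by (simp add: sum.distrib sum_distrib_right)
  also have "(\<Sum>j\<in>UNIV. if j = i then 0 else partial j P X * zeta i X Y $ j)
      = (\<Sum>j\<in>UNIV - {i}. partial j P X * zeta i X Y $ j)"
    by (rule sum.mono_neutral_cong_right) auto
  finally have "dP X Y = 1 / of_nat d * (\<Sum>j\<in>UNIV - {i}. partial j P X * zeta i X Y $ j) + r X * zeta i X Y $ i"
    unfolding dP_def r_def by (simp only: distrib_left mult.assoc)
  then show ?thesis by (simp only: sum_distrib_left mult.assoc)
qed

lemma \<sigma>_P_zero:
  assumes F: "F \<in> near_Y m (k - int m - int d) p"
  shows "\<sigma> (\<lambda>X Y. P X * F X Y) = \<zero>\<^bsub>Te.PM\<^esub>"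
proof -
  have PF: "(\<lambda>X Y. P X * F X Y) \<in> near_Y m (k - int m) p" by (rule near_Y_smult_deg[OF P_near[OF p] F p]) simp
  have "symb (map x (lst e)) (\<lambda>X. cf (\<lambda>X Y. P X * F X Y) e X) = \<zero>\<^bsub>Te.PM\<^esub>" if e: "e \<in> B" for e
  proof -
    have h: "(\<lambda>X. cf F e X) \<in> near_regular (k - int d) p"
      by (rule near_regular_mult_deg[OF near_regular_chart_coeff[OF F pi B_exponents[OF e]] near_regular_power[OF near_regular_coord[OF p] p] p]) simp
    have "symb (map x (lst e)) (\<lambda>X. cf (\<lambda>X Y. P X * F X Y) e X) = symb (map x (lst e)) (\<lambda>X. P X * cf F e X)"
    proof (rule symb_cong[OF cf_near[OF PF e]])
      show "eventually (\<lambda>X. cf (\<lambda>X Y. P X * F X Y) e X = P X * cf F e X) (zf p)"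
        using near_Y_homog[OF F]
      proof eventually_elim
        case (elim X)
        show ?case unfolding chart_coeff_def
          using coeffs_of_cmult[OF homog_poly_eta[OF elim] B_exponents[OF e]] by simp
      qed
    qed
    then show ?thesis using symb_P[OF near_list_lst[OF e] h] by simp
  qed
  then have "\<sigma> (\<lambda>X Y. P X * F X Y) = (\<Oplus>\<^bsub>Te.PM\<^esub>e\<in>B. \<zero>\<^bsub>Te.PM\<^esub>)"
    unfolding \<sigma>_def by (intro Te.PM.M.finsum_cong') auto
  then show ?thesis by (simp add: Te.PM.M.finsum_zero)
qed

text \<open>Each product of dP with a zeta-monomial of C splits into a term with one more factor of
  index i, which \<sigma> drops, and a sum over j \<noteq> i. If the monomial itself involves the
  index i, that sum is dropped as well; otherwise it is the conormal relation times a
  symbol.\<close>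

lemma \<sigma>_dP_zero:
  assumes C: "C \<in> W (m - 1) (k - int m - int d + 1)"
  shows "\<sigma> (\<lambda>X Y. dP X Y * C X Y) = \<zero>\<^bsub>Te.PM\<^esub>"
proof -
  have CY: "C \<in> near_Y (m - 1) (k - int m - int d + 1) p" and dC: "eventually (\<lambda>X. \<forall>Y. (delta ^^ 1) C X Y = 0) (zf p)"
    using C by (auto simp: near_K_def)
  define b where "b e = chart_coeff (m - 1) i C e" for e
  have b: "b e \<in> near_regular (k - int m - int d + 1) p" if "e \<in> exponents (m - 1)" for e
    unfolding b_def by (rule near_regular_chart_coeff[OF CY pi that])
  \<comment> \<open>The coefficients of dP in the coordinates \<open>zeta\<close>, by
    \<open>dP_zeta\<close>.\<close>
  define q where "q j X = (if j = i then r X else 1 / of_nat d * partial j P X)" for j X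
  have q: "q j \<in> near_regular (int d - 1) p" for j
  proof (cases "j = i")
    case True
    then have "q j = r" by (auto simp: q_def fun_eq_iff)
    then show ?thesis using r_near by simp
  next
    case False
    then have "q j = (\<lambda>X. 1 / of_nat d * partial j P X)" by (auto simp: q_def fun_eq_iff)
    then show ?thesis using near_regular_cmult[OF partial_P_near[OF p] p, of "1 / of_nat d" j] by (simp only:)
  qed
  define G where "G e j X Y = (q j X * b e X) * monomial (\<lambda>l. e l + unit_exp j l) (zeta i X Y)" for e j X Y
  have qb: "(\<lambda>X. q j X * b e X) \<in> near_regular (k - int m) p" if "e \<in> exponents (m - 1)" for e j
    by (rule near_regular_mult_deg[OF q b[OF that] p]) simp
  have ex: "(\<lambda>l. e l + unit_exp j l) \<in> exponents m" if "e \<in> exponents (m - 1)" for e j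
    using exponents_add[OF that unit_exp_exponents[of j]] m by simp
  have G: "G e j \<in> near_Y m (k - int m) p" if "e \<in> exponents (m - 1)" for e j
    unfolding G_def[abs_def] by (rule basis_near[OF qb ex]) (use that in auto)
  have \<sigma>G: "\<sigma> (G e j) = (if (e i = 0 \<and> j \<noteq> i) then symb (map x (j # lst e)) (\<lambda>X. q j X * b e X * X $ i ^ m) else \<zero>\<^bsub>Te.PM\<^esub>)"
    if e: "e \<in> exponents (m - 1)" for e j
  proof -
    have h: "(\<lambda>X. q j X * b e X * X $ i ^ m) \<in> near_regular k p"
      by (rule near_regular_mult_deg[OF qb[OF e] near_regular_power[OF near_regular_coord[OF p] p] p]) simp
    show ?thesis unfolding G_def[abs_def] \<sigma>_basis[OF qb[OF e] ex[OF e]] cons_lst[OF e h]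
      by (auto simp: unit_exp_def)
  qed
  have zero: "\<sigma> (\<lambda>X Y. (\<Sum>j\<in>UNIV - {i}. G e j X Y) + G e i X Y) = \<zero>\<^bsub>Te.PM\<^esub>" if e: "e \<in> exponents (m - 1)" for e
  proof -
    have "\<sigma> (\<lambda>X Y. (\<Sum>j\<in>UNIV - {i}. G e j X Y) + G e i X Y)
      = (\<Oplus>\<^bsub>Te.PM\<^esub>j\<in>UNIV - {i}. \<sigma> (G e j)) \<oplus>\<^bsub>Te.PM\<^esub> \<sigma> (G e i)"
      by (subst \<sigma>_add[OF near_Y_sum[OF G[OF e] p] G[OF e]], subst \<sigma>_sum[OF _ G[OF e]]) auto
    also have "\<sigma> (G e i) = \<zero>\<^bsub>Te.PM\<^esub>" by (simp add: \<sigma>G[OF e])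
    also have "(\<Oplus>\<^bsub>Te.PM\<^esub>j\<in>UNIV - {i}. \<sigma> (G e j)) = \<zero>\<^bsub>Te.PM\<^esub>"
    proof (cases "e i = 0")
      case False
      then have "(\<Oplus>\<^bsub>Te.PM\<^esub>j\<in>UNIV - {i}. \<sigma> (G e j)) = (\<Oplus>\<^bsub>Te.PM\<^esub>j\<in>UNIV - {i}. \<zero>\<^bsub>Te.PM\<^esub>)"
        by (intro Te.PM.M.finsum_cong') (auto simp: \<sigma>G[OF e])
      then show ?thesis by (simp add: Te.PM.M.finsum_zero)
    next
      case True
      \<comment> \<open>Chosen so that the factor X_i^(1 - d) of the conormal relation times h
        leaves b X_i^m / d, as (1 - d) + (m + d - 1) = m.\<close>
      define h where "h X = b e X * X $ i ^ (m + d - 1) / of_nat d" for X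
      have h: "h \<in> near_regular k p"
      proof -
        have "(\<lambda>X. b e X * X $ i ^ (m + d - 1)) \<in> near_regular k p"
          by (rule near_regular_mult_deg[OF b[OF e] near_regular_power[OF near_regular_coord[OF p] p] p]) (use m in auto)
        then have "(\<lambda>X. 1 / of_nat d * (b e X * X $ i ^ (m + d - 1))) \<in> near_regular k p"
          by (rule near_regular_cmult[OF _ p])
        then show ?thesis by (simp add: h_def[abs_def])
      qed
      have len: "length (lst e) + 1 = m" using length_lst[OF e] m by simp
      have term_eq: "\<sigma> (G e j) = symb (map x (j # lst e)) (\<lambda>X. (partial j P X * X $ i powi (1 - int d)) * h X)"
        if j: "j \<noteq> i" for j
      proof -
        have "symb (map x (j # lst e)) (\<lambda>X. q j X * b e X * X $ i ^ m)
          = symb (map x (j # lst e)) (\<lambda>X. (partial j P X * X $ i powi (1 - int d)) * h X)"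
        proof (rule symb_cong)
          show "(\<lambda>X. q j X * b e X * X $ i ^ m) \<in> near_regular k p"
            by (rule near_regular_mult_deg[OF qb[OF e] near_regular_power[OF near_regular_coord[OF p] p] p]) simp
          show "eventually (\<lambda>X. q j X * b e X * X $ i ^ m = (partial j P X * X $ i powi (1 - int d)) * h X) (zf p)"
            using Xi_nz
          proof eventually_elim
            case (elim X)
            have "X $ i powi (1 - int d) * X $ i powi int (m + d - 1) = X $ i powi ((1 - int d) + int (m + d - 1))"
              by (rule power_int_add[symmetric]) (use elim in simp)
            also have "(1 - int d) + int (m + d - 1) = int m" using d by simp
            finally have "X $ i powi (1 - int d) * X $ i ^ (m + d - 1) = X $ i ^ m" by simp
            then show ?case using j by (simp add: q_def h_def)
          qed
        qed
        then show ?thesis using \<sigma>G[OF e, of j] True j by simp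
      qed
      have tc: "symb (map x (j # lst e)) (\<lambda>X. (partial j P X * X $ i powi (1 - int d)) * h X) \<in> carrier Te.PM"
        if "j \<noteq> i" for j
        unfolding term_eq[OF that, symmetric] by (rule \<sigma>_closed[OF G[OF e]])
      have "(\<Oplus>\<^bsub>Te.PM\<^esub>j\<in>UNIV - {i}. \<sigma> (G e j))
        = (\<Oplus>\<^bsub>Te.PM\<^esub>j\<in>UNIV - {i}. symb (map x (j # lst e)) (\<lambda>X. (partial j P X * X $ i powi (1 - int d)) * h X))"
        by (rule Te.PM.M.finsum_cong'[OF refl]) (use tc in blast, use term_eq in blast)
      then show ?thesis using symb_relation[OF len h] by simp
    qed
    finally show ?thesis by simp
  qed
  have "\<sigma> (\<lambda>X Y. dP X Y * C X Y) = \<sigma> (\<lambda>X Y. \<Sum>e\<in>exponents (m - 1). (\<Sum>j\<in>UNIV - {i}. G e j X Y) + G e i X Y)"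
  proof (rule \<sigma>_cong)
    show "(\<lambda>X Y. dP X Y * C X Y) \<in> near_Y m (k - int m) p"
      by (rule near_Y_mult_deg[OF dP_near[OF p] CY p]) (use m in auto)
    show "eventually (\<lambda>X. \<forall>Y. dP X Y * C X Y = (\<Sum>e\<in>exponents (m - 1). (\<Sum>j\<in>UNIV - {i}. G e j X Y) + G e i X Y)) (zf p)"
      using near_Y_homog[OF CY] Xi_nz
    proof eventually_elim
      case (elim X)
      show ?case
      proof
        fix Y
        have "C X Y = (\<Sum>e\<in>exponents (m - 1). b e X * monomial e (zeta i X Y))"
          unfolding b_def by (rule chart_expansion[where F = C, OF elim(1)])
        then have "dP X Y * C X Y = (\<Sum>e\<in>exponents (m - 1). dP X Y * (b e X * monomial e (zeta i X Y)))"
          by (simp add: sum_distrib_left)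
        also have "\<dots> = (\<Sum>e\<in>exponents (m - 1). (\<Sum>j\<in>UNIV - {i}. G e j X Y) + G e i X Y)"
        proof (rule sum.cong[OF refl])
          fix e
          have "G e j X Y = q j X * zeta i X Y $ j * (b e X * monomial e (zeta i X Y))" for j
            by (simp add: G_def monomial_add)
          then have "(\<Sum>j\<in>UNIV - {i}. G e j X Y) + G e i X Y
            = ((\<Sum>j\<in>UNIV - {i}. q j X * zeta i X Y $ j) + q i X * zeta i X Y $ i) * (b e X * monomial e (zeta i X Y))"
            by (simp only: distrib_right sum_distrib_right)
          also have "(\<Sum>j\<in>UNIV - {i}. q j X * zeta i X Y $ j) + q i X * zeta i X Y $ i = dP X Y"
            unfolding dP_zeta[OF elim(2)] by (auto simp: q_def intro!: sum.cong)
          finally show "dP X Y * (b e X * monomial e (zeta i X Y)) = (\<Sum>j\<in>UNIV - {i}. G e j X Y) + G e i X Y" ..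
        qed
        finally show "dP X Y * C X Y = (\<Sum>e\<in>exponents (m - 1). (\<Sum>j\<in>UNIV - {i}. G e j X Y) + G e i X Y)" .
      qed
    qed
  qed
  also have "\<dots> = (\<Oplus>\<^bsub>Te.PM\<^esub>e\<in>exponents (m - 1). \<sigma> (\<lambda>X Y. (\<Sum>j\<in>UNIV - {i}. G e j X Y) + G e i X Y))"
    by (rule \<sigma>_sum) (auto intro!: near_Y_add near_Y_sum G p)
  also have "\<dots> = (\<Oplus>\<^bsub>Te.PM\<^esub>e\<in>(exponents (m - 1) :: ('n \<Rightarrow> nat) set). \<zero>\<^bsub>Te.PM\<^esub>)"
    by (rule Te.PM.M.finsum_cong') (auto simp: zero)
  finally show ?thesis by (simp add: Te.PM.M.finsum_zero)
qed

text \<open>\<sigma> kills both terms of \<beta>(P)(b), the multiple of P and the multiple of dP.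
  Taken alone they need not lie in Ker \<delta>, which is why \<sigma> is defined on all of
  \<open>near_Y\<close>.\<close>

lemma \<sigma>_Z:
  assumes "F \<in> Z m (k - int m)" shows "\<sigma> F = \<zero>\<^bsub>Te.PM\<^esub>"
proof -
  obtain b where b: "b \<in> near_K 2 m (k - int m - int d) p" "eventually (\<lambda>X. \<forall>Y. F X Y = beta d P b X Y) (zf p)"
    by (rule ZE[OF assms])
  have bY: "b \<in> near_Y m (k - int m - int d) p" "eventually (\<lambda>X. \<forall>Y. delta (delta b) X Y = 0) (zf p)"
    using b(1) unfolding near_K_eq2 by auto
  have C: "delta b \<in> W (m - 1) (k - int m - int d + 1)"
    unfolding near_K_eq1 using near_Y_delta[OF bY(1) p] bY(2) by simp
  have PY: "(\<lambda>X Y. P X * b X Y) \<in> near_Y m (k - int m) p" by (rule near_Y_smult_deg[OF P_near[OF p] bY(1) p]) simp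
  have dY': "(\<lambda>X Y. dP X Y * delta b X Y) \<in> near_Y m (k - int m) p"
    by (rule near_Y_mult_deg[OF dP_near[OF p] near_K_near_Y[OF C] p]) (use m in auto)
  have m1: "(\<lambda>X. -1) \<in> near_regular 0 p" by (rule near_regular_const[OF p])
  have n: "(\<lambda>X Y. (-1) * (dP X Y * delta b X Y)) \<in> near_Y m (k - int m) p" by (rule near_Y_cmult[OF dY' p])
  have s: "(\<lambda>X Y. P X * b X Y + (-1) * (dP X Y * delta b X Y)) \<in> near_Y m (k - int m) p"
    by (rule near_Y_add[OF PY n p])
  have "\<sigma> (\<lambda>X Y. P X * b X Y + (-1) * (dP X Y * delta b X Y)) = \<sigma> F"
    by (rule \<sigma>_cong[OF s]) (use b(2) in eventually_elim, simp add: beta_dP)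
  moreover have "\<sigma> (\<lambda>X Y. P X * b X Y + (-1) * (dP X Y * delta b X Y))
      = \<sigma> (\<lambda>X Y. P X * b X Y) \<oplus>\<^bsub>Te.PM\<^esub> \<sigma> (\<lambda>X Y. (-1) * (dP X Y * delta b X Y))"
    by (rule \<sigma>_add[OF PY n])
  moreover have "\<sigma> (\<lambda>X Y. (-1) * (dP X Y * delta b X Y)) = germ 0 (\<lambda>X. -1) \<odot>\<^bsub>Te.PM\<^esub> \<sigma> (\<lambda>X Y. dP X Y * delta b X Y)"
    by (rule \<sigma>_smult[OF m1 dY'])
  ultimately show ?thesis
    using \<sigma>_P_zero[OF bY(1)] \<sigma>_dP_zero[OF C] germ_closed[OF m1] by (simp add: Te.PM.smult_r_null)
qed

lemma dY_x: "j \<noteq> i \<Longrightarrow> X $ i \<noteq> 0 \<Longrightarrow> dY (x j) X Y = zeta i X Y $ j / X $ i"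
proof -
  assume j: "j \<noteq> i" and X: "X $ i \<noteq> 0"
  have "has_pd (\<lambda>X. X $ j / X $ i) (\<lambda>l. ((if l = j then 1 else 0) * X $ i - X $ j * (if l = i then 1 else 0)) / (X $ i * X $ i)) X"
    by (intro has_pd_divide has_pd_coord X)
  then have pl: "partial l (x j) X = ((if l = j then 1 else 0) * X $ i - X $ j * (if l = i then 1 else 0)) / (X $ i * X $ i)" for l
    unfolding x_def[abs_def] by (rule has_pd_partial)
  have "dY (x j) X Y = (\<Sum>l\<in>UNIV. (if l = j then Y $ j / X $ i else 0) - (if l = i then X $ j * Y $ i / (X $ i * X $ i) else 0))"
    unfolding dY_def pl by (intro sum.cong) (use j X in \<open>auto simp: field_simps\<close>)
  also have "\<dots> = zeta i X Y $ j / X $ i"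
    using j X by (simp add: sum_subtractf zeta_def field_simps)
  finally show ?thesis .
qed

lemma prod_dY_x:
  assumes e: "e \<in> B" and X: "X $ i \<noteq> 0"
  shows "(\<Prod>f\<leftarrow>map x (lst e). dY f X Y) * X $ i ^ m = monomial e (zeta i X Y)"
proof -
  have "(\<Prod>f\<leftarrow>map x (lst e). dY f X Y) = (\<Prod>j\<in>UNIV. dY (x j) X Y ^ e j)"
    using prod_list_count[of "\<lambda>j. dY (x j) X Y" "lst e"] by (simp add: count_lst comp_def)
  also have "\<dots> = (\<Prod>j\<in>UNIV. (zeta i X Y $ j / X $ i) ^ e j)"
  proof (rule prod.cong[OF refl])
    fix j show "dY (x j) X Y ^ e j = (zeta i X Y $ j / X $ i) ^ e j"
      using e dY_x[OF _ X] by (cases "j = i") (auto simp: B_def)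
  qed
  also have "\<dots> = monomial e (zeta i X Y) / X $ i ^ m"
  proof -
    have "(\<Prod>j\<in>UNIV. X $ i ^ e j) = X $ i ^ m" using e by (simp add: B_def exponents_def flip: power_sum)
    then show ?thesis by (simp add: power_divide prod_dividef monomial_def)
  qed
  finally show ?thesis using X by simp
qed

text \<open>By \<open>prod_dY_x\<close>, X_i^m times the product of the differentials of the affine
  coordinates is the zeta-monomial again. Since \<delta> F = 0, the monomials with exponent in B
  already make up F.\<close>

lemma lift_\<sigma>:
  assumes F: "F \<in> W m (k - int m)"
  shows "(\<lambda>X Y. Te.lift (\<sigma> F) X Y - F X Y) \<in> Z m (k - int m)"
proof -
  have FY: "F \<in> near_Y m (k - int m) p" and dF: "eventually (\<lambda>X. \<forall>Y. (delta ^^ 1) F X Y = 0) (zf p)"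
    using F by (auto simp: near_K_def)
  have 1: "(\<lambda>X Y. Te.lift (\<sigma> F) X Y - (\<Sum>e\<in>B. Te.lift (symb (map x (lst e)) (\<lambda>X. cf F e X)) X Y)) \<in> Z m (k - int m)"
    using Te.lift_finsum[OF finite_B, of "\<lambda>e. symb (map x (lst e)) (\<lambda>X. cf F e X)"] \<sigma>_term[OF FY]
    by (auto simp: Te.eqv_def \<sigma>_def)
  have 2: "(\<lambda>X Y. \<Sum>e\<in>B. Te.lift (symb (map x (lst e)) (\<lambda>X. cf F e X)) X Y
      - cf F e X * (\<Prod>f\<leftarrow>map x (lst e). dY f X Y)) \<in> Z m (k - int m)"
    by (rule Te.Z_sum[OF finite_B lift_symb[OF near_list_lst cf_near[OF FY]]])
  have "(\<lambda>X Y. Te.lift (\<sigma> F) X Y - (\<Sum>e\<in>B. cf F e X * (\<Prod>f\<leftarrow>map x (lst e). dY f X Y))) \<in> Z m (k - int m)"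
    using Z_add[OF 1 2] by (simp add: sum_subtractf)
  then show ?thesis
  proof (rule Z_cong)
    show "eventually (\<lambda>X. \<forall>Y. Te.lift (\<sigma> F) X Y - (\<Sum>e\<in>B. cf F e X * (\<Prod>f\<leftarrow>map x (lst e). dY f X Y))
        = Te.lift (\<sigma> F) X Y - F X Y) (zf p)"
      using near_Y_homog[OF FY] Xi_nz dF
    proof eventually_elim
      case (elim X)
      have "(\<Sum>e\<in>B. cf F e X * (\<Prod>f\<leftarrow>map x (lst e). dY f X Y)) = F X Y" for Y
      proof -
        have "F X Y = (\<Sum>e\<in>exponents m. chart_coeff m i F e X * monomial e (zeta i X Y))"
          by (rule chart_expansion[where F = F, OF elim(1)])
        also have "\<dots> = (\<Sum>e\<in>B. chart_coeff m i F e X * monomial e (zeta i X Y))"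
        proof (rule sum.mono_neutral_right)
          show "\<forall>e\<in>exponents m - B. chart_coeff m i F e X * monomial e (zeta i X Y) = 0"
          proof
            fix e assume "e \<in> exponents m - B"
            then have e: "e \<in> exponents m" "1 \<le> e i" by (auto simp: B_def)
            show "chart_coeff m i F e X * monomial e (zeta i X Y) = 0"
              using chart_coeff_vanish[where F = F, OF elim(1,2,3) e] by simp
          qed
        qed (auto simp: B_def)
        also have "\<dots> = (\<Sum>e\<in>B. cf F e X * (\<Prod>f\<leftarrow>map x (lst e). dY f X Y))"
          by (rule sum.cong[OF refl]) (simp only: prod_dY_x[OF _ elim(2), symmetric] mult_ac)
        finally show ?thesis ..
      qed
      then show ?case by (simp only:) simp
    qed
  qed
qed

section \<open>Surjectivity of \<sigma> and injectivity of the lift\<close>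

definition N where
  "N = \<sigma> ` W m (k - int m)"

lemma submodule_N: "submodule N A Te.PM"
proof (rule Te.PM.submoduleI)
  show "N \<subseteq> carrier Te.PM" unfolding N_def using \<sigma>_closed near_K_near_Y by blast
  show "\<zero>\<^bsub>Te.PM\<^esub> \<in> N" unfolding N_def
    by (rule image_eqI[where x = "\<lambda>X Y. 0"]) (rule \<sigma>_zero[symmetric], rule near_K_zero[OF p])
  have sm: "a \<odot>\<^bsub>Te.PM\<^esub> y \<in> N" if a: "a \<in> carrier A" and y: "y \<in> N" for a y
  proof -
    obtain F where F: "F \<in> W m (k - int m)" "y = \<sigma> F" using y by (auto simp: N_def)
    have "a \<odot>\<^bsub>Te.PM\<^esub> y = \<sigma> (\<lambda>X Y. rep a X * F X Y)"
      using \<sigma>_smult[OF rep(1)[OF a] near_K_near_Y[OF F(1)]] rep(2)[OF a] F(2) by simp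
    moreover have "(\<lambda>X Y. rep a X * F X Y) \<in> W m (k - int m)" by (rule W_smult[OF rep(1)[OF a] F(1)]) simp
    ultimately show ?thesis unfolding N_def by blast
  qed
  show "a \<odot>\<^bsub>Te.PM\<^esub> y \<in> N" if "a \<in> carrier A" "y \<in> N" for a y by (rule sm[OF that])
  show "y \<oplus>\<^bsub>Te.PM\<^esub> z \<in> N" if yz: "y \<in> N" "z \<in> N" for y z
  proof -
    obtain F where F: "F \<in> W m (k - int m)" "y = \<sigma> F" using yz by (auto simp: N_def)
    obtain G where G: "G \<in> W m (k - int m)" "z = \<sigma> G" using yz by (auto simp: N_def)
    have "y \<oplus>\<^bsub>Te.PM\<^esub> z = \<sigma> (\<lambda>X Y. F X Y + G X Y)"
      using \<sigma>_add[OF near_K_near_Y[OF F(1)] near_K_near_Y[OF G(1)]] F G by simp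
    then show ?thesis unfolding N_def using near_K_add[OF F(1) G(1) p] by blast
  qed
  show "\<ominus>\<^bsub>Te.PM\<^esub> y \<in> N" if y: "y \<in> N" for y
  proof -
    have yc: "y \<in> carrier Te.PM" using y \<sigma>_closed near_K_near_Y unfolding N_def by blast
    have "\<ominus>\<^bsub>Te.PM\<^esub> y = (\<ominus>\<^bsub>A\<^esub> \<one>\<^bsub>A\<^esub>) \<odot>\<^bsub>Te.PM\<^esub> y"
      using Te.PM.smult_l_minus[OF Om.F.R.one_closed yc] Te.PM.smult_one[OF yc] by simp
    then show ?thesis using sm[OF Om.F.R.a_inv_closed[OF Om.F.R.one_closed] y] by simp
  qed
qed

text \<open>If i occurs, the symbol is zero, because \<open>x i\<close> is 1 near p and the
  differential of a constant vanishes. Otherwise a reordering of the factors makes it the image of a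
  single zeta-monomial.\<close>

lemma monomial_symb_N:
  assumes js: "length js = m" and h: "h \<in> near_regular k p"
  shows "symb (map x js) h \<in> N"
proof (cases "i \<in> set js")
  case True
  then obtain us vs where js': "js = us @ i # vs" using split_list by metis
  have "dd (x i) = dd (\<lambda>X. 1)" using germ_eqI[OF x_near x_i] by simp
  then have z: "dd (x i) = \<zero>\<^bsub>Om.PM\<^esub>" using dd_const by simp
  have "sprod (map dd (map x js)) = \<zero>\<^bsub>Sy.PM\<^esub>"
    using sprod_zero[of "map dd (map x us)" "map dd (map x vs)"] near_list_gens[OF near_list_x[OF js]]
    by (simp add: js' z)
  then have "symb (map x js) h = \<zero>\<^bsub>Te.PM\<^esub>" unfolding symb_def using ten_zero[OF germ_T_closed[OF h]] by simp
  then show ?thesis using subgroup.one_closed[OF submodule.axioms(1)[OF submodule_N]] by simp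
next
  case False
  define e where "e = count (mset js)"
  have e: "e \<in> exponents m" using js length_eq_sum_count[of js] by (simp add: e_def exponents_def)
  have ei: "e i = 0" using False by (simp add: e_def)
  define f where "f X = h X * X $ i powi (- int m)" for X
  have f: "f \<in> near_regular (k - int m) p"
    unfolding f_def[abs_def] by (rule near_regular_mult_deg[OF h Xi_powi p]) simp
  have K: "(\<lambda>X Y. f X * monomial e (zeta i X Y)) \<in> W m (k - int m)"
    unfolding near_K_eq1
  proof (intro conjI basis_near[OF f e])
    show "eventually (\<lambda>X. \<forall>Y. delta (\<lambda>X Y. f X * monomial e (zeta i X Y)) X Y = 0) (zf p)"
      using Xi_nz
    proof eventually_elim
      case (elim X)
      show ?case
        using delta_smult[where F = "\<lambda>X Y. monomial e (zeta i X Y)" and f = f and X = X, OF homog_poly_zeta[OF homog_poly_monomial[OF e]]]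
          delta_zeta_monomial[OF e elim] ei by simp
    qed
  qed
  have "mset (lst e) = mset js" using count_lst[of e] unfolding e_def by (simp only: count_inject)
  then have ms: "mset (map dd (map x js)) = mset (map dd (map x (lst e)))" by (simp only: mset_map)
  have "sprod ([] @ map dd (map x js)) = sprod ([] @ map dd (map x (lst e)))"
    by (rule sprod_perm[OF ms]) (use near_list_gens[OF near_list_x[OF js]] in simp)
  then have "symb (map x js) h = symb (map x (lst e)) h" by (simp add: symb_def)
  also have "\<dots> = symb (map x (lst e)) (\<lambda>X. f X * X $ i ^ m)"
    by (rule symb_cong[OF h]) (use Xi_nz in eventually_elim, simp add: f_def power_int_minus)
  also have "\<dots> = \<sigma> (\<lambda>X Y. f X * monomial e (zeta i X Y))" using \<sigma>_basis[OF f e] ei by simp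
  finally show ?thesis using K unfolding N_def by blast
qed

lemma submodule_vimage_hom:
  assumes M: "module A M" and c: "\<And>\<omega>. \<omega> \<in> carrier M \<Longrightarrow> f \<omega> \<in> carrier Te.PM"
    and add: "\<And>\<omega> \<omega>'. \<omega> \<in> carrier M \<Longrightarrow> \<omega>' \<in> carrier M \<Longrightarrow> f (\<omega> \<oplus>\<^bsub>M\<^esub> \<omega>') = f \<omega> \<oplus>\<^bsub>Te.PM\<^esub> f \<omega>'"
    and sm: "\<And>a \<omega>. a \<in> carrier A \<Longrightarrow> \<omega> \<in> carrier M \<Longrightarrow> f (a \<odot>\<^bsub>M\<^esub> \<omega>) = a \<odot>\<^bsub>Te.PM\<^esub> f \<omega>"
  shows "submodule {\<omega> \<in> carrier M. f \<omega> \<in> N} A M"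
proof -
  interpret M: module A M by fact
  note NE = Te.PM.submoduleE[OF submodule_N]
  have sm': "a \<odot>\<^bsub>M\<^esub> \<omega> \<in> {\<omega> \<in> carrier M. f \<omega> \<in> N}" if "a \<in> carrier A" "\<omega> \<in> {\<omega> \<in> carrier M. f \<omega> \<in> N}" for a \<omega>
    using that NE(4)[OF that(1)] sm[OF that(1)] M.smult_closed[OF that(1)] by auto
  have z: "f \<zero>\<^bsub>M\<^esub> = \<zero>\<^bsub>Te.PM\<^esub>"
    using sm[OF Om.F.R.zero_closed M.M.zero_closed] M.smult_l_null[OF M.M.zero_closed]
      Te.PM.smult_l_null[OF c[OF M.M.zero_closed]] by simp
  show ?thesis
  proof (rule M.submoduleI)
    show "\<zero>\<^bsub>M\<^esub> \<in> {\<omega> \<in> carrier M. f \<omega> \<in> N}"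
      using z subgroup.one_closed[OF submodule.axioms(1)[OF submodule_N]] by simp
    show "\<ominus>\<^bsub>M\<^esub> \<omega> \<in> {\<omega> \<in> carrier M. f \<omega> \<in> N}" if w: "\<omega> \<in> {\<omega> \<in> carrier M. f \<omega> \<in> N}" for \<omega>
    proof -
      have wc: "\<omega> \<in> carrier M" using w by simp
      have "\<ominus>\<^bsub>M\<^esub> \<omega> = (\<ominus>\<^bsub>A\<^esub> \<one>\<^bsub>A\<^esub>) \<odot>\<^bsub>M\<^esub> \<omega>"
        using M.smult_l_minus[OF Om.F.R.one_closed wc] M.smult_one[OF wc] by simp
      then show ?thesis using sm'[OF Om.F.R.a_inv_closed[OF Om.F.R.one_closed] w] by simp
    qed
    show "\<omega> \<oplus>\<^bsub>M\<^esub> \<omega>' \<in> {\<omega> \<in> carrier M. f \<omega> \<in> N}"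
      if "\<omega> \<in> {\<omega> \<in> carrier M. f \<omega> \<in> N}" "\<omega>' \<in> {\<omega> \<in> carrier M. f \<omega> \<in> N}" for \<omega> \<omega>'
      using that add[of \<omega> \<omega>'] NE(5)[of "f \<omega>" "f \<omega>'"] by auto
  qed (use sm' in auto)
qed

text \<open>The factors are reduced one by one from the left: \<open>js\<close> records those
  already of the form \<open>dd (x j)\<close>, and an arbitrary next factor is a combination of such
  differentials by \<open>dd_eq_D\<close>, in which the symbol is linear.\<close>

lemma list_symb_N:
  assumes C: "C \<in> carrier Tk"
  shows "length js + length post = m \<Longrightarrow> set post \<subseteq> carrier Om.PM \<Longrightarrow>
    ten (sprod (map (\<lambda>j. dd (x j)) js @ post)) C \<in> N"
proof (induction post arbitrary: js)
  case Nil
  obtain h where h: "h \<in> near_regular k p" "C = germ k h" using C by (auto simp: T_simps)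
  have "symb (map x js) h \<in> N" by (rule monomial_symb_N[OF _ h(1)]) (use Nil in simp)
  then show ?case by (simp add: symb_def h(2) comp_def)
next
  case (Cons \<omega> post)
  let ?L = "(map (\<lambda>j. dd (x j)) js, post)"
  have L: "set (fst ?L) \<subseteq> carrier Om.PM" "set (snd ?L) \<subseteq> carrier Om.PM" "length (fst ?L) + 1 + length (snd ?L) = m"
    using Cons.prems dd_closed[OF x_near] by auto
  note lin = \<psi>_linear[OF L C]
  have S: "submodule {\<omega> \<in> carrier Om.PM. \<psi> ?L C \<omega> \<in> N} A Om.PM"
    by (rule submodule_vimage_hom[OF Om.PM.module_axioms]) (use lin in auto)
  have x: "dd (x j) \<in> {\<omega> \<in> carrier Om.PM. \<psi> ?L C \<omega> \<in> N}" for j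
    using Cons.IH[of "js @ [j]"] Cons.prems dd_closed[OF x_near[of j]] by (simp add: \<psi>_def)
  have "\<omega> \<in> {\<omega> \<in> carrier Om.PM. \<psi> ?L C \<omega> \<in> N}"
  proof (rule Om.generated[OF S])
    show "\<omega> \<in> carrier Om.PM" using Cons.prems by simp
    fix a assume "a \<in> carrier A"
    then obtain f where f: "f \<in> near_regular 0 p" "a = germ 0 f" by (auto simp: A_simps)
    have "D f \<in> {\<omega> \<in> carrier Om.PM. \<psi> ?L C \<omega> \<in> N}"
      unfolding D_def
      by (rule finsum_submodule[OF Om.PM.module_axioms S])
        (simp, intro Pi_I Om.PM.submoduleE(4)[OF S germ_closed[OF c_near[OF f(1)]] x])
    then show "Om.gen a \<in> {\<omega> \<in> carrier Om.PM. \<psi> ?L C \<omega> \<in> N}" unfolding f(2) dd_eq_D[OF f(1)] .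
  qed
  then show ?case by (simp add: \<psi>_def)
qed

lemma \<sigma>_surj:
  assumes "t \<in> carrier Te.PM" shows "\<exists>F\<in>W m (k - int m). t = \<sigma> F"
proof -
  have "t \<in> N"
  proof (rule Te.generated[OF submodule_N _ assms])
    fix sC assume "sC \<in> carrier Sy.PM \<times> carrier Tk"
    then obtain s C where sC: "sC = (s, C)" "s \<in> carrier Sy.PM" "C \<in> carrier Tk" by auto
    have S: "submodule {s \<in> carrier Sy.PM. ten s C \<in> N} A Sy.PM"
      by (rule submodule_vimage_hom[OF Sy.PM.module_axioms])
        (use ten_closed ten_add1 ten_smult1 sC(3) in auto)
    have "s \<in> {s \<in> carrier Sy.PM. ten s C \<in> N}"
    proof (rule Sy.generated[OF S _ sC(2)])
      fix xs assume xs: "xs \<in> gens"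
      have "ten (sprod (map (\<lambda>j. dd (x j)) [] @ xs)) C \<in> N"
        by (rule list_symb_N[OF sC(3)]) (use xs in \<open>auto simp: sym_gens_def\<close>)
      then show "sprod xs \<in> {s \<in> carrier Sy.PM. ten s C \<in> N}" using Sy.gen_closed[OF xs] by simp
    qed
    then show "Te.gen sC \<in> N" by (simp add: sC(1))
  qed
  then show ?thesis by (auto simp: N_def)
qed

text \<open>Write t = \<sigma> F. Then F is congruent to the lift of t, hence lies in Z, and
  \<sigma> kills Z.\<close>

lemma lift_injective:
  assumes t: "t \<in> carrier Te.PM" and z: "Te.lift t \<in> Z m (k - int m)"
  shows "t = \<zero>\<^bsub>Te.PM\<^esub>"
proof -
  obtain F where F: "F \<in> W m (k - int m)" "t = \<sigma> F" using \<sigma>_surj[OF t] by blast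
  have "(\<lambda>X Y. Te.lift t X Y + - (Te.lift t X Y - F X Y)) \<in> Z m (k - int m)"
    by (rule Z_add[OF z Z_neg]) (use lift_\<sigma>[OF F(1)] F(2) in simp)
  then have "F \<in> Z m (k - int m)" by simp
  then show ?thesis using \<sigma>_Z F(2) by simp
qed

lemma lift_eq_imp_eq:
  assumes t: "t \<in> carrier Te.PM" and t': "t' \<in> carrier Te.PM"
    and z: "(\<lambda>X Y. Te.lift t X Y - Te.lift t' X Y) \<in> Z m (k - int m)"
  shows "t = t'"
proof -
  define u where "u = t \<ominus>\<^bsub>Te.PM\<^esub> t'"
  have u: "u \<in> carrier Te.PM" unfolding u_def by (rule Te.PM.M.minus_closed[OF t t'])
  have ut: "u \<oplus>\<^bsub>Te.PM\<^esub> t' = t"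
    unfolding u_def a_minus_def using t t' by (simp add: Te.PM.M.a_assoc Te.PM.M.l_neg)
  have "(\<lambda>X Y. Te.lift t X Y - (Te.lift u X Y + Te.lift t' X Y)) \<in> Z m (k - int m)"
    using Te.lift_add[OF u t'] unfolding ut by (simp add: Te.eqv_def)
  from Z_add[OF z Z_neg[OF this]] have "Te.lift u \<in> Z m (k - int m)" by simp
  then have "u = \<zero>\<^bsub>Te.PM\<^esub>" by (rule lift_injective[OF u])
  then show ?thesis using ut t' by simp
qed

end

section \<open>The sheaf of symmetric differentials\<close>

context smooth_hypersurface_context
begin

text \<open>The map \<sigma> with point and chart as arguments, because sections of the sheaf
  require both to vary.\<close>

definition sig :: "nat \<Rightarrow> int \<Rightarrow> 'n \<Rightarrow> 'n point \<Rightarrow> (complex ^ 'n \<Rightarrow> complex ^ 'n \<Rightarrow> complex) \<Rightarrow> _" where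
  "sig m k i q F = (\<Oplus>\<^bsub>Sym_Omega_stalk d P m k q\<^esub>e\<in>{e\<in>exponents m. e i = 0}.
     Sym_Omega_elem d P m k q (map (\<lambda>j X. X $ j / X $ i) (lst e)) (\<lambda>X. chart_coeff m i F e X * X $ i ^ m))"

lemma chart_stalkI: "q \<in> chart i \<Longrightarrow> m \<ge> 1 \<Longrightarrow> chart_stalk d P q m i"
  by (intro chart_stalk.intro symbol_stalk.intro stalk.intro stalk_axioms.intro chart_stalk_axioms.intro
      smooth_hypersurface_context_axioms in_chart(1))

lemma sig_eq:
  assumes "q \<in> chart i" "m \<ge> 1"
  shows "sig m k i q F = chart_stalk.\<sigma> d P q m k i F"
proof -
  interpret S: chart_stalk d P q m k i by (rule chart_stalkI[OF assms])
  show ?thesis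
    unfolding sig_def S.\<sigma>_def S.Sym_Omega_elem_eq S.Sym_Omega_stalk_eq S.B_def S.x_def[abs_def] ..
qed

lemma module_Sym_Omega_stalk:
  assumes "q \<in> proj_points"
  shows "module (OH_stalk d P q) (Sym_Omega_stalk d P m k q)"
proof -
  interpret S: stalk d P q by (intro stalk.intro stalk_axioms.intro smooth_hypersurface_context_axioms assms)
  interpret S: symbol_stalk d P q m k ..
  show ?thesis unfolding S.Sym_Omega_stalk_eq by (rule S.Te.module_PM)
qed

lemma Sym_Omega_elem_closed:
  assumes "q \<in> proj_points" "length fs = m" "\<And>f. f \<in> set fs \<Longrightarrow> f \<in> near_regular 0 q" "h \<in> near_regular k q"
  shows "Sym_Omega_elem d P m k q fs h \<in> carrier (Sym_Omega_stalk d P m k q)"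
proof -
  interpret S: stalk d P q by (intro stalk.intro stalk_axioms.intro smooth_hypersurface_context_axioms assms)
  interpret S: symbol_stalk d P q m k ..
  show ?thesis unfolding S.Sym_Omega_stalk_eq S.Sym_Omega_elem_eq
    by (rule S.symb_closed) (use assms in \<open>auto simp: S.near_list_def\<close>)
qed

context
  fixes m :: nat and n k :: int
  assumes m: "m \<ge> 1" and k: "k = int m + n"
begin

lemma km: "k - int m = n"
  using k by simp

abbreviation "SO q \<equiv> Sym_Omega_stalk d P m k q"

lemma sig_closed: "q \<in> chart i \<Longrightarrow> F \<in> near_Y m n q \<Longrightarrow> sig m k i q F \<in> carrier (SO q)"
proof -
  assume q: "q \<in> chart i" and F: "F \<in> near_Y m n q"
  interpret S: chart_stalk d P q m k i by (rule chart_stalkI[OF q m])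
  show ?thesis unfolding sig_eq[OF q m] S.Sym_Omega_stalk_eq
    by (rule S.\<sigma>_closed) (simp add: km F)
qed

lemma sig_cong:
  assumes q: "q \<in> chart i" and F: "F \<in> near_Y m n q" and e: "eventually (\<lambda>X. \<forall>Y. F X Y = G X Y) (zf q)"
  shows "sig m k i q F = sig m k i q G"
proof -
  interpret S: chart_stalk d P q m k i by (rule chart_stalkI[OF q m])
  show ?thesis unfolding sig_eq[OF q m] by (rule S.\<sigma>_cong[OF _ e]) (simp add: km F)
qed

lemma sig_add:
  assumes q: "q \<in> chart i" and F: "F \<in> near_Y m n q" and G: "G \<in> near_Y m n q"
  shows "sig m k i q (\<lambda>X Y. F X Y + G X Y) = sig m k i q F \<oplus>\<^bsub>SO q\<^esub> sig m k i q G"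
proof -
  interpret S: chart_stalk d P q m k i by (rule chart_stalkI[OF q m])
  show ?thesis unfolding sig_eq[OF q m] S.Sym_Omega_stalk_eq by (rule S.\<sigma>_add) (simp_all add: km F G)
qed

lemma sig_smult:
  assumes q: "q \<in> chart i" and f: "f \<in> near_regular 0 q" and F: "F \<in> near_Y m n q"
  shows "sig m k i q (\<lambda>X Y. f X * F X Y) = OH_germ d P q 0 f \<odot>\<^bsub>SO q\<^esub> sig m k i q F"
proof -
  interpret S: chart_stalk d P q m k i by (rule chart_stalkI[OF q m])
  show ?thesis unfolding sig_eq[OF q m] S.Sym_Omega_stalk_eq by (rule S.\<sigma>_smult[OF f]) (simp add: km F)
qed

lemma sig_zero: "q \<in> chart i \<Longrightarrow> sig m k i q (\<lambda>X Y. 0) = \<zero>\<^bsub>SO q\<^esub>"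
proof -
  assume q: "q \<in> chart i"
  interpret S: chart_stalk d P q m k i by (rule chart_stalkI[OF q m])
  show ?thesis unfolding sig_eq[OF q m] S.Sym_Omega_stalk_eq by (rule S.\<sigma>_zero)
qed

text \<open>F is the lift of the sum of symbols, so this sum and \<sigma> F have congruent lifts and
  agree by injectivity. The formula for F does not mention q, so symbols given on an open set yield
  one function on its cone.\<close>

lemma sig_elem:
  assumes q: "q \<in> chart i" and h: "\<And>j. j < r \<Longrightarrow> h j \<in> near_regular k q"
    and f: "\<And>j. j < (r::nat) \<Longrightarrow> length (f j) = m \<and> (\<forall>g\<in>set (f j). g \<in> near_regular 0 q)"
  defines "F \<equiv> (\<lambda>X Y. \<Sum>j<r. h j X * (\<Prod>g\<leftarrow>f j. dY g X Y))"
  shows "F \<in> near_K 1 m n q"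
    and "(\<Oplus>\<^bsub>SO q\<^esub>j\<in>{..<r}. Sym_Omega_elem d P m k q (f j) (h j)) = sig m k i q F"
proof -
  interpret S: chart_stalk d P q m k i by (rule chart_stalkI[OF q m])
  have nl: "S.near_list (f j)" if "j < r" for j using f[OF that] by (auto simp: S.near_list_def)
  have W: "(\<lambda>X Y. h j X * (\<Prod>g\<leftarrow>f j. dY g X Y)) \<in> near_K 1 m n q" if j: "j < r" for j
  proof -
    have "(\<lambda>X Y. \<Prod>g\<leftarrow>f j. dY g X Y) \<in> near_K 1 m (- int m) q"
      using S.prodl_dd[of "f j"] f[OF j] by simp
    then show ?thesis by (rule S.W_smult[OF h[OF j]]) (simp add: k)
  qed
  have "(\<lambda>X Y. \<Sum>j\<in>I. h j X * (\<Prod>g\<leftarrow>f j. dY g X Y)) \<in> near_K 1 m n q" if "finite I" "I \<subseteq> {..<r}" for I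
    using that
  proof (induction I rule: finite_induct)
    case empty
    show ?case using near_K_zero[OF S.p] by simp
  next
    case (insert j I)
    have "j < r" "I \<subseteq> {..<r}" using insert.prems by auto
    from near_K_add[OF W[OF this(1)] insert.IH[OF this(2)] S.p] show ?case using insert.hyps by simp
  qed
  then show FW: "F \<in> near_K 1 m n q" unfolding F_def by simp
  define t where "t = (\<Oplus>\<^bsub>S.Te.PM\<^esub>j\<in>{..<r}. S.symb (f j) (h j))"
  have sc: "(\<lambda>j. S.symb (f j) (h j)) \<in> {..<r} \<rightarrow> carrier S.Te.PM" using S.symb_closed[OF nl h] by auto
  have tc: "t \<in> carrier S.Te.PM" unfolding t_def by (rule S.Te.PM.M.finsum_closed[OF sc])
  have 1: "(\<lambda>X Y. S.Te.lift t X Y - (\<Sum>j<r. S.Te.lift (S.symb (f j) (h j)) X Y)) \<in> S.Z m (k - int m)"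
    using S.Te.lift_finsum[OF _ sc] by (simp add: S.Te.eqv_def t_def)
  have 2: "(\<lambda>X Y. \<Sum>j<r. S.Te.lift (S.symb (f j) (h j)) X Y - h j X * (\<Prod>g\<leftarrow>f j. dY g X Y)) \<in> S.Z m (k - int m)"
    by (rule S.Te.Z_sum) (use S.lift_symb[OF nl h] in auto)
  have 3: "(\<lambda>X Y. S.Te.lift t X Y - F X Y) \<in> S.Z m (k - int m)"
    using S.Z_add[OF 1 2] by (simp add: sum_subtractf F_def)
  have 4: "(\<lambda>X Y. S.Te.lift (S.\<sigma> F) X Y - F X Y) \<in> S.Z m (k - int m)"
    by (rule S.lift_\<sigma>) (simp add: km FW[simplified])
  have FY: "F \<in> near_Y m (k - int m) q" using FW by (simp add: near_K_def km)
  have "(\<lambda>X Y. S.Te.lift t X Y - S.Te.lift (S.\<sigma> F) X Y) \<in> S.Z m (k - int m)"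
    using S.Z_add[OF 3 S.Z_neg[OF 4]] by simp
  then have "t = S.\<sigma> F"
    by (rule S.lift_eq_imp_eq[OF tc S.\<sigma>_closed[OF FY]])
  then show "(\<Oplus>\<^bsub>SO q\<^esub>j\<in>{..<r}. Sym_Omega_elem d P m k q (f j) (h j)) = sig m k i q F"
    unfolding sig_eq[OF q m] S.Sym_Omega_stalk_eq S.Sym_Omega_elem_eq t_def .
qed

text \<open>Both values lift to F modulo Z, and the lift does not involve a chart.\<close>

lemma sig_chart_independent:
  assumes q: "q \<in> chart i" "q \<in> chart j" and F: "F \<in> near_K 1 m n q"
  shows "sig m k i q F = sig m k j q F"
proof -
  interpret S: chart_stalk d P q m k i by (rule chart_stalkI[OF q(1) m])
  interpret S': chart_stalk d P q m k j by (rule chart_stalkI[OF q(2) m])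
  have F': "F \<in> near_K 1 m (k - int m) q" using F by (simp add: km)
  have FY: "F \<in> near_Y m (k - int m) q" using F' by (simp add: near_K_def)
  have "(\<lambda>X Y. S.Te.lift (S.\<sigma> F) X Y - S.Te.lift (S'.\<sigma> F) X Y) \<in> S.Z m (k - int m)"
    using S.Z_add[OF S.lift_\<sigma>[OF F'] S.Z_neg[OF S'.lift_\<sigma>[OF F']]] by simp
  then show ?thesis unfolding sig_eq[OF q(1) m] sig_eq[OF q(2) m]
    by (rule S.lift_eq_imp_eq[OF S.\<sigma>_closed[OF FY] S'.\<sigma>_closed[OF FY]])
qed

text \<open>Exactness at the stalk. If \<sigma> F = 0, then F is congruent to the lift of 0 and so
  in Z; the converse is \<open>\<sigma>_Z\<close>.\<close>

lemma sig_eq_zero_iff: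
  assumes q: "q \<in> chart i" and F: "F \<in> near_K 1 m n q"
  shows "sig m k i q F = \<zero>\<^bsub>SO q\<^esub> \<longleftrightarrow>
    (\<exists>b\<in>near_K 2 m (n - int d) q. eventually (\<lambda>X. \<forall>Y. F X Y = beta d P b X Y) (zf q))"
proof -
  interpret S: chart_stalk d P q m k i by (rule chart_stalkI[OF q m])
  have F': "F \<in> near_K 1 m (k - int m) q" using F by (simp add: km)
  have "S.\<sigma> F = \<zero>\<^bsub>S.Te.PM\<^esub> \<longleftrightarrow> F \<in> S.Z m (k - int m)"
  proof
    assume "S.\<sigma> F = \<zero>\<^bsub>S.Te.PM\<^esub>"
    then have "S.Te.lift (S.\<sigma> F) \<in> S.Z m (k - int m)" using S.Te.lift_zero by simp
    from S.Z_add[OF this S.Z_neg[OF S.lift_\<sigma>[OF F']]] show "F \<in> S.Z m (k - int m)" by simp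
  qed (rule S.\<sigma>_Z)
  then show ?thesis unfolding sig_eq[OF q m] S.Sym_Omega_stalk_eq by (simp add: S.Z_def km)
qed

text \<open>Any chart around q will do, by \<open>sig_chart_independent\<close>.\<close>

definition ch :: "'n point \<Rightarrow> 'n" where
  "ch q = (SOME i. q \<in> chart i)"

lemma ch: "q \<in> proj_points \<Longrightarrow> q \<in> chart (ch q)"
  unfolding ch_def using exists_chart by (rule someI_ex)

section \<open>Sections of the sheaf of symmetric differentials\<close>

abbreviation "H \<equiv> hypersurface P"
abbreviation "sg q F \<equiv> sig m k (ch q) q F"
abbreviation "\<S> \<equiv> Sym_Omega d P m k"

lemma H_points: "q \<in> H \<Longrightarrow> q \<in> proj_points"
  by (simp add: hypersurface_def)

text \<open>Replaces finite sums of symbols by a single local section of Ker \<delta>. The module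
  structure, gluing and the surjectivity of the augmentation are then obtained from
  functions.\<close>

lemma Sym_Omega_iff:
  assumes U: "openin zariski U"
  shows "s \<in> carrier (sec \<S> U) \<longleftrightarrow> (\<forall>p. p \<notin> U \<inter> H \<longrightarrow> s p = undefined) \<and>
    (\<forall>p\<in>U \<inter> H. \<exists>V F. openin zariski V \<and> p \<in> V \<and> V \<subseteq> U \<and> (\<forall>q\<in>V. F \<in> near_K 1 m n q) \<and>
       (\<forall>q\<in>V \<inter> H. s q = sg q F))"
proof -
  have "(\<exists>V r h f. openin zariski V \<and> p \<in> V \<and> V \<subseteq> U \<and>
             (\<forall>j<r::nat. regular_on k V (h j) \<and> length (f j) = m \<and> (\<forall>g\<in>set (f j). regular_on 0 V g)) \<and>
             (\<forall>q\<in>V \<inter> H. s q = (\<Oplus>\<^bsub>SO q\<^esub>j\<in>{..<r}. Sym_Omega_elem d P m k q (f j) (h j))))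
    \<longleftrightarrow> (\<exists>V F. openin zariski V \<and> p \<in> V \<and> V \<subseteq> U \<and> (\<forall>q\<in>V. F \<in> near_K 1 m n q) \<and> (\<forall>q\<in>V \<inter> H. s q = sg q F))"
    if p: "p \<in> U \<inter> H" for p
  proof
    assume "\<exists>V r h f. openin zariski V \<and> p \<in> V \<and> V \<subseteq> U \<and>
             (\<forall>j<r::nat. regular_on k V (h j) \<and> length (f j) = m \<and> (\<forall>g\<in>set (f j). regular_on 0 V g)) \<and>
             (\<forall>q\<in>V \<inter> H. s q = (\<Oplus>\<^bsub>SO q\<^esub>j\<in>{..<r}. Sym_Omega_elem d P m k q (f j) (h j)))"
    then obtain V r h f where V: "openin zariski V" "p \<in> V" "V \<subseteq> U"
      and hf: "\<forall>j<r::nat. regular_on k V (h j) \<and> length (f j) = m \<and> (\<forall>g\<in>set (f j). regular_on 0 V g)"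
      and s: "\<forall>q\<in>V \<inter> H. s q = (\<Oplus>\<^bsub>SO q\<^esub>j\<in>{..<r}. Sym_Omega_elem d P m k q (f j) (h j))" by blast
    \<comment> \<open>The lift of the given symbols.\<close>
    define F where "F X Y = (\<Sum>j<r. h j X * (\<Prod>g\<leftarrow>f j. dY g X Y))" for X Y
    have h: "h j \<in> near_regular k q" if "q \<in> V" "j < r" for q j
      using hf that V(1) by (auto intro: regular_on_imp_near_regular)
    have f: "length (f j) = m \<and> (\<forall>g\<in>set (f j). g \<in> near_regular 0 q)" if "q \<in> V" "j < r" for q j
      using hf that V(1) by (auto intro: regular_on_imp_near_regular)
    have chV: "q \<in> chart (ch q)" if "q \<in> V" for q using ch openin_zariski_subset[OF V(1)] that by blast
    have "F \<in> near_K 1 m n q" if "q \<in> V" for q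
      unfolding F_def[abs_def] by (rule sig_elem(1)[OF chV[OF that] h[OF that] f[OF that]])
    moreover have "s q = sg q F" if q: "q \<in> V \<inter> H" for q
    proof -
      have qV: "q \<in> V" using q by simp
      show ?thesis unfolding F_def[abs_def] bspec[OF s q]
        by (rule sig_elem(2)[OF chV[OF qV] h[OF qV] f[OF qV]])
    qed
    ultimately show "\<exists>V F. openin zariski V \<and> p \<in> V \<and> V \<subseteq> U \<and> (\<forall>q\<in>V. F \<in> near_K 1 m n q) \<and> (\<forall>q\<in>V \<inter> H. s q = sg q F)"
      using V by (intro exI[of _ V] exI[of _ F]) auto
  next
    assume "\<exists>V F. openin zariski V \<and> p \<in> V \<and> V \<subseteq> U \<and> (\<forall>q\<in>V. F \<in> near_K 1 m n q) \<and> (\<forall>q\<in>V \<inter> H. s q = sg q F)"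
    then obtain V F where V: "openin zariski V" "p \<in> V" "V \<subseteq> U"
      and F: "\<forall>q\<in>V. F \<in> near_K 1 m n q" and s: "\<forall>q\<in>V \<inter> H. s q = sg q F" by blast
    have "p \<in> proj_points" using p H_points by blast
    then obtain i where i: "p \<in> chart i" using exists_chart by blast
    \<comment> \<open>Writing \<sigma> F as a sum of symbols requires one chart for the whole
      neighbourhood, whereas \<open>sg\<close> picks a chart at each point.\<close>
    define V' where "V' = V \<inter> chart i"
    have V': "openin zariski V'" "p \<in> V'" "V' \<subseteq> U" using V i openin_chart by (auto simp: V'_def)
    have V'pp: "q \<in> proj_points" if "q \<in> V'" for q using openin_zariski_subset[OF V'(1)] that by blast
    define B where "B = {e \<in> exponents m. e i = 0}"
    have finB: "finite B" by (simp add: B_def)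
    \<comment> \<open>The definition of a section asks for sums indexed by an initial segment of the
      natural numbers, hence the enumeration of B.\<close>
    obtain b where b: "bij_betw b {..<card B} B" using ex_bij_betw_nat_finite[OF finB] by (auto simp: lessThan_atLeast0)
    have bB: "b j \<in> exponents m" if "j < card B" for j using b that unfolding bij_betw_def B_def by auto
    define h where "h j = (\<lambda>X. chart_coeff m i F (b j) X * X $ i ^ m)" for j
    define f where "f j = map (\<lambda>j (X :: complex ^ 'n). X $ j / X $ i) (lst (b j))" for j
    have hn: "h j \<in> near_regular k q" if "q \<in> V'" "j < card B" for q j
    proof -
      have qi: "q \<in> chart i" "F \<in> near_Y m n q" using F that(1) by (auto simp: V'_def near_K_def)
      show ?thesis unfolding h_def
        by (rule near_regular_mult_deg[OF near_regular_chart_coeff[OF qi(2,1) bB[OF that(2)]]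
              near_regular_power[OF near_regular_coord[OF V'pp[OF that(1)]] V'pp[OF that(1)]] V'pp[OF that(1)]]) (simp add: k)
    qed
    have fl: "length (f j) = m" if "j < card B" for j using length_lst[OF bB[OF that]] by (simp add: f_def)
    have fn: "g \<in> near_regular 0 q" if "q \<in> V'" "g \<in> set (f j)" for q g j
      using that near_regular_ratio[of q i] by (auto simp: f_def V'_def)
    have "s q = (\<Oplus>\<^bsub>SO q\<^esub>j\<in>{..<card B}. Sym_Omega_elem d P m k q (f j) (h j))" if q: "q \<in> V' \<inter> H" for q
    proof -
      have q': "q \<in> V'" "q \<in> V \<inter> H" "q \<in> chart i" using q by (auto simp: V'_def)
      interpret M: module "OH_stalk d P q" "SO q" by (rule module_Sym_Omega_stalk[OF V'pp[OF q'(1)]])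
      have "s q = sig m k i q F"
        using s q'(2,3) sig_chart_independent[OF ch[OF V'pp[OF q'(1)]] q'(3)] F by auto
      also have "\<dots> = (\<Oplus>\<^bsub>SO q\<^esub>e\<in>b ` {..<card B}. Sym_Omega_elem d P m k q (map (\<lambda>j X. X $ j / X $ i) (lst e)) (\<lambda>X. chart_coeff m i F e X * X $ i ^ m))"
        using b unfolding sig_def B_def[symmetric] bij_betw_def by simp
      also have "\<dots> = (\<Oplus>\<^bsub>SO q\<^esub>j\<in>{..<card B}. Sym_Omega_elem d P m k q (f j) (h j))"
        unfolding f_def h_def
      proof (rule M.M.finsum_reindex)
        show "inj_on b {..<card B}" using b by (simp add: bij_betw_def)
        show "(\<lambda>e. Sym_Omega_elem d P m k q (map (\<lambda>j X. X $ j / X $ i) (lst e)) (\<lambda>X. chart_coeff m i F e X * X $ i ^ m))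
          \<in> b ` {..<card B} \<rightarrow> carrier (SO q)"
        proof
          fix e assume "e \<in> b ` {..<card B}"
          then obtain j where j: "j < card B" "e = b j" by auto
          show "Sym_Omega_elem d P m k q (map (\<lambda>j X. X $ j / X $ i) (lst e)) (\<lambda>X. chart_coeff m i F e X * X $ i ^ m) \<in> carrier (SO q)"
            using Sym_Omega_elem_closed[OF V'pp[OF q'(1)] fl[OF j(1)] fn[OF q'(1)] hn[OF q'(1) j(1)]]
            by (simp add: f_def h_def j(2))
        qed
      qed
      finally show ?thesis .
    qed
    then show "\<exists>V r h f. openin zariski V \<and> p \<in> V \<and> V \<subseteq> U \<and>
             (\<forall>j<r::nat. regular_on k V (h j) \<and> length (f j) = m \<and> (\<forall>g\<in>set (f j). regular_on 0 V g)) \<and>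
             (\<forall>q\<in>V \<inter> H. s q = (\<Oplus>\<^bsub>SO q\<^esub>j\<in>{..<r}. Sym_Omega_elem d P m k q (f j) (h j)))"
      using V' hn fl fn unfolding regular_on_iff[OF V'(1)]
      by (intro exI[of _ V'] exI[of _ "card B"] exI[of _ h] exI[of _ f]) (auto simp: regular_on_iff[OF V'(1)])
  qed
  then show ?thesis by (simp add: Sym_Omega_def)
qed

lemma Sym_Omega_simps [simp]:
  "zero (sec \<S> U) = (\<lambda>p\<in>U \<inter> H. \<zero>\<^bsub>SO p\<^esub>)"
  "add (sec \<S> U) = (\<lambda>s t. \<lambda>p\<in>U \<inter> H. s p \<oplus>\<^bsub>SO p\<^esub> t p)"
  "smult (sec \<S> U) = (\<lambda>a s. \<lambda>p\<in>U \<inter> H. OH_germ d P p 0 a \<odot>\<^bsub>SO p\<^esub> s p)"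
  "res \<S> = (\<lambda>V s. restrict s (V \<inter> H))"
  by (simp_all add: Sym_Omega_def)

lemma Sym_OmegaI:
  assumes U: "openin zariski U" and F: "\<And>q. q \<in> U \<Longrightarrow> F \<in> near_K 1 m n q"
  shows "(\<lambda>p\<in>U \<inter> H. sg p F) \<in> carrier (sec \<S> U)"
  unfolding Sym_Omega_iff[OF U]
proof (intro conjI ballI)
  fix p assume "p \<in> U \<inter> H"
  then show "\<exists>V G. openin zariski V \<and> p \<in> V \<and> V \<subseteq> U \<and> (\<forall>q\<in>V. G \<in> near_K 1 m n q) \<and>
       (\<forall>q\<in>V \<inter> H. (\<lambda>p\<in>U \<inter> H. sg p F) q = sg q G)"
    using U F by (intro exI[of _ U] exI[of _ F]) auto
qed auto

lemma Sym_Omega_at: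
  assumes U: "openin zariski U" and s: "s \<in> carrier (sec \<S> U)" and p: "p \<in> U" "p \<in> H"
  shows "s p \<in> carrier (SO p)"
proof -
  obtain V F where "p \<in> V" "\<forall>q\<in>V. F \<in> near_K 1 m n q" "\<forall>q\<in>V \<inter> H. s q = sg q F"
    using s p unfolding Sym_Omega_iff[OF U] by blast
  then show ?thesis using p sig_closed[OF ch[OF H_points[OF p(2)]], of F] by (auto simp: near_K_def)
qed

lemma Sym_Omega_local:
  assumes U: "openin zariski U" and s: "\<And>p. p \<notin> U \<inter> H \<Longrightarrow> s p = undefined"
    and c: "\<And>p. p \<in> U \<Longrightarrow> p \<in> H \<Longrightarrow> \<exists>V F. openin zariski V \<and> p \<in> V \<and> (\<forall>q\<in>V. F \<in> near_K 1 m n q) \<and> (\<forall>q\<in>V \<inter> U \<inter> H. s q = sg q F)"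
  shows "s \<in> carrier (sec \<S> U)"
  unfolding Sym_Omega_iff[OF U]
proof (intro conjI allI impI ballI s)
  fix p assume p: "p \<in> U \<inter> H"
  then obtain V F where "openin zariski V" "p \<in> V" "\<forall>q\<in>V. F \<in> near_K 1 m n q" "\<forall>q\<in>V \<inter> U \<inter> H. s q = sg q F"
    using c[of p] by blast
  then show "\<exists>V F. openin zariski V \<and> p \<in> V \<and> V \<subseteq> U \<and> (\<forall>q\<in>V. F \<in> near_K 1 m n q) \<and> (\<forall>q\<in>V \<inter> H. s q = sg q F)"
    using p U by (intro exI[of _ "V \<inter> U"] exI[of _ F]) auto
qed

lemma Sym_OmegaE:
  assumes U: "openin zariski U" and s: "s \<in> carrier (sec \<S> U)" and p: "p \<in> U" "p \<in> H"
  obtains V F where "openin zariski V" "p \<in> V" "V \<subseteq> U" "\<forall>q\<in>V. F \<in> near_K 1 m n q" "\<forall>q\<in>V \<inter> H. s q = sg q F"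
  using s p unfolding Sym_Omega_iff[OF U] by blast

lemma stalkI: "p \<in> proj_points \<Longrightarrow> stalk d P p"
  by (intro stalk.intro stalk_axioms.intro smooth_hypersurface_context_axioms)

lemma module_Sym_Omega:
  assumes U: "openin zariski U"
  shows "module (fsec proj_space U) (sec \<S> U)"
proof -
  have pp: "p \<in> proj_points" if "p \<in> U" for p using openin_zariski_subset[OF U] that by blast
  have M: "module (OH_stalk d P p) (SO p)" if "p \<in> U" for p by (rule module_Sym_Omega_stalk[OF pp[OF that]])
  let ?C = "carrier (sec \<S> U)"
  note at = Sym_Omega_at[OF U]
  have add: "(\<lambda>p\<in>U \<inter> H. s p \<oplus>\<^bsub>SO p\<^esub> t p) \<in> ?C" if s: "s \<in> ?C" and t: "t \<in> ?C" for s t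
  proof (rule Sym_Omega_local[OF U])
    fix p assume p: "p \<in> U" "p \<in> H"
    obtain V F where V: "openin zariski V" "p \<in> V" "V \<subseteq> U" "\<forall>q\<in>V. F \<in> near_K 1 m n q" "\<forall>q\<in>V \<inter> H. s q = sg q F"
      by (rule Sym_OmegaE[OF U s p])
    obtain V' F' where V': "openin zariski V'" "p \<in> V'" "V' \<subseteq> U" "\<forall>q\<in>V'. F' \<in> near_K 1 m n q" "\<forall>q\<in>V' \<inter> H. t q = sg q F'"
      by (rule Sym_OmegaE[OF U t p])
    have "s q \<oplus>\<^bsub>SO q\<^esub> t q = sg q (\<lambda>X Y. F X Y + F' X Y)" if q: "q \<in> V \<inter> V' \<inter> H" for q
      using q V(4,5) V'(4,5) sig_add[OF ch[OF H_points], of q F F'] by (auto simp: near_K_def)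
    moreover have "(\<lambda>X Y. F X Y + F' X Y) \<in> near_K 1 m n q" if q: "q \<in> V \<inter> V'" for q
      using q V V' pp by (intro near_K_add) auto
    ultimately show "\<exists>V F. openin zariski V \<and> p \<in> V \<and> (\<forall>q\<in>V. F \<in> near_K 1 m n q) \<and>
        (\<forall>q\<in>V \<inter> U \<inter> H. (\<lambda>p\<in>U \<inter> H. s p \<oplus>\<^bsub>SO p\<^esub> t p) q = sg q F)"
      using V V' by (intro exI[of _ "V \<inter> V'"] exI[of _ "\<lambda>X Y. F X Y + F' X Y"]) auto
  qed auto
  have sm: "(\<lambda>p\<in>U \<inter> H. OH_germ d P p 0 a \<odot>\<^bsub>SO p\<^esub> s p) \<in> ?C"
    if a: "\<And>p. p \<in> U \<Longrightarrow> a \<in> near_regular 0 p" and s: "s \<in> ?C" for a s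
  proof (rule Sym_Omega_local[OF U])
    fix p assume p: "p \<in> U" "p \<in> H"
    obtain V F where V: "openin zariski V" "p \<in> V" "V \<subseteq> U" "\<forall>q\<in>V. F \<in> near_K 1 m n q" "\<forall>q\<in>V \<inter> H. s q = sg q F"
      by (rule Sym_OmegaE[OF U s p])
    have "OH_germ d P q 0 a \<odot>\<^bsub>SO q\<^esub> s q = sg q (\<lambda>X Y. a X * F X Y)" if q: "q \<in> V \<inter> H" for q
      using q V(3,4,5) sig_smult[OF ch[OF H_points] a, of q F] by (auto simp: near_K_def)
    moreover have "(\<lambda>X Y. a X * F X Y) \<in> near_K 1 m n q" if q: "q \<in> V" for q
      using near_K_smult[OF a, of q F 1 m n] q V pp by auto
    ultimately show "\<exists>V F. openin zariski V \<and> p \<in> V \<and> (\<forall>q\<in>V. F \<in> near_K 1 m n q) \<and>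
        (\<forall>q\<in>V \<inter> U \<inter> H. (\<lambda>p\<in>U \<inter> H. OH_germ d P p 0 a \<odot>\<^bsub>SO p\<^esub> s p) q = sg q F)"
      using V by (intro exI[of _ V] exI[of _ "\<lambda>X Y. a X * F X Y"]) auto
  qed auto
  have z: "(\<lambda>p\<in>U \<inter> H. \<zero>\<^bsub>SO p\<^esub>) \<in> ?C"
  proof -
    have "(\<lambda>p\<in>U \<inter> H. \<zero>\<^bsub>SO p\<^esub>) = (\<lambda>p\<in>U \<inter> H. sg p (\<lambda>X Y. 0))"
      by (rule restrict_ext) (simp add: sig_zero[OF ch[OF H_points]])
    then show ?thesis using Sym_OmegaI[OF U near_K_zero[OF pp]] by simp
  qed
  have ext: "s = t" if "s \<in> ?C" "t \<in> ?C" "\<And>p. p \<in> U \<Longrightarrow> p \<in> H \<Longrightarrow> s p = t p" for s t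
    using that unfolding Sym_Omega_iff[OF U] by (intro ext) (metis IntD1 IntD2)
  have gc: "OH_germ d P p 0 a \<in> carrier (OH_stalk d P p)" if "a \<in> near_regular 0 p" "p \<in> U" for a p
    using stalk.germ_closed[OF stalkI[OF pp[OF that(2)]] that(1)] .
  have Oa: "a \<in> near_regular 0 p" if "a \<in> O_sections 0 U" "p \<in> U" for a p
    using that by (simp add: O_sections_iff[OF U])
  have "abelian_group (sec \<S> U)"
  proof (rule abelian_groupI)
    fix s t u assume s: "s \<in> ?C" and t: "t \<in> ?C" and u: "u \<in> ?C"
    show "s \<oplus>\<^bsub>sec \<S> U\<^esub> t \<oplus>\<^bsub>sec \<S> U\<^esub> u = s \<oplus>\<^bsub>sec \<S> U\<^esub> (t \<oplus>\<^bsub>sec \<S> U\<^esub> u)"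
      unfolding Sym_Omega_simps
      by (rule restrict_ext) (use abelian_monoid.a_assoc[OF abelian_group.axioms(1)[OF module.axioms(2)[OF M]]] at[OF s] at[OF t] at[OF u] in simp)
  next
    fix s t assume s: "s \<in> ?C" and t: "t \<in> ?C"
    show "s \<oplus>\<^bsub>sec \<S> U\<^esub> t \<in> ?C" unfolding Sym_Omega_simps by (rule add[OF s t])
    show "s \<oplus>\<^bsub>sec \<S> U\<^esub> t = t \<oplus>\<^bsub>sec \<S> U\<^esub> s"
      unfolding Sym_Omega_simps
      by (rule restrict_ext) (use abelian_monoid.a_comm[OF abelian_group.axioms(1)[OF module.axioms(2)[OF M]]] at[OF s] at[OF t] in simp)
  next
    show "\<zero>\<^bsub>sec \<S> U\<^esub> \<in> ?C" unfolding Sym_Omega_simps by (rule z)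
  next
    fix s assume s: "s \<in> ?C"
    show "\<zero>\<^bsub>sec \<S> U\<^esub> \<oplus>\<^bsub>sec \<S> U\<^esub> s = s"
    proof (rule ext[OF _ s])
      show "\<zero>\<^bsub>sec \<S> U\<^esub> \<oplus>\<^bsub>sec \<S> U\<^esub> s \<in> ?C" unfolding Sym_Omega_simps by (rule add[OF z s])
      fix p assume p: "p \<in> U" "p \<in> H"
      then show "(\<zero>\<^bsub>sec \<S> U\<^esub> \<oplus>\<^bsub>sec \<S> U\<^esub> s) p = s p"
        using abelian_monoid.l_zero[OF abelian_group.axioms(1)[OF module.axioms(2)[OF M]] at[OF s p]] by simp
    qed
    have m1: "(\<lambda>X. -1) \<in> near_regular 0 p" if "p \<in> U" for p by (rule near_regular_const[OF pp[OF that]])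
    show "\<exists>t\<in>?C. t \<oplus>\<^bsub>sec \<S> U\<^esub> s = \<zero>\<^bsub>sec \<S> U\<^esub>"
    \<comment> \<open>Multiplication by the constant -1 serves as negation, so that closure under
      scalars can be reused.\<close>
    proof (rule bexI[OF _ sm[OF m1 s]])
      show "(\<lambda>p\<in>U \<inter> H. OH_germ d P p 0 (\<lambda>X. -1) \<odot>\<^bsub>SO p\<^esub> s p) \<oplus>\<^bsub>sec \<S> U\<^esub> s = \<zero>\<^bsub>sec \<S> U\<^esub>"
        unfolding Sym_Omega_simps
      proof (rule restrict_ext)
        fix p assume pUH: "p \<in> U \<inter> H"
        then have p: "p \<in> U" "p \<in> H" by auto
        interpret S: stalk d P p by (rule stalkI[OF pp[OF p(1)]])
        interpret M: module "OH_stalk d P p" "SO p" by (rule M[OF p(1)])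
        note o = near_regular_const[OF S.p, of 1]
        have "OH_germ d P p 0 (\<lambda>X. -1) \<odot>\<^bsub>SO p\<^esub> s p \<oplus>\<^bsub>SO p\<^esub> s p
          = (OH_germ d P p 0 (\<lambda>X. -1) \<oplus>\<^bsub>OH_stalk d P p\<^esub> OH_germ d P p 0 (\<lambda>X. 1)) \<odot>\<^bsub>SO p\<^esub> s p"
          using M.smult_l_distr[OF gc[OF m1[OF p(1)] p(1)] gc[OF o p(1)] at[OF s p]] M.smult_one[OF at[OF s p]]
          by (simp add: S.A_simps)
        also have "\<dots> = \<zero>\<^bsub>SO p\<^esub>"
          unfolding S.A_add[OF m1[OF p(1)] o] using M.smult_l_null[OF at[OF s p]] by (simp add: S.A_simps)
        finally show "(\<lambda>p\<in>U \<inter> H. OH_germ d P p 0 (\<lambda>X. -1) \<odot>\<^bsub>SO p\<^esub> s p) p \<oplus>\<^bsub>SO p\<^esub> s p = \<zero>\<^bsub>SO p\<^esub>"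
          using pUH by simp
      qed
    qed
  qed
  then show ?thesis
  proof (rule moduleI[OF cring_fsec[OF U]])
    fix a s assume a: "a \<in> carrier (fsec proj_space U)" and s: "s \<in> ?C"
    then have a': "a \<in> near_regular 0 p" if "p \<in> U" for p using Oa that by simp
    show "a \<odot>\<^bsub>sec \<S> U\<^esub> s \<in> ?C" unfolding Sym_Omega_simps by (rule sm[OF a' s])
    fix t assume t: "t \<in> ?C"
    show "a \<odot>\<^bsub>sec \<S> U\<^esub> (s \<oplus>\<^bsub>sec \<S> U\<^esub> t) = a \<odot>\<^bsub>sec \<S> U\<^esub> s \<oplus>\<^bsub>sec \<S> U\<^esub> a \<odot>\<^bsub>sec \<S> U\<^esub> t"
      unfolding Sym_Omega_simps
      by (rule restrict_ext) (use module.smult_r_distr[OF M gc[OF a'] at[OF s] at[OF t]] in simp)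
  next
    fix a b s assume a: "a \<in> carrier (fsec proj_space U)" and b: "b \<in> carrier (fsec proj_space U)" and s: "s \<in> ?C"
    then have ab: "a \<in> near_regular 0 p" "b \<in> near_regular 0 p" if "p \<in> U" for p using Oa that by simp_all
    show "(a \<oplus>\<^bsub>fsec proj_space U\<^esub> b) \<odot>\<^bsub>sec \<S> U\<^esub> s = a \<odot>\<^bsub>sec \<S> U\<^esub> s \<oplus>\<^bsub>sec \<S> U\<^esub> b \<odot>\<^bsub>sec \<S> U\<^esub> s"
      unfolding Sym_Omega_simps
    proof (rule restrict_ext)
      fix p assume "p \<in> U \<inter> H"
      then have p: "p \<in> U" "p \<in> H" by auto
      interpret S: stalk d P p by (rule stalkI[OF pp[OF p(1)]])
      show "OH_germ d P p 0 (a \<oplus>\<^bsub>fsec proj_space U\<^esub> b) \<odot>\<^bsub>SO p\<^esub> s p =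
        (\<lambda>p\<in>U \<inter> H. OH_germ d P p 0 a \<odot>\<^bsub>SO p\<^esub> s p) p \<oplus>\<^bsub>SO p\<^esub> (\<lambda>p\<in>U \<inter> H. OH_germ d P p 0 b \<odot>\<^bsub>SO p\<^esub> s p) p"
        using module.smult_l_distr[OF M gc[OF ab(1)] gc[OF ab(2)] at[OF s], of p] p
        by (simp add: S.A_add ab)
    qed
    show "(a \<otimes>\<^bsub>fsec proj_space U\<^esub> b) \<odot>\<^bsub>sec \<S> U\<^esub> s = a \<odot>\<^bsub>sec \<S> U\<^esub> (b \<odot>\<^bsub>sec \<S> U\<^esub> s)"
      unfolding Sym_Omega_simps
    proof (rule restrict_ext)
      fix p assume "p \<in> U \<inter> H"
      then have p: "p \<in> U" "p \<in> H" by auto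
      interpret S: stalk d P p by (rule stalkI[OF pp[OF p(1)]])
      show "OH_germ d P p 0 (a \<otimes>\<^bsub>fsec proj_space U\<^esub> b) \<odot>\<^bsub>SO p\<^esub> s p =
        OH_germ d P p 0 a \<odot>\<^bsub>SO p\<^esub> (\<lambda>p\<in>U \<inter> H. OH_germ d P p 0 b \<odot>\<^bsub>SO p\<^esub> s p) p"
        using module.smult_assoc1[OF M gc[OF ab(1)] gc[OF ab(2)] at[OF s], of p] p
        by (simp add: S.A_mult ab)
    qed
  next
    fix s assume s: "s \<in> ?C"
    show "\<one>\<^bsub>fsec proj_space U\<^esub> \<odot>\<^bsub>sec \<S> U\<^esub> s = s"
    proof (rule ext[OF _ s])
      have o: "(\<lambda>X. if X \<in> \<Union>U then 1 else 0) \<in> near_regular 0 p" if "p \<in> U" for p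
        using cring.cring_simprules(6)[OF cring_fsec[OF U]] Oa[OF _ that] by simp
      show "\<one>\<^bsub>fsec proj_space U\<^esub> \<odot>\<^bsub>sec \<S> U\<^esub> s \<in> ?C"
        unfolding Sym_Omega_simps proj_space_simps by (rule sm[OF o s])
      fix p assume p: "p \<in> U" "p \<in> H"
      interpret S: stalk d P p by (rule stalkI[OF pp[OF p(1)]])
      have "OH_germ d P p 0 (\<lambda>X. if X \<in> \<Union>U then 1 else 0) = OH_germ d P p 0 (\<lambda>X. 1)"
        by (rule S.germ_eqI[OF o[OF p(1)]]) (use eventually_zf_in[OF U p(1)] in eventually_elim, simp)
      then show "(\<one>\<^bsub>fsec proj_space U\<^esub> \<odot>\<^bsub>sec \<S> U\<^esub> s) p = s p"
        using module.smult_one[OF M[OF p(1)] at[OF s p]] p by (simp add: S.A_simps)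
    qed
  qed
qed

lemma Sym_Omega_restrict:
  assumes U: "openin zariski U" and V: "openin zariski V" "V \<subseteq> U" and s: "s \<in> carrier (sec \<S> U)"
  shows "restrict s (V \<inter> H) \<in> carrier (sec \<S> V)"
proof (rule Sym_Omega_local[OF V(1)])
  fix p assume p: "p \<in> V" "p \<in> H"
  then have "p \<in> U" using V by blast
  then obtain W F where "openin zariski W" "p \<in> W" "\<forall>q\<in>W. F \<in> near_K 1 m n q" "\<forall>q\<in>W \<inter> H. s q = sg q F"
    using Sym_OmegaE[OF U s _ p(2)] by metis
  then show "\<exists>W F. openin zariski W \<and> p \<in> W \<and> (\<forall>q\<in>W. F \<in> near_K 1 m n q) \<and>
      (\<forall>q\<in>W \<inter> V \<inter> H. restrict s (V \<inter> H) q = sg q F)"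
    by (intro exI[of _ W] exI[of _ F]) simp
qed auto

lemma sheaf_of_modules_Sym_Omega: "sheaf_of_modules proj_space \<S>"
  unfolding sheaf_of_modules_def
proof (intro conjI allI impI)
  fix U assume "openin (top_of proj_space) (U :: 'n point set)"
  then show "module (fsec proj_space U) (sec \<S> U)" by (simp add: module_Sym_Omega)
next
  fix U V assume "openin (top_of proj_space) (U :: 'n point set)" "openin (top_of proj_space) V" and VU: "V \<subseteq> U"
  then have U: "openin zariski U" and V: "openin zariski V" by simp_all
  show "\<forall>s\<in>carrier (sec \<S> U). res \<S> V s \<in> carrier (sec \<S> V)"
    unfolding Sym_Omega_simps using Sym_Omega_restrict[OF U V VU] by blast
  show "\<forall>s\<in>carrier (sec \<S> U). \<forall>t\<in>carrier (sec \<S> U).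
      res \<S> V (s \<oplus>\<^bsub>sec \<S> U\<^esub> t) = res \<S> V s \<oplus>\<^bsub>sec \<S> V\<^esub> res \<S> V t"
    using VU by (auto simp: fun_eq_iff restrict_def)
  show "\<forall>a\<in>carrier (fsec proj_space U). \<forall>s\<in>carrier (sec \<S> U).
      res \<S> V (a \<odot>\<^bsub>sec \<S> U\<^esub> s) = fres proj_space V a \<odot>\<^bsub>sec \<S> V\<^esub> res \<S> V s"
    unfolding Sym_Omega_simps proj_space_simps
  proof (intro ballI restrict_ext)
    fix a s p assume a: "a \<in> O_sections 0 U" and p: "p \<in> V \<inter> H"
    have pV: "p \<in> V" and pU: "p \<in> U" using p VU by auto
    interpret S: stalk d P p by (rule stalkI[OF H_points]) (use p in simp)
    have an: "a \<in> near_regular 0 p" using a pU by (simp add: O_sections_iff[OF U])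
    have "OH_germ d P p 0 a = OH_germ d P p 0 (\<lambda>X. if X \<in> \<Union>V then a X else 0)"
      by (rule S.germ_eqI[OF an]) (use eventually_zf_in[OF V pV] in eventually_elim, simp)
    then show "(\<lambda>p\<in>U \<inter> H. OH_germ d P p 0 a \<odot>\<^bsub>SO p\<^esub> s p) p =
        OH_germ d P p 0 (\<lambda>X. if X \<in> \<Union>V then a X else 0) \<odot>\<^bsub>SO p\<^esub> (restrict s (V \<inter> H)) p"
      using p pU by simp
  qed
next
  fix U assume "openin (top_of proj_space) (U :: 'n point set)"
  then have U: "openin zariski U" by simp
  show "\<forall>s\<in>carrier (sec \<S> U). res \<S> U s = s"
    unfolding Sym_Omega_simps
  proof (intro ballI ext)
    fix s p assume "s \<in> carrier (sec \<S> U)"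
    then show "restrict s (U \<inter> H) p = s p" unfolding Sym_Omega_iff[OF U] restrict_def by auto
  qed
next
  fix U V W assume "W \<subseteq> (V :: 'n point set)"
  then show "\<forall>s\<in>carrier (sec \<S> U). res \<S> W (res \<S> V s) = res \<S> W s"
    by (auto simp: fun_eq_iff restrict_def)
next
  fix \<V> s assume s: "\<forall>V\<in>\<V>. openin (top_of proj_space) (V :: 'n point set) \<and> s V \<in> carrier (sec \<S> V)"
    and ov: "\<forall>V\<in>\<V>. \<forall>W\<in>\<V>. res \<S> (V \<inter> W) (s V) = res \<S> (V \<inter> W) (s W)"
  have op: "openin zariski V" and sC: "s V \<in> carrier (sec \<S> V)" if "V \<in> \<V>" for V using s that by simp_all
  have opU: "openin zariski (\<Union>\<V>)" using op by (intro openin_Union) auto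
  have su: "s V p = undefined" if "V \<in> \<V>" "p \<notin> V \<inter> H" for V p
    using sC[OF that(1)] that(2) unfolding Sym_Omega_iff[OF op[OF that(1)]] by blast
  have agree: "s V p = s W p" if V: "V \<in> \<V>" "W \<in> \<V>" "p \<in> V" "p \<in> W" for V W p
  proof (cases "p \<in> H")
    case True
    have "restrict (s V) (V \<inter> W \<inter> H) = restrict (s W) (V \<inter> W \<inter> H)"
      using bspec[OF bspec[OF ov V(1)] V(2)] by simp
    from fun_cong[OF this, of p] show ?thesis using V True by simp
  qed (use su V in simp)
  \<comment> \<open>By \<open>agree\<close>, every member of the cover containing p gives the same
    value.\<close>
  define t where "t p = (if p \<in> \<Union>\<V> \<inter> H then s (SOME V. V \<in> \<V> \<and> p \<in> V) p else undefined)" for p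
  have t: "t p = s V p" if V: "V \<in> \<V>" "p \<in> V" for V p
  proof (cases "p \<in> H")
    case True
    have "(SOME V. V \<in> \<V> \<and> p \<in> V) \<in> \<V> \<and> p \<in> (SOME V. V \<in> \<V> \<and> p \<in> V)"
      by (rule someI[of _ V]) (use V in blast)
    then have "s (SOME V. V \<in> \<V> \<and> p \<in> V) p = s V p" using agree V by blast
    then show ?thesis using True V by (auto simp: t_def)
  qed (use su V in \<open>simp add: t_def\<close>)
  show "\<exists>!t. t \<in> carrier (sec \<S> (\<Union>\<V>)) \<and> (\<forall>V\<in>\<V>. res \<S> V t = s V)"
  proof (intro ex1I[of _ t] conjI ballI)
    show "t \<in> carrier (sec \<S> (\<Union>\<V>))"
    proof (rule Sym_Omega_local[OF opU])
      fix p assume "p \<in> \<Union>\<V>" and pH: "p \<in> H"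
      then obtain V where V: "V \<in> \<V>" "p \<in> V" by blast
      obtain W F where W: "openin zariski W" "p \<in> W" "W \<subseteq> V" "\<forall>q\<in>W. F \<in> near_K 1 m n q" "\<forall>q\<in>W \<inter> H. s V q = sg q F"
        by (rule Sym_OmegaE[OF op[OF V(1)] sC[OF V(1)] V(2) pH])
      have "t q = sg q F" if "q \<in> W" "q \<in> H" for q using t[OF V(1)] W(3,5) that by auto
      then show "\<exists>W F. openin zariski W \<and> p \<in> W \<and> (\<forall>q\<in>W. F \<in> near_K 1 m n q) \<and> (\<forall>q\<in>W \<inter> \<Union>\<V> \<inter> H. t q = sg q F)"
        using W by (intro exI[of _ W] exI[of _ F]) auto
    qed (auto simp: t_def)
    fix V assume V: "V \<in> \<V>"
    show "res \<S> V t = s V"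
      unfolding Sym_Omega_simps
    proof
      fix p show "restrict t (V \<inter> H) p = s V p" using t[OF V, of p] su[OF V, of p] by (auto simp: restrict_def)
    qed
  next
    fix t' assume t': "t' \<in> carrier (sec \<S> (\<Union>\<V>)) \<and> (\<forall>V\<in>\<V>. res \<S> V t' = s V)"
    show "t' = t"
    proof
      fix p
      show "t' p = t p"
      proof (cases "p \<in> \<Union>\<V> \<inter> H")
        case True
        then obtain V where V: "V \<in> \<V>" "p \<in> V" by blast
        have "restrict t' (V \<inter> H) = s V" using t' V(1) by simp
        from fun_cong[OF this, of p] show ?thesis using t[OF V] True V by simp
      next
        case False then show ?thesis using t' unfolding Sym_Omega_iff[OF opU] by (auto simp: t_def)
      qed
    qed
  qed
qed

section \<open>The augmentation and the end of the exact sequence\<close>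

definition augmentation :: "'n point set \<Rightarrow> (complex ^ 'n \<Rightarrow> complex ^ 'n \<Rightarrow> complex) \<Rightarrow> _" where
  "augmentation U F = (\<lambda>p\<in>U \<inter> H. sg p F)"

lemma sheaf_hom_augmentation: "sheaf_hom proj_space (Ker_delta 1 m n) \<S> augmentation"
  unfolding sheaf_hom_def
proof (intro conjI allI impI)
  fix U assume "openin (top_of proj_space) (U :: 'n point set)"
  then have U: "openin zariski U" by simp
  have K: "s \<in> near_K 1 m n p" if "s \<in> carrier (sec (Ker_delta 1 m n) U)" "p \<in> U" for s p
    using that unfolding Ker_delta_iff[OF U] by blast
  have Y: "s \<in> near_Y m n p" if "s \<in> carrier (sec (Ker_delta 1 m n) U)" "p \<in> U" for s p
    using K[OF that] by (simp add: near_K_def)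
  show "\<forall>s\<in>carrier (sec (Ker_delta 1 m n) U). augmentation U s \<in> carrier (sec \<S> U)"
  proof
    fix s assume s: "s \<in> carrier (sec (Ker_delta 1 m n) U)"
    show "augmentation U s \<in> carrier (sec \<S> U)" unfolding augmentation_def by (rule Sym_OmegaI[OF U K[OF s]])
  qed
  show "\<forall>s\<in>carrier (sec (Ker_delta 1 m n) U). \<forall>t\<in>carrier (sec (Ker_delta 1 m n) U).
      augmentation U (s \<oplus>\<^bsub>sec (Ker_delta 1 m n) U\<^esub> t) = augmentation U s \<oplus>\<^bsub>sec \<S> U\<^esub> augmentation U t"
    unfolding augmentation_def Sym_Omega_simps Ker_delta_simps
  proof (intro ballI restrict_ext)
    fix s t p assume s: "s \<in> carrier (sec (Ker_delta 1 m n) U)" and t: "t \<in> carrier (sec (Ker_delta 1 m n) U)"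
      and p: "p \<in> U \<inter> H"
    have pU: "p \<in> U" and pc: "p \<in> chart (ch p)" using p ch[OF H_points] by auto
    show "sg p (\<lambda>X Y. s X Y + t X Y) = (\<lambda>p\<in>U \<inter> H. sg p s) p \<oplus>\<^bsub>SO p\<^esub> (\<lambda>p\<in>U \<inter> H. sg p t) p"
      using sig_add[OF pc Y[OF s pU] Y[OF t pU]] p by simp
  qed
  show "\<forall>a\<in>carrier (fsec proj_space U). \<forall>s\<in>carrier (sec (Ker_delta 1 m n) U).
      augmentation U (a \<odot>\<^bsub>sec (Ker_delta 1 m n) U\<^esub> s) = a \<odot>\<^bsub>sec \<S> U\<^esub> augmentation U s"
    unfolding augmentation_def Sym_Omega_simps Ker_delta_simps proj_space_simps
  proof (intro ballI restrict_ext)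
    fix a s p assume a: "a \<in> O_sections 0 U" and s: "s \<in> carrier (sec (Ker_delta 1 m n) U)" and p: "p \<in> U \<inter> H"
    have pU: "p \<in> U" and pc: "p \<in> chart (ch p)" using p ch[OF H_points] by auto
    have an: "a \<in> near_regular 0 p" using a pU by (simp add: O_sections_iff[OF U])
    show "sg p (\<lambda>X Y. a X * s X Y) = OH_germ d P p 0 a \<odot>\<^bsub>SO p\<^esub> (\<lambda>p\<in>U \<inter> H. sg p s) p"
      using sig_smult[OF pc an Y[OF s pU]] p by simp
  qed
next
  fix U V assume "openin (top_of proj_space) (U :: 'n point set)" "openin (top_of proj_space) V" and VU: "V \<subseteq> U"
  then have U: "openin zariski U" and V: "openin zariski V" by simp_all
  show "\<forall>s\<in>carrier (sec (Ker_delta 1 m n) U). augmentation V (res (Ker_delta 1 m n) V s) = res \<S> V (augmentation U s)"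
    unfolding augmentation_def Sym_Omega_simps Ker_delta_simps
  proof (intro ballI restrict_ext)
    fix s p assume s: "s \<in> carrier (sec (Ker_delta 1 m n) U)" and p: "p \<in> V \<inter> H"
    have pV: "p \<in> V" and pU: "p \<in> U" and pc: "p \<in> chart (ch p)" using p VU ch[OF H_points] by auto
    have Y: "s \<in> near_Y m n p" using s pU unfolding Ker_delta_iff[OF U] near_K_def by blast
    have "sg p s = sg p (\<lambda>X Y. if X \<in> \<Union>V then s X Y else 0)"
      by (rule sig_cong[OF pc Y]) (use eventually_zf_in[OF V pV] in eventually_elim, simp)
    then show "sg p (\<lambda>X Y. if X \<in> \<Union>V then s X Y else 0) = (\<lambda>p\<in>U \<inter> H. sg p s) p" using p pU by simp
  qed
qed

lemma beta_onto_outside: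
  assumes t: "t \<in> near_K 1 m n p" and p: "p \<in> proj_points" "p \<notin> H"
  shows "\<exists>b\<in>near_K 2 m (n - int d) p. eventually (\<lambda>X. \<forall>Y. t X Y = beta d P b X Y) (zf p)"
proof -
  obtain X where X: "X \<in> p" "P X \<noteq> 0" using p by (auto simp: hypersurface_def)
  have pb: "p \<in> basic_open P" by (rule iffD2[OF basic_open_iff[OF P_homog p(1) X(1)] X(2)])
  have inv: "(\<lambda>X. inverse (P X)) \<in> near_regular (- int d) p"
    by (rule near_regular_inverse[OF P_near[OF p(1)] p(1) X])
  \<comment> \<open>As \<delta> b = 0 near p, \<beta>(P)(b) is P b = t.\<close>
  define b where "b X Y = inverse (P X) * t X Y" for X Y
  have b1: "b \<in> near_K 1 m (- int d + n) p" unfolding b_def[abs_def] by (rule near_K_smult[OF inv t p(1)])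
  then have db: "eventually (\<lambda>X. \<forall>Y. delta b X Y = 0) (zf p)" by (simp add: near_K_def)
  then have "eventually (\<lambda>X. \<forall>Y. delta (delta b) X Y = 0) (zf p)"
  proof eventually_elim
    case (elim X)
    then have "delta b X = (\<lambda>Y. 0)" by auto
    then show ?case using delta_cong[where F = "delta b" and X = X and G = "\<lambda>X Y. 0"] by (simp add: delta_zero)
  qed
  then have "b \<in> near_K 2 m (n - int d) p" using b1 by (simp add: near_K_def numeral_2_eq_2)
  moreover have "eventually (\<lambda>X. \<forall>Y. t X Y = beta d P b X Y) (zf p)"
    using db eventually_zf_in[OF openin_basic_open[OF P_homog] pb]
  proof eventually_elim
    case (elim X)
    then have "P X \<noteq> 0" by (auto simp: basic_open_def)
    then show ?case using elim(1) by (simp add: beta_dP b_def)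
  qed
  ultimately show ?thesis by blast
qed

lemma sheaf_exact_beta_augmentation:
  "sheaf_exact proj_space (Ker_delta 2 m (n - int d)) (Ker_delta 1 m n) \<S> (\<lambda>U. beta d P) augmentation"
  unfolding sheaf_exact_def
proof (intro allI impI ballI)
  fix U t assume "openin (top_of proj_space) (U :: 'n point set)" and t: "t \<in> carrier (sec (Ker_delta 1 m n) U)"
  then have U: "openin zariski U" by simp
  have tK: "t \<in> near_K 1 m n p" if "p \<in> U" for p using t that unfolding Ker_delta_iff[OF U] by blast
  have pp: "p \<in> proj_points" if "p \<in> U" for p using openin_zariski_subset[OF U] that by blast
  have "augmentation U t = \<zero>\<^bsub>sec \<S> U\<^esub> \<longleftrightarrow> (\<forall>p\<in>U \<inter> H. sg p t = \<zero>\<^bsub>SO p\<^esub>)"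
    unfolding augmentation_def Sym_Omega_simps
    by (auto simp: fun_eq_iff restrict_def split: if_splits)
  \<comment> \<open>On H this is exactness at the stalk; at the other points the condition on the
    right always holds.\<close>
  also have "\<dots> \<longleftrightarrow> (\<forall>p\<in>U. \<exists>b\<in>near_K 2 m (n - int d) p. eventually (\<lambda>X. \<forall>Y. t X Y = beta d P b X Y) (zf p))"
  proof (intro iffI ballI)
    fix p assume z: "\<forall>p\<in>U \<inter> H. sg p t = \<zero>\<^bsub>SO p\<^esub>" and p: "p \<in> U"
    show "\<exists>b\<in>near_K 2 m (n - int d) p. eventually (\<lambda>X. \<forall>Y. t X Y = beta d P b X Y) (zf p)"
    proof (cases "p \<in> H")
      case True
      show ?thesis by (rule iffD1[OF sig_eq_zero_iff[OF ch[OF pp[OF p]] tK[OF p]]]) (use z p True in simp)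
    qed (rule beta_onto_outside[OF tK[OF p] pp[OF p]])
  next
    fix p assume z: "\<forall>p\<in>U. \<exists>b\<in>near_K 2 m (n - int d) p. eventually (\<lambda>X. \<forall>Y. t X Y = beta d P b X Y) (zf p)"
      and "p \<in> U \<inter> H"
    then have p: "p \<in> U" by simp
    show "sg p t = \<zero>\<^bsub>SO p\<^esub>" by (rule iffD2[OF sig_eq_zero_iff[OF ch[OF pp[OF p]] tK[OF p]] bspec[OF z p]])
  qed
  also have "\<dots> \<longleftrightarrow> in_image_sheaf proj_space (Ker_delta 2 m (n - int d)) (Ker_delta 1 m n) (\<lambda>U. beta d P) U t"
    unfolding in_image_sheaf_def
  proof (rule ball_cong[OF refl])
    fix p assume p: "p \<in> U"
    show "(\<exists>b\<in>near_K 2 m (n - int d) p. eventually (\<lambda>X. \<forall>Y. t X Y = beta d P b X Y) (zf p)) \<longleftrightarrow>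
      (\<exists>V. openin (top_of proj_space) V \<and> p \<in> V \<and> V \<subseteq> U \<and>
        (\<exists>s\<in>carrier (sec (Ker_delta 2 m (n - int d)) V). beta d P s = res (Ker_delta 1 m n) V t))"
    proof
      assume "\<exists>b\<in>near_K 2 m (n - int d) p. eventually (\<lambda>X. \<forall>Y. t X Y = beta d P b X Y) (zf p)"
      then obtain b where b: "b \<in> near_K 2 m (n - int d) p" and tb: "eventually (\<lambda>X. \<forall>Y. t X Y = beta d P b X Y) (zf p)"
        by blast
      \<comment> \<open>The witness b is a germ at p only. By \<open>near_K_spread\<close> it is a
        germ of a section at all nearby points, so on a suitable V, extended by zero, it becomes a
        section.\<close>
      obtain V where V: "openin zariski V" "p \<in> V" "V \<subseteq> U"
        and e: "\<forall>X\<in>\<Union>V. b \<in> near_K 2 m (n - int d) (point_of X) \<and> (\<forall>Y. t X Y = beta d P b X Y)"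
        by (rule eventually_zfE[OF eventually_conj[OF near_K_spread[OF b pp[OF p]] tb] U p])
      have bq: "b \<in> near_K 2 m (n - int d) q" if q: "q \<in> V" for q
      proof -
        have qp: "q \<in> proj_points" using q V(3) pp by blast
        obtain X where X: "X \<in> q" using proj_point_nonempty[OF qp] by blast
        have "b \<in> near_K 2 m (n - int d) (point_of X)" using e X q by blast
        then show ?thesis unfolding point_of_def proj_point_eq[OF qp X, symmetric] .
      qed
      define s where "s X Y = (if X \<in> \<Union>V then b X Y else 0)" for X Y
      have "s \<in> carrier (sec (Ker_delta 2 m (n - int d)) V)"
        unfolding s_def[abs_def] by (rule Ker_delta_restrict[OF V(1) bq])
      moreover have "beta d P s = res (Ker_delta 1 m n) V t"
      proof (intro ext)
        fix X Y
        show "beta d P s X Y = res (Ker_delta 1 m n) V t X Y"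
        proof (cases "X \<in> \<Union>V")
          case True
          then have sb: "s X = b X" by (intro ext) (simp add: s_def)
          then have "delta s X = delta b X" by (rule delta_cong)
          then have "beta d P s X Y = beta d P b X Y" by (simp add: beta_dP sb)
          then show ?thesis using bspec[OF e True] True by simp
        next
          case False
          then have s0: "s X = (\<lambda>Y. 0)" by (intro ext) (simp add: s_def)
          then show ?thesis using delta_cong[where F = s and X = X and G = "\<lambda>X Y. 0"] False
            by (simp add: beta_dP delta_zero)
        qed
      qed
      ultimately show "\<exists>V. openin (top_of proj_space) V \<and> p \<in> V \<and> V \<subseteq> U \<and>
          (\<exists>s\<in>carrier (sec (Ker_delta 2 m (n - int d)) V). beta d P s = res (Ker_delta 1 m n) V t)"
        using V by (intro exI[of _ V] conjI bexI[of _ s]) simp_all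
    next
      assume "\<exists>V. openin (top_of proj_space) V \<and> p \<in> V \<and> V \<subseteq> U \<and>
          (\<exists>s\<in>carrier (sec (Ker_delta 2 m (n - int d)) V). beta d P s = res (Ker_delta 1 m n) V t)"
      then obtain V s where V: "openin zariski V" "p \<in> V" and s: "s \<in> carrier (sec (Ker_delta 2 m (n - int d)) V)"
        and st: "beta d P s = res (Ker_delta 1 m n) V t" by auto
      have "s \<in> near_K 2 m (n - int d) p" using s V(2) unfolding Ker_delta_iff[OF V(1)] by blast
      moreover have "eventually (\<lambda>X. \<forall>Y. t X Y = beta d P s X Y) (zf p)"
        unfolding st using eventually_zf_in[OF V] by eventually_elim simp
      ultimately show "\<exists>b\<in>near_K 2 m (n - int d) p. eventually (\<lambda>X. \<forall>Y. t X Y = beta d P b X Y) (zf p)" by blast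
    qed
  qed
  finally show "augmentation U t = \<zero>\<^bsub>sec \<S> U\<^esub> \<longleftrightarrow>
    in_image_sheaf proj_space (Ker_delta 2 m (n - int d)) (Ker_delta 1 m n) (\<lambda>U. beta d P) U t" .
qed

lemma sheaf_surjective_augmentation: "sheaf_surjective proj_space (Ker_delta 1 m n) \<S> augmentation"
  unfolding sheaf_surjective_def in_image_sheaf_def
proof (intro allI impI ballI)
  fix U t p assume "openin (top_of proj_space) (U :: 'n point set)" and t: "t \<in> carrier (sec \<S> U)" and p: "p \<in> U"
  then have U: "openin zariski U" by simp
  have pp: "p \<in> proj_points" using openin_zariski_subset[OF U] p by blast
  have "\<exists>V F. openin zariski V \<and> p \<in> V \<and> V \<subseteq> U \<and> (\<forall>q\<in>V. F \<in> near_K 1 m n q) \<and> (\<forall>q\<in>V \<inter> H. t q = sg q F)"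
  proof (cases "p \<in> H")
    case True
    then show ?thesis using t p unfolding Sym_Omega_iff[OF U] by blast
  next
    case False
    obtain X where X: "X \<in> p" "P X \<noteq> 0" using pp False by (auto simp: hypersurface_def)
    \<comment> \<open>Over an open set that misses H the target has no stalks, so F = 0 will
      do.\<close>
    define V where "V = U \<inter> basic_open P"
    have V: "openin zariski V" unfolding V_def by (intro openin_Int U openin_basic_open[OF P_homog])
    have pV: "p \<in> V" using p iffD2[OF basic_open_iff[OF P_homog pp X(1)] X(2)] by (simp add: V_def)
    have "q \<notin> H" if q: "q \<in> V" for q
    proof -
      have "q \<in> proj_points" using openin_zariski_subset[OF V] q by blast
      from proj_point_nonempty[OF this] show ?thesis using q by (auto simp: V_def basic_open_def hypersurface_def)
    qed
    moreover have "(\<lambda>X Y. 0) \<in> near_K 1 m n q" if "q \<in> V" for q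
      by (rule near_K_zero) (use openin_zariski_subset[OF V] that in blast)
    ultimately show ?thesis using V pV by (intro exI[of _ V] exI[of _ "\<lambda>X Y. 0"]) (auto simp: V_def)
  qed
  then obtain V F where V: "openin zariski V" "p \<in> V" "V \<subseteq> U"
    and F: "\<forall>q\<in>V. F \<in> near_K 1 m n q" and tF: "\<forall>q\<in>V \<inter> H. t q = sg q F" by blast
  define s where "s X Y = (if X \<in> \<Union>V then F X Y else 0)" for X Y
  have "s \<in> carrier (sec (Ker_delta 1 m n) V)"
    unfolding s_def[abs_def] by (rule Ker_delta_restrict[OF V(1)]) (use F in blast)
  moreover have "augmentation V s = res \<S> V t"
    unfolding augmentation_def Sym_Omega_simps
  proof (rule restrict_ext)
    fix q assume q: "q \<in> V \<inter> H"
    then have qV: "q \<in> V" and qc: "q \<in> chart (ch q)" using ch[OF H_points] by auto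
    have "F \<in> near_Y m n q" using F qV unfolding near_K_def by blast
    then have "sg q F = sg q s"
      by (rule sig_cong[OF qc]) (use eventually_zf_in[OF V(1) qV] in eventually_elim, simp add: s_def)
    then show "sg q s = t q" using tF q by simp
  qed
  ultimately show "\<exists>V. openin (top_of proj_space) V \<and> p \<in> V \<and> V \<subseteq> U \<and>
      (\<exists>s\<in>carrier (sec (Ker_delta 1 m n) V). augmentation V s = res \<S> V t)"
    using V by (intro exI[of _ V] conjI bexI[of _ s]) simp_all
qed

end

end

theorem theorem0p0p4:
  fixes P :: "complex ^ 'n::finite \<Rightarrow> complex" and N d :: nat
  assumes "CARD('n) = N + 1" and "N \<ge> 2"
    and "d \<ge> 1" and "smooth_hypersurface d P"
  shows "\<forall>m\<ge>1. \<forall>n::int.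
    locally_free_resolution proj_space
      (Ker_delta 1 (m - 1) (n - 2 * int d + 1)) (\<lambda>U. alpha d P)
      (Ker_delta 2 m (n - int d)) (\<lambda>U. beta d P)
      (Ker_delta 1 m n)
      (Sym_Omega d P m (int m + n))"
proof (intro allI impI)
  fix m :: nat and n :: int assume m: "m \<ge> 1"
  interpret smooth_hypersurface_context d P by unfold_locales (rule assms)+
  show "locally_free_resolution proj_space
      (Ker_delta 1 (m - 1) (n - 2 * int d + 1)) (\<lambda>U. alpha d P)
      (Ker_delta 2 m (n - int d)) (\<lambda>U. beta d P)
      (Ker_delta 1 m n)
      (Sym_Omega d P m (int m + n))"
    unfolding locally_free_resolution_def
    by (intro conjI exI[of _ "augmentation m (int m + n)"] locally_free_Ker_delta sheaf_of_modules_Sym_Omega[OF m refl] sheaf_hom_alpha[OF m] sheaf_hom_beta[OF m]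
        sheaf_injective_alpha sheaf_exact_alpha_beta[OF m] sheaf_hom_augmentation[OF m refl]
        sheaf_exact_beta_augmentation[OF m refl] sheaf_surjective_augmentation[OF m refl])
qed

end
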